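(* Let $0 \le s < 1/2$. Then the Benjamin-Ono equation is globally $C^0$-well-posed in $H^{-s}_r$. For any $c \in \mathbb{R}$ and $t \in \mathbb{R}$, the flow map $\mathcal{S}^t = \mathcal{S}(t,\cdot)$ leaves the affine space $H^{-s}_{r,c}$ invariant. Furthermore, there exists an integral $I_s : H^{-s}_r \to \mathbb{R}_{\ge 0}$ of the Benjamin-Ono equation satisfying $$\|v\|_{-s} \le I_s(v), \qquad \forall v \in H^{-s}_r.$$ In particular, one has $$\sup_{t\in\mathbb{R}} \|\mathcal{S}(t,v_0)\|_{-s} \le I_s(v_0), \qquad \forall v_0 \in H^{-s}_r.$$
   Context: Let $\mathbb{T} = \mathbb{R}/2\pi\mathbb{Z}$, $\widehat f(n) = \frac{1}{2\pi}\int_0^{2\pi} f(x)e^{-inx}dx$ (extended to distributions), $\langle n\rangle = \max\{1,|n|\}$. For $\sigma\in\mathbb{R}$, $H^\sigma_r = H^\sigma(\mathbb{T},\mathbb{R})$ is the Sobolev space of real valued distributions with norm $\|v\|_\sigma = (\sum_{n\in\mathbb{Z}} \langle n\rangle^{2\sigma}|\widehat v(n)|^2)^{1/2}$, and for $c \in \mathbb{R}$, $H^\sigma_{r,c} = \{w\in H^\sigma_r : \widehat w(0) = c\}$. The Benjamin-Ono (BO) equation on $\mathbb{T}$ is $$\partial_t v = H\partial_x^2 v - \partial_x(v^2), \qquad x\in\mathbb{T},\ t\in\mathbb{R},$$ with $v(t,x)$ real valued, where $H$ is the Hilbert transform $Hf(x) = \sum_{n\in\mathbb{Z}} -i\,\mathrm{sign}(n)\widehat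 f(n)e^{inx}$, with $\mathrm{sign}(\pm n) = \pm1$ for $n\ge1$ and $\mathrm{sign}(0)=0$. It is known that for $\sigma>3/2$ and $v_0\in H^\sigma_r$ there is a unique curve $v\in C(\mathbb{R},H^\sigma_r)\cap C^1(\mathbb{R},H^{\sigma-2}_r)$ with $v(0)=v_0$ satisfying the BO equation in $H^{\sigma-2}_r$ for all $t$; it is called the classical solution and denoted $\mathcal{S}(\cdot,v_0)$. Let $s\ge0$. A continuous curve $\gamma:\mathbb{R}\to H^{-s}_r$ with $\gamma(0)=v_0$, $v_0 \in H^{-s}_r$, is called a global in time solution of the BO equation in $H^{-s}_r$ with initial data $v_0$ if for any sequence $(v_0^{(k)})_{k\ge1}$ in $H^\sigma_r$ with $\sigma>3/2$ which converges to $v_0$ in $H^{-s}_r$, the classical solutions $\mathcal{S}(\cdot,v_0^{(k)})$ converge to $\gamma$ in $C(\mathbb{R},H^{-s}_r)$ (i.e. uniformly on every interval $[-T,T]$). This $\gamma$ is denoted $\mathcal{S}(\cdot,v_0)$. The BO equation is said to be globally $C^0$-well-posed in $H^{-s}_r$ if (i) for any $v_0\in H^{-s}_r$ there exists a global in time solution with initial data $v_0$ in this sense, and (ii) the solution map $\mathcal{S}:H^{-s}_r\to C(\mathbb{R},H^{-s}_r)$ is continuous, i.e. for any $v_0\in H^{-s}_r$, $T>0$, $\varepsilon>0$ there is $\delta>0$ so that for any $w_0\in H^{-s}_r$ with $\|w_0-v_0\|_{-s}<\delta$, $\sup_{|t|\le T}\|\mathcal{S}(t,w_0)-\mathcal{S}(t,v_0)\|_{-s}\le\varepsilon$.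 A functional $I: H^{-s}_r\to\mathbb{R}$ is called an integral of the BO equation if $I(\mathcal{S}(t,v_0)) = I(v_0)$ for all $t\in\mathbb{R}$ and $v_0\in H^{-s}_r$. *)

theory Defs
  imports "HOL-Analysis.Analysis"
begin

section \<open>Real distributions on the circle\<close>

text \<open>Functions on the circle are \<open>2 * pi\<close>-periodic functions on the real line.\<close>

definition test_functions :: "(real \<Rightarrow> real) set" where
  "test_functions =
     {\<phi>. (\<forall>x. \<phi> (x + 2 * pi) = \<phi> x) \<and> (\<forall>k x. ((deriv ^^ k) \<phi>) field_differentiable (at x))}"

definition test_converges :: "(nat \<Rightarrow> real \<Rightarrow> real) \<Rightarrow> (real \<Rightarrow> real) \<Rightarrow> bool" where
  "test_converges \<Phi> \<phi> \<longleftrightarrow>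
     (\<forall>k. uniform_limit UNIV (\<lambda>j. (deriv ^^ k) (\<Phi> j)) ((deriv ^^ k) \<phi>) sequentially)"

lemma test_functions_deriv:
  assumes "\<phi> \<in> test_functions"
  shows "deriv \<phi> \<in> test_functions"
proof -
  have per: "\<phi> (x + 2 * pi) = \<phi> x" for x
    using assms by (simp add: test_functions_def)
  have sm: "((deriv ^^ k) \<phi>) field_differentiable (at x)" for k x
    using assms by (simp add: test_functions_def)
  have "deriv \<phi> (x + 2 * pi) = deriv \<phi> x" for x
  proof -
    have "(\<phi> has_field_derivative deriv \<phi> (x + 2 * pi)) (at (x + 2 * pi))"
      using sm[of 0] by (simp add: DERIV_deriv_iff_field_differentiable)
    then have "((\<lambda>y. \<phi> (y + 2 * pi)) has_field_derivative deriv \<phi> (x + 2 * pi)) (at x)"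
      by (simp add: DERIV_shift)
    moreover have "(\<lambda>y. \<phi> (y + 2 * pi)) = \<phi>"
      using per by auto
    ultimately show ?thesis
      by (metis DERIV_imp_deriv)
  qed
  moreover have "((deriv ^^ k) (deriv \<phi>)) field_differentiable (at x)" for k x
    using sm[of "Suc k"] by (simp add: funpow_swap1)
  ultimately show ?thesis
    by (simp add: test_functions_def)
qed

lemma test_functions_differentiable:
  "\<phi> \<in> test_functions \<Longrightarrow> \<phi> field_differentiable (at x)"
  unfolding test_functions_def by (metis (mono_tags, lifting) funpow_0 mem_Collect_eq)

lemma test_converges_deriv:
  assumes "test_converges \<Phi> \<phi>"
  shows "test_converges (\<lambda>j. deriv (\<Phi> j)) (deriv \<phi>)"
  unfolding test_converges_def
proof
  fix k
  show "uniform_limit UNIV (\<lambda>j. (deriv ^^ k) (deriv (\<Phi> j))) ((deriv ^^ k) (deriv \<phi>)) sequentially"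
    using assms[unfolded test_converges_def, rule_format, of "Suc k"] by (simp add: funpow_swap1)
qed

lemma funpow_deriv_add:
  assumes "\<phi> \<in> test_functions" "\<psi> \<in> test_functions"
  shows "(deriv ^^ k) (\<lambda>x. \<phi> x + \<psi> x) = (\<lambda>x. (deriv ^^ k) \<phi> x + (deriv ^^ k) \<psi> x)"
proof (induction k)
  case (Suc k)
  have "(deriv ^^ k) \<phi> field_differentiable at x" "(deriv ^^ k) \<psi> field_differentiable at x" for x
    using assms by (auto simp: test_functions_def)
  then show ?case
    by (simp add: Suc fun_eq_iff)
qed simp

lemma funpow_deriv_cmult:
  assumes "\<phi> \<in> test_functions"
  shows "(deriv ^^ k) (\<lambda>x. c * \<phi> x) = (\<lambda>x. c * (deriv ^^ k) \<phi> x)"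
proof (induction k)
  case (Suc k)
  have "(deriv ^^ k) \<phi> field_differentiable at x" for x
    using assms by (auto simp: test_functions_def)
  then show ?case
    by (simp add: Suc fun_eq_iff)
qed simp

lemma test_functions_add:
  assumes "\<phi> \<in> test_functions" "\<psi> \<in> test_functions"
  shows "(\<lambda>x. \<phi> x + \<psi> x) \<in> test_functions"
  using assms funpow_deriv_add[OF assms]
  by (auto simp: test_functions_def intro: field_differentiable_add)

lemma test_functions_cmult:
  assumes "\<phi> \<in> test_functions"
  shows "(\<lambda>x. c * \<phi> x) \<in> test_functions"
  using assms funpow_deriv_cmult[OF assms]
  by (auto simp: test_functions_def intro: field_differentiable_mult)

text \<open>A real valued distribution is a continuous real-linear functional on the real valued test
  functions. The space of test functions is metrizable, so sequential continuity suffices. The value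
  \<open>0\<close> off the test functions makes equality of distributions coincide with equality of functionals.\<close>

typedef distr =
  "{u :: (real \<Rightarrow> real) \<Rightarrow> real.
     (\<forall>\<phi>. \<phi> \<notin> test_functions \<longrightarrow> u \<phi> = 0) \<and>
     (\<forall>\<phi>\<in>test_functions. \<forall>\<psi>\<in>test_functions. u (\<lambda>x. \<phi> x + \<psi> x) = u \<phi> + u \<psi>) \<and>
     (\<forall>\<phi>\<in>test_functions. \<forall>c. u (\<lambda>x. c * \<phi> x) = c * u \<phi>) \<and>
     (\<forall>\<Phi>. \<forall>\<phi>\<in>test_functions. (\<forall>j. \<Phi> j \<in> test_functions) \<longrightarrow> test_converges \<Phi> \<phi> \<longrightarrow>
        (\<lambda>j. u (\<Phi> j)) \<longlonglongrightarrow> u \<phi>)}"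
  morphisms pairing Abs_distr
  by (rule exI[of _ "\<lambda>_. 0"]) simp

setup_lifting type_definition_distr

instantiation distr :: real_vector
begin

lift_definition zero_distr :: distr is "\<lambda>_. 0"
  by simp

lift_definition plus_distr :: "distr \<Rightarrow> distr \<Rightarrow> distr" is "\<lambda>u v \<phi>. u \<phi> + v \<phi>"
  by (simp add: algebra_simps tendsto_add)

lift_definition minus_distr :: "distr \<Rightarrow> distr \<Rightarrow> distr" is "\<lambda>u v \<phi>. u \<phi> - v \<phi>"
  by (simp add: algebra_simps tendsto_diff)

lift_definition uminus_distr :: "distr \<Rightarrow> distr" is "\<lambda>u \<phi>. - u \<phi>"
  by (simp add: tendsto_minus)

lift_definition scaleR_distr :: "real \<Rightarrow> distr \<Rightarrow> distr" is "\<lambda>c u \<phi>. c * u \<phi>"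
  by (simp add: algebra_simps tendsto_mult_left)

instance
  by standard (transfer; simp add: fun_eq_iff algebra_simps)+

end

lift_definition distr_deriv :: "distr \<Rightarrow> distr" is
  "\<lambda>u \<phi>. if \<phi> \<in> test_functions then - u (deriv \<phi>) else 0"
proof (intro conjI)
  fix u :: "(real \<Rightarrow> real) \<Rightarrow> real"
  let ?d = "\<lambda>\<phi>. if \<phi> \<in> test_functions then - u (deriv \<phi>) else 0"
  assume u: "(\<forall>\<phi>. \<phi> \<notin> test_functions \<longrightarrow> u \<phi> = 0) \<and>
     (\<forall>\<phi>\<in>test_functions. \<forall>\<psi>\<in>test_functions. u (\<lambda>x. \<phi> x + \<psi> x) = u \<phi> + u \<psi>) \<and>
     (\<forall>\<phi>\<in>test_functions. \<forall>c. u (\<lambda>x. c * \<phi> x) = c * u \<phi>) \<and>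
     (\<forall>\<Phi>. \<forall>\<phi>\<in>test_functions. (\<forall>j. \<Phi> j \<in> test_functions) \<longrightarrow> test_converges \<Phi> \<phi> \<longrightarrow>
        (\<lambda>j. u (\<Phi> j)) \<longlonglongrightarrow> u \<phi>)"
  show "\<forall>\<phi>. \<phi> \<notin> test_functions \<longrightarrow> ?d \<phi> = 0"
    by simp
  show "\<forall>\<phi>\<in>test_functions. \<forall>\<psi>\<in>test_functions. ?d (\<lambda>x. \<phi> x + \<psi> x) = ?d \<phi> + ?d \<psi>"
  proof (intro ballI)
    fix \<phi> \<psi> assume *: "\<phi> \<in> test_functions" "\<psi> \<in> test_functions"
    have "deriv (\<lambda>x. \<phi> x + \<psi> x) = (\<lambda>x. deriv \<phi> x + deriv \<psi> x)"
      using funpow_deriv_add[OF *, of 1] by simp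
    then show "?d (\<lambda>x. \<phi> x + \<psi> x) = ?d \<phi> + ?d \<psi>"
      using u * test_functions_add[OF *] by (simp add: test_functions_deriv)
  qed
  show "\<forall>\<phi>\<in>test_functions. \<forall>c. ?d (\<lambda>x. c * \<phi> x) = c * ?d \<phi>"
  proof (intro ballI allI)
    fix \<phi> c assume *: "\<phi> \<in> test_functions"
    have "deriv (\<lambda>x. c * \<phi> x) = (\<lambda>x. c * deriv \<phi> x)"
      using funpow_deriv_cmult[OF *, of 1] by simp
    then show "?d (\<lambda>x. c * \<phi> x) = c * ?d \<phi>"
      using u * test_functions_cmult[OF *] by (simp add: test_functions_deriv)
  qed
  show "\<forall>\<Phi>. \<forall>\<phi>\<in>test_functions. (\<forall>j. \<Phi> j \<in> test_functions) \<longrightarrow> test_converges \<Phi> \<phi> \<longrightarrow>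
        (\<lambda>j. ?d (\<Phi> j)) \<longlonglongrightarrow> ?d \<phi>"
  proof (intro allI ballI impI)
    fix \<Phi> \<phi>
    assume *: "\<phi> \<in> test_functions" "\<forall>j. \<Phi> j \<in> test_functions" "test_converges \<Phi> \<phi>"
    then have "\<forall>j. deriv (\<Phi> j) \<in> test_functions" "deriv \<phi> \<in> test_functions"
      by (simp_all add: test_functions_deriv)
    then have "(\<lambda>j. u (deriv (\<Phi> j))) \<longlonglongrightarrow> u (deriv \<phi>)"
      using u test_converges_deriv[OF *(3)]
      by (elim conjE allE[of _ "\<lambda>j. deriv (\<Phi> j)"]) simp
    then show "(\<lambda>j. ?d (\<Phi> j)) \<longlonglongrightarrow> ?d \<phi>"
      using * by (simp add: tendsto_minus)
  qed
qed

lemma deriv_cos_sin: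
  "deriv (\<lambda>x. a * cos (c * x) + b * sin (c * x)) =
     (\<lambda>x::real. (b * c) * cos (c * x) + (- a * c) * sin (c * x))"
  by (rule ext, rule DERIV_imp_deriv) (auto intro!: derivative_eq_intros simp: algebra_simps)

lemma cos_sin_test_functions:
  "(\<lambda>x. a * cos (of_int n * x) + b * sin (of_int n * x)) \<in> test_functions"
proof -
  have "\<exists>a' b'. (deriv ^^ k) (\<lambda>x. a * cos (of_int n * x) + b * sin (of_int n * x)) =
          (\<lambda>x::real. a' * cos (of_int n * x) + b' * sin (of_int n * x))" for k
  proof (induction k)
    case (Suc k)
    then obtain a' b' where
      "(deriv ^^ k) (\<lambda>x. a * cos (of_int n * x) + b * sin (of_int n * x)) =
         (\<lambda>x::real. a' * cos (of_int n * x) + b' * sin (of_int n * x))"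
      by blast
    then show ?case
      by (simp only: funpow.simps o_apply deriv_cos_sin) blast
  qed auto
  moreover have "(\<lambda>x::real. a' * cos (of_int n * x) + b' * sin (of_int n * x))
      field_differentiable (at x)" for a' b' x
    unfolding field_differentiable_def by (rule exI) (auto intro!: derivative_eq_intros)
  ultimately have "((deriv ^^ k) (\<lambda>x. a * cos (of_int n * x) + b * sin (of_int n * x)))
      field_differentiable (at x)" for k and x :: real
    by metis
  moreover have "cos (of_int n * (x + 2 * pi)) = cos (of_int n * x)"
    "sin (of_int n * (x + 2 * pi)) = sin (of_int n * x)" for x :: real
    using cos_int_2pin[of n] sin_int_2pin[of n]
    by (simp_all add: distrib_left cos_add sin_add mult_ac)
  ultimately show ?thesis
    by (simp add: test_functions_def)
qed

lemma cos_test_functions: "(\<lambda>x. cos (of_int n * x)) \<in> test_functions"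
  using cos_sin_test_functions[of 1 n 0] by simp

lemma sin_test_functions: "(\<lambda>x. sin (of_int n * x)) \<in> test_functions"
  using cos_sin_test_functions[of 0 n 1] by simp

text \<open>\<open>fourier_coeff u n\<close> is the pairing of \<open>u\<close> with \<open>exp (- \<i> * n * x) / (2 * pi)\<close>, where \<open>u\<close> is
  extended complex-linearly to complex valued test functions.\<close>

definition fourier_coeff :: "distr \<Rightarrow> int \<Rightarrow> complex" where
  "fourier_coeff u n =
     (of_real (pairing u (\<lambda>x. cos (of_int n * x))) - \<i> * of_real (pairing u (\<lambda>x. sin (of_int n * x))))
       / of_real (2 * pi)"

definition represents :: "(real \<Rightarrow> real) \<Rightarrow> distr \<Rightarrow> bool" where
  "represents f u \<longleftrightarrow>
     continuous_on UNIV f \<and> (\<forall>x. f (x + 2 * pi) = f x) \<and>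
     (\<forall>\<phi>\<in>test_functions. pairing u \<phi> = integral {0..2 * pi} (\<lambda>x. f x * \<phi> x))"

lemma fourier_coeff_represents:
  assumes "represents f u"
  shows "fourier_coeff u n =
    integral {0..2 * pi} (\<lambda>x. of_real (f x) * exp (- \<i> * of_int n * of_real x)) / of_real (2 * pi)"
proof -
  have f: "continuous_on {0..2 * pi} f"
    using assms continuous_on_subset unfolding represents_def by blast
  let ?c = "\<lambda>x. f x * cos (of_int n * x)" and ?s = "\<lambda>x. f x * sin (of_int n * x)"
  have c: "(?c has_integral pairing u (\<lambda>x. cos (of_int n * x))) {0..2 * pi}"
    using assms cos_test_functions[of n] f unfolding represents_def
    by (auto intro!: integrable_integral integrable_continuous_real continuous_intros)
  have s: "(?s has_integral pairing u (\<lambda>x. sin (of_int n * x))) {0..2 * pi}"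
    using assms sin_test_functions[of n] f unfolding represents_def
    by (auto intro!: integrable_integral integrable_continuous_real continuous_intros)
  have "((\<lambda>x. complex_of_real (?c x) - \<i> * complex_of_real (?s x)) has_integral
      (of_real (pairing u (\<lambda>x. cos (of_int n * x))) -
         \<i> * of_real (pairing u (\<lambda>x. sin (of_int n * x))))) {0..2 * pi}"
    using has_integral_diff[OF has_integral_of_real[OF c]
        has_integral_mult_right[OF has_integral_of_real[OF s]]] .
  moreover have "complex_of_real (?c x) - \<i> * complex_of_real (?s x) =
      of_real (f x) * exp (- \<i> * of_int n * of_real x)" for x
  proof -
    have "exp (- \<i> * of_int n * of_real x) = cis (- (of_int n * x))"
      by (simp add: cis_conv_exp mult.assoc)
    then show ?thesis
      by (simp add: complex_eq_iff)
  qed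
  ultimately show ?thesis
    by (simp add: fourier_coeff_def integral_unique)
qed

lemma fourier_coeff_distr_deriv:
  "fourier_coeff (distr_deriv u) n = \<i> * of_int n * fourier_coeff u n"
proof -
  have d: "deriv (\<lambda>x. cos (of_int n * x)) = (\<lambda>x::real. - of_int n * sin (of_int n * x))"
    "deriv (\<lambda>x. sin (of_int n * x)) = (\<lambda>x::real. of_int n * cos (of_int n * x))"
    using deriv_cos_sin[of 1 "of_int n" 0] deriv_cos_sin[of 0 "of_int n" 1] by simp_all
  have hom: "pairing u (\<lambda>x. c * \<phi> x) = c * pairing u \<phi>" if "\<phi> \<in> test_functions" for c \<phi>
    using pairing[of u] that by blast
  show ?thesis
    using cos_test_functions[of n] sin_test_functions[of n]
    unfolding fourier_coeff_def distr_deriv.rep_eq d hom[OF cos_test_functions]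
      hom[OF sin_test_functions]
    by (simp add: field_simps)
qed

definition hilbert :: "distr \<Rightarrow> distr" where
  "hilbert u = (THE w. \<forall>n. fourier_coeff w n = - \<i> * of_int (sgn n) * fourier_coeff u n)"

text \<open>Meaningful for distributions given by a continuous function, in particular for those in the
  Sobolev spaces of order larger than \<open>1/2\<close>.\<close>

definition distr_square :: "distr \<Rightarrow> distr" where
  "distr_square u = (THE w. \<exists>f. represents f u \<and> represents (\<lambda>x. (f x)\<^sup>2) w)"


section \<open>Sobolev spaces\<close>

definition jap :: "int \<Rightarrow> real" where
  "jap n = max 1 \<bar>of_int n\<bar>"

definition sobolev :: "real \<Rightarrow> distr set" where
  "sobolev \<sigma> = {u. (\<lambda>n. jap n powr (2 * \<sigma>) * (cmod (fourier_coeff u n))\<^sup>2) summable_on UNIV}"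

definition sobolev_norm :: "real \<Rightarrow> distr \<Rightarrow> real" where
  "sobolev_norm \<sigma> u = sqrt (\<Sum>\<^sub>\<infinity>n. jap n powr (2 * \<sigma>) * (cmod (fourier_coeff u n))\<^sup>2)"

definition sobolev_mean :: "real \<Rightarrow> real \<Rightarrow> distr set" where
  "sobolev_mean \<sigma> c = {u \<in> sobolev \<sigma>. fourier_coeff u 0 = of_real c}"

definition continuous_curve :: "real \<Rightarrow> (real \<Rightarrow> distr) \<Rightarrow> bool" where
  "continuous_curve \<sigma> \<gamma> \<longleftrightarrow>
     (\<forall>t. \<gamma> t \<in> sobolev \<sigma>) \<and> (\<forall>t. ((\<lambda>r. sobolev_norm \<sigma> (\<gamma> r - \<gamma> t)) \<longlongrightarrow> 0) (at t))"

definition has_curve_derivative ::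
    "real \<Rightarrow> (real \<Rightarrow> distr) \<Rightarrow> distr \<Rightarrow> real \<Rightarrow> bool" where
  "has_curve_derivative \<sigma> \<gamma> w t \<longleftrightarrow>
     ((\<lambda>h. sobolev_norm \<sigma> ((\<gamma> (t + h) - \<gamma> t) /\<^sub>R h - w)) \<longlongrightarrow> 0) (at 0)"


section \<open>The Benjamin-Ono equation\<close>

definition bo_rhs :: "distr \<Rightarrow> distr" where
  "bo_rhs v = hilbert (distr_deriv (distr_deriv v)) - distr_deriv (distr_square v)"

definition classical_solution :: "real \<Rightarrow> distr \<Rightarrow> (real \<Rightarrow> distr) \<Rightarrow> bool" where
  "classical_solution \<sigma> v0 v \<longleftrightarrow>
     continuous_curve \<sigma> v \<and> v 0 = v0 \<and>
     (\<exists>v'. continuous_curve (\<sigma> - 2) v' \<and>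
           (\<forall>t. has_curve_derivative (\<sigma> - 2) v (v' t) t) \<and>
           (\<forall>t. v' t = bo_rhs (v t)))"

text \<open>For \<open>\<sigma> > 3/2\<close> and \<open>v0\<close> in \<open>sobolev \<sigma>\<close> the classical solution exists and is unique.\<close>

definition classical_flow :: "real \<Rightarrow> distr \<Rightarrow> real \<Rightarrow> distr" where
  "classical_flow \<sigma> v0 = (THE v. classical_solution \<sigma> v0 v)"

definition global_solution :: "real \<Rightarrow> distr \<Rightarrow> (real \<Rightarrow> distr) \<Rightarrow> bool" where
  "global_solution s v0 \<gamma> \<longleftrightarrow>
     v0 \<in> sobolev (- s) \<and> continuous_curve (- s) \<gamma> \<and> \<gamma> 0 = v0 \<and>
     (\<forall>\<sigma> > 3 / 2. \<forall>w. (\<forall>k. w k \<in> sobolev \<sigma>) \<longrightarrow>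
        (\<lambda>k. sobolev_norm (- s) (w k - v0)) \<longlonglongrightarrow> 0 \<longrightarrow>
        (\<forall>T > 0. uniform_limit {- T..T}
           (\<lambda>k t. sobolev_norm (- s) (classical_flow \<sigma> (w k) t - \<gamma> t)) (\<lambda>_. 0) sequentially))"

text \<open>There is at most one global solution, since \<open>sobolev \<sigma>\<close> is dense in \<open>sobolev (- s)\<close>.\<close>

definition bo_flow :: "real \<Rightarrow> real \<Rightarrow> distr \<Rightarrow> distr" where
  "bo_flow s t v0 = (THE \<gamma>. global_solution s v0 \<gamma>) t"

text \<open>Suprema are taken in the extended reals, because the supremum of a set of reals that is
  unbounded above is unspecified.\<close>

definition globally_C0_well_posed :: "real \<Rightarrow> bool" where
  "globally_C0_well_posed s \<longleftrightarrow>
     (\<forall>v0 \<in> sobolev (- s). \<exists>\<gamma>. global_solution s v0 \<gamma>) \<and>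
     (\<forall>v0 \<in> sobolev (- s). \<forall>T > 0. \<forall>\<epsilon> > 0. \<exists>\<delta> > 0. \<forall>w0 \<in> sobolev (- s).
        sobolev_norm (- s) (w0 - v0) < \<delta> \<longrightarrow>
        (SUP t\<in>{- T..T}. ereal (sobolev_norm (- s) (bo_flow s t w0 - bo_flow s t v0))) \<le> ereal \<epsilon>)"

definition bo_integral :: "real \<Rightarrow> (distr \<Rightarrow> real) \<Rightarrow> bool" where
  "bo_integral s I \<longleftrightarrow> (\<forall>t. \<forall>v0 \<in> sobolev (- s). I (bo_flow s t v0) = I v0)"

end

(* The proof rests on Gerard's explicit formula for the Benjamin-Ono equation. Let u be regular data, T_u
   the Toeplitz operator with symbol u on the Hardy space l2 of the nonnegative frequencies, L = D - T_u the
   Lax operator, S the shift, p the projection of u to the Hardy space and S_t = exp(-it) S exp(-2itL). The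
   vectors v_n(t) = S_t^n 1 form an orthonormal basis, and the n-th Fourier coefficient of the solution is
   <p, v_n(t)> for n >= 0. The change of basis conjugates L to the Lax operator of the solution at time t,
   hence the quadratic form of L is conserved. As T_u is form bounded with respect to D with a constant that
   depends on |u|_{-s} only, duality and interpolation yield a bound of |u(t)|_{-s} uniform in time. The
   derivative of <exp(-itL_a) f, exp(-itL_b) f> is controlled by |a - b|_{-s} in the form domain, so that the
   groups, the bases and the solutions depend continuously on the data in the norm of order -s, and the flow
   extends from regular to rough data. Classical solutions are unique by the energy method; therefore the
   extended flow is a group, and the supremum over time of the norm of order -s is an integral. *)
theory Submission
  imports Defs
begin

section \<open>The Hilbert space of square summable sequences\<close>

text \<open>No operator is built for rough data. The flow of regular data is constructed with
  constants that may depend on all of u; a second layer shows that the few constants which matter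
  are controlled by |u|_{-s}. Three points carry the proof. The relation S_t* L S_t = L + 1 makes
  each application of S_t* lower the quadratic form of L by the squared norm of the new remainder,
  up to terms with the coefficient that is split off; as the form is bounded below, these squares
  are summable, which gives completeness and a bound at order 1/2 at once. The a priori bound closes
  because coercivity is used at time 0, so that the unknown norm N at time t enters linearly and the
  argument ends in N^2 <= const (1 + N). Two groups are compared through their inner product and not
  through Duhamel's formula, because the difference of the potentials is controlled as a form only;
  the price is a square root of |a - b|_{-s}, which is harmless for continuity.\<close>

definition sqsum :: "('i \<Rightarrow> complex) \<Rightarrow> bool" where
  "sqsum x \<longleftrightarrow> (\<lambda>i. (cmod (x i))\<^sup>2) summable_on UNIV"

lemma sqsum_le:
  assumes "sqsum y" "\<And>i. cmod (x i) \<le> C * cmod (y i)"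
  shows "sqsum x"
  unfolding sqsum_def
proof (rule summable_on_comparison_test)
  show "(\<lambda>i. C\<^sup>2 * (cmod (y i))\<^sup>2) summable_on UNIV"
    using assms(1) by (intro summable_on_cmult_right) (simp add: sqsum_def)
  show "(cmod (x i))\<^sup>2 \<le> C\<^sup>2 * (cmod (y i))\<^sup>2" for i
    using power_mono[OF assms(2)[of i], of 2] by (simp add: power_mult_distrib)
qed auto

lemma sqsum_bound:
  assumes "\<And>F. finite F \<Longrightarrow> (\<Sum>i\<in>F. (cmod (x i))\<^sup>2) \<le> C"
  shows "sqsum x" "(\<Sum>\<^sub>\<infinity>i. (cmod (x i))\<^sup>2) \<le> C"
proof -
  show s: "sqsum x"
    unfolding sqsum_def
    by (rule nonneg_bdd_above_summable_on) (use assms in \<open>auto intro!: bdd_aboveI\<close>)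
  show "(\<Sum>\<^sub>\<infinity>i. (cmod (x i))\<^sup>2) \<le> C"
    using s assms by (intro infsum_le_finite_sums) (auto simp: sqsum_def)
qed

lemma sqsum_cmult: "sqsum x \<Longrightarrow> sqsum (\<lambda>i. c * x i)"
  by (rule sqsum_le[where C="cmod c"]) (auto simp: norm_mult)

lemma sqsum_add:
  assumes "sqsum x" "sqsum y"
  shows "sqsum (\<lambda>i. x i + y i)"
  unfolding sqsum_def
proof (rule summable_on_comparison_test)
  show "(\<lambda>i. 2 * (cmod (x i))\<^sup>2 + 2 * (cmod (y i))\<^sup>2) summable_on UNIV"
    using assms by (intro summable_on_add summable_on_cmult_right) (auto simp: sqsum_def)
  fix i
  have "(cmod (x i + y i))\<^sup>2 \<le> (cmod (x i) + cmod (y i))\<^sup>2"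
    by (intro power_mono norm_triangle_ineq) auto
  also have "\<dots> \<le> 2 * (cmod (x i))\<^sup>2 + 2 * (cmod (y i))\<^sup>2"
    using zero_le_power2[of "cmod (x i) - cmod (y i)"]
    by (simp add: power2_eq_square algebra_simps)
  finally show "(cmod (x i + y i))\<^sup>2 \<le> 2 * (cmod (x i))\<^sup>2 + 2 * (cmod (y i))\<^sup>2" .
qed auto

lemma sqsum_mult_abs_summable:
  assumes "sqsum x" "sqsum y"
  shows "(\<lambda>i. cmod (x i) * cmod (y i)) summable_on UNIV"
proof (rule summable_on_comparison_test)
  show "(\<lambda>i. (cmod (x i))\<^sup>2 + (cmod (y i))\<^sup>2) summable_on UNIV"
    using assms by (intro summable_on_add) (auto simp: sqsum_def)
  show "cmod (x i) * cmod (y i) \<le> (cmod (x i))\<^sup>2 + (cmod (y i))\<^sup>2" for i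
    using zero_le_power2[of "cmod (x i) - cmod (y i)"] zero_le_power2[of "cmod (x i)"] zero_le_power2[of "cmod (y i)"]
    by (simp add: power2_eq_square algebra_simps del: zero_le_power2) (smt (verit) mult_nonneg_nonneg norm_ge_zero)
qed auto

lemma sqsum_finite: "finite {i. x i \<noteq> 0} \<Longrightarrow> sqsum x"
  unfolding sqsum_def
  by (subst summable_on_cong_neutral[where T="{i. x i \<noteq> 0}" and g="\<lambda>i. (cmod (x i))\<^sup>2"]) auto

text \<open>A type, so that the calculus of Banach spaces applies to curves of sequences. The inner
  product of the type class is the real part of the complex one; the complex structure is carried by
  \<open>scaleC\<close> and by \<open>cinner\<close>, which is antilinear in its second
  argument.\<close>

typedef 'i ell2 = "{x :: 'i \<Rightarrow> complex. sqsum x}"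
  morphisms cf ell2_of
  by (rule exI[of _ "\<lambda>_. 0"]) (simp add: sqsum_def)

setup_lifting type_definition_ell2

lemma cf_of [simp]: "sqsum x \<Longrightarrow> cf (ell2_of x) = x"
  by (simp add: ell2_of_inverse)

lemma sqsum_cf [simp]: "sqsum (cf f)"
  using cf[of f] by simp

lemma ell2_eqI: "(\<And>i. cf f i = cf g i) \<Longrightarrow> f = g"
  by (metis cf_inject ext)

lemma cf_summable: "(\<lambda>i. (cmod (cf f i))\<^sup>2) summable_on UNIV"
  using sqsum_cf[of f] by (simp add: sqsum_def)

lemma sqsum_mult_summable:
  assumes "sqsum x" "sqsum y"
  shows "(\<lambda>i. x i * cnj (y i)) summable_on UNIV"
  by (subst summable_on_iff_abs_summable_on_complex)
    (use sqsum_mult_abs_summable[OF assms] in \<open>simp add: norm_mult\<close>)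

instantiation ell2 :: (type) real_inner
begin

lift_definition zero_ell2 :: "'a ell2" is "\<lambda>_. 0"
  by (simp add: sqsum_def)

lift_definition plus_ell2 :: "'a ell2 \<Rightarrow> 'a ell2 \<Rightarrow> 'a ell2" is "\<lambda>x y i. x i + y i"
  by (simp add: sqsum_add)

lift_definition uminus_ell2 :: "'a ell2 \<Rightarrow> 'a ell2" is "\<lambda>x i. - x i"
  by (simp add: sqsum_def)

lift_definition minus_ell2 :: "'a ell2 \<Rightarrow> 'a ell2 \<Rightarrow> 'a ell2" is "\<lambda>x y i. x i - y i"
  using sqsum_add[of _ "\<lambda>i. - _ i"] by (simp add: sqsum_def)

lift_definition scaleR_ell2 :: "real \<Rightarrow> 'a ell2 \<Rightarrow> 'a ell2" is "\<lambda>c x i. of_real c * x i"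
  by (simp add: sqsum_cmult)

definition inner_ell2 :: "'a ell2 \<Rightarrow> 'a ell2 \<Rightarrow> real" where
  "inner_ell2 f g = Re (\<Sum>\<^sub>\<infinity>i. cf f i * cnj (cf g i))"

definition norm_ell2 :: "'a ell2 \<Rightarrow> real" where
  "norm_ell2 f = sqrt (inner f f)"

definition dist_ell2 :: "'a ell2 \<Rightarrow> 'a ell2 \<Rightarrow> real" where
  "dist_ell2 f g = norm (f - g)"

definition sgn_ell2 :: "'a ell2 \<Rightarrow> 'a ell2" where
  "sgn_ell2 f = inverse (norm f) *\<^sub>R f"

definition uniformity_ell2 :: "('a ell2 \<times> 'a ell2) filter" where
  "uniformity_ell2 = (INF e\<in>{0<..}. principal {(f, g). dist f g < e})"

definition open_ell2 :: "'a ell2 set \<Rightarrow> bool" where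
  "open_ell2 U \<longleftrightarrow> (\<forall>f\<in>U. \<forall>\<^sub>F (f', g) in uniformity. f' = f \<longrightarrow> g \<in> U)"

instance
proof
  fix f g h :: "'a ell2" and c d :: real and U :: "'a ell2 set"
  show "f + g + h = f + (g + h)" "f + g = g + f" "0 + f = f" "- f + f = 0" "f - g = f + - g"
    "c *\<^sub>R (f + g) = c *\<^sub>R f + c *\<^sub>R g" "(c + d) *\<^sub>R f = c *\<^sub>R f + d *\<^sub>R f"
    "c *\<^sub>R d *\<^sub>R f = (c * d) *\<^sub>R f" "1 *\<^sub>R f = f"
    by (transfer; simp add: fun_eq_iff algebra_simps)+
  show "dist f g = norm (f - g)" "sgn f = inverse (norm f) *\<^sub>R f"
    "uniformity = (INF e\<in>{0<..}. principal {(f, g :: 'a ell2). dist f g < e})"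
    "open U \<longleftrightarrow> (\<forall>f\<in>U. \<forall>\<^sub>F (f', g) in uniformity. f' = f \<longrightarrow> g \<in> U)"
    "norm f = sqrt (inner f f)"
    by (simp_all add: dist_ell2_def sgn_ell2_def uniformity_ell2_def open_ell2_def norm_ell2_def)
  have s: "(\<lambda>i. cf f i * cnj (cf g i)) summable_on UNIV" for f g :: "'a ell2"
    by (simp add: sqsum_mult_summable)
  have "(\<Sum>\<^sub>\<infinity>i. cf g i * cnj (cf f i)) = cnj (\<Sum>\<^sub>\<infinity>i. cf f i * cnj (cf g i))"
    by (subst infsum_cnj[symmetric]) (simp add: mult.commute)
  then show "inner f g = inner g f"
    by (simp add: inner_ell2_def)
  show "inner (f + g) h = inner f h + inner g h"
    unfolding inner_ell2_def plus_ell2.rep_eq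
    by (simp add: distrib_right infsum_add[OF s s])
  show "inner (c *\<^sub>R f) g = c * inner f g"
    unfolding inner_ell2_def scaleR_ell2.rep_eq
    by (simp add: mult.assoc infsum_cmult_right[OF s])
  have n: "inner f f = (\<Sum>\<^sub>\<infinity>i. (cmod (cf f i))\<^sup>2)"
  proof -
    have "(\<Sum>\<^sub>\<infinity>i. cf f i * cnj (cf f i)) = (\<Sum>\<^sub>\<infinity>i. of_real ((cmod (cf f i))\<^sup>2))"
      by (simp add: complex_norm_square[symmetric])
    also have "\<dots> = of_real (\<Sum>\<^sub>\<infinity>i. (cmod (cf f i))\<^sup>2)"
      by (rule infsumI[OF has_sum_of_real[OF has_sum_infsum[OF cf_summable]]])
    finally show ?thesis
      by (simp add: inner_ell2_def)
  qed
  show "0 \<le> inner f f"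
    unfolding n by (rule infsum_nonneg) simp
  show "inner f f = 0 \<longleftrightarrow> f = 0"
  proof
    assume "inner f f = 0"
    then have "(cmod (cf f i))\<^sup>2 = 0" for i
      unfolding n by (intro nonneg_infsum_le_0D[of "\<lambda>i. (cmod (cf f i))\<^sup>2" UNIV]) (auto simp: cf_summable)
    then show "f = 0"
      by (intro ell2_eqI) (simp add: zero_ell2.rep_eq)
  qed (simp add: inner_ell2_def zero_ell2.rep_eq)
qed

end

lemmas cf_simps [simp] = zero_ell2.rep_eq plus_ell2.rep_eq uminus_ell2.rep_eq minus_ell2.rep_eq
  scaleR_ell2.rep_eq

lift_definition scaleC :: "complex \<Rightarrow> 'i ell2 \<Rightarrow> 'i ell2" (infixr "*\<^sub>C" 75) is "\<lambda>c x i. c * x i"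
  by (simp add: sqsum_cmult)

lemmas cf_scaleC [simp] = scaleC.rep_eq

definition cinner :: "'i ell2 \<Rightarrow> 'i ell2 \<Rightarrow> complex" where
  "cinner f g = (\<Sum>\<^sub>\<infinity>i. cf f i * cnj (cf g i))"

lemma cinner_summable: "(\<lambda>i. cf f i * cnj (cf g i)) summable_on UNIV"
  by (simp add: sqsum_mult_summable)

lemma Re_cinner: "Re (cinner f g) = inner f g"
  by (simp add: cinner_def inner_ell2_def)

lemma cinner_commute: "cinner f g = cnj (cinner g f)"
  unfolding cinner_def by (subst infsum_cnj[symmetric]) (simp add: mult.commute)

lemma cinner_scaleC_left [simp]: "cinner (c *\<^sub>C f) g = c * cinner f g"
  by (simp add: cinner_def mult.assoc infsum_cmult_right[OF cinner_summable])

lemma cinner_scaleC_right [simp]: "cinner f (c *\<^sub>C g) = cnj c * cinner f g"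
  by (subst (1 2) cinner_commute) simp

lemma cinner_add_left: "cinner (f + g) h = cinner f h + cinner g h"
  by (simp add: cinner_def distrib_right infsum_add[OF cinner_summable cinner_summable])

lemma cinner_add_right: "cinner f (g + h) = cinner f g + cinner f h"
  by (subst (1 2 3) cinner_commute) (simp add: cinner_add_left)

lemma scaleR_scaleC: "c *\<^sub>R f = of_real c *\<^sub>C f"
  by (rule ell2_eqI) simp

lemma scaleC_scaleC [simp]: "a *\<^sub>C b *\<^sub>C f = (a * b) *\<^sub>C f"
  by (rule ell2_eqI) simp

lemma scaleC_one [simp]: "1 *\<^sub>C f = f"
  by (rule ell2_eqI) simp

lemma scaleC_zero [simp]: "0 *\<^sub>C f = 0" "c *\<^sub>C 0 = (0 :: 'i ell2)"
  by (rule ell2_eqI; simp)+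

lemma scaleC_add_right: "c *\<^sub>C (f + g) = c *\<^sub>C f + c *\<^sub>C (g :: 'i ell2)"
  by (rule ell2_eqI) (simp add: algebra_simps)

lemma scaleC_add_left: "(c + d) *\<^sub>C f = c *\<^sub>C f + d *\<^sub>C (f :: 'i ell2)"
  by (rule ell2_eqI) (simp add: algebra_simps)

lemma scaleC_diff_right: "c *\<^sub>C (f - g) = c *\<^sub>C f - c *\<^sub>C (g :: 'i ell2)"
  by (rule ell2_eqI) (simp add: algebra_simps)

lemma scaleC_minus_right [simp]: "c *\<^sub>C (- f) = - (c *\<^sub>C (f :: 'i ell2))"
  by (rule ell2_eqI) simp

lemma scaleC_minus_left [simp]: "(- c) *\<^sub>C f = - (c *\<^sub>C (f :: 'i ell2))"
  by (rule ell2_eqI) simp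

lemma cinner_minus_left [simp]: "cinner (- f) g = - cinner f g"
  using cinner_scaleC_left[of "- 1" f g] by simp

lemma cinner_minus_right [simp]: "cinner f (- g) = - cinner f g"
  using cinner_scaleC_right[of f "- 1" g] by simp

lemma cinner_diff_left: "cinner (f - g) h = cinner f h - cinner g h"
  using cinner_add_left[of f "- g" h] by simp

lemma cinner_diff_right: "cinner f (g - h) = cinner f g - cinner f h"
  using cinner_add_right[of f g "- h"] by simp

lemma cinner_scaleR_left [simp]: "cinner (c *\<^sub>R f) g = of_real c * cinner f g"
  by (simp add: scaleR_scaleC)

lemma cinner_scaleR_right [simp]: "cinner f (c *\<^sub>R g) = of_real c * cinner f g"
  by (simp add: scaleR_scaleC)

lemma cinner_zero [simp]: "cinner 0 f = 0" "cinner f 0 = 0"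
  by (simp_all add: cinner_def)

lemma norm_ell2_sq: "(norm f)\<^sup>2 = (\<Sum>\<^sub>\<infinity>i. (cmod (cf f i))\<^sup>2)"
proof -
  have "(\<Sum>\<^sub>\<infinity>i. cf f i * cnj (cf f i)) = (\<Sum>\<^sub>\<infinity>i. of_real ((cmod (cf f i))\<^sup>2))"
    by (simp add: complex_norm_square[symmetric])
  also have "\<dots> = of_real (\<Sum>\<^sub>\<infinity>i. (cmod (cf f i))\<^sup>2)"
    by (rule infsumI[OF has_sum_of_real[OF has_sum_infsum[OF cf_summable]]])
  finally show ?thesis
    by (simp add: power2_norm_eq_inner inner_ell2_def)
qed

lemma cinner_self: "cinner f f = of_real ((norm f)\<^sup>2)"
  by (simp add: complex_eq_iff Re_cinner power2_norm_eq_inner)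
    (metis cinner_commute complex_cnj_cancel_iff Im_complex_of_real Reals_cnj_iff complex_is_Real_iff)

lemma norm_ell2_leI:
  assumes "\<And>F. finite F \<Longrightarrow> (\<Sum>i\<in>F. (cmod (cf f i))\<^sup>2) \<le> C\<^sup>2" "0 \<le> C"
  shows "norm f \<le> C"
  using sqsum_bound(2)[OF assms(1)] assms(2) by (metis norm_ell2_sq power2_le_imp_le)

lemma sum_cf_le_norm: "finite F \<Longrightarrow> (\<Sum>i\<in>F. (cmod (cf f i))\<^sup>2) \<le> (norm f)\<^sup>2"
  unfolding norm_ell2_sq by (intro finite_sum_le_infsum cf_summable) auto

lemma cmod_cf_le_norm: "cmod (cf f i) \<le> norm f"
  using sum_cf_le_norm[of "{i}" f] by (simp add: power2_le_iff_abs_le)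

lemma norm_ell2_mono:
  assumes "\<And>i. cmod (cf f i) \<le> C * cmod (cf g i)" "0 \<le> C"
  shows "norm f \<le> C * norm g"
proof (rule norm_ell2_leI)
  fix F :: "'a set" assume F: "finite F"
  have "(\<Sum>i\<in>F. (cmod (cf f i))\<^sup>2) \<le> (\<Sum>i\<in>F. C\<^sup>2 * (cmod (cf g i))\<^sup>2)"
    using assms(1) by (intro sum_mono) (metis norm_ge_zero power_mono power_mult_distrib)
  also have "\<dots> \<le> C\<^sup>2 * (norm g)\<^sup>2"
    unfolding sum_distrib_left[symmetric] by (intro mult_left_mono sum_cf_le_norm F) auto
  finally show "(\<Sum>i\<in>F. (cmod (cf f i))\<^sup>2) \<le> (C * norm g)\<^sup>2"
    by (simp add: power_mult_distrib)
qed (use assms in auto)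

lemma norm_scaleC [simp]: "norm (c *\<^sub>C f) = cmod c * norm f"
proof -
  have "(norm (c *\<^sub>C f))\<^sup>2 = (cmod c * norm f)\<^sup>2"
    by (simp add: norm_ell2_sq norm_mult power_mult_distrib infsum_cmult_right[OF cf_summable])
  then show ?thesis
    by (simp add: power2_eq_iff_nonneg)
qed

lemma cmod_cinner_le: "cmod (cinner f g) \<le> norm f * norm g"
proof -
  \<comment> \<open>A unimodular factor (0 if the product vanishes) that turns the complex inner
    product into its modulus, so that the real Cauchy-Schwarz inequality suffices.\<close>
  define c where "c = cnj (sgn (cinner f g))"
  have "c * cinner f g = of_real (cmod (cinner f g))"
  proof (cases "cinner f g = 0")
    case False
    have "cnj (cinner f g) * cinner f g = (of_real (cmod (cinner f g)))\<^sup>2"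
      using complex_norm_square[of "cinner f g"] by (simp add: mult.commute)
    then show ?thesis
      using False by (simp add: c_def sgn_eq field_simps power2_eq_square)
  qed simp
  then have "cmod (cinner f g) = inner (c *\<^sub>C f) g"
    by (metis Re_cinner Re_complex_of_real cinner_scaleC_left)
  also have "\<dots> \<le> norm (c *\<^sub>C f) * norm g"
    by (rule norm_cauchy_schwarz)
  also have "\<dots> \<le> 1 * norm f * norm g"
    by (intro mult_right_mono) (auto simp: c_def norm_sgn)
  finally show ?thesis
    by simp
qed

lemma bounded_linear_cf: "bounded_linear (\<lambda>f. cf f i)"
  by (rule bounded_linear_intro[where K=1]) (auto simp: cmod_cf_le_norm scaleR_conv_of_real)

lemma bounded_linear_scaleC: "bounded_linear (\<lambda>f :: 'i ell2. c *\<^sub>C f)"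
  by (rule bounded_linear_intro[where K="cmod c"])
    (auto simp: scaleC_add_right scaleR_scaleC mult.commute)

lemma bounded_bilinear_scaleC: "bounded_bilinear (\<lambda>c (f :: 'i ell2). c *\<^sub>C f)"
  by (rule bounded_bilinear.intro)
    (auto intro!: exI[of _ 1] simp: scaleC_add_right scaleC_add_left scaleR_scaleC mult.commute
      scaleR_conv_of_real)

lemma bounded_bilinear_cinner: "bounded_bilinear (cinner :: 'i ell2 \<Rightarrow> _)"
  by (rule bounded_bilinear.intro)
    (auto intro!: exI[of _ 1] simp: cinner_add_left cinner_add_right cmod_cinner_le scaleR_conv_of_real)

lemmas tendsto_cf [tendsto_intros] = bounded_linear.tendsto[OF bounded_linear_cf]
lemmas tendsto_scaleC [tendsto_intros] = bounded_bilinear.tendsto[OF bounded_bilinear_scaleC]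
lemmas continuous_on_scaleC [continuous_intros] = bounded_bilinear.continuous_on[OF bounded_bilinear_scaleC]
lemmas tendsto_cinner [tendsto_intros] = bounded_bilinear.tendsto[OF bounded_bilinear_cinner]

lemma cf_sum [simp]: "cf (\<Sum>a\<in>A. f a) i = (\<Sum>a\<in>A. cf (f a) i)"
  by (induction A rule: infinite_finite_induct) auto

lemma cinner_sum_left: "cinner (\<Sum>a\<in>A. f a) g = (\<Sum>a\<in>A. cinner (f a) g)"
  by (induction A rule: infinite_finite_induct) (auto simp: cinner_add_left)

lemma cinner_sum_right: "cinner g (\<Sum>a\<in>A. f a) = (\<Sum>a\<in>A. cinner g (f a))"
  by (induction A rule: infinite_finite_induct) (auto simp: cinner_add_right)

instance ell2 :: (type) banach
proof
  fix X :: "nat \<Rightarrow> 'a ell2"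
  assume X: "Cauchy X"
  have "Cauchy (\<lambda>n. cf (X n) i)" for i
    by (rule bounded_linear.Cauchy[OF bounded_linear_cf X])
  then have "\<exists>l. (\<lambda>n. cf (X n) i) \<longlonglongrightarrow> l" for i
    using Cauchy_convergent convergent_def by blast
  then obtain x where x: "\<And>i. (\<lambda>n. cf (X n) i) \<longlonglongrightarrow> x i"
    by metis
  \<comment> \<open>Closeness to the coordinatewise limit is stated for finite partial sums, where
    the limit in \<open>n\<close> can be taken termwise; it yields both the square summability of
    the limit and the convergence in norm.\<close>
  have key: "\<exists>M. \<forall>m\<ge>M. \<forall>F. finite F \<longrightarrow> (\<Sum>i\<in>F. (cmod (cf (X m) i - x i))\<^sup>2) \<le> e\<^sup>2" if "e > 0" for e :: real
  proof -
    obtain M where M: "\<And>m n. m \<ge> M \<Longrightarrow> n \<ge> M \<Longrightarrow> norm (X m - X n) < e"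
      using X \<open>e > 0\<close> by (metis Cauchy_def dist_norm)
    have "(\<Sum>i\<in>F. (cmod (cf (X m) i - x i))\<^sup>2) \<le> e\<^sup>2" if "m \<ge> M" "finite F" for m F
    proof (rule LIMSEQ_le_const2)
      show "(\<lambda>n. \<Sum>i\<in>F. (cmod (cf (X m) i - cf (X n) i))\<^sup>2) \<longlonglongrightarrow> (\<Sum>i\<in>F. (cmod (cf (X m) i - x i))\<^sup>2)"
        by (intro tendsto_intros x)
      have "(\<Sum>i\<in>F. (cmod (cf (X m) i - cf (X n) i))\<^sup>2) \<le> e\<^sup>2" if "n \<ge> M" for n
        using sum_cf_le_norm[OF \<open>finite F\<close>, of "X m - X n"] M[OF \<open>m \<ge> M\<close> \<open>n \<ge> M\<close>]
        by (simp add: order_trans[OF _ power_mono] less_imp_le)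
      then show "\<exists>N. \<forall>n\<ge>N. (\<Sum>i\<in>F. (cmod (cf (X m) i - cf (X n) i))\<^sup>2) \<le> e\<^sup>2"
        by blast
    qed
    then show ?thesis
      by blast
  qed
  have "sqsum x"
  proof -
    obtain M where M: "\<And>F. finite F \<Longrightarrow> (\<Sum>i\<in>F. (cmod (cf (X M) i - x i))\<^sup>2) \<le> 1\<^sup>2"
      using key[of 1] by auto
    have "sqsum (\<lambda>i. cf (X M) i - x i)"
      using sqsum_bound(1)[OF M] by blast
    then have "sqsum (\<lambda>i. cf (X M) i + - 1 * (cf (X M) i - x i))"
      by (intro sqsum_add sqsum_cmult) auto
    then show ?thesis
      by simp
  qed
  have "X \<longlonglongrightarrow> ell2_of x"
  proof (rule LIMSEQ_I)
    fix e :: real assume "e > 0"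
    then obtain M where "\<forall>m\<ge>M. \<forall>F. finite F \<longrightarrow> (\<Sum>i\<in>F. (cmod (cf (X m) i - x i))\<^sup>2) \<le> (e/2)\<^sup>2"
      using key[of "e/2"] by auto
    then have "norm (X m - ell2_of x) \<le> e / 2" if "m \<ge> M" for m
      using \<open>sqsum x\<close> \<open>e > 0\<close> that by (intro norm_ell2_leI) auto
    then show "\<exists>M. \<forall>m\<ge>M. norm (X m - ell2_of x) < e"
      using \<open>e > 0\<close> by (intro exI[of _ M]) (fastforce intro: le_less_trans)
  qed
  then show "convergent X"
    by (auto simp: convergent_def)
qed

definition unit2 :: "'i \<Rightarrow> 'i ell2" where
  "unit2 i = ell2_of (\<lambda>j. if j = i then 1 else 0)"

lemma cf_unit2 [simp]: "cf (unit2 i) j = (if j = i then 1 else 0)"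
  unfolding unit2_def by (subst cf_of) (auto intro!: sqsum_finite finite_subset[of _ "{i}"] split: if_splits)

lemma infsum_single: "(\<Sum>\<^sub>\<infinity>j. if j = i then f j else 0) = f i"
  using infsum_cong_neutral[of UNIV "{i}" "\<lambda>j. if j = i then f j else 0" f] by auto

lemma cinner_unit2 [simp]: "cinner f (unit2 i) = cf f i" "cinner (unit2 i) f = cnj (cf f i)"
proof -
  have "cinner f (unit2 i) = (\<Sum>\<^sub>\<infinity>j. if j = i then cf f j else 0)"
    unfolding cinner_def by (rule infsum_cong) auto
  then show "cinner f (unit2 i) = cf f i"
    by (simp add: infsum_single)
  then show "cinner (unit2 i) f = cnj (cf f i)"
    by (metis cinner_commute)
qed

lemma norm_unit2 [simp]: "norm (unit2 i) = 1"
  using cinner_self[of "unit2 i"] norm_ge_zero[of "unit2 i"]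
  by (simp flip: of_real_power add: power2_eq_1_iff del: norm_ge_zero)

lift_definition restr :: "'i set \<Rightarrow> 'i ell2 \<Rightarrow> 'i ell2" is "\<lambda>F x i. if i \<in> F then x i else 0"
  by (rule sqsum_le[where C=1]) auto

lemmas cf_restr [simp] = restr.rep_eq

lemma restr_finite: "finite F \<Longrightarrow> restr F f = (\<Sum>i\<in>F. cf f i *\<^sub>C unit2 i)"
  by (rule ell2_eqI) (simp add: if_distrib cong: if_cong)

text \<open>By Pythagoras the squared error is the total mass minus a finite partial sum. Through
  this lemma bounds on finitely supported vectors extend to all vectors.\<close>

lemma restr_tendsto: "((\<lambda>F. restr F f) \<longlongrightarrow> f) (finite_subsets_at_top UNIV)"
proof (rule tendstoI)
  fix e :: real assume "e > 0"
  have "((\<lambda>F. \<Sum>i\<in>F. (cmod (cf f i))\<^sup>2) \<longlongrightarrow> (norm f)\<^sup>2) (finite_subsets_at_top UNIV)"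
    unfolding norm_ell2_sq using cf_summable[of f] by (metis has_sum_def has_sum_infsum)
  then have "\<forall>\<^sub>F F in finite_subsets_at_top UNIV. dist (\<Sum>i\<in>F. (cmod (cf f i))\<^sup>2) ((norm f)\<^sup>2) < e\<^sup>2"
    using \<open>e > 0\<close> by (intro tendstoD) auto
  moreover have "\<forall>\<^sub>F F in finite_subsets_at_top (UNIV :: 'a set). finite F"
    by (rule eventually_finite_subsets_at_top_weakI) simp
  ultimately show "\<forall>\<^sub>F F in finite_subsets_at_top UNIV. dist (restr F f) f < e"
  proof eventually_elim
    case (elim F)
    have "(norm f)\<^sup>2 = inner (restr F f + (f - restr F f)) (restr F f + (f - restr F f))"
      by (simp add: power2_norm_eq_inner)
    moreover have "inner (restr F f) (f - restr F f) = 0"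
      unfolding inner_ell2_def by (subst infsum_0) auto
    ultimately have "(norm f)\<^sup>2 = (norm (restr F f))\<^sup>2 + (norm (f - restr F f))\<^sup>2"
      by (simp only: inner_add_left inner_add_right inner_commute power2_norm_eq_inner)
    moreover have "(norm (restr F f))\<^sup>2 = (\<Sum>i\<in>F. (cmod (cf f i))\<^sup>2)"
      unfolding norm_ell2_sq using elim
      by (subst infsum_finite[symmetric, of F]) (auto intro!: infsum_cong_neutral simp del: infsum_finite)
    ultimately have "(norm (f - restr F f))\<^sup>2 < e\<^sup>2"
      using elim by (simp add: dist_real_def)
    then show ?case
      using \<open>e > 0\<close> by (simp add: dist_norm norm_minus_commute power_less_imp_less_base)
  qed
qed

section \<open>Interpolation of diagonal weights\<close>

text \<open>The identity \<open>\<integral> \<tau> powr (- \<theta>) * w / (1 + \<tau> * w) = const * w powr \<theta>\<close> over \<open>\<tau> > 0\<close> exhibits a power of a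
  weight as a superposition of quadratic K-functionals; this gives interpolation with the sharp exponent.\<close>

definition Kfun :: "real \<Rightarrow> real \<Rightarrow> real \<Rightarrow> real" where
  "Kfun \<theta> w \<tau> = (if \<tau> > 0 then \<tau> powr (- \<theta>) * (w / (1 + \<tau> * w)) else 0)"

lemma Kfun_measurable [measurable]: "Kfun \<theta> w \<in> borel_measurable borel"
  unfolding Kfun_def[abs_def] by measurable

lemma Kfun_nonneg: "0 < w \<Longrightarrow> 0 \<le> Kfun \<theta> w \<tau>"
  by (simp add: Kfun_def)

text \<open>The substitution of \<open>\<tau> / w\<close> for \<open>\<tau>\<close> extracts
  \<open>w powr \<theta>\<close>; what remains is a constant that
  \<open>interpolation_weights\<close> cancels, once it is known to be positive and finite.\<close>

lemma nn_integral_Kfun: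
  assumes "w > 0"
  shows "(\<integral>\<^sup>+\<tau>. Kfun \<theta> w \<tau> \<partial>lborel) = ennreal (w powr \<theta>) * (\<integral>\<^sup>+\<tau>. Kfun \<theta> 1 \<tau> \<partial>lborel)"
proof -
  have *: "ennreal (1 / w) * ennreal (Kfun \<theta> w (\<tau> / w)) = ennreal (w powr \<theta>) * ennreal (Kfun \<theta> 1 \<tau>)" for \<tau>
  proof (cases "\<tau> > 0")
    case True
    have "(\<tau> / w) powr (- \<theta>) = \<tau> powr (- \<theta>) * w powr \<theta>"
      using True assms by (simp add: powr_divide powr_minus field_simps)
    then have "1 / w * Kfun \<theta> w (\<tau> / w) = w powr \<theta> * Kfun \<theta> 1 \<tau>"
      using True assms by (simp add: Kfun_def field_simps)
    then show ?thesis
      using assms by (simp add: ennreal_mult'' [symmetric] Kfun_nonneg)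
  qed (use assms in \<open>auto simp: Kfun_def zero_less_divide_iff\<close>)
  have "(\<integral>\<^sup>+\<tau>. Kfun \<theta> w \<tau> \<partial>lborel) = ennreal (1 / w) * (\<integral>\<^sup>+\<tau>. Kfun \<theta> w (0 + 1 / w * \<tau>) \<partial>lborel)"
    using assms by (subst nn_integral_real_affine[where c="1/w" and t=0]) auto
  also have "\<dots> = (\<integral>\<^sup>+\<tau>. ennreal (1 / w) * ennreal (Kfun \<theta> w (\<tau> / w)) \<partial>lborel)"
    by (subst nn_integral_cmult[symmetric]) auto
  also have "\<dots> = ennreal (w powr \<theta>) * (\<integral>\<^sup>+\<tau>. Kfun \<theta> 1 \<tau> \<partial>lborel)"
    unfolding * by (rule nn_integral_cmult) simp
  finally show ?thesis .
qed

text \<open>The integrand is at most \<open>\<tau> powr - \<theta>\<close> near 0, integrable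
  because \<open>\<theta> < 1\<close>, and at most \<open>\<tau> powr (- \<theta> - 1)\<close> at
  infinity, integrable because \<open>0 < \<theta>\<close>.\<close>

lemma nn_integral_Kfun_finite:
  assumes "0 < \<theta>" "\<theta> < 1"
  shows "(\<integral>\<^sup>+\<tau>. Kfun \<theta> 1 \<tau> \<partial>lborel) < \<infinity>"
proof -
  have 1: "integral\<^sup>N lborel (\<lambda>x. ennreal (x powr - \<theta>) * indicator {0..1} x) = ennreal (1 powr (- \<theta> + 1) / (- \<theta> + 1))"
    by (intro nn_integral_has_integral_lebesgue' has_integral_powr_from_0) (use assms in auto)
  have 2: "integral\<^sup>N lborel (\<lambda>x. ennreal (x powr (- \<theta> - 1)) * indicator {1..} x) = ennreal (- (1 powr (- \<theta> - 1 + 1)) / (- \<theta> - 1 + 1))"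
    by (intro nn_integral_has_integral_lebesgue' has_integral_powr_to_inf) (use assms in auto)
  have "(\<integral>\<^sup>+\<tau>. Kfun \<theta> 1 \<tau> \<partial>lborel) \<le> (\<integral>\<^sup>+\<tau>. ennreal (\<tau> powr - \<theta>) * indicator {0..1} \<tau> +
      ennreal (\<tau> powr (- \<theta> - 1)) * indicator {1..} \<tau> \<partial>lborel)"
  proof (rule nn_integral_mono)
    fix \<tau> :: real
    consider "\<tau> \<le> 0" | "0 < \<tau>" "\<tau> < 1" | "\<tau> \<ge> 1" by linarith
    then show "ennreal (Kfun \<theta> 1 \<tau>) \<le> ennreal (\<tau> powr - \<theta>) * indicator {0..1} \<tau> +
      ennreal (\<tau> powr (- \<theta> - 1)) * indicator {1..} \<tau>"
    proof cases
      case 2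
      then have "Kfun \<theta> 1 \<tau> \<le> \<tau> powr - \<theta>"
        by (simp add: Kfun_def mult_left_le divide_simps)
      then show ?thesis using 2 by (simp add: ennreal_leI)
    next
      case 3
      have "\<tau> powr (- \<theta> - 1) = \<tau> powr - \<theta> * (1 / \<tau>)"
        using 3 by (simp add: powr_diff)
      moreover have "\<tau> powr - \<theta> * (1 / (1 + \<tau>)) \<le> \<tau> powr - \<theta> * (1 / \<tau>)"
        using 3 by (intro mult_left_mono) (auto simp: divide_simps)
      ultimately have "Kfun \<theta> 1 \<tau> \<le> \<tau> powr (- \<theta> - 1)"
        using 3 by (simp add: Kfun_def)
      then have "ennreal (Kfun \<theta> 1 \<tau>) \<le> ennreal (\<tau> powr (- \<theta> - 1)) * indicator {1..} \<tau>"
        using 3 by (simp add: ennreal_leI)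
      then show ?thesis
        by (rule order_trans) simp
    qed (simp add: Kfun_def)
  qed
  also have "\<dots> = ennreal (1 powr (- \<theta> + 1) / (- \<theta> + 1)) + ennreal (- (1 powr (- \<theta> - 1 + 1)) / (- \<theta> - 1 + 1))"
    unfolding 1[symmetric] 2[symmetric] by (intro nn_integral_add) auto
  also have "\<dots> < \<infinity>" by simp
  finally show ?thesis .
qed

lemma nn_integral_Kfun_pos: "0 < (\<integral>\<^sup>+\<tau>. Kfun \<theta> 1 \<tau> \<partial>lborel)"
proof (rule ccontr)
  assume "\<not> ?thesis"
  then have "(\<integral>\<^sup>+\<tau>. Kfun \<theta> 1 \<tau> \<partial>lborel) = 0"
    by simp
  then have "AE \<tau> in lborel. ennreal (Kfun \<theta> 1 \<tau>) = 0"
    by (subst (asm) nn_integral_0_iff_AE) auto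
  then have "AE \<tau> in lborel. \<tau> \<notin> {0<..<1::real}"
    by eventually_elim (auto simp: Kfun_def)
  then have "{0<..<1::real} \<in> null_sets lborel"
    by (subst AE_iff_null_sets) auto
  then show False
    by (simp add: null_sets_def)
qed

text \<open>Integrating the hypothesis \<open>K\<close> against
  \<open>\<tau> powr - \<theta>\<close> replaces every weight \<open>w / (1 + \<tau> * w)\<close> by
  the same multiple of \<open>w powr \<theta>\<close>. The multiple cancels, so no constant is
  lost.\<close>

lemma interpolation_weights:
  fixes w :: "'i \<Rightarrow> real" and w' :: "'j \<Rightarrow> real"
  assumes fin: "finite F" "finite G" and \<theta>: "0 < \<theta>" "\<theta> < 1"
    and w: "\<And>i. 0 < w i" "\<And>j. 0 < w' j"
    and nonneg: "\<And>i. 0 \<le> x i" "\<And>j. 0 \<le> y j"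
    and K: "\<And>\<tau>. \<tau> > 0 \<Longrightarrow> (\<Sum>j\<in>G. w' j / (1 + \<tau> * w' j) * y j) \<le> (\<Sum>i\<in>F. w i / (1 + \<tau> * w i) * x i)"
  shows "(\<Sum>j\<in>G. w' j powr \<theta> * y j) \<le> (\<Sum>i\<in>F. w i powr \<theta> * x i)"
proof -
  define c where "c = (\<integral>\<^sup>+\<tau>. Kfun \<theta> 1 \<tau> \<partial>lborel)"
  have c: "c \<noteq> 0" "c \<noteq> \<infinity>"
    using nn_integral_Kfun_finite[OF \<theta>] nn_integral_Kfun_pos[of \<theta>] unfolding c_def by auto
  have I: "(\<integral>\<^sup>+\<tau>. ennreal (\<Sum>i\<in>F. Kfun \<theta> (w i) \<tau> * x i) \<partial>lborel) = ennreal (\<Sum>i\<in>F. w i powr \<theta> * x i) * c"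
    if "finite F" "\<And>i. 0 < w i" "\<And>i. 0 \<le> x i" for F :: "'k set" and w x
  proof -
    have "(\<integral>\<^sup>+\<tau>. ennreal (\<Sum>i\<in>F. Kfun \<theta> (w i) \<tau> * x i) \<partial>lborel) =
        (\<integral>\<^sup>+\<tau>. (\<Sum>i\<in>F. ennreal (Kfun \<theta> (w i) \<tau>) * ennreal (x i)) \<partial>lborel)"
      using that by (subst sum_ennreal[symmetric]) (auto simp: ennreal_mult Kfun_nonneg)
    also have "\<dots> = (\<Sum>i\<in>F. (\<integral>\<^sup>+\<tau>. ennreal (Kfun \<theta> (w i) \<tau>) * ennreal (x i) \<partial>lborel))"
      by (intro nn_integral_sum) measurable
    also have "\<dots> = (\<Sum>i\<in>F. ennreal (w i powr \<theta>) * c * ennreal (x i))"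
      using that by (intro sum.cong refl) (simp add: nn_integral_multc nn_integral_Kfun[OF that(2)] c_def)
    also have "\<dots> = (\<Sum>i\<in>F. ennreal (w i powr \<theta> * x i)) * c"
      using that by (simp add: sum_distrib_left ennreal_mult mult_ac)
    also have "(\<Sum>i\<in>F. ennreal (w i powr \<theta> * x i)) = ennreal (\<Sum>i\<in>F. w i powr \<theta> * x i)"
      using that by (intro sum_ennreal) auto
    finally show ?thesis .
  qed
  have "(\<Sum>j\<in>G. Kfun \<theta> (w' j) \<tau> * y j) \<le> (\<Sum>i\<in>F. Kfun \<theta> (w i) \<tau> * x i)" for \<tau>
  proof (cases "\<tau> > 0")
    case True
    have "\<tau> powr - \<theta> * (\<Sum>j\<in>G. w' j / (1 + \<tau> * w' j) * y j) \<le> \<tau> powr - \<theta> * (\<Sum>i\<in>F. w i / (1 + \<tau> * w i) * x i)"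
      using K[OF True] by (intro mult_left_mono) auto
    then show ?thesis
      using True by (simp add: Kfun_def sum_distrib_left mult_ac)
  qed (simp add: Kfun_def)
  then have "ennreal (\<Sum>j\<in>G. w' j powr \<theta> * y j) * c \<le> ennreal (\<Sum>i\<in>F. w i powr \<theta> * x i) * c"
    unfolding I[OF fin(1) w(1) nonneg(1), symmetric] I[OF fin(2) w(2) nonneg(2), symmetric]
    by (intro nn_integral_mono ennreal_leI)
  then have "ennreal (\<Sum>j\<in>G. w' j powr \<theta> * y j) \<le> ennreal (\<Sum>i\<in>F. w i powr \<theta> * x i)"
    using c ennreal_mult_le_mult_iff[of c] by (simp add: mult.commute[of _ c])
  then show ?thesis
    using nonneg by (subst (asm) ennreal_le_iff) (auto intro!: sum_nonneg)
qed

text \<open>The left-hand side is the minimum of the right-hand side over all splittings of the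
  number \<open>a + b\<close>; after the triangle inequality the claim is
  \<open>0 \<le> (cmod a - u * cmod b)\<^sup>2\<close>.\<close>

lemma K_functional_split:
  fixes a b :: complex
  assumes "u > 0"
  shows "u / (1 + u) * (cmod (a + b))\<^sup>2 \<le> (cmod a)\<^sup>2 + u * (cmod b)\<^sup>2"
proof -
  have "(cmod (a + b))\<^sup>2 \<le> (cmod a + cmod b)\<^sup>2"
    by (intro power_mono norm_triangle_ineq) auto
  also have "u * \<dots> \<le> (1 + u) * ((cmod a)\<^sup>2 + u * (cmod b)\<^sup>2)"
    using zero_le_power2[of "cmod a - u * cmod b"]
    by (simp add: power2_eq_square algebra_simps)
  finally have "u * (cmod (a + b))\<^sup>2 \<le> (1 + u) * ((cmod a)\<^sup>2 + u * (cmod b)\<^sup>2)"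
    using assms by simp
  then show ?thesis
    using assms by (simp add: field_simps)
qed

text \<open>\<open>K_functional_split\<close> bounds the K-functional of \<open>A f\<close> from
  below for every splitting of \<open>f\<close>, and the splitting \<open>f0 + f1\<close> attains
  the minimum for \<open>f\<close>. The contraction bound acts on \<open>f0\<close>, the weighted
  bound \<open>bd\<close> on \<open>f1\<close>.\<close>

lemma interpolation_contraction:
  fixes A :: "'i ell2 \<Rightarrow> 'j ell2" and w :: "'i \<Rightarrow> real" and w' :: "'j \<Rightarrow> real"
  assumes add: "\<And>f g. A (f + g) = A f + A g" and contr: "\<And>f. norm (A f) \<le> norm f"
    and w: "\<And>i. 0 < w i" "\<And>j. 0 < w' j" and \<theta>: "0 < \<theta>" "\<theta> < 1"
    and bd: "\<And>f F G. finite F \<Longrightarrow> finite G \<Longrightarrow> restr F f = f \<Longrightarrow>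
      (\<Sum>j\<in>G. w' j * (cmod (cf (A f) j))\<^sup>2) \<le> (\<Sum>i\<in>F. w i * (cmod (cf f i))\<^sup>2)"
    and F: "finite F" "restr F f = f" and G: "finite G"
  shows "(\<Sum>j\<in>G. w' j powr \<theta> * (cmod (cf (A f) j))\<^sup>2) \<le> (\<Sum>i\<in>F. w i powr \<theta> * (cmod (cf f i))\<^sup>2)"
proof (rule interpolation_weights[OF F(1) G \<theta> w])
  fix \<tau> :: real assume \<tau>: "\<tau> > 0"
  have pos: "0 < 1 + \<tau> * w i" for i
    using w \<tau> by (simp add: add_pos_pos)
  \<comment> \<open>At each index this is the \<open>h\<close> that minimizes
    \<open>|f - h|^2 + \<tau> * w * |h|^2\<close>.\<close>
  define f1 where "f1 = ell2_of (\<lambda>i. of_real (1 / (1 + \<tau> * w i)) * cf f i)"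
  define f0 where "f0 = f - f1"
  have z: "cf f i = 0" if "i \<notin> F" for i
    using arg_cong[OF F(2), of "\<lambda>h. cf h i"] that by simp
  have "sqsum (\<lambda>i. of_real (1 / (1 + \<tau> * w i)) * cf f i)"
    by (rule sqsum_finite) (rule finite_subset[OF _ F(1)], use z in auto)
  then have f1: "cf f1 i = of_real (1 / (1 + \<tau> * w i)) * cf f i" for i
    by (simp add: f1_def)
  have f0: "cf f0 i = of_real (\<tau> * w i / (1 + \<tau> * w i)) * cf f i" for i
  proof -
    have "1 - 1 / (1 + \<tau> * w i) = \<tau> * w i / (1 + \<tau> * w i)"
      using pos[of i] by (simp add: field_simps)
    moreover have "cf f0 i = of_real (1 - 1 / (1 + \<tau> * w i)) * cf f i"
      by (simp only: f0_def cf_simps f1 of_real_diff of_real_1 left_diff_distrib mult_1)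
    ultimately show ?thesis
      by simp
  qed
  have f01: "restr F f0 = f0" "restr F f1 = f1"
    by (rule ell2_eqI; simp add: f0 f1 z)+
  have n0: "(norm f0)\<^sup>2 = (\<Sum>i\<in>F. (cmod (cf f0 i))\<^sup>2)"
    unfolding norm_ell2_sq
    by (subst infsum_finite[OF F(1), symmetric], rule infsum_cong_neutral) (auto simp: f0 z)
  have "(\<Sum>j\<in>G. \<tau> * (w' j / (1 + \<tau> * w' j) * (cmod (cf (A f) j))\<^sup>2))
      \<le> (\<Sum>j\<in>G. (cmod (cf (A f0) j))\<^sup>2 + \<tau> * w' j * (cmod (cf (A f1) j))\<^sup>2)"
  proof (rule sum_mono)
    fix j
    have "A f = A f0 + A f1"
      by (simp add: f0_def flip: add)
    then show "\<tau> * (w' j / (1 + \<tau> * w' j) * (cmod (cf (A f) j))\<^sup>2) \<le> (cmod (cf (A f0) j))\<^sup>2 + \<tau> * w' j * (cmod (cf (A f1) j))\<^sup>2"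
      using K_functional_split[of "\<tau> * w' j" "cf (A f0) j" "cf (A f1) j"] \<tau> w by simp
  qed
  also have "\<dots> = (\<Sum>j\<in>G. (cmod (cf (A f0) j))\<^sup>2) + \<tau> * (\<Sum>j\<in>G. w' j * (cmod (cf (A f1) j))\<^sup>2)"
    by (simp add: sum.distrib sum_distrib_left mult.assoc)
  also have "\<dots> \<le> (norm f0)\<^sup>2 + \<tau> * (\<Sum>i\<in>F. w i * (cmod (cf f1 i))\<^sup>2)"
  proof (intro add_mono mult_left_mono bd F G f01)
    show "(\<Sum>j\<in>G. (cmod (cf (A f0) j))\<^sup>2) \<le> (norm f0)\<^sup>2"
      using sum_cf_le_norm[OF G, of "A f0"] power_mono[OF contr[of f0] norm_ge_zero, of 2] by linarith
  qed (use \<tau> in auto)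
  also have "\<dots> = (\<Sum>i\<in>F. \<tau> * (w i / (1 + \<tau> * w i) * (cmod (cf f i))\<^sup>2))"
    unfolding n0 sum_distrib_left sum.distrib[symmetric]
  proof (rule sum.cong[OF refl])
    fix i
    have "(\<tau> * w i / (1 + \<tau> * w i))\<^sup>2 + \<tau> * w i * (1 / (1 + \<tau> * w i))\<^sup>2 = (\<tau> * w i * (1 + \<tau> * w i)) / (1 + \<tau> * w i)\<^sup>2"
      by (simp add: power_divide add_divide_distrib[symmetric]) (simp add: power2_eq_square algebra_simps)
    also have "\<dots> = \<tau> * (w i / (1 + \<tau> * w i))"
      using pos[of i] by (simp add: power2_eq_square)
    finally have e: "(\<tau> * w i / (1 + \<tau> * w i))\<^sup>2 + \<tau> * w i * (1 / (1 + \<tau> * w i))\<^sup>2 = \<tau> * (w i / (1 + \<tau> * w i))" .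
    have "(cmod (cf f0 i))\<^sup>2 + \<tau> * (w i * (cmod (cf f1 i))\<^sup>2) =
        ((\<tau> * w i / (1 + \<tau> * w i))\<^sup>2 + \<tau> * w i * (1 / (1 + \<tau> * w i))\<^sup>2) * (cmod (cf f i))\<^sup>2"
      using pos[of i] \<tau> w(1)[of i] unfolding f0 f1 norm_mult norm_of_real power_mult_distrib power2_abs by (simp only: distrib_left distrib_right mult_ac)
    then show "(cmod (cf f0 i))\<^sup>2 + \<tau> * (w i * (cmod (cf f1 i))\<^sup>2) = \<tau> * (w i / (1 + \<tau> * w i) * (cmod (cf f i))\<^sup>2)"
      unfolding e by (simp add: mult.assoc)
  qed
  finally show "(\<Sum>j\<in>G. w' j / (1 + \<tau> * w' j) * (cmod (cf (A f) j))\<^sup>2) \<le> (\<Sum>i\<in>F. w i / (1 + \<tau> * w i) * (cmod (cf f i))\<^sup>2)"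
    using \<tau> unfolding sum_distrib_left[symmetric] by simp
qed auto

section \<open>Weighted sequence spaces\<close>

text \<open>One class for the two index sets: \<open>int\<close> for Fourier coefficients on the
  circle, \<open>nat\<close> for the Hardy space of nonnegative frequencies.\<close>

class weight = countable +
  fixes br :: "'a \<Rightarrow> real"
  assumes br_ge1: "1 \<le> br x"

instantiation int :: weight
begin
definition br_int :: "int \<Rightarrow> real" where "br_int = jap"
instance by standard (simp add: br_int_def jap_def)
end

instantiation nat :: weight
begin
definition br_nat :: "nat \<Rightarrow> real" where "br_nat n = max 1 (real n)"
instance by standard (simp add: br_nat_def)
end

lemma br_pos [simp]: "0 < br x" "0 \<le> br x" "br x \<noteq> 0"
  using br_ge1[of x] by auto

definition insob :: "real \<Rightarrow> ('i::weight \<Rightarrow> complex) \<Rightarrow> bool" where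
  "insob r x \<longleftrightarrow> sqsum (\<lambda>i. of_real (br i powr r) * x i)"

text \<open>Meaningful only under \<open>insob r x\<close>; otherwise \<open>ell2_of\<close> is
  applied off its domain, and \<open>J\<close> and \<open>hn\<close> carry no information. Sequences
  stay plain functions because those of negative order need not be square summable.\<close>

definition J :: "real \<Rightarrow> ('i::weight \<Rightarrow> complex) \<Rightarrow> 'i ell2" where
  "J r x = ell2_of (\<lambda>i. of_real (br i powr r) * x i)"

definition hn :: "real \<Rightarrow> ('i::weight \<Rightarrow> complex) \<Rightarrow> real" where
  "hn r x = norm (J r x)"

lemma cf_J [simp]: "insob r x \<Longrightarrow> cf (J r x) i = of_real (br i powr r) * x i"
  by (simp add: J_def insob_def)

lemma hn_nonneg [simp]: "0 \<le> hn r x"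
  by (simp add: hn_def)

lemma insob_add: "insob r x \<Longrightarrow> insob r y \<Longrightarrow> insob r (\<lambda>i. x i + y i)"
  unfolding insob_def using sqsum_add by (force simp: distrib_left)

lemma insob_cmult: "insob r x \<Longrightarrow> insob r (\<lambda>i. c * x i)"
  unfolding insob_def using sqsum_cmult[of _ c] by (force simp: mult.left_commute)

lemma insob_uminus: "insob r x \<Longrightarrow> insob r (\<lambda>i. - x i)"
  using insob_cmult[of r x "- 1"] by simp

lemma insob_diff: "insob r x \<Longrightarrow> insob r y \<Longrightarrow> insob r (\<lambda>i. x i - y i)"
  using insob_add[OF _ insob_uminus] by simp

lemma insob_zero [simp]: "insob r (\<lambda>i. 0)"
  by (simp add: insob_def sqsum_def)

lemma insob_finite: "finite {i. x i \<noteq> 0} \<Longrightarrow> insob r x"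
  unfolding insob_def by (rule sqsum_finite) simp

lemma J_add: "insob r x \<Longrightarrow> insob r y \<Longrightarrow> J r (\<lambda>i. x i + y i) = J r x + J r y"
  by (rule ell2_eqI) (simp add: insob_add algebra_simps)

lemma J_diff: "insob r x \<Longrightarrow> insob r y \<Longrightarrow> J r (\<lambda>i. x i - y i) = J r x - J r y"
  by (rule ell2_eqI) (simp add: insob_diff algebra_simps)

lemma J_cmult: "insob r x \<Longrightarrow> J r (\<lambda>i. c * x i) = c *\<^sub>C J r x"
  by (rule ell2_eqI) (simp add: insob_cmult algebra_simps)

lemma hn_add_le: "insob r x \<Longrightarrow> insob r y \<Longrightarrow> hn r (\<lambda>i. x i + y i) \<le> hn r x + hn r y"
  by (simp add: hn_def J_add norm_triangle_ineq)

lemma hn_diff_le: "insob r x \<Longrightarrow> insob r y \<Longrightarrow> hn r (\<lambda>i. x i - y i) \<le> hn r x + hn r y"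
  by (simp add: hn_def J_diff norm_triangle_ineq4)

lemma hn_cmult: "insob r x \<Longrightarrow> hn r (\<lambda>i. c * x i) = cmod c * hn r x"
  by (simp add: hn_def J_cmult)

lemma hn_zero [simp]: "hn r (\<lambda>i. 0) = 0"
proof -
  have "J r (\<lambda>i. 0) = 0" by (rule ell2_eqI) simp
  then show ?thesis by (simp add: hn_def)
qed

lemma hn_triangle3:
  "insob r x \<Longrightarrow> insob r y \<Longrightarrow> insob r z \<Longrightarrow> hn r (\<lambda>i. x i - z i) \<le> hn r (\<lambda>i. x i - y i) + hn r (\<lambda>i. y i - z i)"
  using hn_add_le[OF insob_diff insob_diff, of r x y y z] by simp

lemma hn_diff_commute: "insob r x \<Longrightarrow> insob r y \<Longrightarrow> hn r (\<lambda>i. x i - y i) = hn r (\<lambda>i. y i - x i)"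
  by (simp add: hn_def J_diff norm_minus_commute)

lemma br_powr_sq: "(br i powr r)\<^sup>2 = br i powr (2 * r)"
  by (simp add: power2_eq_square flip: powr_add)

lemma sum_le_hn:
  assumes "insob r x" "finite F"
  shows "(\<Sum>i\<in>F. br i powr (2 * r) * (cmod (x i))\<^sup>2) \<le> (hn r x)\<^sup>2"
  using sum_cf_le_norm[OF assms(2), of "J r x"] assms(1)
  by (simp add: hn_def norm_mult power_mult_distrib br_powr_sq)

lemma insob_boundI:
  assumes "\<And>F. finite F \<Longrightarrow> (\<Sum>i\<in>F. br i powr (2 * r) * (cmod (x i))\<^sup>2) \<le> C\<^sup>2" "0 \<le> C"
  shows "insob r x" "hn r x \<le> C"
proof -
  have *: "(\<Sum>i\<in>F. (cmod (of_real (br i powr r) * x i))\<^sup>2) \<le> C\<^sup>2" if "finite F" for F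
    using assms(1)[OF that] by (simp add: norm_mult power_mult_distrib br_powr_sq)
  show i: "insob r x"
    unfolding insob_def using sqsum_bound(1)[OF *] .
  show "hn r x \<le> C"
    unfolding hn_def using * assms(2) i by (intro norm_ell2_leI) auto
qed

lemma hn_sq: "insob r x \<Longrightarrow> (hn r x)\<^sup>2 = (\<Sum>\<^sub>\<infinity>i. br i powr (2 * r) * (cmod (x i))\<^sup>2)"
  unfolding hn_def norm_ell2_sq by (simp add: norm_mult power_mult_distrib br_powr_sq)

lemma insob_summable: "insob r x \<longleftrightarrow> (\<lambda>i. br i powr (2 * r) * (cmod (x i))\<^sup>2) summable_on UNIV"
  unfolding insob_def sqsum_def by (simp add: norm_mult power_mult_distrib br_powr_sq)

lemma coord_le_hn: "insob r x \<Longrightarrow> cmod (x i) \<le> br i powr (- r) * hn r x"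
  using cmod_cf_le_norm[of "J r x" i] by (simp add: hn_def norm_mult powr_minus field_simps)

lemma insob_dominated:
  assumes "insob q y" "\<And>i. br i powr r * cmod (x i) \<le> C * (br i powr q * cmod (y i))" "0 \<le> C"
  shows "insob r x" "hn r x \<le> C * hn q y"
proof -
  have *: "cmod (of_real (br i powr r) * x i) \<le> C * cmod (of_real (br i powr q) * y i)" for i
    using assms(2)[of i] by (simp add: norm_mult)
  show i: "insob r x"
    using assms(1) unfolding insob_def by (rule sqsum_le[OF _ *])
  show "hn r x \<le> C * hn q y"
    unfolding hn_def by (rule norm_ell2_mono) (simp_all only: cf_J[OF i] cf_J[OF assms(1)] * assms(3))
qed

lemma
  assumes "insob q x" "r \<le> q"
  shows insob_mono: "insob r x" and hn_mono: "hn r x \<le> hn q x"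
proof -
  have "br i powr r * cmod (x i) \<le> 1 * (br i powr q * cmod (x i))" for i
    using assms(2) br_ge1[of i] by (simp add: mult_right_mono powr_mono)
  note * = insob_dominated[OF assms(1) this zero_le_one]
  show "insob r x"
    by (rule *(1))
  show "hn r x \<le> hn q x"
    using *(2) by simp
qed

lemma insob_0_cf [simp]: "insob 0 (cf f)"
  by (simp add: insob_def powr_zero_eq_one)

lemma insob_cf [simp]: "r \<le> 0 \<Longrightarrow> insob r (cf f)"
  by (rule insob_mono[OF insob_0_cf])

lemma hn_0_cf [simp]: "hn 0 (cf f) = norm f"
proof -
  have "J 0 (cf f) = f"
    by (rule ell2_eqI) (simp add: powr_zero_eq_one)
  then show ?thesis
    by (simp add: hn_def)
qed

lemma
  assumes "insob r x"
  shows insob_restr: "insob r (\<lambda>i. if i \<in> F then x i else 0)"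
    and hn_restr_le: "hn r (\<lambda>i. if i \<in> F then x i else 0) \<le> hn r x"
proof -
  have "br i powr r * cmod (if i \<in> F then x i else 0) \<le> 1 * (br i powr r * cmod (x i))" for i
    by simp
  note * = insob_dominated[OF assms this zero_le_one]
  show "insob r (\<lambda>i. if i \<in> F then x i else 0)"
    by (rule *(1))
  show "hn r (\<lambda>i. if i \<in> F then x i else 0) \<le> hn r x"
    using *(2) by simp
qed

lemma sob_duality:
  assumes "insob r x" "insob (- r) y"
  shows "(\<lambda>i. cmod (x i * cnj (y i))) summable_on UNIV"
    "cmod (\<Sum>\<^sub>\<infinity>i. x i * cnj (y i)) \<le> hn r x * hn (- r) y"
    "cinner (J r x) (J (- r) y) = (\<Sum>\<^sub>\<infinity>i. x i * cnj (y i))"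
proof -
  have e: "cf (J r x) i * cnj (cf (J (- r) y) i) = x i * cnj (y i)" for i
  proof -
    have "complex_of_real (br i powr r) * of_real (br i powr (- r)) = 1"
      by (simp flip: of_real_mult powr_add)
    then show ?thesis using assms
      by (simp add: mult_ac)
  qed
  show "cinner (J r x) (J (- r) y) = (\<Sum>\<^sub>\<infinity>i. x i * cnj (y i))"
    unfolding cinner_def e ..
  then show "cmod (\<Sum>\<^sub>\<infinity>i. x i * cnj (y i)) \<le> hn r x * hn (- r) y"
    unfolding hn_def by (metis cmod_cinner_le)
  show "(\<lambda>i. cmod (x i * cnj (y i))) summable_on UNIV"
    using cinner_summable[of "J r x" "J (- r) y"] unfolding e by (simp add: summable_on_iff_abs_summable_on_complex)
qed

lemma cinner_le_hn: "insob r (cf f) \<Longrightarrow> insob (- r) (cf g) \<Longrightarrow> cmod (cinner f g) \<le> hn r (cf f) * hn (- r) (cf g)"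
  unfolding cinner_def by (rule sob_duality(2))

text \<open>Testing with \<open>br powr (2 * r)\<close> times \<open>x\<close>, cut off to
  \<open>F\<close>, makes the pairing and the square of the dual norm of the test sequence the same
  number \<open>S\<close>, so that \<open>S \<le> C * sqrt S\<close>.\<close>

lemma sob_duality_converse:
  fixes x :: "'i::weight \<Rightarrow> complex"
  assumes "\<And>F g. finite F \<Longrightarrow> (\<And>i. i \<notin> F \<Longrightarrow> g i = 0) \<Longrightarrow> cmod (\<Sum>i\<in>F. x i * cnj (g i)) \<le> C * hn (- r) g" "0 \<le> C"
  shows "insob r x" "hn r x \<le> C"
proof -
  have "(\<Sum>i\<in>F. br i powr (2 * r) * (cmod (x i))\<^sup>2) \<le> C\<^sup>2" if F: "finite F" for F
  proof -
    define g where "g i = (if i \<in> F then of_real (br i powr (2 * r)) * x i else 0)" for i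
    define S where "S = (\<Sum>i\<in>F. br i powr (2 * r) * (cmod (x i))\<^sup>2)"
    have ig: "insob (- r) g"
      by (rule insob_finite) (rule finite_subset[OF _ F], auto simp: g_def split: if_splits)
    have "(hn (- r) g)\<^sup>2 = (\<Sum>i\<in>F. br i powr (2 * - r) * (cmod (g i))\<^sup>2)"
      unfolding hn_sq[OF ig]
      by (subst infsum_finite[OF F, symmetric], rule infsum_cong_neutral) (auto simp: g_def)
    also have "\<dots> = S"
      unfolding S_def by (intro sum.cong refl) (auto simp: g_def norm_mult power_mult_distrib br_powr_sq simp flip: powr_add mult.assoc)
    finally have n: "(hn (- r) g)\<^sup>2 = S" .
    have "x i * cnj (g i) = of_real (br i powr (2 * r) * (cmod (x i))\<^sup>2)" if "i \<in> F" for i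
      using that by (simp add: g_def complex_norm_square[symmetric] mult.left_commute flip: of_real_power)
    then have "(\<Sum>i\<in>F. x i * cnj (g i)) = of_real S"
      by (simp add: S_def)
    then have "\<bar>S\<bar> \<le> C * hn (- r) g"
      using assms(1)[OF F, of g] by (simp add: g_def)
    then have "hn (- r) g * hn (- r) g \<le> C * hn (- r) g"
      unfolding n[symmetric] by (simp add: power2_eq_square)
    then have "hn (- r) g \<le> C"
      using assms(2) by (cases "hn (- r) g = 0") (auto simp: mult_le_cancel_right less_le)
    then show ?thesis
      unfolding S_def[symmetric] n[symmetric] by (intro power_mono) auto
  qed
  from insob_boundI[OF this assms(2)] show "insob r x" "hn r x \<le> C"
    by auto
qed

text \<open>On finitely supported vectors this is \<open>interpolation_contraction\<close> with
  weights \<open>B\<^sup>2 * br powr (2 * k)\<close> and \<open>br powr (2 * k)\<close>, where the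
  factor \<open>B\<^sup>2\<close> turns into \<open>(B powr \<theta>)\<^sup>2\<close>. The order
  \<open>k\<close> may have either sign, which serves both the regularity of \<open>Vs t\<close> and
  its bound at order \<open>- s\<close>.\<close>

lemma sob_interpolation:
  fixes A :: "'i::weight ell2 \<Rightarrow> 'j::weight ell2"
  assumes add: "\<And>f g. A (f + g) = A f + A g" and contr: "\<And>f. norm (A f) \<le> norm f" and "0 < B"
    and \<theta>: "0 < \<theta>" "\<theta> < 1"
    and bd: "\<And>f F. finite F \<Longrightarrow> restr F f = f \<Longrightarrow> insob k (cf (A f)) \<and> hn k (cf (A f)) \<le> B * hn k (cf f)"
    and f: "insob (\<theta> * k) (cf f)"
  shows "insob (\<theta> * k) (cf (A f))" "hn (\<theta> * k) (cf (A f)) \<le> B powr \<theta> * hn (\<theta> * k) (cf f)"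
proof -
  have fin: "(\<Sum>j\<in>G. br j powr (2 * (\<theta> * k)) * (cmod (cf (A f) j))\<^sup>2) \<le> (B powr \<theta> * hn (\<theta> * k) (cf f))\<^sup>2"
    if F: "finite F" "restr F f = f" and G: "finite G" and i: "insob (\<theta> * k) (cf f)" for F :: "'i set" and G :: "'j set" and f
  proof -
    have "(\<Sum>j\<in>G. (br j powr (2 * k)) powr \<theta> * (cmod (cf (A f) j))\<^sup>2) \<le>
        (\<Sum>i\<in>F. (B\<^sup>2 * br i powr (2 * k)) powr \<theta> * (cmod (cf f i))\<^sup>2)"
    proof (rule interpolation_contraction[OF add contr _ _ \<theta> _ F G])
      fix f :: "'i ell2" and F and G :: "'j set" assume *: "finite F" "finite G" "restr F f = f"
      have z: "cf f i = 0" if "i \<notin> F" for i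
        using arg_cong[OF *(3), of "\<lambda>h. cf h i"] that by simp
      have "insob k (cf f)"
        by (rule insob_finite) (rule finite_subset[OF _ *(1)], use z in auto)
      then have h: "(hn k (cf f))\<^sup>2 = (\<Sum>i\<in>F. br i powr (2 * k) * (cmod (cf f i))\<^sup>2)"
        by (subst hn_sq) (auto intro!: infsum_cong_neutral simp: z simp flip: infsum_finite[OF *(1)] simp del: infsum_finite)
      have "(\<Sum>j\<in>G. br j powr (2 * k) * (cmod (cf (A f) j))\<^sup>2) \<le> (hn k (cf (A f)))\<^sup>2"
        using bd[OF *(1,3)] by (intro sum_le_hn *) auto
      also have "\<dots> \<le> (B * hn k (cf f))\<^sup>2"
        using bd[OF *(1,3)] by (intro power_mono) auto
      also have "\<dots> = (\<Sum>i\<in>F. B\<^sup>2 * br i powr (2 * k) * (cmod (cf f i))\<^sup>2)"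
        by (simp add: power_mult_distrib h sum_distrib_left mult.assoc)
      finally show "(\<Sum>j\<in>G. br j powr (2 * k) * (cmod (cf (A f) j))\<^sup>2) \<le> (\<Sum>i\<in>F. B\<^sup>2 * br i powr (2 * k) * (cmod (cf f i))\<^sup>2)" .
    qed (use \<open>0 < B\<close> in auto)
    also have "\<dots> = (B powr \<theta>)\<^sup>2 * (\<Sum>i\<in>F. br i powr (2 * (\<theta> * k)) * (cmod (cf f i))\<^sup>2)"
      using \<open>0 < B\<close> by (simp add: sum_distrib_left powr_mult powr_powr power2_eq_square mult_ac)
    also have "\<dots> \<le> (B powr \<theta>)\<^sup>2 * (hn (\<theta> * k) (cf f))\<^sup>2"
      by (intro mult_left_mono sum_le_hn i F) auto
    finally show ?thesis
      by (simp add: powr_powr power_mult_distrib mult_ac)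
  qed
  have "(\<Sum>j\<in>G. br j powr (2 * (\<theta> * k)) * (cmod (cf (A f) j))\<^sup>2) \<le> (B powr \<theta> * hn (\<theta> * k) (cf f))\<^sup>2"
    if G: "finite G" for G
  proof (rule tendsto_upperbound)
    \<comment> \<open>Additivity and contraction make \<open>A\<close> continuous, so that the
      finite sums for \<open>restr F f\<close> converge to those for \<open>f\<close>.\<close>
    have "isCont A f"
    proof -
      have "A x - A y = A (x - y)" for x y
        using add[of "x - y" y] by simp
      then show ?thesis
        unfolding continuous_at_eps_delta dist_norm by (metis contr le_less_trans)
    qed
    then show "((\<lambda>F. \<Sum>j\<in>G. br j powr (2 * (\<theta> * k)) * (cmod (cf (A (restr F f)) j))\<^sup>2) \<longlongrightarrow>
        (\<Sum>j\<in>G. br j powr (2 * (\<theta> * k)) * (cmod (cf (A f) j))\<^sup>2)) (finite_subsets_at_top UNIV)"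
      by (intro tendsto_intros isCont_tendsto_compose[of _ A] restr_tendsto)
    have "(\<Sum>j\<in>G. br j powr (2 * (\<theta> * k)) * (cmod (cf (A (restr F f)) j))\<^sup>2) \<le> (B powr \<theta> * hn (\<theta> * k) (cf f))\<^sup>2"
      if F: "finite F" for F
    proof -
      have e: "cf (restr F f) = (\<lambda>i. if i \<in> F then cf f i else 0)" by auto
      have "(\<Sum>j\<in>G. br j powr (2 * (\<theta> * k)) * (cmod (cf (A (restr F f)) j))\<^sup>2) \<le> (B powr \<theta> * hn (\<theta> * k) (cf (restr F f)))\<^sup>2"
        by (intro fin[OF F _ G]) (auto simp: e insob_restr[OF f] intro: ell2_eqI)
      also have "\<dots> \<le> (B powr \<theta> * hn (\<theta> * k) (cf f))\<^sup>2"
        unfolding e by (intro power_mono mult_left_mono hn_restr_le f) auto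
      finally show ?thesis .
    qed
    then show "\<forall>\<^sub>F F in finite_subsets_at_top UNIV. (\<Sum>j\<in>G. br j powr (2 * (\<theta> * k)) * (cmod (cf (A (restr F f)) j))\<^sup>2) \<le> (B powr \<theta> * hn (\<theta> * k) (cf f))\<^sup>2"
      by (intro eventually_finite_subsets_at_top_weakI)
  qed auto
  then show "insob (\<theta> * k) (cf (A f))" "hn (\<theta> * k) (cf (A f)) \<le> B powr \<theta> * hn (\<theta> * k) (cf f)"
    using insob_boundI[of "\<theta> * k" "cf (A f)" "B powr \<theta> * hn (\<theta> * k) (cf f)"] by auto
qed

section \<open>Products and Toeplitz operators\<close>

lemma br_int_simps: "br (k :: int) = max 1 \<bar>of_int k\<bar>"
  by (simp add: br_int_def jap_def)

lemma br_int_uminus [simp]: "br (- k :: int) = br k"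
  by (simp add: br_int_simps)

lemma br_int_add_le: "br (m + n :: int) \<le> br m + br n"
  unfolding br_int_simps by linarith

lemma br_of_nat [simp]: "br (int n) = br n"
  by (simp add: br_int_simps br_nat_def)

lemma zeta_bound:
  assumes "\<rho> > 1 / 2"
  shows "\<exists>Z\<ge>0. \<forall>F. finite F \<longrightarrow> (\<Sum>n\<in>F. br (n :: int) powr (- 2 * \<rho>)) \<le> Z"
proof -
  define g where "g n = br (n :: nat) powr (- 2 * \<rho>)" for n
  have "summable (\<lambda>n. real n powr (- 2 * \<rho>))"
    using assms by (subst summable_real_powr_iff) auto
  then have "summable g"
    by (rule summable_comparison_test_ev[rotated])
      (auto simp: g_def br_nat_def intro!: eventually_sequentiallyI[of 1])
  then have le: "sum g N \<le> suminf g" if "finite N" for N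
    using that by (intro sum_le_suminf) (auto simp: g_def)
  have "(\<Sum>n\<in>F. br (n :: int) powr (- 2 * \<rho>)) \<le> 2 * suminf g" if F: "finite F" for F
  proof -
    have "(\<Sum>n\<in>F. br (n :: int) powr (- 2 * \<rho>)) =
        (\<Sum>n\<in>F \<inter> {0..}. br n powr (- 2 * \<rho>)) + (\<Sum>n\<in>F - {0..}. br n powr (- 2 * \<rho>))"
      by (rule sum.Int_Diff) (rule F)
    also have "(\<Sum>n\<in>F \<inter> {0..}. br n powr (- 2 * \<rho>)) = sum g (nat ` (F \<inter> {0..}))"
      by (subst sum.reindex) (auto simp: inj_on_def g_def br_int_simps br_nat_def intro!: sum.cong)
    also have "(\<Sum>n\<in>F - {0..}. br n powr (- 2 * \<rho>)) = sum g ((\<lambda>n. nat (- n)) ` (F - {0..}))"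
      by (subst sum.reindex) (auto simp: inj_on_def g_def br_int_simps br_nat_def intro!: sum.cong)
    also have "sum g (nat ` (F \<inter> {0..})) + sum g ((\<lambda>n. nat (- n)) ` (F - {0..})) \<le> suminf g + suminf g"
      using F by (intro add_mono le) auto
    finally show ?thesis by simp
  qed
  moreover have "suminf g \<ge> 0"
    using le[of "{}"] by simp
  ultimately show ?thesis
    by (intro exI[of _ "2 * suminf g"]) auto
qed

section \<open>Trilinear sums over the frequencies m, n and m + n\<close>

definition l2b :: "(int \<Rightarrow> real) \<Rightarrow> real \<Rightarrow> bool" where
  "l2b A \<alpha> \<longleftrightarrow> 0 \<le> \<alpha> \<and> (\<forall>k. 0 \<le> A k) \<and> (\<forall>F. finite F \<longrightarrow> (\<Sum>k\<in>F. (A k)\<^sup>2) \<le> \<alpha>\<^sup>2)"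

lemma l2b_L2_set: "l2b A \<alpha> \<Longrightarrow> finite F \<Longrightarrow> L2_set A F \<le> \<alpha>"
  unfolding l2b_def L2_set_def by (metis real_sqrt_le_mono real_sqrt_abs abs_of_nonneg)

lemma l2b_L2_set_reindex:
  assumes "l2b A \<alpha>" "finite P" "inj_on a P"
  shows "L2_set (\<lambda>p. A (a p)) P \<le> \<alpha>"
proof -
  have "L2_set (\<lambda>p. A (a p)) P = L2_set A (a ` P)"
    unfolding L2_set_def by (subst sum.reindex[OF assms(3)]) simp
  then show ?thesis
    using l2b_L2_set[OF assms(1), of "a ` P"] assms(2) by simp
qed

text \<open>Cauchy-Schwarz on each fibre of \<open>c\<close>, then summation of \<open>C\<close>
  over the values of \<open>c\<close>. The index maps are abstract so that each of
  \<open>m + n\<close>, \<open>m\<close> and \<open>n\<close> can carry the summable factor; the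
  injectivity says that \<open>c\<close> and one further index determine the pair.\<close>

lemma tri_l1:
  assumes P: "finite P" and A: "l2b A \<alpha>" and B: "l2b B \<beta>"
    and C: "\<And>k. 0 \<le> C k" "\<And>F. finite F \<Longrightarrow> (\<Sum>k\<in>F. C k) \<le> \<gamma>"
    and inj: "inj_on (\<lambda>p. (c p, a p)) P" "inj_on (\<lambda>p. (c p, b p)) P"
  shows "(\<Sum>p\<in>P. A (a p) * B (b p) * C (c p)) \<le> \<alpha> * \<beta> * \<gamma>"
proof -
  have ab: "0 \<le> \<alpha>" "0 \<le> \<beta>"
    using A B by (auto simp: l2b_def)
  have "(\<Sum>p\<in>P. A (a p) * B (b p) * C (c p)) = (\<Sum>n\<in>c ` P. \<Sum>p\<in>{p\<in>P. c p = n}. A (a p) * B (b p) * C (c p))"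
    by (rule sum.image_gen) (rule P)
  also have "\<dots> \<le> (\<Sum>n\<in>c ` P. (\<alpha> * \<beta>) * C n)"
  proof (rule sum_mono)
    fix n
    let ?Q = "{p\<in>P. c p = n}"
    have Q: "finite ?Q" "inj_on a ?Q" "inj_on b ?Q"
      using P inj by (auto simp: inj_on_def)
    have "(\<Sum>p\<in>?Q. A (a p) * B (b p)) = (\<Sum>p\<in>?Q. \<bar>A (a p)\<bar> * \<bar>B (b p)\<bar>)"
      using A B by (simp add: l2b_def)
    also have "\<dots> \<le> L2_set (\<lambda>p. A (a p)) ?Q * L2_set (\<lambda>p. B (b p)) ?Q"
      by (rule L2_set_mult_ineq)
    also have "\<dots> \<le> \<alpha> * \<beta>"
      by (intro mult_mono l2b_L2_set_reindex A B Q ab L2_set_nonneg)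
    finally have "(\<Sum>p\<in>?Q. A (a p) * B (b p)) * C n \<le> (\<alpha> * \<beta>) * C n"
      by (intro mult_right_mono C)
    then show "(\<Sum>p\<in>?Q. A (a p) * B (b p) * C (c p)) \<le> (\<alpha> * \<beta>) * C n"
      by (simp add: sum_distrib_right)
  qed
  also have "\<dots> = (\<alpha> * \<beta>) * (\<Sum>n\<in>c ` P. C n)"
    by (simp add: sum_distrib_left)
  also have "\<dots> \<le> (\<alpha> * \<beta>) * \<gamma>"
    using P ab by (intro mult_left_mono C) auto
  finally show ?thesis .
qed

lemma l2b_weighted_l1:
  assumes Z: "\<And>F. finite F \<Longrightarrow> (\<Sum>n\<in>F. br (n :: int) powr (- 2 * \<rho>)) \<le> Z" "0 \<le> Z" and C: "l2b C \<gamma>" and F: "finite F"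
  shows "(\<Sum>n\<in>F. br n powr (- \<rho>) * C n) \<le> sqrt Z * \<gamma>"
proof -
  have "(\<Sum>n\<in>F. br n powr (- \<rho>) * C n) = (\<Sum>n\<in>F. \<bar>br n powr (- \<rho>)\<bar> * \<bar>C n\<bar>)"
    using C by (simp add: l2b_def)
  also have "\<dots> \<le> L2_set (\<lambda>n. br n powr (- \<rho>)) F * L2_set C F"
    by (rule L2_set_mult_ineq)
  also have "\<dots> \<le> sqrt Z * \<gamma>"
  proof (rule mult_mono)
    show "L2_set C F \<le> \<gamma>"
      by (rule l2b_L2_set[OF C F])
    show "L2_set (\<lambda>n. br n powr (- \<rho>)) F \<le> sqrt Z"
      unfolding L2_set_def using Z(1)[OF F] by (simp add: br_powr_sq)
  qed (auto simp: Z L2_set_nonneg)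
  finally show ?thesis .
qed

text \<open>All three negative powers are moved to the smallest of the three brackets, hence to one
  of them, with total exponent \<open>x + y + z\<close>. As this exceeds 1/2, the factor at that
  bracket is summable by Cauchy-Schwarz, and \<open>tri_l1\<close> applies.\<close>

lemma tri_pos:
  assumes "0 \<le> x" "0 \<le> y" "0 \<le> z" "x + y + z > 1 / 2"
  shows "\<exists>K\<ge>0. \<forall>P A B C \<alpha> \<beta> \<gamma>. finite P \<longrightarrow> l2b A \<alpha> \<longrightarrow> l2b B \<beta> \<longrightarrow> l2b C \<gamma> \<longrightarrow>
    (\<Sum>(m, n)\<in>P. (br (m + n) powr (- x) * A (m + n)) * (br m powr (- y) * B m) * (br n powr (- z) * C n)) \<le> K * \<alpha> * \<beta> * \<gamma>"
proof -
  define \<rho> where "\<rho> = x + y + z"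
  obtain Z where Z: "0 \<le> Z" "\<And>F. finite F \<Longrightarrow> (\<Sum>n\<in>F. br (n :: int) powr (- 2 * \<rho>)) \<le> Z"
    using zeta_bound[of \<rho>] assms by (auto simp: \<rho>_def)
  have w: "br k powr (- x) * br m powr (- y) * br n powr (- z) \<le> br k powr (- \<rho>) + br m powr (- \<rho>) + br n powr (- \<rho>)" for k m n :: int
  proof -
    define \<mu> where "\<mu> = min (br k) (min (br m) (br n))"
    have \<mu>: "\<mu> > 0" "\<mu> \<le> br k" "\<mu> \<le> br m" "\<mu> \<le> br n"
      by (auto simp: \<mu>_def)
    have "br k powr (- x) * br m powr (- y) * br n powr (- z) \<le> \<mu> powr (- x) * \<mu> powr (- y) * \<mu> powr (- z)"
      using assms \<mu> by (intro mult_mono powr_mono2') auto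
    also have "\<dots> = \<mu> powr (- \<rho>)"
      by (simp add: \<rho>_def flip: powr_add)
    also have "\<dots> \<le> br k powr (- \<rho>) + br m powr (- \<rho>) + br n powr (- \<rho>)"
      by (auto simp: \<mu>_def min_def)
    finally show ?thesis .
  qed
  have "(\<Sum>(m, n)\<in>P. (br (m + n) powr (- x) * A (m + n)) * (br m powr (- y) * B m) * (br n powr (- z) * C n)) \<le> (3 * sqrt Z) * \<alpha> * \<beta> * \<gamma>"
    if P: "finite P" and A: "l2b A \<alpha>" and B: "l2b B \<beta>" and C: "l2b C \<gamma>" for P A B C \<alpha> \<beta> \<gamma>
  proof -
    have nn: "0 \<le> A k" "0 \<le> B k" "0 \<le> C k" for k
      using A B C by (auto simp: l2b_def)
    have w': "(br (m + n) powr (- x) * A (m + n)) * (br m powr (- y) * B m) * (br n powr (- z) * C n)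
      \<le> B m * C n * (br (m + n) powr (- \<rho>) * A (m + n)) + A (m + n) * C n * (br m powr (- \<rho>) * B m)
           + A (m + n) * B m * (br n powr (- \<rho>) * C n)" for m n
    proof -
      have "(br (m + n) powr (- x) * br m powr (- y) * br n powr (- z)) * (A (m + n) * B m * C n)
        \<le> (br (m + n) powr (- \<rho>) + br m powr (- \<rho>) + br n powr (- \<rho>)) * (A (m + n) * B m * C n)"
        by (intro mult_right_mono w) (simp add: nn)
      then show ?thesis
        by (simp add: algebra_simps)
    qed
    have "(\<Sum>(m, n)\<in>P. (br (m + n) powr (- x) * A (m + n)) * (br m powr (- y) * B m) * (br n powr (- z) * C n))
      \<le> (\<Sum>p\<in>P. B (fst p) * C (snd p) * (br (fst p + snd p) powr (- \<rho>) * A (fst p + snd p))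
           + A (fst p + snd p) * C (snd p) * (br (fst p) powr (- \<rho>) * B (fst p))
           + A (fst p + snd p) * B (fst p) * (br (snd p) powr (- \<rho>) * C (snd p)))"
      by (rule sum_mono) (simp only: case_prod_unfold w')
    also have "\<dots> \<le> \<beta> * \<gamma> * (sqrt Z * \<alpha>) + \<alpha> * \<gamma> * (sqrt Z * \<beta>) + \<alpha> * \<beta> * (sqrt Z * \<gamma>)"
      unfolding sum.distrib
      by (intro add_mono tri_l1 P A B C l2b_weighted_l1[OF Z(2,1)]) (auto simp: nn inj_on_def)
    finally show ?thesis
      by (simp add: algebra_simps)
  qed
  then show ?thesis
    using Z(1) by (intro exI[of _ "3 * sqrt Z"]) auto
qed

lemma br_add_powr_le:
  assumes "0 \<le> x"
  shows "br (m + n :: int) powr x \<le> 2 powr x * (br m powr x + br n powr x)"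
proof -
  have "br (m + n) \<le> 2 * max (br m) (br n)"
    using br_int_add_le[of m n] by linarith
  then have "br (m + n) powr x \<le> (2 * max (br m) (br n)) powr x"
    using assms by (intro powr_mono2) auto
  also have "\<dots> = 2 powr x * max (br m) (br n) powr x"
    by (simp add: powr_mult le_max_iff_disj)
  also have "max (br m) (br n) powr x \<le> br m powr x + br n powr x"
    by (auto simp: max_def)
  finally show ?thesis by simp
qed

text \<open>A negative \<open>x\<close> means growth in \<open>m + n\<close>, which is passed on to
  \<open>m\<close> or to \<open>n\<close> by \<open>br_add_powr_le\<close>. This lowers
  \<open>y\<close> or \<open>z\<close> by \<open>- x\<close>, hence the conditions on
  \<open>x + y\<close> and \<open>x + z\<close>.\<close>

lemma tri_bound:
  assumes "0 \<le> y" "0 \<le> z" "0 \<le> x + y" "0 \<le> x + z" "x + y + z > 1 / 2"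
  shows "\<exists>K\<ge>0. \<forall>P A B C \<alpha> \<beta> \<gamma>. finite P \<longrightarrow> l2b A \<alpha> \<longrightarrow> l2b B \<beta> \<longrightarrow> l2b C \<gamma> \<longrightarrow>
    (\<Sum>(m, n)\<in>P. (br (m + n) powr (- x) * A (m + n)) * (br m powr (- y) * B m) * (br n powr (- z) * C n)) \<le> K * \<alpha> * \<beta> * \<gamma>"
proof (cases "x \<ge> 0")
  case True
  then show ?thesis using tri_pos[of x y z] assms by blast
next
  case False
  have "0 + (x + y) + z > 1 / 2" "0 + y + (x + z) > 1 / 2"
    using assms by auto
  note h = this
  obtain K1 where K1: "K1 \<ge> 0" "\<And>P A B C \<alpha> \<beta> \<gamma>. finite P \<Longrightarrow> l2b A \<alpha> \<Longrightarrow> l2b B \<beta> \<Longrightarrow> l2b C \<gamma> \<Longrightarrow>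
    (\<Sum>(m, n)\<in>P. (br (m + n) powr (- 0) * A (m + n)) * (br m powr (- (x + y)) * B m) * (br n powr (- z) * C n)) \<le> K1 * \<alpha> * \<beta> * \<gamma>"
    using tri_pos[OF order_refl assms(3,2) h(1)] by blast
  obtain K2 where K2: "K2 \<ge> 0" "\<And>P A B C \<alpha> \<beta> \<gamma>. finite P \<Longrightarrow> l2b A \<alpha> \<Longrightarrow> l2b B \<beta> \<Longrightarrow> l2b C \<gamma> \<Longrightarrow>
    (\<Sum>(m, n)\<in>P. (br (m + n) powr (- 0) * A (m + n)) * (br m powr (- y) * B m) * (br n powr (- (x + z)) * C n)) \<le> K2 * \<alpha> * \<beta> * \<gamma>"
    using tri_pos[OF order_refl assms(1,4) h(2)] by blast
  define c where "c = 2 powr (- x)"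
  have "(\<Sum>(m, n)\<in>P. (br (m + n) powr (- x) * A (m + n)) * (br m powr (- y) * B m) * (br n powr (- z) * C n)) \<le> (c * (K1 + K2)) * \<alpha> * \<beta> * \<gamma>"
    if P: "finite P" and A: "l2b A \<alpha>" and B: "l2b B \<beta>" and C: "l2b C \<gamma>" for P A B C \<alpha> \<beta> \<gamma>
  proof -
    have nn: "0 \<le> A k" "0 \<le> B k" "0 \<le> C k" for k
      using A B C by (auto simp: l2b_def)
    have w': "(br (m + n) powr (- x) * A (m + n)) * (br m powr (- y) * B m) * (br n powr (- z) * C n)
        \<le> c * ((br (m + n) powr (- 0) * A (m + n)) * (br m powr (- (x + y)) * B m) * (br n powr (- z) * C n))
          + c * ((br (m + n) powr (- 0) * A (m + n)) * (br m powr (- y) * B m) * (br n powr (- (x + z)) * C n))" for m n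
    proof -
      have e: "br m powr (- (x + y)) = br m powr (- x) * br m powr (- y)"
        "br n powr (- (x + z)) = br n powr (- x) * br n powr (- z)"
        by (simp_all flip: powr_add)
      have "br (m + n) powr (- x) * (A (m + n) * (br m powr (- y) * B m) * (br n powr (- z) * C n))
        \<le> (c * (br m powr (- x) + br n powr (- x))) * (A (m + n) * (br m powr (- y) * B m) * (br n powr (- z) * C n))"
        unfolding c_def using False by (intro mult_right_mono br_add_powr_le) (auto simp: nn)
      then show ?thesis
        unfolding e by (simp add: algebra_simps powr_zero_eq_one)
    qed
    have "(\<Sum>(m, n)\<in>P. (br (m + n) powr (- x) * A (m + n)) * (br m powr (- y) * B m) * (br n powr (- z) * C n))
       \<le> (\<Sum>p\<in>P. c * (case p of (m, n) \<Rightarrow> (br (m + n) powr (- 0) * A (m + n)) * (br m powr (- (x + y)) * B m) * (br n powr (- z) * C n))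
          + c * (case p of (m, n) \<Rightarrow> (br (m + n) powr (- 0) * A (m + n)) * (br m powr (- y) * B m) * (br n powr (- (x + z)) * C n)))"
      by (rule sum_mono) (simp only: case_prod_unfold w')
    also have "\<dots> \<le> c * (K1 * \<alpha> * \<beta> * \<gamma>) + c * (K2 * \<alpha> * \<beta> * \<gamma>)"
      unfolding sum.distrib sum_distrib_left[symmetric]
      by (intro add_mono mult_left_mono K1(2) K2(2) P A B C) (auto simp: c_def)
    finally show ?thesis
      by (simp add: algebra_simps)
  qed
  then show ?thesis
    using K1(1) K2(1) by (intro exI[of _ "c * (K1 + K2)"]) (auto simp: c_def)
qed

lemma l2b_insob: "insob x a \<Longrightarrow> l2b (\<lambda>k. br k powr x * cmod (a k)) (hn x a)"
  unfolding l2b_def power_mult_distrib br_powr_sq using sum_le_hn by auto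

lemma tri_sob:
  assumes "0 \<le> y" "0 \<le> z" "0 \<le> x + y" "0 \<le> x + z" "x + y + z > 1 / 2"
  shows "\<exists>K\<ge>0. \<forall>P a b c. finite P \<longrightarrow> insob x a \<longrightarrow> insob y b \<longrightarrow> insob z c \<longrightarrow>
    (\<Sum>(m, n)\<in>P. cmod (a (m + n)) * cmod (b m) * cmod (c n)) \<le> K * hn x a * hn y b * hn z (c :: int \<Rightarrow> complex)"
proof -
  have *: "br k powr (- r) * (br k powr r * t) = t" for k :: int and r t :: real
    by (simp flip: mult.assoc powr_add)
  from tri_bound[OF assms] obtain K where K: "K \<ge> 0" "\<And>P A B C \<alpha> \<beta> \<gamma>. finite P \<Longrightarrow> l2b A \<alpha> \<Longrightarrow> l2b B \<beta> \<Longrightarrow> l2b C \<gamma> \<Longrightarrow>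
    (\<Sum>(m, n)\<in>P. (br (m + n) powr (- x) * A (m + n)) * (br m powr (- y) * B m) * (br n powr (- z) * C n)) \<le> K * \<alpha> * \<beta> * \<gamma>"
    by blast
  have "(\<Sum>(m, n)\<in>P. cmod (a (m + n)) * cmod (b m) * cmod (c n)) \<le> K * hn x a * hn y b * hn z c"
    if "finite P" "insob x a" "insob y b" "insob z c" for P and a b c :: "int \<Rightarrow> complex"
    using K(2)[OF that(1) l2b_insob[OF that(2)] l2b_insob[OF that(3)] l2b_insob[OF that(4)]]
    unfolding * .
  with K(1) show ?thesis by blast
qed

text \<open>Bounds on finite rectangles give absolute summability of the double series, which
  justifies exchanging the sums and estimating the iterated ones.\<close>

lemma double_sum_bound:
  fixes G :: "'a \<Rightarrow> 'b \<Rightarrow> complex"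
  assumes D: "\<And>F M. finite F \<Longrightarrow> finite M \<Longrightarrow> (\<Sum>k\<in>F. \<Sum>m\<in>M. cmod (G k m)) \<le> D"
  shows "(\<lambda>(k, m). G k m) summable_on UNIV \<times> UNIV" "\<And>k. G k summable_on UNIV"
    "\<And>F. finite F \<Longrightarrow> (\<Sum>k\<in>F. cmod (\<Sum>\<^sub>\<infinity>m. G k m)) \<le> D" "cmod (\<Sum>\<^sub>\<infinity>k. \<Sum>\<^sub>\<infinity>m. G k m) \<le> D"
proof -
  have "(\<lambda>p. cmod (case p of (k, m) \<Rightarrow> G k m)) summable_on UNIV \<times> UNIV"
  proof (rule nonneg_bdd_above_summable_on)
    show "bdd_above (sum (\<lambda>p. cmod (case p of (k, m) \<Rightarrow> G k m)) ` {F. F \<subseteq> UNIV \<times> UNIV \<and> finite F})"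
    proof (rule bdd_aboveI2)
      fix P :: "('a \<times> 'b) set" assume "P \<in> {F. F \<subseteq> UNIV \<times> UNIV \<and> finite F}"
      then have P: "finite P" by simp
      have "sum (\<lambda>p. cmod (case p of (k, m) \<Rightarrow> G k m)) P \<le> sum (\<lambda>p. cmod (case p of (k, m) \<Rightarrow> G k m)) (fst ` P \<times> snd ` P)"
        using P by (intro sum_mono2) (auto intro: rev_image_eqI)
      also have "\<dots> = (\<Sum>k\<in>fst ` P. \<Sum>m\<in>snd ` P. cmod (G k m))"
        by (simp add: sum.cartesian_product case_prod_unfold)
      also have "\<dots> \<le> D" using P by (intro D) auto
      finally show "sum (\<lambda>p. cmod (case p of (k, m) \<Rightarrow> G k m)) P \<le> D" .
    qed
  qed auto
  then show s: "(\<lambda>(k, m). G k m) summable_on UNIV \<times> UNIV"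
    by (subst summable_on_iff_abs_summable_on_complex)
  have t: "(\<lambda>m. cmod (G k m)) summable_on UNIV" for k
  proof (rule nonneg_bdd_above_summable_on)
    show "bdd_above (sum (\<lambda>m. cmod (G k m)) ` {F. F \<subseteq> UNIV \<and> finite F})"
      by (rule bdd_aboveI2[of _ _ D]) (use D[of "{k}"] in auto)
  qed auto
  then show t': "G k summable_on UNIV" for k
    by (subst summable_on_iff_abs_summable_on_complex)
  show f: "(\<Sum>k\<in>F. cmod (\<Sum>\<^sub>\<infinity>m. G k m)) \<le> D" if F: "finite F" for F
  proof (rule tendsto_upperbound)
    show "((\<lambda>M. \<Sum>k\<in>F. cmod (\<Sum>m\<in>M. G k m)) \<longlongrightarrow> (\<Sum>k\<in>F. cmod (\<Sum>\<^sub>\<infinity>m. G k m))) (finite_subsets_at_top UNIV)"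
      by (intro tendsto_intros) (metis t' has_sum_def has_sum_infsum)
    have "(\<Sum>k\<in>F. cmod (\<Sum>m\<in>M. G k m)) \<le> D" if "finite M" for M
      using D[OF F that] by (rule order_trans[rotated]) (intro sum_mono norm_sum)
    then show "\<forall>\<^sub>F M in finite_subsets_at_top UNIV. (\<Sum>k\<in>F. cmod (\<Sum>m\<in>M. G k m)) \<le> D"
      by (intro eventually_finite_subsets_at_top_weakI)
  qed auto
  have "(\<lambda>k. cmod (\<Sum>\<^sub>\<infinity>m. G k m)) summable_on UNIV"
    by (rule nonneg_bdd_above_summable_on) (auto intro!: bdd_aboveI2[of _ _ D] f)
  then have "cmod (\<Sum>\<^sub>\<infinity>k. \<Sum>\<^sub>\<infinity>m. G k m) \<le> (\<Sum>\<^sub>\<infinity>k. cmod (\<Sum>\<^sub>\<infinity>m. G k m))"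
    by (intro norm_infsum_bound) auto
  also have "\<dots> \<le> D"
    by (rule infsum_le_finite_sums) (use \<open>(\<lambda>k. cmod (\<Sum>\<^sub>\<infinity>m. G k m)) summable_on UNIV\<close> f in auto)
  finally show "cmod (\<Sum>\<^sub>\<infinity>k. \<Sum>\<^sub>\<infinity>m. G k m) \<le> D" .
qed

section \<open>Convolutions and Toeplitz matrices between weighted spaces\<close>

definition conv :: "(int \<Rightarrow> complex) \<Rightarrow> (int \<Rightarrow> complex) \<Rightarrow> int \<Rightarrow> complex" where
  "conv b c k = (\<Sum>\<^sub>\<infinity>m. b (k - m) * c m)"

text \<open>By duality: the pairing of the convolution with a test sequence of order
  \<open>- r\<close> is the trilinear sum of \<open>tri_sob\<close> with
  \<open>x = - r\<close>.\<close>

lemma conv_bound: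
  assumes "0 \<le> y" "0 \<le> z" "r \<le> y" "r \<le> z" "y + z - r > 1 / 2"
  shows "\<exists>K\<ge>0. \<forall>b c. insob y b \<longrightarrow> insob z c \<longrightarrow>
    (\<forall>k. (\<lambda>m. b (k - m) * c m) summable_on UNIV) \<and> insob r (conv b c) \<and> hn r (conv b c) \<le> K * hn y b * hn z c"
proof -
  have *: "0 \<le> - r + y" "0 \<le> - r + z" "- r + y + z > 1 / 2" using assms by auto
  from tri_sob[OF assms(1,2) *] obtain K where K: "K \<ge> 0"
    "\<And>P a b c. finite P \<Longrightarrow> insob (- r) a \<Longrightarrow> insob y b \<Longrightarrow> insob z c \<Longrightarrow>
    (\<Sum>(m, n)\<in>P. cmod (a (m + n)) * cmod (b m) * cmod (c n)) \<le> K * hn (- r) a * hn y b * hn z (c :: int \<Rightarrow> complex)"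
    by blast
  have "(\<forall>k. (\<lambda>m. b (k - m) * c m) summable_on UNIV) \<and> insob r (conv b c) \<and> hn r (conv b c) \<le> K * hn y b * hn z c"
    if bc: "insob y b" "insob z c" for b c
  proof -
    have D: "(\<Sum>k\<in>F. \<Sum>m\<in>M. cmod (b (k - m) * c m * cnj (g k))) \<le> K * hn (- r) g * hn y b * hn z c"
      if "finite F" "finite M" "insob (- r) g" for F M g
    proof -
      have "(\<Sum>k\<in>F. \<Sum>m\<in>M. cmod (b (k - m) * c m * cnj (g k))) =
          (\<Sum>(p, m)\<in>(\<lambda>(k, m). (k - m, m)) ` (F \<times> M). cmod (g (p + m)) * cmod (b p) * cmod (c m))"
        by (subst sum.reindex) (auto simp: inj_on_def sum.cartesian_product norm_mult mult_ac intro!: sum.cong)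
      also have "\<dots> \<le> K * hn (- r) g * hn y b * hn z c"
        using that bc by (intro K(2)) auto
      finally show ?thesis .
    qed
    have s: "(\<lambda>m. b (k - m) * c m) summable_on UNIV" for k
    proof -
      \<comment> \<open>Testing at the single frequency \<open>k\<close> gives the summability of
        the series for that coefficient.\<close>
      have u: "insob (- r) (\<lambda>i. if i = k then 1 else 0)"
        by (rule insob_finite) simp
      show ?thesis
        using double_sum_bound(2)[OF D[OF _ _ u], of k] by simp
    qed
    have "cmod (\<Sum>k\<in>F. conv b c k * cnj (g k)) \<le> (K * hn y b * hn z c) * hn (- r) g"
      if "finite F" "\<And>i. i \<notin> F \<Longrightarrow> g i = 0" for F g
    proof -
      have "{i. g i \<noteq> 0} \<subseteq> F" using that(2) by auto
      then have u: "insob (- r) g"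
        by (intro insob_finite) (rule finite_subset[OF _ that(1)])
      have "cmod (\<Sum>k\<in>F. conv b c k * cnj (g k)) \<le> (\<Sum>k\<in>F. cmod (\<Sum>\<^sub>\<infinity>m. b (k - m) * c m * cnj (g k)))"
        by (rule order_trans[OF norm_sum]) (simp add: conv_def infsum_cmult_left')
      also have "\<dots> \<le> K * hn (- r) g * hn y b * hn z c"
        by (rule double_sum_bound(3)[OF D[OF _ _ u] that(1)])
      finally show ?thesis by (simp add: mult_ac)
    qed
    then show ?thesis
      using sob_duality_converse[of "conv b c" "K * hn y b * hn z c" r] K(1) s by auto
  qed
  with K(1) show ?thesis by blast
qed

definition ext :: "(nat \<Rightarrow> complex) \<Rightarrow> int \<Rightarrow> complex" where
  "ext x k = (if 0 \<le> k then x (nat k) else 0)"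

lemma
  assumes "insob r x"
  shows insob_ext: "insob r (ext x)" and hn_ext_le: "hn r (ext x) \<le> hn r x"
proof -
  have "(\<Sum>k\<in>F. br k powr (2 * r) * (cmod (ext x k))\<^sup>2) \<le> (hn r x)\<^sup>2" if "finite F" for F
  proof -
    have "(\<Sum>k\<in>F. br k powr (2 * r) * (cmod (ext x k))\<^sup>2) = (\<Sum>k\<in>F \<inter> {0..}. br k powr (2 * r) * (cmod (ext x k))\<^sup>2)"
      using that by (intro sum.mono_neutral_right) (auto simp: ext_def)
    also have "\<dots> = (\<Sum>n\<in>nat ` (F \<inter> {0..}). br n powr (2 * r) * (cmod (x n))\<^sup>2)"
      by (subst sum.reindex) (auto simp: inj_on_def ext_def br_int_simps br_nat_def intro!: sum.cong)
    also have "\<dots> \<le> (hn r x)\<^sup>2"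
      using that by (intro sum_le_hn assms) auto
    finally show ?thesis .
  qed
  from insob_boundI[OF this] show "insob r (ext x)" "hn r (ext x) \<le> hn r x"
    by auto
qed

lemma
  fixes y :: "int \<Rightarrow> complex"
  assumes "insob r y"
  shows insob_nat: "insob r (\<lambda>n :: nat. y (int n))" and hn_nat_le: "hn r (\<lambda>n :: nat. y (int n)) \<le> hn r y"
proof -
  have "(\<Sum>n\<in>F. br n powr (2 * r) * (cmod (y (int n)))\<^sup>2) \<le> (hn r y)\<^sup>2" if "finite F" for F
  proof -
    have "(\<Sum>n\<in>F. br n powr (2 * r) * (cmod (y (int n)))\<^sup>2) = (\<Sum>n\<in>int ` F. br n powr (2 * r) * (cmod (y n))\<^sup>2)"
      by (subst sum.reindex) auto
    also have "\<dots> \<le> (hn r y)\<^sup>2"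
      using that by (intro sum_le_hn assms) auto
    finally show ?thesis .
  qed
  from insob_boundI[OF this] show "insob r (\<lambda>n :: nat. y (int n))" "hn r (\<lambda>n :: nat. y (int n)) \<le> hn r y"
    by auto
qed

lemma
  fixes y :: "int \<Rightarrow> complex"
  assumes "insob r y"
  shows insob_reflect: "insob r (\<lambda>k. y (- k))" and hn_reflect_le: "hn r (\<lambda>k. y (- k)) \<le> hn r y"
proof -
  have "(\<Sum>n\<in>F. br n powr (2 * r) * (cmod (y (- n)))\<^sup>2) \<le> (hn r y)\<^sup>2" if "finite F" for F
  proof -
    have "(\<Sum>n\<in>F. br n powr (2 * r) * (cmod (y (- n)))\<^sup>2) = (\<Sum>n\<in>uminus ` F. br n powr (2 * r) * (cmod (y n))\<^sup>2)"
      by (subst sum.reindex) auto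
    also have "\<dots> \<le> (hn r y)\<^sup>2"
      using that by (intro sum_le_hn assms) auto
    finally show ?thesis .
  qed
  from insob_boundI[OF this] show "insob r (\<lambda>k. y (- k))" "hn r (\<lambda>k. y (- k)) \<le> hn r y"
    by auto
qed

definition toep :: "(int \<Rightarrow> complex) \<Rightarrow> (nat \<Rightarrow> complex) \<Rightarrow> nat \<Rightarrow> complex" where
  "toep a x n = (\<Sum>\<^sub>\<infinity>m. a (int n - int m) * x m)"

lemma ext_infsum: "(\<Sum>\<^sub>\<infinity>k. g k * ext x k) = (\<Sum>\<^sub>\<infinity>m. g (int m) * x m)"
proof -
  have "(\<Sum>\<^sub>\<infinity>k. g k * ext x k) = (\<Sum>\<^sub>\<infinity>k\<in>range int. g k * ext x k)"
    by (rule infsum_cong_neutral) (auto simp: ext_def image_def, metis nat_0_le)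
  also have "\<dots> = (\<Sum>\<^sub>\<infinity>m. g (int m) * x m)"
    by (subst infsum_reindex) (auto simp: o_def ext_def)
  finally show ?thesis .
qed

lemma ext_summable: "(\<lambda>k. g k * ext x k) summable_on UNIV \<Longrightarrow> (\<lambda>m. g (int m) * x m) summable_on UNIV"
proof -
  assume "(\<lambda>k. g k * ext x k) summable_on UNIV"
  then have "(\<lambda>k. g k * ext x k) summable_on range int"
    by (rule summable_on_subset_banach) simp
  then show ?thesis
    by (subst (asm) summable_on_reindex) (auto simp: o_def ext_def)
qed

lemma toep_conv: "toep a x n = conv a (ext x) (int n)"
  unfolding toep_def conv_def using ext_infsum[of "\<lambda>k. a (int n - k)" x] by simp

lemma toep_bound:
  assumes "0 \<le> y" "0 \<le> z" "r \<le> y" "r \<le> z" "y + z - r > 1 / 2"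
  shows "\<exists>K\<ge>0. \<forall>a x. insob y a \<longrightarrow> insob z x \<longrightarrow>
    (\<forall>n. (\<lambda>m. a (int n - int m) * x m) summable_on UNIV) \<and> insob r (toep a x) \<and> hn r (toep a x) \<le> K * hn y a * hn z x"
proof -
  from conv_bound[OF assms] obtain K where K: "K \<ge> 0" "\<And>b c. insob y b \<Longrightarrow> insob z c \<Longrightarrow>
    (\<forall>k. (\<lambda>m. b (k - m) * c m) summable_on UNIV) \<and> insob r (conv b c) \<and> hn r (conv b c) \<le> K * hn y b * hn z c"
    by blast
  have "(\<forall>n. (\<lambda>m. a (int n - int m) * x m) summable_on UNIV) \<and> insob r (toep a x) \<and> hn r (toep a x) \<le> K * hn y a * hn z x"
    if a: "insob y a" and x: "insob z x" for a x
  proof -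
    note c = K(2)[OF a insob_ext[OF x]]
    have e: "toep a x = (\<lambda>n. conv a (ext x) (int n))"
      by (rule ext) (rule toep_conv)
    have "hn r (toep a x) \<le> hn r (conv a (ext x))"
      unfolding e using c by (intro hn_nat_le) auto
    also have "\<dots> \<le> K * hn y a * hn z (ext x)" using c by auto
    also have "\<dots> \<le> K * hn y a * hn z x"
      using K(1) by (intro mult_left_mono hn_ext_le x) auto
    finally have "hn r (toep a x) \<le> K * hn y a * hn z x" .
    moreover have "insob r (toep a x)"
      unfolding e using c by (intro insob_nat) auto
    moreover have "(\<lambda>m. a (int n - int m) * x m) summable_on UNIV" for n
      using c by (intro ext_summable) auto
    ultimately show ?thesis by auto
  qed
  with K(1) show ?thesis by blast
qed

text \<open>The substitution \<open>p = - m\<close>, \<open>q = n\<close> turns the sesquilinear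
  form of a Toeplitz matrix into a trilinear sum with \<open>a\<close> at \<open>p + q\<close>. The
  order \<open>x\<close> of the symbol may be negative, which is the source of the form bound for
  rough symbols.\<close>

lemma tri_form:
  assumes "0 \<le> y" "0 \<le> z" "0 \<le> x + y" "0 \<le> x + z" "x + y + z > 1 / 2"
  shows "\<exists>K\<ge>0. \<forall>F M a f g. finite F \<longrightarrow> finite M \<longrightarrow> insob x a \<longrightarrow> insob y f \<longrightarrow> insob z g \<longrightarrow>
    (\<Sum>n\<in>F. \<Sum>m\<in>M. cmod (a (int n - int m) * f m * cnj (g n))) \<le> K * hn x a * hn y f * hn z g"
proof -
  from tri_sob[OF assms] obtain K where K: "K \<ge> 0"
    "\<And>P a b c. finite P \<Longrightarrow> insob x a \<Longrightarrow> insob y b \<Longrightarrow> insob z c \<Longrightarrow>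
    (\<Sum>(m, n)\<in>P. cmod (a (m + n)) * cmod (b m) * cmod (c n)) \<le> K * hn x a * hn y b * hn z (c :: int \<Rightarrow> complex)"
    by blast
  have "(\<Sum>n\<in>F. \<Sum>m\<in>M. cmod (a (int n - int m) * f m * cnj (g n))) \<le> K * hn x a * hn y f * hn z g"
    if F: "finite F" "finite M" and i: "insob x a" "insob y f" "insob z g" for F M a f g
  proof -
    have "(\<Sum>n\<in>F. \<Sum>m\<in>M. cmod (a (int n - int m) * f m * cnj (g n))) =
      (\<Sum>(p, q)\<in>(\<lambda>(n, m). (- int m, int n)) ` (F \<times> M). cmod (a (p + q)) * cmod (ext f (- p)) * cmod (ext g q))"
      by (subst sum.reindex) (auto simp: inj_on_def sum.cartesian_product norm_mult mult_ac ext_def intro!: sum.cong)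
    also have "\<dots> \<le> K * hn x a * hn y (\<lambda>p. ext f (- p)) * hn z (ext g)"
      using F i by (intro K(2) insob_reflect insob_ext) auto
    also have "\<dots> \<le> K * hn x a * hn y f * hn z g"
      using K(1) by (intro mult_mono order_trans[OF hn_reflect_le hn_ext_le] hn_ext_le insob_ext i order_refl) auto
    finally show ?thesis .
  qed
  with K(1) show ?thesis by blast
qed

text \<open>Of use for symbols of order above 1/2, whose matrices preserve square summability; rough
  symbols enter through forms only.\<close>

definition T :: "(int \<Rightarrow> complex) \<Rightarrow> nat ell2 \<Rightarrow> nat ell2" where
  "T a f = ell2_of (toep a (cf f))"

lemma insob_0_iff: "insob 0 x \<longleftrightarrow> sqsum x"
  by (simp add: insob_def powr_zero_eq_one)

lemma
  assumes "\<sigma> > 1 / 2" "insob \<sigma> a"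
  shows cf_T: "cf (T a f) = toep a (cf f)"
    and toep_summable: "(\<lambda>m. a (int n - int m) * cf f m) summable_on UNIV"
proof -
  obtain K where "\<And>a x. insob \<sigma> a \<Longrightarrow> insob 0 x \<Longrightarrow>
    (\<forall>n. (\<lambda>m. a (int n - int m) * x m) summable_on UNIV) \<and> insob 0 (toep a x) \<and> hn 0 (toep a x) \<le> K * hn \<sigma> a * hn 0 x"
    using toep_bound[of \<sigma> 0 0] assms(1) by auto
  from this[OF assms(2) insob_0_cf[of f]]
  show "cf (T a f) = toep a (cf f)" "(\<lambda>m. a (int n - int m) * cf f m) summable_on UNIV"
    by (auto simp: T_def insob_0_iff)
qed

lemma T_bounds:
  assumes "\<sigma> > 1 / 2" "0 \<le> z" "z \<le> \<sigma>"
  shows "\<exists>K\<ge>0. \<forall>a f. insob \<sigma> a \<longrightarrow> insob z (cf f) \<longrightarrow> insob z (cf (T a f)) \<and> hn z (cf (T a f)) \<le> K * hn \<sigma> a * hn z (cf f)"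
  using toep_bound[of \<sigma> z z] assms cf_T[OF assms(1)] by auto

lemma
  assumes "\<sigma> > 1 / 2" "insob \<sigma> a"
  shows T_add: "T a (f + g) = T a f + T a g" and T_scaleC: "T a (c *\<^sub>C f) = c *\<^sub>C T a f"
    and bounded_linear_T: "bounded_linear (T a)"
proof -
  note cf = cf_T[OF assms] and s = toep_summable[OF assms]
  show add: "T a (f + g) = T a f + T a g" for f g
    by (rule ell2_eqI) (simp add: cf toep_def distrib_left infsum_add[OF s s])
  show sc: "T a (c *\<^sub>C f) = c *\<^sub>C T a f" for c f
    by (rule ell2_eqI) (simp add: cf toep_def mult.left_commute[of _ c] infsum_cmult_right')
  obtain K where K: "\<And>a f. insob \<sigma> a \<Longrightarrow> insob 0 (cf f) \<Longrightarrow> hn 0 (cf (T a f)) \<le> K * hn \<sigma> a * hn 0 (cf f)"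
    using T_bounds[of \<sigma> 0] assms by auto
  show "bounded_linear (T a)"
    by (rule bounded_linear_intro[where K="K * hn \<sigma> a"])
      (use K[OF assms(2)] in \<open>auto simp: add scaleR_scaleC sc mult.commute\<close>)
qed

lemma cinner_T:
  assumes "\<sigma> > 1 / 2" "insob \<sigma> a"
  shows "cinner (T a f) g = (\<Sum>\<^sub>\<infinity>n. \<Sum>\<^sub>\<infinity>m. a (int n - int m) * cf f m * cnj (cf g n))"
  unfolding cinner_def cf_T[OF assms] toep_def by (simp add: infsum_cmult_left')

text \<open>The coefficients of a real function are conjugate symmetric; the exchange of the two
  sums rests on the absolute bound of \<open>tri_form\<close>.\<close>

lemma T_selfadjoint:
  assumes "\<sigma> > 1 / 2" "insob \<sigma> a" and real: "\<And>k. a (- k) = cnj (a k)"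
  shows "cinner (T a f) g = cinner f (T a g)"
proof -
  have h: "0 \<le> \<sigma> + 0" "\<sigma> + 0 + 0 > 1 / 2"
    using assms(1) by auto
  obtain K where K:
    "\<And>F M a f g. finite F \<Longrightarrow> finite M \<Longrightarrow> insob \<sigma> a \<Longrightarrow> insob 0 f \<Longrightarrow> insob 0 g \<Longrightarrow>
    (\<Sum>n\<in>F. \<Sum>m\<in>M. cmod (a (int n - int m) * f m * cnj (g n))) \<le> K * hn \<sigma> a * hn 0 f * hn 0 g"
    using tri_form[OF order_refl order_refl h(1) h(1) h(2)] by blast
  have "cinner (T a f) g = (\<Sum>\<^sub>\<infinity>m. \<Sum>\<^sub>\<infinity>n. a (int n - int m) * cf f m * cnj (cf g n))"
    unfolding cinner_T[OF assms(1,2)]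
    by (rule infsum_swap_banach, rule double_sum_bound(1)) (rule K[OF _ _ assms(2) insob_0_cf insob_0_cf])
  also have "\<dots> = (\<Sum>\<^sub>\<infinity>m. \<Sum>\<^sub>\<infinity>n. cnj (a (int m - int n) * cf g n * cnj (cf f m)))"
  proof -
    have "a (int n - int m) * cf f m * cnj (cf g n) = cnj (a (int m - int n) * cf g n * cnj (cf f m))" for m n
      using real[of "int m - int n"] by simp
    then show ?thesis
      by (simp only:)
  qed
  also have "\<dots> = cnj (\<Sum>\<^sub>\<infinity>m. \<Sum>\<^sub>\<infinity>n. a (int m - int n) * cf g n * cnj (cf f m))"
    by (simp only: infsum_cnj)
  also have "\<dots> = cnj (cinner (T a g) f)"
    unfolding cinner_T[OF assms(1,2)] ..
  finally show ?thesis
    by (metis cinner_commute)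
qed

section \<open>Linear evolution equations\<close>

lemma antiderivative_exists:
  fixes g :: "real \<Rightarrow> 'a::banach"
  assumes g: "continuous_on UNIV g"
  shows "\<exists>G. G 0 = 0 \<and> (\<forall>t. (G has_vector_derivative g t) (at t))"
proof -
  \<comment> \<open>One of the two intervals is empty or a point, so this is the oriented integral
    from 0 to \<open>t\<close>.\<close>
  define G where "G t = integral {0..t} g - integral {t..0} g" for t
  have i: "g integrable_on {a..b}" for a b
    using g by (intro integrable_continuous_real) (auto intro: continuous_on_subset)
  have "(G has_vector_derivative g t) (at t)" for t
  proof -
    define N where "N = \<bar>t\<bar> + 1"
    have e: "G s = integral {-N..s} g - integral {-N..0} g" if "s \<in> {-N<..<N}" for s
    proof (cases "s \<ge> 0")
      case True
      then have "integral {s..0} g = 0" by (cases "s = 0") auto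
      then show ?thesis
        using Henstock_Kurzweil_Integration.integral_combine[where a="-N" and c=0 and b=s and f=g, OF _ True i] by (simp add: G_def N_def algebra_simps)
    next
      case False
      then show ?thesis
        using Henstock_Kurzweil_Integration.integral_combine[where a="-N" and c=s and b=0 and f=g, OF _ _ i] that by (simp add: G_def algebra_simps)
    qed
    have "((\<lambda>s. integral {-N..s} g) has_vector_derivative g t) (at t within {-N..N})"
      using g by (intro integral_has_vector_derivative) (auto intro: continuous_on_subset simp: N_def)
    then have "((\<lambda>s. integral {-N..s} g) has_vector_derivative g t) (at t within {-N<..<N})"
      by (rule has_vector_derivative_within_subset) auto
    then have "((\<lambda>s. integral {-N..s} g) has_vector_derivative g t) (at t)"
      by (subst (asm) at_within_open) (auto simp: N_def)
    from has_vector_derivative_diff[OF this has_vector_derivative_const[of "integral {-N..0} g"]]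
    have "((\<lambda>s. integral {-N..s} g - integral {-N..0} g) has_vector_derivative g t) (at t)"
      by simp
    then show ?thesis
      by (rule has_vector_derivative_transform_within_open[where S="{-N<..<N}"])
        (use e in \<open>auto simp: N_def\<close>)
  qed
  then show ?thesis
    by (intro exI[of _ G]) (auto simp: G_def)
qed

text \<open>Supplies the factorials in the Picard series of \<open>linear_ode_exists\<close>;
  negative times follow by reflection.\<close>

lemma norm_le_power_deriv:
  fixes f :: "real \<Rightarrow> 'a::real_normed_vector"
  assumes d: "\<And>t. (f has_vector_derivative g t) (at t)" and "f 0 = 0"
    and g: "\<And>t. norm (g t) \<le> C * \<bar>t\<bar> ^ k"
  shows "norm (f t) \<le> C * \<bar>t\<bar> ^ Suc k / Suc k"
proof -
  have *: "norm (f t) \<le> C * t ^ Suc k / Suc k"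
    if "t > 0" and d: "\<And>t. (f has_vector_derivative g t) (at t)" and "f 0 = 0"
    and g: "\<And>t. norm (g t) \<le> C * \<bar>t\<bar> ^ k" for f g :: "real \<Rightarrow> 'a" and t
  proof -
    have "norm (f t - f 0) \<le> C * t ^ Suc k / Suc k - C * 0 ^ Suc k / Suc k"
    proof (rule differentiable_bound_general[OF \<open>t > 0\<close>, where \<phi>'="\<lambda>s. C * s ^ k"])
      show "continuous_on {0..t} f"
        by (rule continuous_on_vector_derivative) (rule has_vector_derivative_at_within[OF d])
      show "((\<lambda>s. C * s ^ Suc k / Suc k) has_vector_derivative C * s ^ k) (at s)" for s
        unfolding has_real_derivative_iff_has_vector_derivative[symmetric]
        using DERIV_cmult[OF DERIV_pow[of "Suc k" s UNIV], of "C / real (Suc k)"]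
        by (simp del: of_nat_Suc power_Suc)
      show "norm (g s) \<le> C * s ^ k" if "0 < s" for s
        using g[of s] that by simp
    qed (auto intro!: continuous_intros d)
    then show ?thesis
      using \<open>f 0 = 0\<close> by simp
  qed
  consider "t = 0" | "t > 0" | "t < 0" by linarith
  then show ?thesis
  proof cases
    case 2
    then show ?thesis using *[OF 2 d assms(2) g] by simp
  next
    case 3
    have "((\<lambda>s. f (- s)) has_vector_derivative - g (- s)) (at s)" for s
    proof -
      have "(uminus has_vector_derivative - 1) (at s)"
        unfolding has_real_derivative_iff_has_vector_derivative[symmetric] by (auto intro!: derivative_eq_intros)
      from vector_diff_chain_at[OF this d] show ?thesis by (simp add: o_def)
    qed
    from *[OF _ this, of "- t"] 3 assms(2) show ?thesis
      using g[of "- _"] by simp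
  qed (use assms in auto)
qed

text \<open>The solution is the Picard series, whose term \<open>k\<close> is a k-fold iterated
  integral. The hypothesis \<open>cont\<close> asks for continuity along continuous curves only: in
  the interaction picture the coefficient is conjugated by a group that is strongly but not norm
  continuous.\<close>

lemma linear_ode_exists:
  fixes B :: "real \<Rightarrow> 'a::banach \<Rightarrow> 'a"
  assumes lin: "\<And>t. bounded_linear (B t)" and M: "\<And>t x. norm (B t x) \<le> M * norm x"
    and cont: "\<And>w. continuous_on UNIV w \<Longrightarrow> continuous_on UNIV (\<lambda>t. B t (w t))"
  shows "\<exists>w. w 0 = f \<and> (\<forall>t. (w has_vector_derivative B t (w t)) (at t))"
proof -
  have M0: "0 \<le> M * norm x" for x :: 'a
    using M[of 0 x] norm_ge_zero order_trans by blast
  define P where "P g = (SOME G. G 0 = 0 \<and> (\<forall>t. (G has_vector_derivative g t) (at t)))" for g :: "real \<Rightarrow> 'a"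
  have P: "P g 0 = 0" "(P g has_vector_derivative g t) (at t)" if "continuous_on UNIV g" for g t
    using someI_ex[OF antiderivative_exists[OF that]] unfolding P_def by auto
  define w where "w k = ((\<lambda>g. P (\<lambda>s. B s (g s))) ^^ k) (\<lambda>_. f)" for k
  have w_simps: "w 0 = (\<lambda>_. f)" "w (Suc k) = P (\<lambda>s. B s (w k s))" for k
    by (simp_all add: w_def)
  have c: "continuous_on UNIV (w k)" for k
  proof (induction k)
    case (Suc k)
    show ?case
      unfolding w_simps continuous_on_eq_continuous_at[OF open_UNIV]
      using has_vector_derivative_continuous[OF P(2)[OF cont[OF Suc]]] by blast
  qed (simp add: w_simps)
  have w0: "w 0 t = f" "w (Suc k) 0 = 0" for t k
    using P(1)[OF cont[OF c]] by (auto simp: w_simps)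
  have d: "(w (Suc k) has_vector_derivative B t (w k t)) (at t)" for k t
    using P(2)[OF cont[OF c]] by (simp add: w_simps)
  have b: "norm (w k t) \<le> M ^ k * norm f / fact k * \<bar>t\<bar> ^ k" for k t
  proof (induction k arbitrary: t)
    case (Suc k)
    have M1: "0 \<le> M" if "f \<noteq> 0" using M0[of f] that by (simp add: zero_le_mult_iff)
    have "norm (B s (w k s)) \<le> M * (M ^ k * norm f / fact k) * \<bar>s\<bar> ^ k" for s
    \<comment> \<open>A nonzero \<open>f\<close> forces \<open>0 \<le> M\<close>; for
      \<open>f = 0\<close> every term of the series vanishes.\<close>
    proof (cases "f = 0")
      case True
      then have "w k s = 0" using Suc[of s] by simp
      then show ?thesis using True M[of s 0] by simp
    next
      case False
      have "norm (B s (w k s)) \<le> M * norm (w k s)" by (rule M)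
      also have "\<dots> \<le> M * (M ^ k * norm f / fact k * \<bar>s\<bar> ^ k)"
        using M1[OF False] Suc by (intro mult_left_mono) auto
      finally show ?thesis by (simp add: mult.assoc)
    qed
    from norm_le_power_deriv[OF d w0(2) this, of t]
    show ?case by (simp add: field_simps)
  qed (simp add: w0)
  define S where "S t = (\<Sum>k. w k t)" for t
  have sb: "summable (\<lambda>k. M ^ k * norm f / fact k * R ^ k)" for R :: real
    using summable_mult[OF summable_exp[of "M * R"], of "norm f"]
    by (simp add: power_mult_distrib field_simps)
  have s: "summable (\<lambda>k. w k t)" for t
    by (rule summable_comparison_test'[OF sb[of "\<bar>t\<bar>"], of 0]) (use b in auto)
  have sB: "(\<lambda>k. B t (w k t)) sums B t (S t)" for t
    using bounded_linear.sums[OF lin] s summable_sums S_def by force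
  have "(S has_vector_derivative B t (S t)) (at t)" for t
  proof -
    define R where "R = \<bar>t\<bar> + 1"
    have t: "t \<in> {-R<..<R}" by (auto simp: R_def)
    \<comment> \<open>Term 0 is constant and the derivative of term \<open>Suc k\<close> is
      \<open>B\<close> applied to term \<open>k\<close>, so the sums of the derivatives lag one
      index behind.\<close>
    let ?f' = "\<lambda>n x h. h *\<^sub>R (case n of 0 \<Rightarrow> 0 | Suc k \<Rightarrow> B x (w k x))"
    have "\<exists>g. \<forall>x\<in>{-R<..<R}. (\<lambda>n. w n x) sums g x \<and> (g has_derivative (\<lambda>h. h *\<^sub>R B x (S x))) (at x within {-R<..<R})"
    proof (rule has_derivative_series[where f'="?f'", OF _ _ _ t])
      show "(w n has_derivative ?f' n x) (at x within {-R<..<R})" for n x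
      proof (cases n)
        case 0
        then show ?thesis by (simp add: w_simps)
      next
        case (Suc k)
        then show ?thesis using d[of k x] unfolding has_vector_derivative_def by (auto intro: has_derivative_at_withinI)
      qed
      fix e :: real assume "e > 0"
      have "uniform_limit {-R<..<R} (\<lambda>n x. \<Sum>k<n. B x (w k x)) (\<lambda>x. \<Sum>k. B x (w k x)) sequentially"
      proof (rule Weierstrass_m_test)
        show "summable (\<lambda>k. M * (M ^ k * norm f / fact k * R ^ k))"
          by (intro summable_mult sb)
        show "norm (B x (w k x)) \<le> M * (M ^ k * norm f / fact k * R ^ k)" if "x \<in> {-R<..<R}" for k x
        proof (cases "f = 0")
          case True
          then have "w k x = 0" using b[of k x] by simp
          then show ?thesis using True M[of x 0] by simp
        next
          case False
          then have "0 \<le> M" using M0[of f] by (simp add: zero_le_mult_iff)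
          have "norm (B x (w k x)) \<le> M * norm (w k x)" by (rule M)
          also have "\<dots> \<le> M * (M ^ k * norm f / fact k * \<bar>x\<bar> ^ k)"
            using \<open>0 \<le> M\<close> b by (intro mult_left_mono) auto
          also have "\<dots> \<le> M * (M ^ k * norm f / fact k * R ^ k)"
            using \<open>0 \<le> M\<close> that by (intro mult_left_mono power_mono) auto
          finally show ?thesis .
        qed
      qed
      then obtain N where N: "\<And>n x. n \<ge> N \<Longrightarrow> x \<in> {-R<..<R} \<Longrightarrow> norm ((\<Sum>k<n. B x (w k x)) - (\<Sum>k. B x (w k x))) < e"
        using \<open>e > 0\<close> unfolding uniform_limit_iff eventually_sequentially dist_norm by meson
      have "norm ((\<Sum>i<n. ?f' i x h) - h *\<^sub>R B x (S x)) \<le> e * norm h" if nN: "n \<ge> Suc N" and that: "x \<in> {-R<..<R}" for n x h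
      proof -
        obtain m where m: "n = Suc m" "m \<ge> N" using nN by (cases n) auto
        have "(\<Sum>i<n. ?f' i x h) - h *\<^sub>R B x (S x) = h *\<^sub>R ((\<Sum>k<m. B x (w k x)) - (\<Sum>k. B x (w k x)))"
          unfolding m(1) sum.lessThan_Suc_shift using sums_unique[OF sB[of x]] by (simp add: scaleR_right.sum scaleR_right_diff_distrib)
        then show ?thesis
          using mult_left_mono[OF less_imp_le[OF N[OF m(2) that]], of "\<bar>h\<bar>"] by (simp add: mult.commute)
      qed
      then show "\<forall>\<^sub>F n in sequentially. \<forall>x\<in>{-R<..<R}. \<forall>h. norm ((\<Sum>i<n. ?f' i x h) - h *\<^sub>R B x (S x)) \<le> e * norm h"
        by (intro eventually_sequentiallyI[of "Suc N"]) blast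
    next
      show "(\<lambda>n. w n t) sums S t"
        using summable_sums[OF s] by (simp add: S_def)
    qed auto
    then obtain g where g: "\<forall>x\<in>{-R<..<R}. (\<lambda>n. w n x) sums g x \<and> (g has_derivative (\<lambda>h. h *\<^sub>R B x (S x))) (at x within {-R<..<R})"
      by (rule exE)
    have "(\<lambda>n. w n x) sums g x" if "x \<in> {-R<..<R}" for x
      using bspec[OF g that] by (rule conjunct1)
    then have e: "g x = S x" if "x \<in> {-R<..<R}" for x
      unfolding S_def by (rule sums_unique2[OF _ summable_sums[OF s]]) (rule that)
    have "(g has_vector_derivative B t (S t)) (at t within {-R<..<R})"
      unfolding has_vector_derivative_def using bspec[OF g t] by (rule conjunct2)
    then have "(g has_vector_derivative B t (S t)) (at t)"
      using has_vector_derivative_within_open[OF t open_greaterThanLessThan] by blast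
    then show ?thesis
      by (rule has_vector_derivative_transform_within_open[OF _ open_greaterThanLessThan t e])
  qed
  moreover have "S 0 = f"
  proof -
    have "(\<lambda>k. w k 0) sums (\<Sum>k\<in>{0}. w k 0)"
      by (rule sums_finite) (auto simp: w0(2) gr0_conv_Suc)
    then show ?thesis by (simp add: S_def sums_iff w0)
  qed
  ultimately show ?thesis by blast
qed

text \<open>Dominated convergence for sequences: a finite set carries all but a small part of
  \<open>G\<close>, and on it the coordinates converge.\<close>

lemma ell2_dominated:
  assumes lim: "\<And>i. ((\<lambda>h. cf (\<Phi> h) i) \<longlongrightarrow> 0) F" and dom: "\<forall>\<^sub>F h in F. \<forall>i. cmod (cf (\<Phi> h) i) \<le> cmod (cf G i)"
  shows "(\<Phi> \<longlongrightarrow> (0 :: 'i ell2)) F"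
proof (rule tendstoI)
  fix e :: real assume "e > 0"
  have "\<forall>\<^sub>F A in finite_subsets_at_top (UNIV :: 'i set). finite A"
    by (rule eventually_finite_subsets_at_top_weakI) simp
  moreover have "\<forall>\<^sub>F A in finite_subsets_at_top UNIV. dist (restr A G) G < e / 2"
    using restr_tendsto \<open>e > 0\<close> by (intro tendstoD) auto
  ultimately obtain A where A: "finite A" "dist (restr A G) G < e / 2"
    using eventually_happens'[OF finite_subsets_at_top_neq_bot eventually_conj] by blast
  have "((\<lambda>h. \<Sum>i\<in>A. cmod (cf (\<Phi> h) i)) \<longlongrightarrow> 0) F"
    using tendsto_sum[of A "\<lambda>i h. cmod (cf (\<Phi> h) i)" "\<lambda>_. 0" F] lim by (simp add: tendsto_norm_zero)
  then have "\<forall>\<^sub>F h in F. dist (\<Sum>i\<in>A. cmod (cf (\<Phi> h) i)) 0 < e / 2"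
    using \<open>e > 0\<close> by (intro tendstoD) auto
  with dom show "\<forall>\<^sub>F h in F. dist (\<Phi> h) 0 < e"
  proof eventually_elim
    case (elim h)
    have "norm (restr A (\<Phi> h)) \<le> (\<Sum>i\<in>A. norm (cf (\<Phi> h) i *\<^sub>C unit2 i))"
      unfolding restr_finite[OF A(1)] by (rule norm_sum)
    moreover have "norm (\<Phi> h - restr A (\<Phi> h)) \<le> 1 * norm (G - restr A G)"
      by (rule norm_ell2_mono) (use elim in auto)
    moreover have "norm (\<Phi> h) \<le> norm (restr A (\<Phi> h)) + norm (\<Phi> h - restr A (\<Phi> h))"
      using norm_triangle_ineq[of "restr A (\<Phi> h)" "\<Phi> h - restr A (\<Phi> h)"] by simp
    ultimately show ?case
      using A(2) elim by (simp add: dist_norm norm_minus_commute)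
  qed
qed

lemma has_vector_derivative_iff_tendsto:
  "(f has_vector_derivative d) (at t) \<longleftrightarrow> ((\<lambda>h. (f h - f t) /\<^sub>R (h - t)) \<longlongrightarrow> d) (at t)"
proof -
  have "(f has_vector_derivative d) (at t) \<longleftrightarrow> ((\<lambda>h. norm (f h - f t - (h - t) *\<^sub>R d) / norm (h - t)) \<longlongrightarrow> 0) (at t)"
    by (simp add: has_vector_derivative_def has_derivative_iff_norm bounded_linear_scaleR_left)
  also have "\<dots> \<longleftrightarrow> ((\<lambda>h. norm ((f h - f t) /\<^sub>R (h - t) - d)) \<longlongrightarrow> 0) (at t)"
  proof (intro filterlim_cong refl)
    have "norm (f h - f t - (h - t) *\<^sub>R d) / norm (h - t) = norm ((f h - f t) /\<^sub>R (h - t) - d)" if "h \<noteq> t" for h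
    proof -
      have "(f h - f t) /\<^sub>R (h - t) - d = (f h - f t - (h - t) *\<^sub>R d) /\<^sub>R (h - t)"
        using that by (simp add: scaleR_right_diff_distrib)
      then show ?thesis by (simp add: divide_inverse mult.commute)
    qed
    then show "\<forall>\<^sub>F h in at t. norm (f h - f t - (h - t) *\<^sub>R d) / norm (h - t) = norm ((f h - f t) /\<^sub>R (h - t) - d)"
      by (simp add: eventually_at_filter)
  qed
  also have "\<dots> \<longleftrightarrow> ((\<lambda>h. (f h - f t) /\<^sub>R (h - t)) \<longlongrightarrow> d) (at t)"
    by (simp add: tendsto_norm_zero_iff LIM_zero_iff)
  finally show ?thesis .
qed

text \<open>A product rule for operators that are continuous in the strong sense only: the
  contraction bound absorbs the error of the difference quotient of \<open>w\<close>, and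
  differentiability of \<open>A\<close> is required at the single vector \<open>w t\<close>.\<close>

lemma strong_comp_deriv:
  fixes A :: "real \<Rightarrow> 'a::real_normed_vector \<Rightarrow> 'b::real_normed_vector"
  assumes lin: "\<And>h. linear (A h)" and bd: "\<And>h x. norm (A h x) \<le> norm x"
    and strong: "\<And>x. ((\<lambda>h. A h x) \<longlongrightarrow> A t x) (at t)"
    and w: "(w has_vector_derivative w') (at t)" and d: "((\<lambda>h. A h (w t)) has_vector_derivative d) (at t)"
  shows "((\<lambda>h. A h (w h)) has_vector_derivative A t w' + d) (at t)"
proof -
  have lim: "((\<lambda>h. (w h - w t) /\<^sub>R (h - t)) \<longlongrightarrow> w') (at t)" "((\<lambda>h. (A h (w t) - A t (w t)) /\<^sub>R (h - t)) \<longlongrightarrow> d) (at t)"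
    using w d by (simp_all add: has_vector_derivative_iff_tendsto)
  have "((\<lambda>h. A h ((w h - w t) /\<^sub>R (h - t) - w')) \<longlongrightarrow> 0) (at t)"
    by (rule Lim_null_comparison[where g="\<lambda>h. norm ((w h - w t) /\<^sub>R (h - t) - w')"])
      (use lim(1) bd in \<open>simp_all only: eventually_True tendsto_norm_zero_iff LIM_zero_iff\<close>)
  then have "((\<lambda>h. A h ((w h - w t) /\<^sub>R (h - t) - w') + A h w' + (A h (w t) - A t (w t)) /\<^sub>R (h - t)) \<longlongrightarrow> 0 + A t w' + d) (at t)"
    by (intro tendsto_add strong lim)
  moreover have "A h ((w h - w t) /\<^sub>R (h - t) - w') + A h w' + (A h (w t) - A t (w t)) /\<^sub>R (h - t) = (A h (w h) - A t (w t)) /\<^sub>R (h - t)" for h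
    using lin[of h] by (simp add: linear_diff linear_scale scaleR_right_diff_distrib)
  ultimately show ?thesis
    by (simp add: has_vector_derivative_iff_tendsto)
qed

section \<open>The unitary group of the Lax operator\<close>

lift_definition phase :: "real \<Rightarrow> nat ell2 \<Rightarrow> nat ell2" is "\<lambda>t x n. cis (- (real n * t)) * x n"
  by (rule sqsum_le[where C=1]) (auto simp: norm_mult)

lemma cf_phase [simp]: "cf (phase t f) n = cis (- (real n * t)) * cf f n"
  by (simp add: phase.rep_eq)

lemma scaleC_scaleR [simp]: "c *\<^sub>C (r *\<^sub>R f) = r *\<^sub>R (c *\<^sub>C (f :: 'i ell2))"
  by (rule ell2_eqI) simp

lemma phase_phase [simp]: "phase s (phase t f) = phase (s + t) f"
  by (rule ell2_eqI) (simp add: mult.assoc[symmetric] cis_mult distrib_left)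

lemma phase_simps [simp]: "phase 0 f = f" "phase t (f + g) = phase t f + phase t g" "phase t (c *\<^sub>C f) = c *\<^sub>C phase t f"
  "phase t (r *\<^sub>R f) = r *\<^sub>R phase t f"
  by (rule ell2_eqI; simp add: distrib_left mult.left_commute)+

lemma insob_phase [simp]: "insob r (cf (phase t f)) \<longleftrightarrow> insob r (cf f)"
  by (simp add: insob_summable norm_mult)

lemma norm_phase [simp]: "norm (phase t f) = norm f"
proof (rule power2_eq_imp_eq)
  show "(norm (phase t f))\<^sup>2 = (norm f)\<^sup>2"
    unfolding norm_ell2_sq by (simp add: norm_mult)
qed auto

lemma linear_phase: "linear (phase t)"
  by (rule linearI) auto

lemma phase_tendsto: "((\<lambda>h. phase h f) \<longlongrightarrow> phase t f) (at t)"
proof -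
  have "((\<lambda>h. phase h f - phase t f) \<longlongrightarrow> 0) (at t)"
  proof (rule ell2_dominated[where G="2 *\<^sub>R f"])
    show "((\<lambda>h. cf (phase h f - phase t f) n) \<longlongrightarrow> 0) (at t)" for n
      by (auto intro!: tendsto_eq_intros simp: cis_conv_exp)
    have "cmod (cis x * z - cis y * z) \<le> 2 * cmod z" for x y z
      using norm_triangle_ineq4[of "cis x * z" "cis y * z"] by (simp add: norm_mult)
    then show "\<forall>\<^sub>F h in at t. \<forall>n. cmod (cf (phase h f - phase t f) n) \<le> cmod (cf (2 *\<^sub>R f) n)"
      by (simp add: norm_mult)
  qed
  then show ?thesis by (simp add: LIM_zero_iff)
qed

lemma strong_comp_cont:
  fixes A :: "real \<Rightarrow> 'a::real_normed_vector \<Rightarrow> 'b::real_normed_vector"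
  assumes lin: "\<And>h. linear (A h)" and bd: "\<And>h x. norm (A h x) \<le> norm x"
    and strong: "\<And>x t. ((\<lambda>h. A h x) \<longlongrightarrow> A t x) (at t)" and w: "continuous_on UNIV w"
  shows "continuous_on UNIV (\<lambda>h. A h (w h))"
proof -
  have "((\<lambda>h. A h (w h)) \<longlongrightarrow> A t (w t)) (at t)" for t
  proof -
    have "((\<lambda>h. w h - w t) \<longlongrightarrow> 0) (at t)"
      using w by (simp add: LIM_zero_iff continuous_on_def)
    then have "((\<lambda>h. A h (w h - w t)) \<longlongrightarrow> 0) (at t)"
      by (rule Lim_null_comparison[where g="\<lambda>h. norm (w h - w t)", rotated, OF tendsto_norm_zero]) (simp add: bd)
    from tendsto_add[OF this strong[of "w t" t]] show ?thesis
      by (simp add: linear_diff[OF lin])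
  qed
  then show ?thesis by (simp add: continuous_on_def)
qed

text \<open>Made total by the value 0 outside the domain of D, so additivity of \<open>D1\<close>
  and of the Lax operator is available for sequences of order 1.\<close>

lift_definition D1 :: "nat ell2 \<Rightarrow> nat ell2" is "\<lambda>x n. if insob 1 x then of_nat n * x n else 0"
proof -
  fix x :: "nat \<Rightarrow> complex"
  have "sqsum (\<lambda>n. of_nat n * x n)" if "insob 1 x"
    using that unfolding insob_def by (rule sqsum_le[where C=1]) (auto simp: norm_mult br_nat_def mult_right_mono)
  then show "sqsum (\<lambda>n. if insob 1 x then of_nat n * x n else 0)"
    by (cases "insob 1 x") (auto simp: sqsum_def)
qed

lemma cf_D1 [simp]: "insob 1 (cf f) \<Longrightarrow> cf (D1 f) n = of_nat n * cf f n"
  by (simp add: D1.rep_eq)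

lemma cmod_cis_minus_1_le: "cmod (cis x - 1) \<le> \<bar>x\<bar>"
proof -
  have "cmod (cis x - 1) = 2 * \<bar>sin (x / 2)\<bar>"
    using dist_exp_i_1[of x] by (simp add: cis_conv_exp)
  then show ?thesis
    using abs_sin_x_le_abs_x[of "x / 2"] by simp
qed

text \<open>Dominated convergence: the difference quotient at frequency \<open>n\<close> is at most
  \<open>n\<close> times the modulus of the coefficient, and so is its limit, hence the majorant
  \<open>2 *\<^sub>R D1 f\<close>.\<close>

lemma phase_deriv:
  assumes f: "insob 1 (cf f)"
  shows "((\<lambda>h. phase h f) has_vector_derivative (- \<i>) *\<^sub>C D1 (phase t f)) (at t)"
proof -
  have d: "((\<lambda>h. cis (- (real n * h)) * cf f n) has_vector_derivative - \<i> * (of_nat n * (cis (- (real n * t)) * cf f n))) (at t)" for n t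
    unfolding cis_conv_exp
    by (auto intro!: derivative_eq_intros has_vector_derivative_real_field simp: algebra_simps)
  have "((\<lambda>h. (phase h f - phase t f) /\<^sub>R (h - t) - (- \<i>) *\<^sub>C D1 (phase t f)) \<longlongrightarrow> 0) (at t)"
  proof (rule ell2_dominated[where G="2 *\<^sub>R D1 f"])
    fix n
    show "((\<lambda>h. cf ((phase h f - phase t f) /\<^sub>R (h - t) - (- \<i>) *\<^sub>C D1 (phase t f)) n) \<longlongrightarrow> 0) (at t)"
      using d[of n t] f by (simp add: has_vector_derivative_iff_tendsto LIM_zero_iff scaleR_conv_of_real LIM_zero_iff[of _ "- _", simplified])
  next
    have 1: "cmod ((cis (- (real n * h)) * cf f n - cis (- (real n * t)) * cf f n) /\<^sub>R (h - t)) \<le> real n * cmod (cf f n)" if "h \<noteq> t" for n h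
    proof -
      have "cis (- (real n * h)) * cf f n - cis (- (real n * t)) * cf f n = cis (- (real n * t)) * ((cis (real n * (t - h)) - 1) * cf f n)"
        by (simp add: right_diff_distrib left_diff_distrib mult.assoc[symmetric] cis_mult)
      then have "cmod (cis (- (real n * h)) * cf f n - cis (- (real n * t)) * cf f n) \<le> real n * cmod (cf f n) * norm (h - t)"
        using mult_right_mono[OF cmod_cis_minus_1_le[of "real n * (t - h)"], of "cmod (cf f n)"]
        by (simp add: norm_mult abs_mult abs_minus_commute mult_ac)
      then have "cmod (cis (- (real n * h)) * cf f n - cis (- (real n * t)) * cf f n) / \<bar>h - t\<bar> \<le> real n * cmod (cf f n)"
        using that by (simp add: divide_le_eq)
      then show ?thesis by (simp add: divide_inverse mult.commute)
    qed
    have "cmod (cf ((phase h f - phase t f) /\<^sub>R (h - t) - (- \<i>) *\<^sub>C D1 (phase t f)) n) \<le> cmod (cf (2 *\<^sub>R D1 f) n)" if "h \<noteq> t" for h n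
    proof -
      have "cf ((phase h f - phase t f) /\<^sub>R (h - t) - (- \<i>) *\<^sub>C D1 (phase t f)) n =
          (cis (- (real n * h)) * cf f n - cis (- (real n * t)) * cf f n) /\<^sub>R (h - t) + \<i> * (of_nat n * (cis (- (real n * t)) * cf f n))"
        using f by (simp add: scaleR_conv_of_real)
      then show ?thesis
        using norm_triangle_le[OF add_mono[OF 1[OF that, of n] order_refl], of "\<i> * (of_nat n * (cis (- (real n * t)) * cf f n))"] f
        by (simp add: norm_mult)
    qed
    then show "\<forall>\<^sub>F h in at t. \<forall>n. cmod (cf ((phase h f - phase t f) /\<^sub>R (h - t) - (- \<i>) *\<^sub>C D1 (phase t f)) n) \<le> cmod (cf (2 *\<^sub>R D1 f) n)"
      by (simp add: eventually_at_filter)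
  qed
  then show ?thesis
    unfolding has_vector_derivative_iff_tendsto by (rule LIM_zero_cancel)
qed

text \<open>Stated for every bounded \<open>R\<close> because it is used twice: for the Toeplitz
  operator itself, and for its conjugate by the weight of order 1, which shows that order 1 is
  propagated.\<close>

lemma interaction_ode_exists:
  assumes R: "bounded_linear R"
  shows "\<exists>w. w 0 = f \<and> (\<forall>t. (w has_vector_derivative \<i> *\<^sub>C phase (- t) (R (phase t (w t)))) (at t))"
proof -
  obtain M where M: "\<And>x. norm (R x) \<le> norm x * M"
    using bounded_linear.bounded[OF R] by blast
  interpret R: bounded_linear R by (rule R)
  show ?thesis
  proof (rule linear_ode_exists[where M=M])
    show b: "norm (\<i> *\<^sub>C phase (- t) (R (phase t x))) \<le> M * norm x" for t x
      using M[of "phase t x"] by (simp add: mult.commute)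
    show "bounded_linear (\<lambda>x. \<i> *\<^sub>C phase (- t) (R (phase t x)))" for t
      by (rule bounded_linear_intro[where K=M]) (use b in \<open>auto simp: R.add R.scaleR scaleC_add_right mult.commute\<close>)
    show "continuous_on UNIV (\<lambda>t. \<i> *\<^sub>C phase (- t) (R (phase t (w t))))" if w: "continuous_on UNIV w" for w
    proof -
      have 1: "continuous_on UNIV (\<lambda>t. phase t (w t))"
        by (rule strong_comp_cont) (auto simp: linear_phase phase_tendsto w)
      have 2: "continuous_on UNIV (\<lambda>t. R (phase (- t) (w (- t))))"
        by (intro R.continuous_on continuous_on_compose2[OF 1 continuous_on_minus[OF continuous_on_id]]) auto
      have "continuous_on UNIV (\<lambda>t. phase t (R (phase (- t) (w (- t)))))"
        by (rule strong_comp_cont) (auto simp: linear_phase phase_tendsto 2)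
      from continuous_on_compose2[OF this continuous_on_minus[OF continuous_on_id]]
      have "continuous_on UNIV (\<lambda>t. phase (- t) (R (phase t (w t))))" by simp
      then show ?thesis by (intro continuous_intros)
    qed
  qed
qed

text \<open>Polarization; the imaginary part comes from the real identity for
  \<open>\<i> *\<^sub>C f\<close>.\<close>

lemma norm_preserving_cinner:
  assumes add: "\<And>f g. A (f + g) = A f + A g" and sc: "\<And>c f. A (c *\<^sub>C f) = c *\<^sub>C A f" and n: "\<And>f. norm (A f) = norm f"
  shows "cinner (A f) (A g) = cinner f g"
proof -
  have *: "inner (A f) (A g) = inner f g" for f g
  proof -
    have "norm (A f + A g) = norm (f + g)"
      using n[of "f + g"] by (simp add: add)
    then have "(norm (A f + A g))\<^sup>2 = (norm (f + g))\<^sup>2" by simp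
    then show ?thesis
      using arg_cong[OF n[of f], of "\<lambda>x. x\<^sup>2"] arg_cong[OF n[of g], of "\<lambda>x. x\<^sup>2"]
      by (simp add: power2_norm_eq_inner inner_add_left inner_add_right inner_commute)
  qed
  have "Re (cinner (A (\<i> *\<^sub>C f)) (A g)) = Re (cinner (\<i> *\<^sub>C f) g)"
    using *[of "\<i> *\<^sub>C f" g] by (simp only: Re_cinner)
  then show ?thesis
    using *[of f g] by (simp add: complex_eq_iff sc flip: Re_cinner)
qed

section \<open>The shift, its adjoint, and the weight of order -1\<close>

lift_definition Sh :: "nat ell2 \<Rightarrow> nat ell2" is "\<lambda>x n. case n of 0 \<Rightarrow> 0 | Suc m \<Rightarrow> x m"
proof -
  fix x :: "nat \<Rightarrow> complex" assume x: "sqsum x"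
  have "(\<Sum>n\<in>F. (cmod (case n of 0 \<Rightarrow> 0 | Suc m \<Rightarrow> x m))\<^sup>2) \<le> (norm (ell2_of x))\<^sup>2" if F: "finite F" for F
  proof -
    have "(\<Sum>n\<in>F. (cmod (case n of 0 \<Rightarrow> 0 | Suc m \<Rightarrow> x m))\<^sup>2) = (\<Sum>n\<in>F - {0}. (cmod (case n of 0 \<Rightarrow> 0 | Suc m \<Rightarrow> x m))\<^sup>2)"
      using F by (intro sum.mono_neutral_right) auto
    also have "\<dots> = (\<Sum>m\<in>(\<lambda>n. n - 1) ` (F - {0}). (cmod (cf (ell2_of x) m))\<^sup>2)"
      using x by (subst sum.reindex) (auto simp: inj_on_def split: nat.splits intro!: sum.cong)
    also have "\<dots> \<le> (norm (ell2_of x))\<^sup>2"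
      using F by (intro sum_cf_le_norm) auto
    finally show ?thesis .
  qed
  then show "sqsum (\<lambda>n. case n of 0 \<Rightarrow> 0 | Suc m \<Rightarrow> x m)"
    by (rule sqsum_bound(1))
qed

lift_definition Sha :: "nat ell2 \<Rightarrow> nat ell2" is "\<lambda>x n. x (Suc n)"
  unfolding sqsum_def using summable_on_reindex[of Suc UNIV] summable_on_subset_banach
  by (metis (no_types, lifting) inj_Suc o_def subset_UNIV summable_on_cong)

lemma cf_Sh [simp]: "cf (Sh f) 0 = 0" "cf (Sh f) (Suc n) = cf f n"
  by (simp_all add: Sh.rep_eq)

lemma cf_Sha [simp]: "cf (Sha f) n = cf f (Suc n)"
  by (simp add: Sha.rep_eq)

lemma Sh_simps [simp]: "Sh (f + g) = Sh f + Sh g" "Sh (c *\<^sub>C f) = c *\<^sub>C Sh f" "Sh (r *\<^sub>R f) = r *\<^sub>R Sh f" "Sha (Sh f) = f"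
  by (rule ell2_eqI; simp add: Sh.rep_eq split: nat.split)+

lemma Sha_simps [simp]: "Sha (f + g) = Sha f + Sha g" "Sha (c *\<^sub>C f) = c *\<^sub>C Sha f"
  by (rule ell2_eqI; simp)+

lemma Sh_Sha: "Sh (Sha f) = f - cf f 0 *\<^sub>C unit2 0"
  by (rule ell2_eqI) (simp add: Sh.rep_eq split: nat.split)

lemma cinner_Sh: "cinner (Sh f) g = cinner f (Sha g)"
proof -
  have "cinner (Sh f) g = (\<Sum>\<^sub>\<infinity>n\<in>range Suc. cf (Sh f) n * cnj (cf g n))"
    unfolding cinner_def by (rule infsum_cong_neutral) (auto simp: Sh.rep_eq image_def split: nat.split)
  also have "\<dots> = cinner f (Sha g)"
    unfolding cinner_def by (subst infsum_reindex) (auto simp: o_def)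
  finally show ?thesis .
qed

lemma norm_Sh [simp]: "norm (Sh f) = norm f"
proof -
  have "cinner (Sh f) (Sh f) = cinner f f" by (simp add: cinner_Sh)
  then show ?thesis by (simp add: cinner_self flip: of_real_power)
qed

lemma insob_Sh:
  assumes "insob 1 (cf f)"
  shows "insob 1 (cf (Sh f))"
proof (rule insob_boundI(1)[where C="2 * hn 1 (cf f)"])
  fix F :: "nat set" assume F: "finite F"
  have "(\<Sum>n\<in>F. br n powr (2 * 1) * (cmod (cf (Sh f) n))\<^sup>2) = (\<Sum>n\<in>F - {0}. br n powr (2 * 1) * (cmod (cf (Sh f) n))\<^sup>2)"
    using F by (intro sum.mono_neutral_right) auto
  also have "\<dots> = (\<Sum>m\<in>(\<lambda>n. n - 1) ` (F - {0}). br (Suc m) powr (2 * 1) * (cmod (cf f m))\<^sup>2)"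
    by (subst sum.reindex) (auto simp: inj_on_def Sh.rep_eq split: nat.splits intro!: sum.cong)
  also have "\<dots> \<le> (\<Sum>m\<in>(\<lambda>n. n - 1) ` (F - {0}). 4 * (br m powr (2 * 1) * (cmod (cf f m))\<^sup>2))"
  proof (rule sum_mono)
    fix m :: nat
    have "(br (Suc m))\<^sup>2 \<le> (2 * br m)\<^sup>2"
      by (intro power_mono) (auto simp: br_nat_def)
    then show "br (Suc m) powr (2 * 1) * (cmod (cf f m))\<^sup>2 \<le> 4 * (br m powr (2 * 1) * (cmod (cf f m))\<^sup>2)"
      by (simp add: mult_right_mono powr_numeral flip: mult.assoc)
  qed
  also have "\<dots> \<le> 4 * (hn 1 (cf f))\<^sup>2"
    unfolding sum_distrib_left[symmetric] using F by (intro mult_left_mono sum_le_hn assms) auto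
  finally show "(\<Sum>n\<in>F. br n powr (2 * 1) * (cmod (cf (Sh f) n))\<^sup>2) \<le> (2 * hn 1 (cf f))\<^sup>2"
    by (simp add: power_mult_distrib)
qed simp

lemma cinner_phase: "cinner (phase t f) g = cinner f (phase (- t) g)"
  using norm_preserving_cinner[of "phase t" f "phase (- t) g"] by simp

lemma vector_derivative_affine:
  assumes "(f has_vector_derivative d) (at (c * s + t))"
  shows "((\<lambda>s. f (c * s + t)) has_vector_derivative c *\<^sub>R d) (at s)"
proof -
  have "((\<lambda>s. c * s + t) has_vector_derivative c) (at s)"
    unfolding has_real_derivative_iff_has_vector_derivative[symmetric] by (auto intro!: derivative_eq_intros)
  from vector_diff_chain_at[OF this assms] show ?thesis
    by (simp add: o_def)
qed

lemma cmod_br_inverse_le: "cmod (of_real (br n powr - 1) * z) \<le> 1 * cmod z"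
proof -
  have "\<bar>br n powr - 1\<bar> \<le> 1"
    using powr_mono[of "- 1" 0 "br n"] br_ge1[of n] by (simp add: powr_zero_eq_one)
  then show ?thesis
    unfolding norm_mult norm_of_real by (rule mult_right_mono) simp
qed

text \<open>The inverse of \<open>J 1\<close>; it identifies \<open>nat ell2\<close> with the
  sequences of order 1 and commutes with \<open>phase\<close>.\<close>

lift_definition Ki :: "nat ell2 \<Rightarrow> nat ell2" is "\<lambda>x n. of_real (br n powr - 1) * x n"
  by (erule sqsum_le) (rule cmod_br_inverse_le)

lemma cf_Ki [simp]: "cf (Ki x) n = of_real (br n powr - 1) * cf x n"
  by (simp add: Ki.rep_eq)

lemma insob_Ki [simp]: "insob 1 (cf (Ki x))"
  by (simp add: insob_def flip: mult.assoc of_real_mult powr_add)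

lemma J_Ki [simp]: "J 1 (cf (Ki x)) = x"
  by (rule ell2_eqI) (simp flip: mult.assoc of_real_mult powr_add)

lemma Ki_J [simp]: "insob 1 (cf f) \<Longrightarrow> Ki (J 1 (cf f)) = f"
  by (rule ell2_eqI) (simp flip: mult.assoc of_real_mult powr_add)

lemma Ki_simps: "Ki (x + y) = Ki x + Ki y" "Ki (c *\<^sub>C x) = c *\<^sub>C Ki x" "Ki (r *\<^sub>R x) = r *\<^sub>R Ki x" "Ki (phase t x) = phase t (Ki x)"
  by (rule ell2_eqI; simp add: algebra_simps)+

lemma bounded_linear_Ki: "bounded_linear Ki"
proof (rule bounded_linear_intro[where K=1])
  have "norm (Ki x) \<le> 1 * norm x" for x
    by (rule norm_ell2_mono) (simp_all only: cf_Ki cmod_br_inverse_le zero_le_one)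
  then show "norm (Ki x) \<le> norm x * 1" for x
    by simp
qed (simp_all add: Ki_simps)

lemma Sh_minus [simp]: "Sh (- f) = - Sh f" "Sh (f - g) = Sh f - Sh g"
  by (rule ell2_eqI; simp add: Sh.rep_eq split: nat.split)+

text \<open>Regular data, given by Fourier coefficients; \<open>real\<close> says that the function
  is real valued. The order is that of classical solutions, and it makes the Toeplitz operator
  bounded at order 1 as well.\<close>

locale bodata =
  fixes a :: "int \<Rightarrow> complex" and \<sigma> :: real
  assumes sig: "3 / 2 < \<sigma>" and a: "insob \<sigma> a" and real: "\<And>k. a (- k) = cnj (a k)"
begin

lemma s12: "1 / 2 < \<sigma>" using sig by simp

lemmas T_lin = bounded_linear_T[OF s12 a] and T_add' = T_add[OF s12 a] and T_scaleC' = T_scaleC[OF s12 a]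
  and T_adj = T_selfadjoint[OF s12 a real] and cf_T' = cf_T[OF s12 a]

lemma T_diff': "T a (f - g) = T a f - T a g"
  using bounded_linear.linear[OF T_lin] by (rule linear_diff)

lemma insob_T: "insob 1 (cf f) \<Longrightarrow> insob 1 (cf (T a f))"
  using T_bounds[OF s12, of 1] sig a by auto

lemma insob1 [simp]: "insob 1 (cf f) \<Longrightarrow> insob 1 (cf g) \<Longrightarrow> insob 1 (cf (f + g))"
  "insob 1 (cf f) \<Longrightarrow> insob 1 (cf g) \<Longrightarrow> insob 1 (cf (f - g))" "insob 1 (cf f) \<Longrightarrow> insob 1 (cf (c *\<^sub>C f))"
  by (simp_all add: insob_add insob_diff insob_cmult)

text \<open>The interaction picture: \<open>w t = phase (- t) (exp (- \<i> t L) f)\<close> for the Lax operator \<open>L = D1 - T a\<close>. It removes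
  the unbounded part \<open>D1\<close> from the equation, so that the bounded theory of linear evolution equations applies.\<close>

definition solves :: "(real \<Rightarrow> nat ell2) \<Rightarrow> bool" where
  "solves w \<longleftrightarrow> (\<forall>t. (w has_vector_derivative \<i> *\<^sub>C phase (- t) (T a (phase t (w t)))) (at t))"

text \<open>The Toeplitz operator is self-adjoint and the equation carries a factor
  \<open>\<i>\<close>, so the norm of the difference of two solutions is constant.\<close>

lemma solves_unique:
  assumes "solves w" "solves z" "w 0 = z 0"
  shows "w = z"
proof -
  define y where "y t = w t - z t" for t
  have y: "(y has_vector_derivative \<i> *\<^sub>C phase (- t) (T a (phase t (y t)))) (at t)" for t
  proof -
    have "\<i> *\<^sub>C phase (- t) (T a (phase t (w t))) - \<i> *\<^sub>C phase (- t) (T a (phase t (z t))) = \<i> *\<^sub>C phase (- t) (T a (phase t (y t)))"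
      by (simp only: y_def linear_diff[OF linear_phase] T_diff' scaleC_diff_right)
    then show ?thesis
      using has_vector_derivative_diff[OF assms(1)[unfolded solves_def, rule_format, of t] assms(2)[unfolded solves_def, rule_format, of t]]
      by (simp add: y_def[abs_def])
  qed
  have "((\<lambda>t. inner (y t) (y t)) has_real_derivative 0) (at t)" for t
  proof -
    let ?x = "phase t (y t)"
    have "cinner (T a ?x) ?x = cnj (cinner (T a ?x) ?x)"
      using T_adj[of ?x ?x] cinner_commute by metis
    then have "Im (cinner (T a ?x) ?x) = 0"
      by (metis Im_complex_of_real Reals_cnj_iff complex_is_Real_iff)
    then have z: "inner (\<i> *\<^sub>C phase (- t) (T a ?x)) (y t) = 0"
      by (simp add: cinner_phase flip: Re_cinner)
    have "((\<lambda>t. inner (y t) (y t)) has_vector_derivative inner (y t) (\<i> *\<^sub>C phase (- t) (T a ?x)) + inner (\<i> *\<^sub>C phase (- t) (T a ?x)) (y t)) (at t)"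
      by (rule bounded_bilinear.has_vector_derivative[OF bounded_bilinear_inner y y])
    then show ?thesis
      using z by (simp add: inner_commute has_real_derivative_iff_has_vector_derivative)
  qed
  then have "inner (y t) (y t) = inner (y 0) (y 0)" for t
    by (intro DERIV_isconst_all) auto
  then have "y t = 0" for t
    using assms(3) by (simp add: y_def)
  then show ?thesis
    by (auto simp: y_def)
qed

definition W :: "nat ell2 \<Rightarrow> real \<Rightarrow> nat ell2" where
  "W f = (SOME w. w 0 = f \<and> solves w)"

lemma W: "W f 0 = f" "solves (W f)"
  using someI_ex[OF interaction_ode_exists[OF T_lin, of f]] unfolding W_def solves_def by auto

lemma W_eqI: "solves w \<Longrightarrow> w 0 = f \<Longrightarrow> w = W f"
  by (rule solves_unique) (auto simp: W)

lemma W_add: "W (f + g) t = W f t + W g t" and W_scaleC: "W (c *\<^sub>C f) t = c *\<^sub>C W f t"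
proof -
  have "solves (\<lambda>t. W f t + W g t)"
    using W(2) unfolding solves_def by (auto simp: T_add' scaleC_add_right intro!: has_vector_derivative_add)
  from W_eqI[OF this] show "W (f + g) t = W f t + W g t" by (simp add: W fun_eq_iff)
  have "solves (\<lambda>t. c *\<^sub>C W f t)"
    unfolding solves_def
  proof
    fix t
    show "((\<lambda>t. c *\<^sub>C W f t) has_vector_derivative \<i> *\<^sub>C phase (- t) (T a (phase t (c *\<^sub>C W f t)))) (at t)"
      using bounded_linear.has_vector_derivative[OF bounded_linear_scaleC[of c] W(2)[of f, unfolded solves_def, rule_format, of t]]
      by (simp add: T_scaleC' mult.commute)
  qed
  from W_eqI[OF this] show "W (c *\<^sub>C f) t = c *\<^sub>C W f t" by (simp add: W fun_eq_iff)
qed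

lemma norm_W: "norm (W f t) = norm f"
proof -
  have "((\<lambda>t. inner (W f t) (W f t)) has_real_derivative 0) (at t)" for t
  proof -
    let ?x = "phase t (W f t)"
    have "cinner (T a ?x) ?x = cnj (cinner (T a ?x) ?x)"
      using T_adj[of ?x ?x] cinner_commute by metis
    then have "Im (cinner (T a ?x) ?x) = 0"
      by (metis Im_complex_of_real Reals_cnj_iff complex_is_Real_iff)
    then have z: "inner (\<i> *\<^sub>C phase (- t) (T a ?x)) (W f t) = 0"
      by (simp add: cinner_phase flip: Re_cinner)
    show ?thesis
      using bounded_bilinear.has_vector_derivative[OF bounded_bilinear_inner W(2)[of f, unfolded solves_def, rule_format, of t] W(2)[of f, unfolded solves_def, rule_format, of t]] z
      by (simp add: inner_commute has_real_derivative_iff_has_vector_derivative)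
  qed
  then have "inner (W f t) (W f t) = inner (W f 0) (W f 0)"
    by (intro DERIV_isconst_all) auto
  then show ?thesis by (simp add: W norm_eq_sqrt_inner)
qed

text \<open>The equation is solved once more at order 1, with the Toeplitz operator conjugated by
  \<open>J 1\<close> and \<open>Ki\<close>; the image under \<open>Ki\<close> solves the original
  equation, and uniqueness identifies the two solutions.\<close>

lemma W_insob:
  assumes f: "insob 1 (cf f)"
  shows "insob 1 (cf (W f t))"
proof -
  define T1 where "T1 x = J 1 (cf (T a (Ki x)))" for x
  have i: "insob 1 (cf (T a (Ki x)))" for x
    by (simp add: insob_T)
  obtain K where K: "\<And>f. insob 1 (cf f) \<Longrightarrow> hn 1 (cf (T a f)) \<le> K * hn \<sigma> a * hn 1 (cf f)"
    using T_bounds[OF s12, of 1] sig a by auto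
  have "bounded_linear T1"
  proof (rule bounded_linear_intro[where K="K * hn \<sigma> a"])
    show "norm (T1 x) \<le> norm x * (K * hn \<sigma> a)" for x
      using K[of "Ki x"] by (simp add: T1_def hn_def mult.commute)
    show "T1 (x + y) = T1 x + T1 y" for x y
      by (simp add: T1_def Ki_simps T_add' i flip: J_add)
    show "T1 (r *\<^sub>R x) = r *\<^sub>R T1 x" for r x
      by (rule ell2_eqI) (simp add: T1_def Ki_simps linear_scale[OF bounded_linear.linear[OF T_lin]] i insob_cmult)
  qed
  from interaction_ode_exists[OF this, of "J 1 (cf f)"] obtain w where
    w: "w 0 = J 1 (cf f)" "\<And>t. (w has_vector_derivative \<i> *\<^sub>C phase (- t) (T1 (phase t (w t)))) (at t)"
    by blast
  have "solves (\<lambda>t. Ki (w t))"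
    unfolding solves_def
  proof
    fix t
    show "((\<lambda>t. Ki (w t)) has_vector_derivative \<i> *\<^sub>C phase (- t) (T a (phase t (Ki (w t))))) (at t)"
      using bounded_linear.has_vector_derivative[OF bounded_linear_Ki w(2), of t]
      by (simp add: Ki_simps T1_def insob_T)
  qed
  from W_eqI[OF this] have "W f t = Ki (w t)"
    using f by (simp add: w fun_eq_iff)
  then show ?thesis by simp
qed

definition U :: "real \<Rightarrow> nat ell2 \<Rightarrow> nat ell2" where
  "U t f = phase t (W f t)"

definition L :: "nat ell2 \<Rightarrow> nat ell2" where
  "L f = D1 f - T a f"

lemma U_simps [simp]: "U 0 f = f" "U t (f + g) = U t f + U t g" "U t (c *\<^sub>C f) = c *\<^sub>C U t f" "U t (r *\<^sub>R f) = r *\<^sub>R U t f"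
  "norm (U t f) = norm f"
  by (simp_all add: U_def W W_add W_scaleC norm_W scaleR_scaleC)

lemma linear_U: "linear (U t)"
  by (rule linearI) auto

lemma U_insob [simp]: "insob 1 (cf f) \<Longrightarrow> insob 1 (cf (U t f))"
  by (simp add: U_def W_insob)

lemma U_cinner: "cinner (U t f) (U t g) = cinner f g"
  by (rule norm_preserving_cinner) auto

lemma U_U [simp]: "U s (U t f) = U (s + t) f"
proof -
  have "solves (\<lambda>s. phase t (W f (s + t)))"
    unfolding solves_def
  proof
    fix s
    have "((\<lambda>s. W f (s + t)) has_vector_derivative \<i> *\<^sub>C phase (- (s + t)) (T a (phase (s + t) (W f (s + t))))) (at s)"
      using vector_derivative_affine[OF W(2)[of f, unfolded solves_def, rule_format, of "1 * s + t"]] by simp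
    have bl: "bounded_linear (phase t)"
      by (rule bounded_linear_intro[where K=1]) auto
    from bounded_linear.has_vector_derivative[OF bl \<open>((\<lambda>s. W f (s + t)) has_vector_derivative _) _\<close>]
    show "((\<lambda>s. phase t (W f (s + t))) has_vector_derivative \<i> *\<^sub>C phase (- s) (T a (phase s (phase t (W f (s + t)))))) (at s)"
      by simp
  qed
  from W_eqI[OF this] show ?thesis
    by (simp add: U_def fun_eq_iff) (metis add.commute phase_phase)
qed

lemma U_tendsto: "((\<lambda>h. U h f) \<longlongrightarrow> U t f) (at t)"
proof -
  have "continuous_on UNIV (W f)"
    using has_vector_derivative_continuous[OF W(2)[unfolded solves_def, rule_format]] by (simp add: continuous_on_eq_continuous_at)
  then have "continuous_on UNIV (\<lambda>h. U h f)"
    unfolding U_def by (rule strong_comp_cont[where A=phase and w="W f", OF linear_phase _ phase_tendsto, rotated]) simp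
  then show ?thesis by (simp add: continuous_on_def)
qed

lemma U_deriv:
  assumes f: "insob 1 (cf f)"
  shows "((\<lambda>h. U h f) has_vector_derivative (- \<i>) *\<^sub>C L (U t f)) (at t)"
proof -
  have "((\<lambda>h. phase h (W f h)) has_vector_derivative
      phase t (\<i> *\<^sub>C phase (- t) (T a (phase t (W f t)))) + (- \<i>) *\<^sub>C D1 (phase t (W f t))) (at t)"
    by (rule strong_comp_deriv[where A=phase and w="W f", OF linear_phase _ phase_tendsto W(2)[unfolded solves_def, rule_format] phase_deriv])
      (simp_all add: W_insob f)
  then show ?thesis by (simp add: U_def L_def scaleC_diff_right)
qed

text \<open>Both sides arise by differentiating \<open>U h (U t f) = U t (U h f)\<close> at
  \<open>h = 0\<close>.\<close>

lemma U_L: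
  assumes f: "insob 1 (cf f)"
  shows "L (U t f) = U t (L f)"
proof -
  have "((\<lambda>h. U h (U t f)) has_vector_derivative (- \<i>) *\<^sub>C L (U t f)) (at 0)"
    using U_deriv[OF U_insob[OF f, of t], of 0] by simp
  moreover have "bounded_linear (U t)"
    by (rule bounded_linear_intro[where K=1]) auto
  then have "((\<lambda>h. U t (U h f)) has_vector_derivative U t ((- \<i>) *\<^sub>C L f)) (at 0)"
    using bounded_linear.has_vector_derivative[OF _ U_deriv[OF f, of 0], of "U t"] by simp
  ultimately have "(- \<i>) *\<^sub>C L (U t f) = U t ((- \<i>) *\<^sub>C L f)"
    by (simp add: add.commute vector_derivative_unique_at)
  then have "\<i> *\<^sub>C (- \<i>) *\<^sub>C L (U t f) = \<i> *\<^sub>C (- \<i>) *\<^sub>C U t (L f)"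
    by (simp only: U_simps)
  then show ?thesis by simp
qed

text \<open>A Toeplitz matrix does not change when both indices are shifted, while the diagonal of D
  grows by 1.\<close>

lemma Sha_L_Sh:
  assumes "insob 1 (cf f)"
  shows "Sha (L (Sh f)) = L f + f"
proof (rule ell2_eqI)
  fix n
  have "toep a (cf (Sh f)) (Suc n) = toep a (cf f) n"
  proof -
    have "toep a (cf (Sh f)) (Suc n) = (\<Sum>\<^sub>\<infinity>m\<in>range Suc. a (int (Suc n) - int m) * cf (Sh f) m)"
      unfolding toep_def by (rule infsum_cong_neutral) (auto simp: Sh.rep_eq image_def split: nat.split)
    also have "\<dots> = toep a (cf f) n"
      unfolding toep_def by (subst infsum_reindex) (auto simp: o_def)
    finally show ?thesis .
  qed
  then show "cf (Sha (L (Sh f))) n = cf (L f + f) n"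
    using assms by (simp add: L_def cf_T' insob_Sh algebra_simps)
qed

definition St :: "real \<Rightarrow> nat ell2 \<Rightarrow> nat ell2" where
  "St t f = cis (- t) *\<^sub>C Sh (U (2 * t) f)"

definition Sta :: "real \<Rightarrow> nat ell2 \<Rightarrow> nat ell2" where
  "Sta t f = cis t *\<^sub>C U (- 2 * t) (Sha f)"

lemma St_simps [simp]: "St t (f + g) = St t f + St t g" "St t (c *\<^sub>C f) = c *\<^sub>C St t f" "St t (r *\<^sub>R f) = r *\<^sub>R St t f" "norm (St t f) = norm f"
  by (simp_all add: St_def scaleC_add_right mult.commute)

lemma linear_St: "linear (St t)"
  by (rule linearI) auto

lemma minus_simps [simp]: "U t (- f) = - U t f" "U t (f - g) = U t f - U t g" "St t (- f) = - St t f" "St t (f - g) = St t f - St t g"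
  by (simp_all add: linear_neg[OF linear_U] linear_diff[OF linear_U] linear_neg[OF linear_St] linear_diff[OF linear_St])

lemma St_insob [simp]: "insob 1 (cf f) \<Longrightarrow> insob 1 (cf (St t f))"
  unfolding St_def by (intro insob1 insob_Sh U_insob)

lemma St_cinner: "cinner (St t f) (St t g) = cinner f g"
  by (rule norm_preserving_cinner) auto

lemma cinner_St: "cinner (St t f) g = cinner f (Sta t g)"
proof -
  have "cinner (St t f) g = cis (- t) * cinner (U (2 * t) f) (U (2 * t) (U (- 2 * t) (Sha g)))"
    by (simp add: St_def cinner_Sh)
  also have "\<dots> = cinner f (Sta t g)"
    unfolding U_cinner by (simp add: Sta_def cis_cnj)
  finally show ?thesis .
qed

lemma St_Sta: "St t (Sta t f) = f - cf f 0 *\<^sub>C unit2 0"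
  by (simp add: St_def Sta_def cis_mult Sh_Sha)

text \<open>The group commutes with \<open>L\<close> and drops out by unitarity, the scalar phase
  cancels, and the shift contributes the summand \<open>cinner f g\<close>. The basis, its
  completeness and the conserved form all rest on this identity.\<close>

lemma L_St:
  assumes "insob 1 (cf f)"
  shows "cinner (L (St t f)) (St t g) = cinner (L f) g + cinner f g"
proof -
  have i: "insob 1 (cf (U (2 * t) f))" using assms by simp
  have "L (c *\<^sub>C h) = c *\<^sub>C L h" if "insob 1 (cf h)" for c h
    using that by (intro ell2_eqI) (simp add: L_def T_scaleC' insob_cmult algebra_simps)
  then have "cinner (L (St t f)) (St t g) = cinner (L (Sh (U (2 * t) f))) (Sh (U (2 * t) g))"
    using insob_Sh[OF i] by (simp add: St_def cis_cnj cis_mult flip: mult.assoc)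
  also have "\<dots> = cinner (Sha (L (Sh (U (2 * t) f)))) (U (2 * t) g)"
    by (metis cinner_Sh cinner_commute)
  also have "\<dots> = cinner (L f) g + cinner f g"
    using assms i by (simp add: Sha_L_Sh U_L cinner_add_left U_cinner)
  finally show ?thesis .
qed

lemma St_tendsto: "((\<lambda>h. St h f) \<longlongrightarrow> St t f) (at t)"
proof -
  have "((\<lambda>h. U (2 * h) f) \<longlongrightarrow> U (2 * t) f) (at t)"
    by (rule isCont_tendsto_compose[of _ "\<lambda>h. U h f"]) (auto simp: isCont_def U_tendsto intro!: tendsto_intros)
  moreover have "bounded_linear Sh"
    by (rule bounded_linear_intro[where K=1]) auto
  ultimately have "((\<lambda>h. Sh (U (2 * h) f)) \<longlongrightarrow> Sh (U (2 * t) f)) (at t)"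
    by (rule bounded_linear.tendsto[rotated])
  moreover have "((\<lambda>h. cis (- h)) \<longlongrightarrow> cis (- t)) (at t)"
    unfolding cis_conv_exp by (intro tendsto_intros)
  ultimately show ?thesis
    unfolding St_def by (rule tendsto_scaleC[rotated])
qed

text \<open>The group at time \<open>2 * t\<close> contributes \<open>2 *\<^sub>R L f\<close>, the
  scalar phase the summand \<open>f\<close>.\<close>

lemma St_deriv:
  assumes f: "insob 1 (cf f)"
  shows "((\<lambda>h. St h f) has_vector_derivative (- \<i>) *\<^sub>C St t (2 *\<^sub>C L f + f)) (at t)"
proof -
  have bl: "bounded_linear Sh"
    by (rule bounded_linear_intro[where K=1]) auto
  have "((\<lambda>h. U (2 * h) f) has_vector_derivative 2 *\<^sub>R ((- \<i>) *\<^sub>C L (U (2 * t) f))) (at t)"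
    using vector_derivative_affine[where f="\<lambda>h. U h f" and c=2 and s=t and t=0, unfolded add_0_right, OF U_deriv[OF f]] .
  from bounded_linear.has_vector_derivative[OF bl this]
  have 1: "((\<lambda>h. Sh (U (2 * h) f)) has_vector_derivative Sh (2 *\<^sub>R ((- \<i>) *\<^sub>C U (2 * t) (L f)))) (at t)"
    by (simp add: U_L f)
  have 2: "((\<lambda>h. cis (- h)) has_vector_derivative - \<i> * cis (- t)) (at t)"
    unfolding cis_conv_exp by (auto intro!: derivative_eq_intros has_vector_derivative_real_field)
  show ?thesis
    using bounded_bilinear.has_vector_derivative[OF bounded_bilinear_scaleC 2 1]
    by (simp add: St_def scaleC_add_right scaleR_scaleC mult_ac)
qed

text \<open>Gerard's explicit formula: the coefficients of the solution with data \<open>a\<close> are \<open>cinner p (v t n)\<close>, where \<open>p\<close>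
  is the part of \<open>a\<close> of nonnegative frequencies.\<close>

definition v :: "real \<Rightarrow> nat \<Rightarrow> nat ell2" where
  "v t n = (St t ^^ n) (unit2 0)"

lemma v_simps [simp]: "v t 0 = unit2 0" "v t (Suc n) = St t (v t n)"
  by (simp_all add: v_def)

lemma insob_unit2 [simp]: "insob r (cf (unit2 i))"
  by (rule insob_finite) (auto split: if_splits)

lemma v_insob [simp]: "insob 1 (cf (v t n))"
  by (induction n) (auto simp del: cf_unit2)

lemma v_orth: "cinner (v t n) (v t m) = (if n = m then 1 else 0)"
proof (induction n arbitrary: m)
  case 0
  show ?case
    by (cases m) (auto simp: St_def)
next
  case (Suc n)
  show ?case
    by (cases m) (auto simp: St_cinner Suc, simp add: St_def)
qed

text \<open>Leibniz rule for the n-fold product of \<open>St t\<close>: summand \<open>m\<close>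
  differentiates the factor that acts on \<open>v t m\<close>.\<close>

lemma v_deriv:
  "((\<lambda>t. v t n) has_vector_derivative (- \<i>) *\<^sub>C (\<Sum>m<n. (St t ^^ (n - m)) (2 *\<^sub>C L (v t m) + v t m))) (at t)"
proof (induction n)
  case (Suc n)
  have *: "St t (\<Sum>m<k. f m) = (\<Sum>m<k. St t (f m))" for k f
    using linear_sum[OF linear_St] .
  have "((\<lambda>h. St h (v h n)) has_vector_derivative St t ((- \<i>) *\<^sub>C (\<Sum>m<n. (St t ^^ (n - m)) (2 *\<^sub>C L (v t m) + v t m))) + (- \<i>) *\<^sub>C St t (2 *\<^sub>C L (v t n) + v t n)) (at t)"
    by (rule strong_comp_deriv[OF linear_St _ St_tendsto Suc St_deriv[OF v_insob]]) simp
  also have "St t ((- \<i>) *\<^sub>C (\<Sum>m<n. (St t ^^ (n - m)) (2 *\<^sub>C L (v t m) + v t m))) + (- \<i>) *\<^sub>C St t (2 *\<^sub>C L (v t n) + v t n)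
     = (- \<i>) *\<^sub>C (\<Sum>m<Suc n. (St t ^^ (Suc n - m)) (2 *\<^sub>C L (v t m) + v t m))"
    by (simp add: * Suc_diff_le scaleC_add_right)
  finally show ?case by simp
qed simp

end

section \<open>Completeness and conjugation\<close>

lemma insob_Sha:
  assumes "insob r (cf f)" "0 \<le> r"
  shows "insob r (cf (Sha f))"
proof (rule insob_boundI(1)[where C="hn r (cf f)"])
  fix F :: "nat set" assume F: "finite F"
  have "(\<Sum>n\<in>F. br n powr (2 * r) * (cmod (cf (Sha f) n))\<^sup>2) \<le> (\<Sum>n\<in>F. br (Suc n) powr (2 * r) * (cmod (cf f (Suc n)))\<^sup>2)"
    using assms(2) by (intro sum_mono) (auto intro!: mult_right_mono powr_mono2 simp: br_nat_def)
  also have "\<dots> = (\<Sum>n\<in>Suc ` F. br n powr (2 * r) * (cmod (cf f n))\<^sup>2)"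
    by (subst sum.reindex) auto
  also have "\<dots> \<le> (hn r (cf f))\<^sup>2"
    using F by (intro sum_le_hn assms) auto
  finally show "(\<Sum>n\<in>F. br n powr (2 * r) * (cmod (cf (Sha f) n))\<^sup>2) \<le> (hn r (cf f))\<^sup>2" .
qed simp

text \<open>The coefficients of a real function, recovered from those of nonnegative frequency;
  symmetry at frequency 0 needs \<open>x 0\<close> to be real.\<close>

definition herm :: "(nat \<Rightarrow> complex) \<Rightarrow> int \<Rightarrow> complex" where
  "herm x k = (if 0 \<le> k then x (nat k) else cnj (x (nat (- k))))"

lemma
  assumes "insob r x"
  shows insob_herm: "insob r (herm x)" and hn_herm_le: "hn r (herm x) \<le> 2 * hn r x"
proof -
  let ?g = "\<lambda>k. if k < 0 then cnj (herm x k) else 0"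
  have c: "insob r (\<lambda>k. cnj (y k))" "hn r (\<lambda>k. cnj (y k)) \<le> hn r y" if "insob r y" for y :: "int \<Rightarrow> complex"
    using insob_dominated[OF that, of r "\<lambda>k. cnj (y k)" 1] by auto
  have "insob r (\<lambda>k. if k < 0 then ext x (- k) else 0)" "hn r (\<lambda>k. if k < 0 then ext x (- k) else 0) \<le> hn r x"
    using insob_restr[OF insob_reflect[OF insob_ext[OF assms]], of "{..<0}"]
      order_trans[OF hn_restr_le[OF insob_reflect[OF insob_ext[OF assms]], of "{..<0}"] order_trans[OF hn_reflect_le[OF insob_ext[OF assms]] hn_ext_le[OF assms]]]
    by auto
  note n = c(1)[OF this(1)] order_trans[OF c(2)[OF this(1)] this(2)]
  have e: "herm x = (\<lambda>k. ext x k + cnj (if k < 0 then ext x (- k) else 0))"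
    by (auto simp: herm_def ext_def)
  show "insob r (herm x)"
    unfolding e by (intro insob_add insob_ext assms n(1))
  show "hn r (herm x) \<le> 2 * hn r x"
    unfolding e using hn_add_le[OF insob_ext[OF assms] n(1)] hn_ext_le[OF assms] n(2) by linarith
qed

lemma herm_real: "x 0 = cnj (x 0) \<Longrightarrow> herm x (- k) = cnj (herm x k)"
  by (cases "k = 0") (auto simp: herm_def)

text \<open>All three bounds come from \<open>0 \<le> n \<le> br n \<le> n + 1\<close>.\<close>

lemma D1_form:
  assumes i: "insob 1 (cf f)"
  shows "0 \<le> Re (cinner (D1 f) f)" "Re (cinner (D1 f) f) \<le> (hn (1/2) (cf f))\<^sup>2"
    "(hn (1/2) (cf f))\<^sup>2 \<le> Re (cinner (D1 f) f) + (norm f)\<^sup>2"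
proof -
  have h: "insob (1/2) (cf f)" by (rule insob_mono[OF i]) simp
  have s: "(\<lambda>n. real n * (cmod (cf f n))\<^sup>2) summable_on UNIV"
    using summable_on_bounded_linear[OF bounded_linear_Re cinner_summable[of "D1 f" f]] i
    by (simp add: mult.assoc flip: complex_norm_square of_real_power)
  have "cinner (D1 f) f = (\<Sum>\<^sub>\<infinity>n. of_real (real n * (cmod (cf f n))\<^sup>2))"
    unfolding cinner_def using i by (intro infsum_cong) (simp add: mult.assoc flip: complex_norm_square)
  also have "\<dots> = of_real (\<Sum>\<^sub>\<infinity>n. real n * (cmod (cf f n))\<^sup>2)"
    by (rule infsumI[OF has_sum_of_real[OF has_sum_infsum[OF s]]])
  finally have e: "Re (cinner (D1 f) f) = (\<Sum>\<^sub>\<infinity>n. real n * (cmod (cf f n))\<^sup>2)"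
    by simp
  show "0 \<le> Re (cinner (D1 f) f)"
    unfolding e by (rule infsum_nonneg) simp
  show "Re (cinner (D1 f) f) \<le> (hn (1/2) (cf f))\<^sup>2"
    unfolding e by (rule infsum_le_finite_sums[OF s], rule order_trans[OF sum_mono sum_le_hn[OF h]])
      (auto intro!: mult_right_mono simp: br_nat_def)
  show "(hn (1/2) (cf f))\<^sup>2 \<le> Re (cinner (D1 f) f) + (norm f)\<^sup>2"
    unfolding hn_sq[OF h]
  proof (rule infsum_le_finite_sums)
    fix F :: "nat set" assume F: "finite F"
    have "(\<Sum>n\<in>F. br n powr (2 * (1/2)) * (cmod (cf f n))\<^sup>2) \<le> (\<Sum>n\<in>F. real n * (cmod (cf f n))\<^sup>2 + (cmod (cf f n))\<^sup>2)"
    proof (rule sum_mono)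
      fix n :: nat
      have "br n powr (2 * (1/2)) \<le> real n + 1" by (simp add: br_nat_def)
      from mult_right_mono[OF this, of "(cmod (cf f n))\<^sup>2"]
      show "br n powr (2 * (1/2)) * (cmod (cf f n))\<^sup>2 \<le> real n * (cmod (cf f n))\<^sup>2 + (cmod (cf f n))\<^sup>2"
        by (simp add: distrib_right)
    qed
    also have "\<dots> \<le> Re (cinner (D1 f) f) + (norm f)\<^sup>2"
      unfolding sum.distrib e using F by (intro add_mono sum_cf_le_norm finite_sum_le_infsum s) auto
    finally show "(\<Sum>n\<in>F. br n powr (2 * (1/2)) * (cmod (cf f n))\<^sup>2) \<le> Re (cinner (D1 f) f) + (norm f)\<^sup>2" .
  qed (use h in \<open>simp add: insob_summable\<close>)
qed

context bodata
begin

lemma Sta_simps [simp]: "Sta t (f + g) = Sta t f + Sta t g" "Sta t (c *\<^sub>C f) = c *\<^sub>C Sta t f"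
  by (simp_all add: Sta_def scaleC_add_right mult.commute)

lemma Sta_insob: "insob 1 (cf f) \<Longrightarrow> insob 1 (cf (Sta t f))"
  unfolding Sta_def by (intro insob1 insob_Sha U_insob) auto

lemma cinner_unit2_St [simp]: "cf (St t f) 0 = 0"
  by (simp add: St_def)

lemma St_decomp: "f = St t (Sta t f) + cf f 0 *\<^sub>C unit2 0"
  by (simp add: St_Sta)

lemma norm_Sta: "(norm f)\<^sup>2 = (norm (Sta t f))\<^sup>2 + (cmod (cf f 0))\<^sup>2"
proof -
  define u where "u = cf f 0 *\<^sub>C (unit2 0 :: nat ell2)"
  have "inner (St t (Sta t f)) u = 0"
    by (simp add: u_def flip: Re_cinner)
  then have "(norm (St t (Sta t f) + u))\<^sup>2 = (norm (St t (Sta t f)))\<^sup>2 + (norm u)\<^sup>2"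
    by (simp only: power2_norm_eq_inner inner_add_left inner_add_right inner_commute[of u "St t (Sta t f)"] add_0_left add_0_right)
  then show ?thesis
    unfolding u_def by (simp flip: St_decomp)
qed

lemma L_sym: "insob 1 (cf f) \<Longrightarrow> insob 1 (cf g) \<Longrightarrow> cinner (L f) g = cinner f (L g)"
proof -
  assume i: "insob 1 (cf f)" "insob 1 (cf g)"
  then have "cinner (D1 f) g = cinner f (D1 g)"
    unfolding cinner_def by (intro infsum_cong) simp
  then show ?thesis
    by (simp add: L_def cinner_diff_left cinner_diff_right T_adj)
qed

lemma L_add: "insob 1 (cf f) \<Longrightarrow> insob 1 (cf g) \<Longrightarrow> L (f + g) = L f + L g"
  and L_scaleC: "insob 1 (cf f) \<Longrightarrow> L (c *\<^sub>C f) = c *\<^sub>C L f"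
  by (rule ell2_eqI; simp add: L_def T_add' T_scaleC' insob_add insob_cmult algebra_simps)+

section \<open>The quadratic form along the remainders, and completeness of the basis\<close>

definition p :: "nat ell2" where
  "p = ell2_of (\<lambda>n. a (int n))"

lemma cf_p: "cf p = (\<lambda>n. a (int n))"
proof -
  have "insob 0 (\<lambda>n. a (int n))"
    by (rule insob_mono[OF insob_nat[OF a]]) (use sig in auto)
  then show ?thesis
    by (simp add: p_def insob_0_iff)
qed

lemma insob_p: "insob \<sigma> (cf p)"
  unfolding cf_p by (rule insob_nat[OF a])

lemma herm_p: "herm (cf p) = a"
  by (auto simp: herm_def cf_p fun_eq_iff simp flip: real)

text \<open>\<open>unit2 0\<close> is the constant function 1: D annihilates it, and the Toeplitz
  operator maps it to the part of its symbol of nonnegative frequencies.\<close>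

lemma L_unit2: "L (unit2 0) = - p"
proof (rule ell2_eqI)
  fix n
  have "toep a (cf (unit2 0)) n = (\<Sum>\<^sub>\<infinity>m. if m = 0 then a (int n - int m) else 0)"
    unfolding toep_def by (rule infsum_cong) auto
  then show "cf (L (unit2 0)) n = cf (- p) n"
    using insob_unit2[of 1 "0::nat"] by (simp add: L_def cf_T' cf_p infsum_single del: cf_unit2) (simp add: if_distrib)
qed

definition q :: "nat ell2 \<Rightarrow> real" where
  "q f = Re (cinner (L f) f)"

text \<open>The form is expanded along \<open>St_decomp\<close>. By \<open>L_St\<close> the part in
  the range of \<open>St t\<close> contributes \<open>q (Sta t f)\<close> and the squared norm to be
  bounded; the terms with the coefficient \<open>cf f 0\<close> involve \<open>L\<close> only
  through \<open>L_unit2\<close>.\<close>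

lemma q_Sta:
  assumes f: "insob 1 (cf f)"
  shows "(norm (Sta t f))\<^sup>2 \<le> q f - q (Sta t f) + norm p * (cmod (cf f 0))\<^sup>2 + 2 * (cmod (cf f 0) * norm p * norm (Sta t f))"
proof -
  let ?g = "Sta t f" and ?c = "cf f 0"
  have i: "insob 1 (cf ?g)" "insob 1 (cf (St t ?g))" "insob 1 (cf (?c *\<^sub>C unit2 0))"
    using f by (simp_all only: Sta_insob St_insob insob1(3)[OF insob_unit2])
  have "q f = Re (cinner (L (St t ?g) + ?c *\<^sub>C (- p)) (St t ?g + ?c *\<^sub>C unit2 0))"
    unfolding q_def by (subst (1 2) St_decomp[of f t], subst L_add[OF i(2,3)]) (simp only: L_scaleC[OF insob_unit2] L_unit2)
  also have "cinner (L (St t ?g) + ?c *\<^sub>C (- p)) (St t ?g + ?c *\<^sub>C unit2 0) =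
      cinner (L ?g) ?g + cinner ?g ?g + cinner (L (St t ?g)) (?c *\<^sub>C unit2 0) - ?c * cinner p (St t ?g) - ?c * cnj ?c * cinner p (unit2 0)"
    by (simp only: cinner_add_left cinner_add_right L_St[OF i(1)] cinner_scaleC_left cinner_scaleC_right cinner_minus_left) algebra
  also have "cinner (L (St t ?g)) (?c *\<^sub>C unit2 0) = - cnj (?c * cinner p (St t ?g))"
    unfolding cinner_scaleC_right L_sym[OF i(2) insob_unit2] L_unit2 by (simp add: cinner_commute[of _ p])
  finally have "q f = q ?g + (norm ?g)\<^sup>2 - 2 * Re (?c * cinner p (St t ?g)) - Re (?c * cnj ?c * cinner p (unit2 0))"
    by (simp add: q_def cinner_self flip: of_real_power)
  moreover have "Re (?c * cinner p (St t ?g)) \<le> cmod ?c * norm p * norm ?g"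
    using order_trans[OF complex_Re_le_cmod[of "?c * cinner p (St t ?g)"], unfolded norm_mult,
        OF mult_left_mono[OF cmod_cinner_le[of p "St t ?g"] norm_ge_zero[of ?c]]]
    by (simp add: mult.assoc)
  moreover have "Re (?c * cnj ?c * cinner p (unit2 0)) \<le> norm p * (cmod ?c)\<^sup>2"
  proof -
    have "Re (?c * cnj ?c * cinner p (unit2 0)) \<le> cmod ?c * cmod ?c * cmod (cinner p (unit2 0))"
      by (rule order_trans[OF complex_Re_le_cmod]) (simp add: norm_mult)
    also have "\<dots> \<le> cmod ?c * cmod ?c * (norm p * norm (unit2 0 :: nat ell2))"
      by (intro mult_left_mono cmod_cinner_le) auto
    finally show ?thesis by (simp add: power2_eq_square mult_ac)
  qed
  ultimately show ?thesis by linarith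
qed

text \<open>The remainder of \<open>f\<close> after its first \<open>n\<close> coefficients have
  been split off: by \<open>norm_g\<close> its squared norm is what Bessel's inequality loses at
  that stage.\<close>

abbreviation g :: "real \<Rightarrow> nat ell2 \<Rightarrow> nat \<Rightarrow> nat ell2" where
  "g t f n \<equiv> (Sta t ^^ n) f"

lemma cf_g: "cf (g t f n) 0 = cinner f (v t n)"
proof -
  have c: "cinner (Sta t y) x = cinner y (St t x)" for x y
    by (metis cinner_St cinner_commute)
  have "cinner (g t f n) x = cinner f ((St t ^^ n) x)" for x
    by (induction n arbitrary: x) (simp_all add: c, simp only: funpow_swap1)
  then show ?thesis
    by (metis cinner_unit2(1) v_def)
qed

lemma g_insob: "insob 1 (cf f) \<Longrightarrow> insob 1 (cf (g t f n))"
  by (induction n) (auto simp: Sta_insob)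

lemma norm_g: "(\<Sum>m<n. (cmod (cinner f (v t m)))\<^sup>2) + (norm (g t f n))\<^sup>2 = (norm f)\<^sup>2"
proof (induction n)
  case (Suc n)
  then show ?case using norm_Sta[of "g t f n" t] by (simp add: cf_g)
qed simp

lemma norm_g_between:
  assumes "n \<le> N"
  shows "(\<Sum>m=n..<N. (cmod (cinner f (v t m)))\<^sup>2) \<le> (norm (g t f n))\<^sup>2"
proof -
  have "(\<Sum>m<n. (cmod (cinner f (v t m)))\<^sup>2) + (\<Sum>m=n..<N. (cmod (cinner f (v t m)))\<^sup>2) = (\<Sum>m<N. (cmod (cinner f (v t m)))\<^sup>2)"
    using assms by (metis atLeast0LessThan le0 sum.atLeastLessThan_concat)
  then show ?thesis
    using norm_g[where n=n and f=f and t=t] norm_g[where n=N and f=f and t=t] zero_le_power2[of "norm (g t f N)"] by linarith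
qed

text \<open>The constant is an operator norm of the Toeplitz operator and depends on the regular
  norm of the data; \<open>q_lower\<close> and \<open>q_upper\<close> are the counterparts in terms
  of the rough norm.\<close>

lemma q_bounds: "\<exists>C\<ge>0. \<forall>f. insob 1 (cf f) \<longrightarrow> - C * (norm f)\<^sup>2 \<le> q f \<and> q f \<le> (hn (1/2) (cf f))\<^sup>2 + C * (norm f)\<^sup>2"
proof -
  obtain C where C: "0 \<le> C" "\<And>f. norm (T a f) \<le> norm f * C"
    using bounded_linear.nonneg_bounded[OF T_lin] by blast
  have "- C * (norm f)\<^sup>2 \<le> q f \<and> q f \<le> (hn (1/2) (cf f))\<^sup>2 + C * (norm f)\<^sup>2" if i: "insob 1 (cf f)" for f
  proof -
    have "cmod (cinner (T a f) f) \<le> norm (T a f) * norm f"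
      by (rule cmod_cinner_le)
    also have "\<dots> \<le> C * (norm f)\<^sup>2"
      using mult_right_mono[OF C(2)[of f] norm_ge_zero[of f]] by (simp add: power2_eq_square mult_ac)
    finally have T: "\<bar>Re (cinner (T a f) f)\<bar> \<le> C * (norm f)\<^sup>2"
      using abs_Re_le_cmod order_trans by blast
    note e = D1_form[OF i]
    have "q f = Re (cinner (D1 f) f) - Re (cinner (T a f) f)"
      by (simp add: q_def L_def cinner_diff_left)
    then show ?thesis
      using T e by linarith
  qed
  with C(1) show ?thesis by blast
qed

text \<open>\<open>q_Sta\<close> is summed along the remainders: the values of \<open>q\<close>
  telescope, and as \<open>q\<close> is bounded below the norms of the remainders are square
  summable.\<close>

lemma sum_g_bound: "\<exists>K\<ge>0. \<forall>f t N. insob 1 (cf f) \<longrightarrow> (\<Sum>n<N. (norm (g t f (Suc n)))\<^sup>2) \<le> K * (hn (1/2) (cf f))\<^sup>2"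
proof -
  obtain C where C: "C \<ge> 0" "\<And>f. insob 1 (cf f) \<Longrightarrow> - C * (norm f)\<^sup>2 \<le> q f"
    "\<And>f. insob 1 (cf f) \<Longrightarrow> q f \<le> (hn (1/2) (cf f))\<^sup>2 + C * (norm f)\<^sup>2"
    using q_bounds by blast
  define P where "P = norm p"
  have P: "P \<ge> 0" by (simp add: P_def)
  define K where "K = 2 * (1 + 2 * C + P + 2 * P\<^sup>2)"
  have "(\<Sum>n<N. (norm (g t f (Suc n)))\<^sup>2) \<le> K * (hn (1/2) (cf f))\<^sup>2" if f: "insob 1 (cf f)" for f t N
  proof -
    let ?c = "\<lambda>n. cmod (cinner f (v t n))" and ?g = "\<lambda>n. norm (g t f (Suc n))"
    have "(\<Sum>n<N. (?g n)\<^sup>2) \<le> (\<Sum>n<N. q (g t f n) - q (g t f (Suc n)) + (P + 2 * P\<^sup>2) * (?c n)\<^sup>2 + (?g n)\<^sup>2 / 2)"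
    proof (rule sum_mono)
      fix n
      have "(?g n)\<^sup>2 \<le> q (g t f n) - q (g t f (Suc n)) + P * (?c n)\<^sup>2 + 2 * (?c n * P * ?g n)"
        using q_Sta[where t=t, OF g_insob[where t=t and n=n, OF f]] by (simp add: cf_g P_def)
      \<comment> \<open>Young's inequality; the half of the squared remainder is absorbed on the
        left after summation.\<close>
      moreover have "2 * (?c n * P * ?g n) \<le> 2 * P\<^sup>2 * (?c n)\<^sup>2 + (?g n)\<^sup>2 / 2"
        using zero_le_power2[of "2 * P * ?c n - ?g n"] by (simp add: power2_eq_square algebra_simps)
      ultimately show "(?g n)\<^sup>2 \<le> q (g t f n) - q (g t f (Suc n)) + (P + 2 * P\<^sup>2) * (?c n)\<^sup>2 + (?g n)\<^sup>2 / 2"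
        by (simp add: algebra_simps)
    qed
    also have "\<dots> = (q f - q (g t f N)) + (P + 2 * P\<^sup>2) * (\<Sum>n<N. (?c n)\<^sup>2) + (\<Sum>n<N. (?g n)\<^sup>2) / 2"
      using sum_lessThan_telescope'[of "\<lambda>n. q (g t f n)" N]
      by (simp only: sum.distrib sum_distrib_left sum_divide_distrib funpow_0)
    finally have 1: "(\<Sum>n<N. (?g n)\<^sup>2) / 2 \<le> (q f - q (g t f N)) + (P + 2 * P\<^sup>2) * (\<Sum>n<N. (?c n)\<^sup>2)"
      by simp
    have "(\<Sum>n<N. (?c n)\<^sup>2) \<le> (norm f)\<^sup>2" "(norm (g t f N))\<^sup>2 \<le> (norm f)\<^sup>2"
      using norm_g[where n=N and f=f and t=t] sum_nonneg[of "{..<N}" "\<lambda>n. (?c n)\<^sup>2", OF zero_le_power2] zero_le_power2[of "norm (g t f N)"] by linarith+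
    then have "(P + 2 * P\<^sup>2) * (\<Sum>n<N. (?c n)\<^sup>2) \<le> (P + 2 * P\<^sup>2) * (norm f)\<^sup>2" "C * (norm (g t f N))\<^sup>2 \<le> C * (norm f)\<^sup>2"
      using P C(1) by (intro mult_left_mono; simp)+
    with 1 C(2)[OF g_insob[where t=t and n=N, OF f]] C(3)[OF f]
    have 2: "(\<Sum>n<N. (?g n)\<^sup>2) \<le> 2 * ((hn (1/2) (cf f))\<^sup>2 + (2 * C + (P + 2 * P\<^sup>2)) * (norm f)\<^sup>2)"
      by (simp add: algebra_simps)
    have "(norm f)\<^sup>2 \<le> (hn (1/2) (cf f))\<^sup>2"
      using hn_mono[of "1/2" "cf f" 0] insob_mono[OF f, of "1/2"] by (intro power_mono) auto
    then have "(2 * C + (P + 2 * P\<^sup>2)) * (norm f)\<^sup>2 \<le> (2 * C + (P + 2 * P\<^sup>2)) * (hn (1/2) (cf f))\<^sup>2"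
      using P C(1) by (intro mult_left_mono) auto
    with 2 show ?thesis by (simp add: K_def algebra_simps)
  qed
  moreover have "K \<ge> 0" using P C(1) by (simp add: K_def)
  ultimately show ?thesis by blast
qed

text \<open>The vectors \<open>v t n\<close> form an orthonormal basis, and \<open>Vs t\<close> is the unitary change to it. It conjugates the Lax
  operator of the data to the Lax operator of the solution at time \<open>t\<close>.\<close>

definition Vs :: "real \<Rightarrow> nat ell2 \<Rightarrow> nat ell2" where
  "Vs t f = ell2_of (\<lambda>n. cinner f (v t n))"

lemma bessel: "finite F \<Longrightarrow> (\<Sum>n\<in>F. (cmod (cinner f (v t n)))\<^sup>2) \<le> (norm f)\<^sup>2"
proof -
  assume F: "finite F"
  then have "(\<Sum>n\<in>F. (cmod (cinner f (v t n)))\<^sup>2) \<le> (\<Sum>n<Suc (Max (insert 0 F)). (cmod (cinner f (v t n)))\<^sup>2)"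
    by (intro sum_mono2) (auto simp: less_Suc_eq_le)
  then show ?thesis
    using norm_g[where n="Suc (Max (insert 0 F))" and f=f and t=t] zero_le_power2[of "norm (g t f (Suc (Max (insert 0 F))))"] by linarith
qed

lemma cf_Vs [simp]: "cf (Vs t f) n = cinner f (v t n)"
  unfolding Vs_def by (subst cf_of) (auto intro: sqsum_bound(1)[OF bessel])

lemma Vs_simps [simp]: "Vs t (f + h) = Vs t f + Vs t h" "Vs t (c *\<^sub>C f) = c *\<^sub>C Vs t f" "Vs t (f - h) = Vs t f - Vs t h"
  by (rule ell2_eqI; simp add: cinner_add_left cinner_diff_left)+

lemma norm_Vs_le: "norm (Vs t f) \<le> norm f"
  by (rule norm_ell2_leI) (auto simp: bessel)

text \<open>A sum of \<open>n\<close> times the squared coefficients is a sum of their tails, and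
  the tail from \<open>Suc m\<close> on is at most the squared norm of the remainder with index
  \<open>Suc m\<close>.\<close>

lemma Vs_half: "\<exists>K\<ge>0. \<forall>t f. insob 1 (cf f) \<longrightarrow> insob (1/2) (cf (Vs t f)) \<and> hn (1/2) (cf (Vs t f)) \<le> K * hn (1/2) (cf f)"
proof -
  obtain K where K: "K \<ge> 0" "\<And>f t N. insob 1 (cf f) \<Longrightarrow> (\<Sum>n<N. (norm (g t f (Suc n)))\<^sup>2) \<le> K * (hn (1/2) (cf f))\<^sup>2"
    using sum_g_bound by blast
  have "insob (1/2) (cf (Vs t f)) \<and> hn (1/2) (cf (Vs t f)) \<le> sqrt (K + 1) * hn (1/2) (cf f)" if f: "insob 1 (cf f)" for t f
  proof -
    let ?c = "\<lambda>n. (cmod (cinner f (v t n)))\<^sup>2"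
    have n: "(norm f)\<^sup>2 \<le> (hn (1/2) (cf f))\<^sup>2"
      using hn_mono[of "1/2" "cf f" 0] insob_mono[OF f, of "1/2"] by (intro power_mono) auto
    have "(\<Sum>n\<in>F. br n powr (2 * (1/2)) * (cmod (cf (Vs t f) n))\<^sup>2) \<le> (sqrt (K + 1) * hn (1/2) (cf f))\<^sup>2" if F: "finite F" for F
    proof -
      define M where "M = Max (insert 0 F)"
      have "br n powr (2 * (1/2)) * (cmod (cf (Vs t f) n))\<^sup>2 \<le> real n * ?c n + ?c n" for n
      proof -
        have "br n powr (2 * (1/2)) \<le> real n + 1" by (simp add: br_nat_def)
        from mult_right_mono[OF this, of "?c n"] show ?thesis by (simp add: distrib_right)
      qed
      then have "(\<Sum>n\<in>F. br n powr (2 * (1/2)) * (cmod (cf (Vs t f) n))\<^sup>2) \<le> (\<Sum>n\<in>F. real n * ?c n + ?c n)"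
        by (rule sum_mono)
      also have "\<dots> \<le> (\<Sum>n\<le>M. real n * ?c n + ?c n)"
        using F by (intro sum_mono2) (auto simp: M_def)
      also have "\<dots> = (\<Sum>n\<le>M. \<Sum>m<n. ?c n) + (\<Sum>n\<le>M. ?c n)"
        by (simp add: sum.distrib)
      also have "(\<Sum>n\<le>M. \<Sum>m<n. ?c n) = (\<Sum>m<M. \<Sum>n=Suc m..M. ?c n)"
        by (rule sum.nested_swap')
      also have "\<dots> \<le> (\<Sum>m<M. (norm (g t f (Suc m)))\<^sup>2)"
        by (intro sum_mono norm_g_between[where N="Suc M", unfolded atLeastLessThanSuc_atLeastAtMost]) auto
      also have "\<dots> \<le> K * (hn (1/2) (cf f))\<^sup>2"
        by (rule K(2)[OF f])
      also have "(\<Sum>n\<le>M. ?c n) \<le> (hn (1/2) (cf f))\<^sup>2"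
        by (rule order_trans[OF bessel n]) simp
      finally show ?thesis
        using K(1) by (simp add: power_mult_distrib algebra_simps)
    qed
    from insob_boundI[OF this] show ?thesis using K(1) by (simp del: cf_Vs)
  qed
  then show ?thesis using K(1) by (intro exI[of _ "sqrt (K + 1)"]) auto
qed

text \<open>This is completeness of the basis. At order 1 the remainders are square summable by
  \<open>sum_g_bound\<close>, so they tend to 0 and Bessel's inequality becomes an equality; density
  covers the other vectors.\<close>

lemma norm_Vs: "norm (Vs t f) = norm f"
proof -
  have 1: "norm (Vs t f) = norm f" if f: "insob 1 (cf f)" for f
  proof -
    obtain K where K: "\<And>N. (\<Sum>n<N. (norm (g t f (Suc n)))\<^sup>2) \<le> K * (hn (1/2) (cf f))\<^sup>2"
      using sum_g_bound f by blast
    have "summable (\<lambda>n. (norm (g t f (Suc n)))\<^sup>2)"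
      by (rule bounded_imp_summable[OF _ K[unfolded lessThan_Suc_atMost[symmetric], of "Suc _", unfolded lessThan_Suc_atMost]]) simp
    then have "(\<lambda>n. (norm (g t f (Suc n)))\<^sup>2) \<longlonglongrightarrow> 0"
      by (rule summable_LIMSEQ_zero)
    then have "(\<lambda>n. (norm (g t f n))\<^sup>2) \<longlonglongrightarrow> 0"
      by (rule LIMSEQ_imp_Suc)
    then have "(\<lambda>n. (norm f)\<^sup>2 - (norm (g t f n))\<^sup>2) \<longlonglongrightarrow> (norm f)\<^sup>2 - 0"
      by (intro tendsto_intros)
    moreover have "(norm f)\<^sup>2 - (norm (g t f n))\<^sup>2 \<le> (norm (Vs t f))\<^sup>2" for n
      using norm_g[where n=n and f=f and t=t] sum_cf_le_norm[of "{..<n}" "Vs t f"] by simp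
    ultimately have "(norm f)\<^sup>2 \<le> (norm (Vs t f))\<^sup>2"
      by (intro LIMSEQ_le_const2[of _ "(norm f)\<^sup>2"]) auto
    then show ?thesis
      using norm_Vs_le[of t f] by (simp add: power2_le_iff_abs_le)
  qed
  have "((\<lambda>F. norm (Vs t (restr F f))) \<longlongrightarrow> norm (Vs t f)) (finite_subsets_at_top UNIV)"
  proof -
    have bl: "bounded_linear (Vs t)"
      by (rule bounded_linear_intro[where K=1]) (auto simp: scaleR_scaleC norm_Vs_le)
    show ?thesis by (intro tendsto_norm bounded_linear.tendsto[OF bl] restr_tendsto)
  qed
  moreover have "\<forall>\<^sub>F F in finite_subsets_at_top UNIV. norm (Vs t (restr F f)) = norm (restr F f)"
    by (rule eventually_finite_subsets_at_top_weakI, rule 1, rule insob_finite) auto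
  ultimately have "((\<lambda>F. norm (restr F f)) \<longlongrightarrow> norm (Vs t f)) (finite_subsets_at_top UNIV)"
    by (rule Lim_transform_eventually)
  then show ?thesis
    using tendsto_unique[OF finite_subsets_at_top_neq_bot _ tendsto_norm[OF restr_tendsto]] by blast
qed

lemma Vs_cinner: "cinner (Vs t f) (Vs t h) = cinner f h"
  by (rule norm_preserving_cinner) (auto simp: norm_Vs)

definition ut :: "real \<Rightarrow> int \<Rightarrow> complex" where
  "ut t = herm (cf (Vs t p))"

lemma ut_nat [simp]: "ut t (int n) = cinner p (v t n)"
  by (simp add: ut_def herm_def)

lemma ut_zero: "ut t 0 = a 0"
  using ut_nat[of t 0] by (simp add: cf_p del: ut_nat)

lemma ut_real: "ut t (- k) = cnj (ut t k)"
  unfolding ut_def by (rule herm_real) (use real[of 0] in \<open>simp add: cf_p\<close>)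

lemma ut_summable: "insob 0 (ut t)"
  unfolding ut_def by (rule insob_herm) simp

text \<open>\<open>L_St\<close> lowers both indices by 1 at the cost of a diagonal term, until one
  index is 0 and \<open>L_unit2\<close> yields \<open>- p\<close>. Hence in the new basis
  \<open>L\<close> is again D minus a Toeplitz matrix, now with symbol \<open>ut t\<close>.\<close>

lemma L_matrix: "cinner (L (v t n)) (v t k) = (if n = k then of_nat n else 0) - ut t (int k - int n)"
proof -
  have s: "cinner (L (v t (n + j))) (v t (k + j)) = cinner (L (v t n)) (v t k) + of_nat j * (if n = k then 1 else 0)" for n k j
    by (induction j) (auto simp: L_St v_orth algebra_simps)
  show ?thesis
  proof (cases "n \<le> k")
    case True
    have i: "int k - int n = int (k - n)"
      using True by simp
    show ?thesis
      unfolding i ut_nat using s[of 0 n "k - n"] True by (auto simp: L_unit2 simp del: cf_unit2 cinner_unit2)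
  next
    case False
    have "cinner (L (v t (n - k + k))) (v t (0 + k)) = cinner (L (v t (n - k))) (unit2 0)"
      using False by (subst s) auto
    also have "\<dots> = - cnj (ut t (int (n - k)))"
      by (subst L_sym) (auto simp: L_unit2 cinner_commute[of _ p] simp del: cf_unit2 cinner_unit2)
    also have "\<dots> = - ut t (int k - int n)"
      using False ut_real[of t "int (n - k)"] by (simp add: of_nat_diff del: ut_nat)
    finally show ?thesis using False by simp
  qed
qed

text \<open>Stated by coordinates and with a separate claim of summability, since at this stage
  \<open>ut t\<close> is known to be square summable and no more, so that its Toeplitz matrix is not
  yet an operator.\<close>

lemma Vs_L:
  assumes f: "insob 1 (cf f)"
  shows "cf (Vs t (L f)) n = of_nat n * cf (Vs t f) n - toep (ut t) (cf (Vs t f)) n"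
    "(\<lambda>k. ut t (int n - int k) * cf (Vs t f) k) summable_on UNIV"
proof -
  let ?\<alpha> = "cf (Vs t f)"
  have e: "?\<alpha> k * cnj (cf (Vs t (L (v t n))) k) = (if k = n then of_nat n * ?\<alpha> k else 0) - ut t (int n - int k) * ?\<alpha> k" for k
    using ut_real[of t "int k - int n"] by (simp add: L_matrix algebra_simps)
  have s1: "(\<lambda>k. ?\<alpha> k * cnj (cf (Vs t (L (v t n))) k)) summable_on UNIV"
    by (rule cinner_summable)
  have s2: "(\<lambda>k. if k = n then of_nat n * ?\<alpha> k else 0) summable_on UNIV"
    by (subst summable_on_cong_neutral[where T="{n}" and g="\<lambda>k. of_nat n * ?\<alpha> k"]) auto
  show s3: "(\<lambda>k. ut t (int n - int k) * ?\<alpha> k) summable_on UNIV"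
    using summable_on_add[OF s2 iffD2[OF summable_on_uminus s1]] unfolding e by simp
  have "cf (Vs t (L f)) n = cinner (Vs t f) (Vs t (L (v t n)))"
    using f by (simp add: L_sym Vs_cinner)
  also have "\<dots> = (\<Sum>\<^sub>\<infinity>k. (if k = n then of_nat n * ?\<alpha> k else 0) - ut t (int n - int k) * ?\<alpha> k)"
    unfolding cinner_def e ..
  also have "\<dots> = of_nat n * ?\<alpha> n - toep (ut t) ?\<alpha> n"
    using infsumI[OF has_sum_add[OF has_sum_infsum[OF s2] has_sum_uminusI[OF has_sum_infsum[OF s3]]]]
    by (simp only: infsum_single toep_def add_uminus_conv_diff)
  finally show "cf (Vs t (L f)) n = of_nat n * ?\<alpha> n - toep (ut t) ?\<alpha> n" .
qed

end

section \<open>The evolution of the Fourier coefficients\<close>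

text \<open>Low frequencies are compared one by one, high frequencies through a stronger norm; both
  \<open>Vs_cont\<close> and \<open>flow_close\<close> rely on this split.\<close>

lemma hn_split:
  fixes x :: "nat \<Rightarrow> complex"
  assumes x: "insob r' x" and "r \<le> r'" "1 \<le> N"
  shows "hn r x \<le> (\<Sum>n<N. br n powr r * cmod (x n)) + real N powr (r - r') * hn r' x"
proof -
  let ?lo = "\<lambda>n. if n \<in> {..<N} then x n else 0" and ?hi = "\<lambda>n. if n \<in> {N..} then x n else 0"
  have i: "insob r x" by (rule insob_mono[OF x assms(2)])
  have "hn r x = hn r (\<lambda>n. ?lo n + ?hi n)"
    by (rule arg_cong[of _ _ "hn r"]) auto
  also have "\<dots> \<le> hn r ?lo + hn r ?hi"
    by (intro hn_add_le insob_restr i)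
  also have "hn r ?lo \<le> (\<Sum>n<N. br n powr r * cmod (x n))"
  proof -
    have "J r ?lo = (\<Sum>n<N. (of_real (br n powr r) * x n) *\<^sub>C unit2 n)"
      by (rule ell2_eqI) (use insob_restr[OF i, of "{..<N}"] in \<open>auto simp: if_distrib cong: if_cong\<close>)
    then show ?thesis
      unfolding hn_def by (simp add: order_trans[OF norm_sum] norm_mult)
  qed
  also have "hn r ?hi \<le> real N powr (r - r') * hn r' x"
  proof (rule insob_dominated(2)[OF x])
    show "br n powr r * cmod (?hi n) \<le> real N powr (r - r') * (br n powr r' * cmod (x n))" for n
    proof (cases "N \<le> n")
      case True
      have "br n powr r = br n powr (r - r') * br n powr r'" by (simp flip: powr_add)
      also have "\<dots> \<le> real N powr (r - r') * br n powr r'"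
        using True assms by (intro mult_right_mono powr_mono2') (auto simp: br_nat_def)
      finally show ?thesis using True by (simp add: mult_right_mono flip: mult.assoc)
    qed simp
  qed simp
  finally show ?thesis by simp
qed

lemma insob_dense:
  assumes x: "insob r x" and "e > 0"
  shows "\<exists>A. finite A \<and> hn r (\<lambda>i. x i - (if i \<in> A then x i else 0)) < e"
proof -
  have "\<forall>\<^sub>F A in finite_subsets_at_top (UNIV :: 'a set). finite A"
    by (rule eventually_finite_subsets_at_top_weakI) simp
  moreover have "\<forall>\<^sub>F A in finite_subsets_at_top UNIV. dist (restr A (J r x)) (J r x) < e"
    using restr_tendsto \<open>e > 0\<close> by (intro tendstoD) auto
  ultimately obtain A where A: "finite A" "dist (restr A (J r x)) (J r x) < e"
    using eventually_happens'[OF finite_subsets_at_top_neq_bot eventually_conj] by blast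
  note i = insob_restr[OF x, of A]
  have "J r (\<lambda>i. if i \<in> A then x i else 0) = restr A (J r x)"
    by (rule ell2_eqI) (use i x in simp)
  then show ?thesis
    using A x i by (intro exI[of _ A]) (simp add: hn_def J_diff dist_norm norm_minus_commute)
qed

lemma hn_D1_le:
  assumes "insob (r + 1) x"
  shows "insob r (\<lambda>n::nat. of_nat n * x n)" "hn r (\<lambda>n::nat. of_nat n * x n) \<le> hn (r + 1) x"
proof -
  have "br n powr r * cmod (of_nat n * x n) \<le> 1 * (br n powr (r + 1) * cmod (x n))" for n
  proof -
    have "real n \<le> br n" by (simp add: br_nat_def)
    then have "br n powr r * (real n * cmod (x n)) \<le> br n powr r * (br n * cmod (x n))"
      by (intro mult_left_mono mult_right_mono) auto
    then show ?thesis by (simp add: norm_mult powr_add mult.assoc)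
  qed
  note * = insob_dominated[OF assms this zero_le_one]
  show "insob r (\<lambda>n::nat. of_nat n * x n)" "hn r (\<lambda>n::nat. of_nat n * x n) \<le> hn (r + 1) x"
    using * by simp_all
qed

lemma insob_integrate:
  assumes "insob r (\<lambda>n::nat. of_nat n * x n)"
  shows "insob (r + 1) x" "hn (r + 1) x \<le> hn r (\<lambda>n. of_nat n * x n) + cmod (x 0)"
proof -
  let ?\<delta> = "\<lambda>n::nat. if n = 0 then x 0 else 0" and ?z = "\<lambda>n::nat. of_nat n * x n + (if n = 0 then x 0 else 0)"
  have d: "insob r ?\<delta>" by (rule insob_finite) (auto intro: finite_subset[of _ "{0}"])
  have z: "insob r ?z" by (intro insob_add assms d)
  have "J r ?\<delta> = x 0 *\<^sub>C unit2 0"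
    by (rule ell2_eqI) (simp add: d br_nat_def)
  then have "hn r ?\<delta> = cmod (x 0)" by (simp add: hn_def)
  then have le: "hn r ?z \<le> hn r (\<lambda>n. of_nat n * x n) + cmod (x 0)"
    using hn_add_le[OF assms d] by simp
  have "br n powr (r + 1) * cmod (x n) \<le> 1 * (br n powr r * cmod (?z n))" for n
    by (cases "n = 0") (auto simp: br_nat_def powr_add norm_mult max_def)
  note * = insob_dominated[OF z this zero_le_one]
  show "insob (r + 1) x" "hn (r + 1) x \<le> hn r (\<lambda>n. of_nat n * x n) + cmod (x 0)"
    using * le by simp_all
qed

context bodata
begin

lemma cinner_funpow: "cinner ((Sta t ^^ j) x) y = cinner x ((St t ^^ j) y)"
proof -
  have c: "cinner (Sta t y) x = cinner y (St t x)" for x y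
    by (metis cinner_St cinner_commute)
  show ?thesis
    by (induction j arbitrary: y) (simp_all add: c, simp only: funpow_swap1)
qed

lemma v_funpow: "(St t ^^ j) (v t k) = v t (k + j)"
  by (induction j) auto

text \<open>Parseval in the basis \<open>v t\<close>: moving the powers of \<open>St t\<close> to
  \<open>p\<close> shifts the coefficients of \<open>p\<close>, and \<open>L_matrix\<close> gives
  those of the other factor. The index \<open>i = m - k\<close> with \<open>k \<ge> 0\<close> runs
  over all integers up to \<open>m\<close>, hence a partial convolution.\<close>

lemma cinner_p_term:
  assumes "m \<le> n"
  shows "cinner p ((St t ^^ (n - m)) (2 *\<^sub>C L (v t m) + v t m)) =
    (2 * of_nat m + 1) * ut t (int n) - 2 * (\<Sum>\<^sub>\<infinity>i\<in>{..int m}. ut t (int n - i) * ut t i)"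
proof -
  let ?G = "\<lambda>i. ut t (int n - i) * ut t i"
  let ?x = "Vs t ((Sta t ^^ (n - m)) p)" and ?y = "Vs t (2 *\<^sub>C L (v t m) + v t m)"
  have x: "cf ?x k = ut t (int n - (int m - int k))" for k
    using assms by (simp add: cinner_funpow v_funpow algebra_simps flip: ut_nat)
  have e: "cf ?x k * cnj (cf ?y k) = (if k = m then (2 * of_nat m + 1) * ut t (int n) else 0) + - (2 * ?G (int m - int k))" for k
    using ut_real[of t "int k - int m"] unfolding x by (simp add: cinner_add_left L_matrix v_orth algebra_simps)
  have b: "bij_betw (\<lambda>k. int m - int k) UNIV {..int m}"
    by (rule bij_betwI[where g="\<lambda>i. nat (int m - i)"]) auto
  have s1: "(\<lambda>k. cf ?x k * cnj (cf ?y k)) summable_on UNIV"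
    by (rule cinner_summable)
  have s2: "(\<lambda>k. if k = m then (2 * of_nat m + 1) * ut t (int n) else 0) summable_on UNIV"
    by (subst summable_on_cong_neutral[where T="{m}" and g="\<lambda>k. (2 * of_nat m + 1) * ut t (int n)"]) auto
  have "(\<lambda>k. - (2 * ?G (int m - int k))) summable_on UNIV"
    using summable_on_add[OF s1 iffD2[OF summable_on_uminus s2]] unfolding e by simp
  from infsum_add[OF s2 this]
  have "cinner ?x ?y = (2 * of_nat m + 1) * ut t (int n) - 2 * (\<Sum>\<^sub>\<infinity>k. ?G (int m - int k))"
    unfolding cinner_def e by (simp only: infsum_single infsum_uminus infsum_cmult_right' diff_conv_add_uminus)
  then show ?thesis
    unfolding infsum_reindex_bij_betw[OF b, of ?G] by (simp only: Vs_cinner cinner_funpow)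
qed

lemma ut_conv_summable: "(\<lambda>i. ut t (k - i) * ut t i) summable_on UNIV"
proof -
  have "sqsum (\<lambda>i. cnj (ut t (k - i)))"
    using ut_summable[of t] summable_on_reindex_bij_betw[of "\<lambda>i. k - i" UNIV UNIV "\<lambda>i. (cmod (ut t i))\<^sup>2"]
      bij_betwI[of "\<lambda>i. k - i" UNIV UNIV "\<lambda>i. k - i"]
    unfolding insob_0_iff sqsum_def by (simp add: Pi_def)
  from sqsum_mult_summable[OF _ this, of "ut t"] ut_summable[of t] show ?thesis
    by (simp add: insob_0_iff mult.commute)
qed

text \<open>In the sum over \<open>m\<close> from \<open>v_deriv\<close> the odd numbers add up to
  \<open>n\<^sup>2\<close>, and the reflection of \<open>i\<close> to \<open>n - i\<close> completes
  the partial convolution up to \<open>m\<close> by the one up to \<open>n - Suc m\<close>. The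
  result is the Benjamin-Ono equation at a nonnegative frequency.\<close>

lemma ut_deriv:
  "((\<lambda>t. ut t (int n)) has_vector_derivative
     \<i> * of_nat n ^ 2 * ut t (int n) - \<i> * of_nat n * conv (ut t) (ut t) (int n)) (at t)"
proof -
  let ?G = "\<lambda>i. ut t (int n - i) * ut t i"
  let ?P = "\<lambda>m. \<Sum>\<^sub>\<infinity>i\<in>{..int m}. ?G i"
  have s: "?G summable_on A" for A
    using ut_conv_summable[of t "int n"] by (rule summable_on_subset_banach) simp
  have sym: "?P m + ?P (n - Suc m) = conv (ut t) (ut t) (int n)" if "m < n" for m
  proof -
    have "bij_betw (\<lambda>i. int n - i) {..int (n - Suc m)} {int m<..}"
      by (rule bij_betwI[where g="\<lambda>i. int n - i"]) (use that in auto)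
    from infsum_reindex_bij_betw[OF this, of ?G]
    have "?P (n - Suc m) = (\<Sum>\<^sub>\<infinity>i\<in>{int m<..}. ?G i)"
      by (simp add: mult.commute)
    moreover have "{..int m} \<union> {int m<..} = UNIV" "{..int m} \<inter> {int m<..} = {}" by auto
    ultimately show ?thesis
      using infsum_Un_disjoint[OF s s, of "{..int m}" "{int m<..}"] by (simp add: conv_def)
  qed
  have "2 * (\<Sum>m<n. ?P m) = (\<Sum>m<n. ?P m) + (\<Sum>m<n. ?P (n - Suc m))"
    by (simp only: sum.nat_diff_reindex[of ?P n] mult_2)
  also have "\<dots> = of_nat n * conv (ut t) (ut t) (int n)"
    unfolding sum.distrib[symmetric] using sym by simp
  finally have P: "2 * (\<Sum>m<n. ?P m) = of_nat n * conv (ut t) (ut t) (int n)" .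
  have odd: "(\<Sum>m<n. 2 * of_nat m + 1 :: complex) = of_nat n ^ 2"
    by (induction n) (auto simp: power2_eq_square algebra_simps)
  have "((\<lambda>t. cinner p (v t n)) has_vector_derivative
      cinner p ((- \<i>) *\<^sub>C (\<Sum>m<n. (St t ^^ (n - m)) (2 *\<^sub>C L (v t m) + v t m)))) (at t)"
    by (rule bounded_linear.has_vector_derivative[OF bounded_bilinear.bounded_linear_right[OF bounded_bilinear_cinner] v_deriv])
  also have "cinner p ((- \<i>) *\<^sub>C (\<Sum>m<n. (St t ^^ (n - m)) (2 *\<^sub>C L (v t m) + v t m))) =
      \<i> * (\<Sum>m<n. (2 * of_nat m + 1) * ut t (int n) - 2 * ?P m)"
    unfolding cinner_scaleC_right cinner_sum_right by (simp add: cinner_p_term del: minus_simps)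
  also have "(\<Sum>m<n. (2 * of_nat m + 1) * ut t (int n) - 2 * ?P m) = of_nat n ^ 2 * ut t (int n) - of_nat n * conv (ut t) (ut t) (int n)"
    unfolding sum_subtractf sum_distrib_right[symmetric] sum_distrib_left[symmetric] odd P ..
  finally show ?thesis by (simp add: right_diff_distrib mult.assoc)
qed

lemma v_0: "v 0 n = unit2 n"
proof (induction n)
  case (Suc n)
  have "Sh (unit2 n) = unit2 (Suc n)"
    by (rule ell2_eqI) (simp add: Sh.rep_eq split: nat.split)
  then show ?case using Suc by (simp add: St_def)
qed simp

lemma Vs_0 [simp]: "Vs 0 f = f"
  by (rule ell2_eqI) (simp add: v_0)

lemma ut_0: "ut 0 = a"
  by (simp add: ut_def herm_p)

subsection \<open>Regularity\<close>

text \<open>A qualitative property: the constant may depend on the data in the regular norm. The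
  bounds in terms of the rough norm are those of \<open>uniform_bounds\<close>.\<close>

definition Vbd :: "real \<Rightarrow> bool" where
  "Vbd r \<longleftrightarrow> (\<exists>K\<ge>0. \<forall>t f. insob r (cf f) \<longrightarrow> insob r (cf (Vs t f)) \<and> hn r (cf (Vs t f)) \<le> K * hn r (cf f))"

lemma Vbd_0: "Vbd 0"
  unfolding Vbd_def by (intro exI[of _ 1]) (auto simp del: cf_Vs simp: norm_Vs)

text \<open>\<open>Vs_L\<close> is solved for \<open>n\<close> times the coefficient:
  \<open>Vs t (L f)\<close> is bounded at order \<open>r\<close> by assumption, and the Toeplitz
  term is a product of two factors of an order \<open>y\<close> at which \<open>Vs t\<close> is
  already understood, with \<open>2 * y - r > 1/2\<close>. The condition \<open>insob 1\<close> in
  \<open>bd\<close> allows \<open>Vs_half\<close> to start the chain.\<close>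

lemma Vbd_step:
  assumes r: "0 \<le> r" "r \<le> \<sigma>" "Vbd r" and y: "r \<le> y" "y \<le> r + 1" "y \<le> \<sigma>" "2 * y - r > 1 / 2"
    and bd: "\<exists>K\<ge>0. \<forall>t f. insob 1 (cf f) \<and> insob y (cf f) \<longrightarrow> insob y (cf (Vs t f)) \<and> hn y (cf (Vs t f)) \<le> K * hn y (cf f)"
  shows "Vbd (r + 1)"
proof -
  obtain K1 where K1: "K1 \<ge> 0" "\<And>t f. insob r (cf f) \<Longrightarrow> insob r (cf (Vs t f)) \<and> hn r (cf (Vs t f)) \<le> K1 * hn r (cf f)"
    using r(3) unfolding Vbd_def by blast
  obtain K2 where K2: "K2 \<ge> 0" "\<And>t f. insob 1 (cf f) \<Longrightarrow> insob y (cf f) \<Longrightarrow> insob y (cf (Vs t f)) \<and> hn y (cf (Vs t f)) \<le> K2 * hn y (cf f)"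
    using bd by blast
  obtain K3 where K3: "K3 \<ge> 0" "\<And>f. insob r (cf f) \<Longrightarrow> insob r (cf (T a f)) \<and> hn r (cf (T a f)) \<le> K3 * hn \<sigma> a * hn r (cf f)"
    using T_bounds[OF s12 r(1,2)] a by blast
  have "0 \<le> y" "y + y - r > 1 / 2" using r y by auto
  then obtain K4 where K4: "K4 \<ge> 0" "\<And>b x. insob y b \<Longrightarrow> insob y x \<Longrightarrow> insob r (toep b x) \<and> hn r (toep b x) \<le> K4 * hn y b * hn y x"
    using toep_bound[OF _ _ y(1) y(1)] by meson
  have p: "insob 1 (cf p)" "insob y (cf p)"
    by (rule insob_mono[OF insob_p]; use sig y in simp)+
  define M where "M = 2 * (K2 * hn y (cf p))"
  have M: "insob y (ut t)" "hn y (ut t) \<le> M" for t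
    unfolding ut_def M_def using K2(2)[OF p, of t] insob_herm[of y "cf (Vs t p)"] hn_herm_le[of y "cf (Vs t p)"] by auto
  define K where "K = K1 * (1 + K3 * hn \<sigma> a) + K4 * M * K2 + 1"
  have "insob (r + 1) (cf (Vs t f)) \<and> hn (r + 1) (cf (Vs t f)) \<le> K * hn (r + 1) (cf f)" if f: "insob (r + 1) (cf f)" for t f
  proof -
    have i: "insob 1 (cf f)" "insob r (cf f)" "insob y (cf f)"
      by (rule insob_mono[OF f]; use r y in simp)+
    have m: "hn r (cf f) \<le> hn (r + 1) (cf f)" "hn y (cf f) \<le> hn (r + 1) (cf f)" "hn 0 (cf f) \<le> hn (r + 1) (cf f)"
      by (rule hn_mono[OF f]; use r y in simp)+
    have Lf: "cf (L f) = (\<lambda>n. of_nat n * cf f n - cf (T a f) n)"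
      using i by (auto simp: L_def)
    have iL: "insob r (cf (L f))"
      unfolding Lf using hn_D1_le(1)[OF f] K3(2)[OF i(2)] by (intro insob_diff) auto
    have "hn r (cf (L f)) \<le> hn r (\<lambda>n. of_nat n * cf f n) + hn r (cf (T a f))"
      unfolding Lf using hn_D1_le(1)[OF f] K3(2)[OF i(2)] by (intro hn_diff_le) auto
    also have "\<dots> \<le> hn (r + 1) (cf f) + K3 * hn \<sigma> a * hn (r + 1) (cf f)"
    proof -
      have "K3 * hn \<sigma> a * hn r (cf f) \<le> K3 * hn \<sigma> a * hn (r + 1) (cf f)"
        using K3(1) by (intro mult_left_mono m) auto
      then show ?thesis
        using K3(2)[OF i(2)] hn_D1_le(2)[OF f] by linarith
    qed
    finally have "K1 * hn r (cf (L f)) \<le> K1 * ((1 + K3 * hn \<sigma> a) * hn (r + 1) (cf f))"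
      using K1(1) by (intro mult_left_mono) (auto simp: distrib_right)
    then have b1: "hn r (cf (Vs t (L f))) \<le> K1 * (1 + K3 * hn \<sigma> a) * hn (r + 1) (cf f)"
      using K1(2)[OF iL, of t] by linarith
    note x = K2(2)[OF i(1,3), of t]
    have "hn y (ut t) * hn y (cf (Vs t f)) \<le> M * (K2 * hn (r + 1) (cf f))"
    proof (rule mult_mono[OF M(2)])
      have "K2 * hn y (cf f) \<le> K2 * hn (r + 1) (cf f)"
        using K2(1) by (intro mult_left_mono m) auto
      then show "hn y (cf (Vs t f)) \<le> K2 * hn (r + 1) (cf f)"
        using x by linarith
    qed (use order_trans[OF hn_nonneg M(2)] in auto)
    then have "K4 * (hn y (ut t) * hn y (cf (Vs t f))) \<le> K4 * (M * (K2 * hn (r + 1) (cf f)))"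
      using K4(1) by (intro mult_left_mono)
    then have b2: "insob r (toep (ut t) (cf (Vs t f)))" "hn r (toep (ut t) (cf (Vs t f))) \<le> K4 * M * K2 * hn (r + 1) (cf f)"
      using K4(2)[OF M(1)[of t], of "cf (Vs t f)"] x by (auto simp: mult.assoc simp del: cf_Vs)
    have e: "(\<lambda>n. of_nat n * cf (Vs t f) n) = (\<lambda>n. cf (Vs t (L f)) n + toep (ut t) (cf (Vs t f)) n)"
      using Vs_L(1)[OF i(1), of t] by (auto simp del: cf_Vs)
    have iD: "insob r (\<lambda>n. of_nat n * cf (Vs t f) n)"
      unfolding e using K1(2)[OF iL, of t] b2(1) by (intro insob_add) (auto simp del: cf_Vs)
    have "hn r (\<lambda>n. of_nat n * cf (Vs t f) n) \<le> hn r (cf (Vs t (L f))) + hn r (toep (ut t) (cf (Vs t f)))"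
      unfolding e using K1(2)[OF iL, of t] b2(1) by (intro hn_add_le) (auto simp del: cf_Vs)
    moreover have "cmod (cf (Vs t f) 0) \<le> hn (r + 1) (cf f)"
      using cmod_cf_le_norm[of "Vs t f" 0] m(3) by (simp add: norm_Vs del: cf_Vs)
    ultimately show ?thesis
      using insob_integrate[OF iD] b1 b2(2) by (auto simp: K_def algebra_simps simp del: cf_Vs)
  qed
  moreover have "M \<ge> 0" by (rule order_trans[OF hn_nonneg M(2)])
  then have "K \<ge> 0" using K1(1) K2(1) K3(1) K4(1) by (simp add: K_def)
  ultimately show ?thesis unfolding Vbd_def by blast
qed

lemma Vbd_1: "Vbd 1"
proof -
  have "\<exists>K\<ge>0. \<forall>t f. insob 1 (cf f) \<and> insob (1/2) (cf f) \<longrightarrow> insob (1/2) (cf (Vs t f)) \<and> hn (1/2) (cf (Vs t f)) \<le> K * hn (1/2) (cf f)"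
    using Vs_half by blast
  from Vbd_step[OF _ _ Vbd_0 _ _ _ _ this] show ?thesis
    using sig by simp
qed

lemma Vbd_unit:
  assumes "0 \<le> r" "r \<le> 1"
  shows "Vbd r"
proof (cases "r = 0 \<or> r = 1")
  case False
  obtain K where K: "K \<ge> 0" "\<And>t f. insob 1 (cf f) \<Longrightarrow> insob 1 (cf (Vs t f)) \<and> hn 1 (cf (Vs t f)) \<le> K * hn 1 (cf f)"
    using Vbd_1 unfolding Vbd_def by blast
  have "insob r (cf (Vs t f)) \<and> hn r (cf (Vs t f)) \<le> (K + 1) powr r * hn r (cf f)" if f: "insob r (cf f)" for t f
  proof -
    have b: "insob 1 (cf (Vs t f)) \<and> hn 1 (cf (Vs t f)) \<le> (K + 1) * hn 1 (cf f)" if "finite F" "restr F f = f" for f F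
    proof -
      have i: "insob 1 (cf f)"
        by (rule insob_finite) (rule finite_subset[OF _ that(1)], use arg_cong[OF that(2), of cf] in \<open>auto simp: fun_eq_iff split: if_splits\<close>)
      show ?thesis
        using K(2)[OF i, of t] by (auto simp: distrib_right simp del: cf_Vs intro: order_trans)
    qed
    have "insob (r * 1) (cf f)" using f by simp
    from sob_interpolation[of "Vs t" "K + 1" r 1, OF _ _ _ _ _ b this] show ?thesis
      using K(1) assms False by (auto simp: norm_Vs simp del: cf_Vs)
  qed
  then show ?thesis unfolding Vbd_def by (intro exI[of _ "(K + 1) powr r"]) auto
qed (use Vbd_0 Vbd_1 in auto)

text \<open>Order 1 comes from order 0 with \<open>y = 1/2\<close>, the orders between by
  interpolation, those up to 2 from \<open>r - 1\<close> with \<open>y = 1\<close>, and the rest by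
  unit steps with \<open>y = r - 1\<close>. The range up to \<open>\<sigma> + 1\<close> is what
  \<open>Vs_cont\<close> uses to reach order \<open>\<sigma>\<close>.\<close>

lemma Vbd:
  assumes "0 \<le> r" "r \<le> \<sigma> + 1"
  shows "Vbd r"
proof -
  have res: "\<exists>K\<ge>0. \<forall>t f. insob 1 (cf f) \<and> insob y (cf f) \<longrightarrow> insob y (cf (Vs t f)) \<and> hn y (cf (Vs t f)) \<le> K * hn y (cf f)" if "Vbd y" for y
    using that unfolding Vbd_def by blast
  have 1: "Vbd r" if "1 \<le> r" "r \<le> 2" for r
    using Vbd_step[of "r - 1" 1] Vbd_unit[of "r - 1"] res[OF Vbd_1] that sig by simp
  have 2: "1 \<le> r \<Longrightarrow> r \<le> real k + 2 \<Longrightarrow> r \<le> \<sigma> + 1 \<Longrightarrow> Vbd r" for k r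
  proof (induction k arbitrary: r)
    case (Suc k)
    show ?case
    proof (cases "r \<le> 2")
      case False
      then have "Vbd (r - 1)" using Suc by (intro Suc.IH) auto
      then show ?thesis
        using Vbd_step[of "r - 1" "r - 1"] res False Suc.prems by simp
    qed (use 1 Suc in auto)
  qed (use 1 in auto)
  show ?thesis
  proof (cases "r \<le> 1")
    case False
    have "r \<le> real (nat \<lceil>r\<rceil>) + 2" by linarith
    then show ?thesis by (rule 2[rotated]) (use False assms in simp_all)
  qed (use Vbd_unit assms in auto)
qed

lemma bodata_ut: "bodata (ut t) \<sigma>"
proof
  show "3 / 2 < \<sigma>" by (rule sig)
  show "insob \<sigma> (ut t)"
    unfolding ut_def using Vbd[of \<sigma>] sig insob_p insob_herm unfolding Vbd_def by auto
qed (rule ut_real)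

text \<open>The vector is replaced by a finitely supported \<open>h\<close>, with an error that is
  uniform in time. For \<open>h\<close> the bound at order \<open>r + 1\<close> makes the high
  frequencies small, and each low one is continuous because \<open>v t n\<close> is continuous in
  \<open>t\<close>.\<close>

lemma Vs_cont:
  assumes r: "0 \<le> r" "r \<le> \<sigma>" and f: "insob r (cf f)" and e: "e > 0"
  shows "\<forall>\<^sub>F s in at t. hn r (\<lambda>n. cf (Vs s f) n - cf (Vs t f) n) < e"
proof -
  obtain K where K: "K \<ge> 0" "\<And>t f. insob r (cf f) \<Longrightarrow> insob r (cf (Vs t f)) \<and> hn r (cf (Vs t f)) \<le> K * hn r (cf f)"
    using Vbd[of r] r unfolding Vbd_def by auto
  obtain K' where K': "K' \<ge> 0" "\<And>t f. insob (r + 1) (cf f) \<Longrightarrow> insob (r + 1) (cf (Vs t f)) \<and> hn (r + 1) (cf (Vs t f)) \<le> K' * hn (r + 1) (cf f)"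
    using Vbd[of "r + 1"] r unfolding Vbd_def by auto
  obtain A where A: "finite A" "hn r (\<lambda>i. cf f i - cf (restr A f) i) < e / (4 * (K + 1))"
    using insob_dense[OF f, of "e / (4 * (K + 1))"] e K(1) by auto
  define h where "h = restr A f"
  have ih: "insob k (cf h)" for k
    by (rule insob_finite) (rule finite_subset[OF _ A(1)], auto simp: h_def)
  define C where "C = 2 * (K' * hn (r + 1) (cf h))"
  have C: "C \<ge> 0" using K'(1) by (simp add: C_def)
  obtain N :: nat where N: "1 \<le> N" "C * 4 / e < real N"
    using reals_Archimedean2[of "max 1 (C * 4 / e)"] by (auto simp: max_def split: if_splits)
  have "((\<lambda>s. \<Sum>n<N. br n powr r * cmod (cf (Vs s h) n - cf (Vs t h) n)) \<longlongrightarrow> (\<Sum>n<N. br n powr r * cmod (cf (Vs t h) n - cf (Vs t h) n))) (at t)"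
  proof -
    have "((\<lambda>s. v s n) \<longlongrightarrow> v t n) (at t)" for n
      using has_vector_derivative_continuous[OF v_deriv] unfolding isCont_def by blast
    then show ?thesis
      unfolding cf_Vs by (intro tendsto_intros)
  qed
  then have "\<forall>\<^sub>F s in at t. dist (\<Sum>n<N. br n powr r * cmod (cf (Vs s h) n - cf (Vs t h) n)) 0 < e / 4"
    using e by (intro tendstoD) auto
  then show ?thesis
  proof eventually_elim
    case (elim s)
    have iV: "insob r (cf (Vs s g))" "hn r (cf (Vs s g)) \<le> K * hn r (cf g)" if "insob r (cf g)" for s g
      using K(2)[OF that] by auto
    have fh: "insob r (cf (f - h))" "hn r (cf (f - h)) < e / (4 * (K + 1))"
      using insob_diff[OF f ih] A(2) by (simp_all add: h_def)
    have small: "hn r (cf (Vs s (f - h))) \<le> e / 4" for s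
    proof -
      have "hn r (cf (Vs s (f - h))) \<le> K * (e / (4 * (K + 1)))"
        using iV(2)[OF fh(1), of s] mult_left_mono[OF less_imp_le[OF fh(2)] K(1)] by linarith
      also have "\<dots> \<le> e / 4" using e K(1) by (simp add: field_simps)
      finally show ?thesis .
    qed
    have i: "insob (r + 1) (\<lambda>n. cf (Vs s h) n - cf (Vs t h) n)"
      using K'(2)[OF ih] by (intro insob_diff) (auto simp del: cf_Vs)
    have "hn (r + 1) (\<lambda>n. cf (Vs s h) n - cf (Vs t h) n) \<le> C"
      using hn_diff_le[of "r + 1" "cf (Vs s h)" "cf (Vs t h)"] K'(2)[OF ih, of s] K'(2)[OF ih, of t] by (simp add: C_def del: cf_Vs)
    then have "real N powr (r - (r + 1)) * hn (r + 1) (\<lambda>n. cf (Vs s h) n - cf (Vs t h) n) \<le> real N powr (- 1) * C"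
      by (intro mult_mono) auto
    also have "\<dots> < e / 4"
      using N e C by (simp add: powr_minus field_simps)
    finally have mid: "hn r (\<lambda>n. cf (Vs s h) n - cf (Vs t h) n) < e / 2"
      using hn_split[OF i _ N(1), of r] elim unfolding dist_real_def by linarith
    have "(\<lambda>n. cf (Vs s f) n - cf (Vs t f) n) = (\<lambda>n. (cf (Vs s (f - h)) n - cf (Vs t (f - h)) n) + (cf (Vs s h) n - cf (Vs t h) n))"
      by (auto simp: cinner_diff_left)
    then have "hn r (\<lambda>n. cf (Vs s f) n - cf (Vs t f) n) \<le> hn r (\<lambda>n. cf (Vs s (f - h)) n - cf (Vs t (f - h)) n) + hn r (\<lambda>n. cf (Vs s h) n - cf (Vs t h) n)"
      by (simp only:) (intro hn_add_le insob_diff iV fh ih)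
    also have "\<dots> < (e / 4 + e / 4) + e / 2"
      using hn_diff_le[OF iV(1)[OF fh(1), of s] iV(1)[OF fh(1), of t]] small[of s] small[of t] mid by linarith
    finally show ?case by simp
  qed
qed

end

section \<open>Estimates that depend on the rough norm only\<close>

context bodata
begin

lemma Vs_insob: "insob 1 (cf f) \<Longrightarrow> insob 1 (cf (Vs t f))"
  using Vbd_1 unfolding Vbd_def by blast

lemma L_ut:
  assumes f: "insob 1 (cf f)"
  shows "bodata.L (ut t) (Vs t f) = Vs t (L f)"
proof -
  interpret u: bodata "ut t" \<sigma> by (rule bodata_ut)
  show ?thesis
    by (rule ell2_eqI) (simp add: u.L_def u.cf_T' Vs_insob f Vs_L(1)[OF f] del: cf_Vs)
qed

lemma q_ut:
  assumes f: "insob 1 (cf f)"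
  shows "bodata.q (ut t) (Vs t f) = q f"
proof -
  interpret u: bodata "ut t" \<sigma> by (rule bodata_ut)
  show ?thesis by (simp add: u.q_def q_def L_ut[OF f] Vs_cinner)
qed

lemma q_U: "insob 1 (cf f) \<Longrightarrow> q (U t f) = q f"
  by (simp add: q_def U_L U_cinner)

lemma Vs_v: "Vs t (v t n) = unit2 n"
  by (rule ell2_eqI) (simp add: v_orth)

text \<open>The preimage is a finite combination of the vectors \<open>v t n\<close>, hence of order
  1, as the duality argument in \<open>Vs_rough\<close> requires.\<close>

lemma Vs_preimage:
  assumes F: "finite F" "restr F y = y"
  shows "\<exists>h. insob 1 (cf h) \<and> Vs t h = y"
proof -
  define h where "h = (\<Sum>n\<in>F. cf y n *\<^sub>C v t n)"
  have "insob 1 (cf (\<Sum>n\<in>A. cf y n *\<^sub>C v t n))" if "finite A" for A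
    using that
  proof (induction A rule: finite_induct)
    case (insert n A)
    then show ?case
      by (simp only: sum.insert[OF insert.hyps(1,2)] insob1 v_insob)
  qed (simp add: zero_ell2.rep_eq)
  from this[OF F(1)] have "insob 1 (cf h)"
    by (simp only: h_def)
  moreover have "Vs t h = y"
  proof (rule ell2_eqI)
    fix m
    have "cf (Vs t h) m = (\<Sum>n\<in>F. if n = m then cf y n else 0)"
      by (simp add: h_def cinner_sum_left v_orth if_distrib cong: if_cong)
    also have "\<dots> = cf (restr F y) m"
      using F(1) by simp
    finally show "cf (Vs t h) m = cf y m" by (simp only: F(2))
  qed
  ultimately show ?thesis by blast
qed

end

text \<open>Below the threshold \<open>M\<close> the weight of order \<open>r\<close> is bounded;
  above it, it is at most \<open>\<epsilon>\<close> times the weight of order 1/2, because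
  \<open>M powr (2 * r - 1) = \<epsilon>\<close>.\<close>

lemma hn_absorb:
  assumes "r < 1 / 2" "0 < \<epsilon>"
  shows "\<exists>C\<ge>0. \<forall>x :: nat \<Rightarrow> complex. insob (1/2) x \<longrightarrow> (hn r x)\<^sup>2 \<le> \<epsilon> * (hn (1/2) x)\<^sup>2 + C * (hn 0 x)\<^sup>2"
proof -
  define M where "M = \<epsilon> powr (- 1 / (1 - 2 * r))"
  have M: "M > 0" using assms by (simp add: M_def)
  define C where "C = max 1 (M powr (2 * r))"
  have w: "br n powr (2 * r) \<le> \<epsilon> * br n powr (2 * (1/2)) + C" for n :: nat
  proof (cases "br n \<le> M")
    case True
    have "br n powr (2 * r) \<le> C"
    proof (cases "r \<ge> 0")
      case True
      then have "br n powr (2 * r) \<le> M powr (2 * r)" using \<open>br n \<le> M\<close> by (intro powr_mono2) auto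
      then show ?thesis by (simp add: C_def)
    next
      case False
      then have "br n powr (2 * r) \<le> br n powr 0" by (intro powr_mono br_ge1) auto
      then show ?thesis by (simp add: C_def powr_zero_eq_one)
    qed
    then show ?thesis using assms(2) by (simp add: add_increasing)
  next
    case False
    then have "br n powr (2 * r - 1) \<le> M powr (2 * r - 1)"
      using M assms by (intro powr_mono2') auto
    also have "\<dots> = \<epsilon>"
    proof -
      have "- 1 / (1 - 2 * r) * (2 * r - 1) = 1" using assms by (simp add: field_simps)
      then show ?thesis using assms by (simp only: M_def powr_powr powr_one less_imp_le)
    qed
    finally have "br n powr (2 * r - 1) * br n powr 1 \<le> \<epsilon> * br n powr 1"
      by (intro mult_right_mono) auto
    moreover have "br n powr (2 * r) = br n powr (2 * r - 1) * br n powr 1"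
      using powr_add[of "br n" "2 * r - 1" 1] by simp
    moreover have "2 * (1/2) = (1 :: real)"
      by simp
    ultimately have "br n powr (2 * r) \<le> \<epsilon> * br n powr (2 * (1/2))"
      by (simp only:)
    then show ?thesis by (simp add: C_def le_max_iff_disj add_increasing2)
  qed
  have "(hn r x)\<^sup>2 \<le> \<epsilon> * (hn (1/2) x)\<^sup>2 + C * (hn 0 x)\<^sup>2" if x: "insob (1/2) x" for x :: "nat \<Rightarrow> complex"
  proof -
    have i: "insob r x" "insob 0 x" by (rule insob_mono[OF x]; use assms in simp)+
    show ?thesis
      unfolding hn_sq[OF i(1)]
    proof (rule infsum_le_finite_sums)
      fix F :: "nat set" assume F: "finite F"
      have "(\<Sum>n\<in>F. br n powr (2 * r) * (cmod (x n))\<^sup>2) \<le> (\<Sum>n\<in>F. \<epsilon> * (br n powr (2 * (1/2)) * (cmod (x n))\<^sup>2) + C * (br n powr (2 * 0) * (cmod (x n))\<^sup>2))"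
      proof (rule sum_mono)
        fix n
        show "br n powr (2 * r) * (cmod (x n))\<^sup>2 \<le> \<epsilon> * (br n powr (2 * (1/2)) * (cmod (x n))\<^sup>2) + C * (br n powr (2 * 0) * (cmod (x n))\<^sup>2)"
          using mult_right_mono[OF w[of n], of "(cmod (x n))\<^sup>2"] by (simp add: distrib_right mult.assoc powr_zero_eq_one)
      qed
      also have "\<dots> = \<epsilon> * (\<Sum>n\<in>F. br n powr (2 * (1/2)) * (cmod (x n))\<^sup>2) + C * (\<Sum>n\<in>F. br n powr (2 * 0) * (cmod (x n))\<^sup>2)"
        by (simp only: sum.distrib sum_distrib_left)
      also have "\<dots> \<le> \<epsilon> * (hn (1/2) x)\<^sup>2 + C * (hn 0 x)\<^sup>2"
        using assms(2) by (intro add_mono mult_left_mono sum_le_hn x i F) (auto simp: C_def)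
      finally show "(\<Sum>n\<in>F. br n powr (2 * r) * (cmod (x n))\<^sup>2) \<le> \<epsilon> * (hn (1/2) x)\<^sup>2 + C * (hn 0 x)\<^sup>2" .
    qed (use i in \<open>simp add: insob_summable\<close>)
  qed
  then show ?thesis by (intro exI[of _ C]) (auto simp: C_def)
qed

lemma T_diff_symbol:
  assumes "1 / 2 < \<sigma>" "insob \<sigma> a" "insob \<sigma> b"
  shows "T (\<lambda>k. a k - b k) f = T a f - T b f"
proof (rule ell2_eqI)
  fix n
  note s = toep_summable[OF assms(1,2), of n f] toep_summable[OF assms(1,3), of n f]
  have "toep (\<lambda>k. a k - b k) (cf f) n = (\<Sum>\<^sub>\<infinity>m. a (int n - int m) * cf f m + - (b (int n - int m) * cf f m))"
    unfolding toep_def by (simp add: left_diff_distrib)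
  also have "\<dots> = toep a (cf f) n - toep b (cf f) n"
    unfolding toep_def using infsumI[OF has_sum_add[OF has_sum_infsum[OF s(1)] has_sum_uminusI[OF has_sum_infsum[OF s(2)]]]] by simp
  finally show "cf (T (\<lambda>k. a k - b k) f) n = cf (T a f - T b f) n"
    using assms by (simp add: cf_T[OF assms(1)] insob_diff)
qed

text \<open>Only \<open>1/4 + s/2 < r < 1/2\<close> matters for the exponent \<open>r = 3/8 + s/4\<close>: the first inequality gives the form bound, and by
  the second the potential is a small perturbation of \<open>D1\<close> on the form domain.\<close>

locale rough =
  fixes s K :: real
  assumes s: "0 \<le> s" "s < 1 / 2" and K: "0 \<le> K"
    and form: "\<And>\<sigma> a f g. 1 / 2 < \<sigma> \<Longrightarrow> insob \<sigma> a \<Longrightarrow> insob (3/8 + s/4) (cf f) \<Longrightarrow> insob (3/8 + s/4) (cf g) \<Longrightarrow>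
      cmod (cinner (T a f) g) \<le> K * hn (- s) a * hn (3/8 + s/4) (cf f) * hn (3/8 + s/4) (cf g)"

lemma rough_exists:
  assumes "0 \<le> s" "s < 1 / 2"
  shows "\<exists>K. rough s K"
proof -
  have "0 \<le> 3/8 + s/4" "0 \<le> - s + (3/8 + s/4)" "- s + (3/8 + s/4) + (3/8 + s/4) > 1 / 2"
    using assms by auto
  from tri_form[OF this(1,1,2,2,3)] obtain K where K: "K \<ge> 0"
    "\<And>F M a f g. finite F \<Longrightarrow> finite M \<Longrightarrow> insob (- s) a \<Longrightarrow> insob (3/8 + s/4) f \<Longrightarrow> insob (3/8 + s/4) g \<Longrightarrow>
    (\<Sum>n\<in>F. \<Sum>m\<in>M. cmod (a (int n - int m) * f m * cnj (g n))) \<le> K * hn (- s) a * hn (3/8 + s/4) f * hn (3/8 + s/4) g"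
    by blast
  have "rough s K"
  proof
    fix \<sigma> and a :: "int \<Rightarrow> complex" and f g :: "nat ell2"
    assume *: "1 / 2 < \<sigma>" "insob \<sigma> a" "insob (3/8 + s/4) (cf f)" "insob (3/8 + s/4) (cf g)"
    have "insob (- s) a" by (rule insob_mono[OF *(2)]) (use * assms in simp)
    then show "cmod (cinner (T a f) g) \<le> K * hn (- s) a * hn (3/8 + s/4) (cf f) * hn (3/8 + s/4) (cf g)"
      unfolding cinner_T[OF *(1,2)] by (intro double_sum_bound(4) K(2) *)
  qed (use assms K in auto)
  then show ?thesis by blast
qed

context rough
begin

text \<open>A choice made once for each \<open>R\<close>, so that the constants built from it are
  functions of the bound \<open>R\<close> and not of the data.\<close>

definition kap :: "real \<Rightarrow> real" where
  "kap R = (SOME \<kappa>. 0 \<le> \<kappa> \<and> (\<forall>x :: nat \<Rightarrow> complex. insob (1/2) x \<longrightarrow> K * R * (hn (3/8 + s/4) x)\<^sup>2 \<le> (hn (1/2) x)\<^sup>2 / 2 + \<kappa> * (hn 0 x)\<^sup>2))"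

lemma kap:
  assumes R: "0 \<le> R"
  shows "0 \<le> kap R" "insob (1/2) (x :: nat \<Rightarrow> complex) \<Longrightarrow> K * R * (hn (3/8 + s/4) x)\<^sup>2 \<le> (hn (1/2) x)\<^sup>2 / 2 + kap R * (hn 0 x)\<^sup>2"
proof -
  define \<epsilon> where "\<epsilon> = 1 / (2 * (K * R + 1))"
  have KR: "0 \<le> K * R" using K R by simp
  then have \<epsilon>: "\<epsilon> > 0" "K * R * \<epsilon> \<le> 1 / 2" by (auto simp: \<epsilon>_def field_simps)
  obtain C where C: "C \<ge> 0" "\<And>x :: nat \<Rightarrow> complex. insob (1/2) x \<Longrightarrow> (hn (3/8 + s/4) x)\<^sup>2 \<le> \<epsilon> * (hn (1/2) x)\<^sup>2 + C * (hn 0 x)\<^sup>2"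
    using hn_absorb[of "3/8 + s/4" \<epsilon>] s \<epsilon>(1) by auto
  have "K * R * (hn (3/8 + s/4) x)\<^sup>2 \<le> (hn (1/2) x)\<^sup>2 / 2 + (K * R * C) * (hn 0 x)\<^sup>2" if "insob (1/2) x" for x :: "nat \<Rightarrow> complex"
    using mult_left_mono[OF C(2)[OF that] KR] mult_right_mono[OF \<epsilon>(2), of "(hn (1/2) x)\<^sup>2"]
    by (simp add: algebra_simps)
  then have "\<exists>\<kappa>. 0 \<le> \<kappa> \<and> (\<forall>x :: nat \<Rightarrow> complex. insob (1/2) x \<longrightarrow> K * R * (hn (3/8 + s/4) x)\<^sup>2 \<le> (hn (1/2) x)\<^sup>2 / 2 + \<kappa> * (hn 0 x)\<^sup>2)"
    using KR C(1) by (intro exI[of _ "K * R * C"]) auto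
  from someI_ex[OF this] show "0 \<le> kap R" "insob (1/2) x \<Longrightarrow> K * R * (hn (3/8 + s/4) x)\<^sup>2 \<le> (hn (1/2) x)\<^sup>2 / 2 + kap R * (hn 0 x)\<^sup>2"
    unfolding kap_def by auto
qed

lemma T_form:
  assumes "bodata a \<sigma>" "hn (- s) a \<le> N" "insob 1 (cf f)"
  shows "\<bar>Re (cinner (T a f) f)\<bar> \<le> K * N * (hn (3/8 + s/4) (cf f))\<^sup>2"
proof -
  interpret bodata a \<sigma> by fact
  have i: "insob (3/8 + s/4) (cf f)" by (rule insob_mono[OF assms(3)]) (use s in simp)
  have "\<bar>Re (cinner (T a f) f)\<bar> \<le> K * hn (- s) a * hn (3/8 + s/4) (cf f) * hn (3/8 + s/4) (cf f)"
    by (rule order_trans[OF abs_Re_le_cmod form[OF s12 a i i]])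
  also have "\<dots> \<le> K * N * hn (3/8 + s/4) (cf f) * hn (3/8 + s/4) (cf f)"
    using K assms(2) by (intro mult_right_mono mult_left_mono) auto
  finally show ?thesis by (simp add: power2_eq_square mult.assoc)
qed

text \<open>Coercivity: by the choice of \<open>kap\<close> the potential costs half of the squared
  norm of order 1/2 and a multiple of the squared norm of order 0.\<close>

lemma q_lower:
  assumes "bodata a \<sigma>" "hn (- s) a \<le> R" "insob 1 (cf f)"
  shows "(hn (1/2) (cf f))\<^sup>2 \<le> 2 * (bodata.q a f + (1 + kap R) * (norm f)\<^sup>2)"
proof -
  interpret bodata a \<sigma> by fact
  have R: "0 \<le> R" using order_trans[OF hn_nonneg assms(2)] .
  have i: "insob (1/2) (cf f)" by (rule insob_mono[OF assms(3)]) simp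
  have "q f = Re (cinner (D1 f) f) - Re (cinner (T a f) f)"
    by (simp add: q_def L_def cinner_diff_left)
  then show ?thesis
    using T_form[OF assms] kap(2)[OF R i] D1_form(3)[OF assms(3)] by (simp add: algebra_simps)
qed

lemma q_upper:
  assumes "bodata a \<sigma>" "hn (- s) a \<le> N" "insob 1 (cf f)"
  shows "bodata.q a f \<le> (1 + K * N) * (hn (1/2) (cf f))\<^sup>2"
proof -
  interpret bodata a \<sigma> by fact
  have N: "0 \<le> N" using order_trans[OF hn_nonneg assms(2)] .
  have "q f = Re (cinner (D1 f) f) - Re (cinner (T a f) f)"
    by (simp add: q_def L_def cinner_diff_left)
  moreover have "K * N * (hn (3/8 + s/4) (cf f))\<^sup>2 \<le> K * N * (hn (1/2) (cf f))\<^sup>2"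
    using K N s by (intro mult_left_mono power_mono hn_mono insob_mono[OF assms(3)]) auto
  ultimately show ?thesis
    using T_form[OF assms] D1_form(2)[OF assms(3)] by (simp add: algebra_simps)
qed

lemma norm_le_half: "insob 1 (cf f) \<Longrightarrow> (norm f)\<^sup>2 \<le> (hn (1/2) (cf f))\<^sup>2"
  using hn_mono[of "1/2" "cf f" 0] insob_mono[of 1 "cf f" "1/2"] by (intro power_mono) auto

text \<open>Coercivity at time 0, conservation of the form, and the upper bound of the form at time
  \<open>t\<close>. The unknown size \<open>N\<close> thus enters linearly and not through
  \<open>kap\<close>, which is what lets \<open>uniform_bounds\<close> close.\<close>

lemma half_lower:
  assumes d: "bodata a \<sigma>" "hn (- s) a \<le> R" "hn (- s) (bodata.ut a t) \<le> N" and h: "insob 1 (cf h)"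
  shows "hn (1/2) (cf h) \<le> sqrt (2 * (2 + kap R + K * N)) * hn (1/2) (cf (bodata.Vs a t h))"
proof -
  interpret bodata a \<sigma> by fact
  have R: "0 \<le> R" using order_trans[OF hn_nonneg assms(2)] .
  have "(1 + kap R) * (norm h)\<^sup>2 \<le> (1 + kap R) * (hn (1/2) (cf (Vs t h)))\<^sup>2"
    using norm_le_half[OF Vs_insob[OF h, of t]] kap(1)[OF R] by (intro mult_left_mono) (simp_all only: norm_Vs)
  then have "(hn (1/2) (cf h))\<^sup>2 \<le> (2 * (2 + kap R + K * N)) * (hn (1/2) (cf (Vs t h)))\<^sup>2"
    using q_lower[OF d(1,2) h] q_upper[OF bodata_ut[of t] d(3) Vs_insob[OF h, of t]] unfolding q_ut[OF h]
    by (simp add: algebra_simps del: cf_Vs)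
  then have "sqrt ((hn (1/2) (cf h))\<^sup>2) \<le> sqrt ((2 * (2 + kap R + K * N)) * (hn (1/2) (cf (Vs t h)))\<^sup>2)"
    by (rule real_sqrt_le_mono)
  then show ?thesis by (simp add: real_sqrt_mult del: cf_Vs)
qed

text \<open>A lower bound for \<open>Vs t\<close> in the order \<open>1/2\<close> is dual to an upper bound in the order \<open>- 1/2\<close>; interpolation with
  the isometry in the order 0 reaches the order \<open>- s\<close>.\<close>

lemma Vs_rough:
  assumes d: "bodata a \<sigma>" and B: "1 \<le> B" "\<And>h. insob 1 (cf h) \<Longrightarrow> hn (1/2) (cf h) \<le> B * hn (1/2) (cf (bodata.Vs a t h))"
  shows "hn (- s) (cf (bodata.Vs a t f)) \<le> B * hn (- s) (cf f)"
proof -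
  interpret bodata a \<sigma> by fact
  have dual: "hn (- (1/2)) (cf (Vs t f)) \<le> B * hn (- (1/2)) (cf f)" for f
  proof (rule sob_duality_converse(2))
    fix F and g :: "nat \<Rightarrow> complex" assume F: "finite F" "\<And>i. i \<notin> F \<Longrightarrow> g i = 0"
    have fin: "finite {i. g i \<noteq> 0}" by (rule finite_subset[OF _ F(1)]) (use F(2) in auto)
    define g' where "g' = ell2_of g"
    have g': "cf g' = g" unfolding g'_def by (rule cf_of[OF sqsum_finite[OF fin]])
    have "restr F g' = g'" by (rule ell2_eqI) (use F(2) g' in auto)
    \<comment> \<open>Unitarity turns the pairing with \<open>g\<close> into a pairing of
      \<open>f\<close> with a preimage of \<open>g\<close>, whose norm of order 1/2 is bounded by
      the hypothesis \<open>B\<close>.\<close>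
    then obtain h where h: "insob 1 (cf h)" "Vs t h = g'"
      using Vs_preimage[OF F(1)] by blast
    have "(\<Sum>i\<in>F. cf (Vs t f) i * cnj (g i)) = cinner (Vs t f) g'"
      unfolding cinner_def g' using F by (subst infsum_finite[OF F(1), symmetric]) (rule infsum_cong_neutral; auto)
    also have "\<dots> = cinner f h" using Vs_cinner[of t f h] h by simp
    finally have "cmod (\<Sum>i\<in>F. cf (Vs t f) i * cnj (g i)) \<le> hn (1/2) (cf h) * hn (- (1/2)) (cf f)"
      using cinner_le_hn[of "1/2" h f] insob_mono[OF h(1), of "1/2"] cinner_commute[of f h] by (simp del: cf_Vs)
    also have "hn (1/2) (cf h) \<le> B * hn (1/2) g"
      using B(2)[OF h(1)] by (simp add: h g' del: cf_Vs)
    finally show "cmod (\<Sum>i\<in>F. cf (Vs t f) i * cnj (g i)) \<le> (B * hn (- (1/2)) (cf f)) * hn (- (- (1/2))) g"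
      by (simp add: mult_ac mult_right_mono del: cf_Vs)
  qed (use B(1) in auto)
  show ?thesis
  proof (cases "s = 0")
    case True
    then show ?thesis using mult_right_mono[OF B(1) norm_ge_zero[of f]] by (simp add: norm_Vs del: cf_Vs)
  next
    case False
    \<comment> \<open>The interpolation parameter is \<open>2 * s\<close>, strictly between 0 and 1
      in this case.\<close>
    have "hn (2 * s * - (1/2)) (cf (Vs t f)) \<le> B powr (2 * s) * hn (2 * s * - (1/2)) (cf f)"
      using dual s B(1) False by (intro sob_interpolation(2)) (auto simp: norm_Vs simp del: cf_Vs)
    moreover have "B powr (2 * s) \<le> B powr 1"
      using B(1) s by (intro powr_mono) auto
    then have "B powr (2 * s) * hn (- s) (cf f) \<le> B * hn (- s) (cf f)"
      using B(1) by (intro mult_right_mono) auto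
    ultimately show ?thesis by simp
  qed
qed

text \<open>Conservation of the quadratic form of the Lax operator bounds \<open>N = hn (- s) (ut t)\<close> by a constant times
  \<open>sqrt (1 + N)\<close>, hence by a constant that depends on the data only.\<close>

lemma uniform_bounds:
  assumes R: "0 \<le> R"
  shows "\<exists>B\<ge>1. \<forall>a \<sigma> t. bodata a \<sigma> \<longrightarrow> hn (- s) a \<le> R \<longrightarrow> hn (- s) (bodata.ut a t) \<le> B \<and>
    (\<forall>f. hn (- s) (cf (bodata.Vs a t f)) \<le> B * hn (- s) (cf f)) \<and>
    (\<forall>f. insob 1 (cf f) \<longrightarrow> hn (1/2) (cf (bodata.Vs a t f)) \<le> B * hn (1/2) (cf f) \<and>
      hn (1/2) (cf f) \<le> B * hn (1/2) (cf (bodata.Vs a t f)) \<and> hn (1/2) (cf (bodata.U a t f)) \<le> B * hn (1/2) (cf f))"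
proof -
  \<comment> \<open>From \<open>N \<le> 2 * (B0 * R)\<close> with
    \<open>B0\<^sup>2 = 2 * (2 + kap R + K * N)\<close>, where the first factor 2 is the cost of the
    negative frequencies in \<open>herm\<close>. For \<open>N \<ge> 1\<close> the resulting
    quadratic inequality gives \<open>N \<le> R' - 1\<close>.\<close>
  define R' where "R' = 8 * R\<^sup>2 * (2 + kap R) + 8 * R\<^sup>2 * K + 1"
  note kR = kap(1)[OF R]
  have R': "R' \<ge> 0" using kR K by (simp add: R'_def)
  note kR' = kap(1)[OF R']
  \<comment> \<open>Large enough for the lower bound of \<open>Vs t\<close>, its upper bound and the
    bound of the group, which combine \<open>kap R\<close> or \<open>kap R'\<close> with
    \<open>K * R\<close> or \<open>K * R'\<close>.\<close>
  define C where "C = 2 * (2 + kap R + kap R' + K * R + K * R')"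
  have C: "C \<ge> 4" using kR kR' K R R' by (simp add: C_def)
  define B where "B = max R' (sqrt C)"
  have sC: "sqrt C \<ge> 1" using C by simp
  have rough_ut: "hn (- s) (bodata.ut a t) \<le> R'" if d: "bodata a \<sigma>" "hn (- s) a \<le> R" for a \<sigma> t
  proof -
    interpret bodata a \<sigma> by fact
    define N where "N = hn (- s) (ut t)"
    define B0 where "B0 = sqrt (2 * (2 + kap R + K * N))"
    have N: "N \<ge> 0" by (simp add: N_def)
    have B0: "B0 \<ge> 1" "B0\<^sup>2 = 2 * (2 + kap R + K * N)"
      using kR K N by (auto simp: B0_def)
    have "hn (- s) (cf p) \<le> R"
      unfolding cf_p using hn_nat_le[of "- s" a] insob_mono[OF a, of "- s"] sig s d(2) by simp
    then have "B0 * hn (- s) (cf p) \<le> B0 * R"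
      using B0(1) by (intro mult_left_mono) auto
    then have "hn (- s) (cf (Vs t p)) \<le> B0 * R"
      using Vs_rough[OF d(1) B0(1) half_lower[OF d, of t N, folded B0_def], of p] by (simp add: N_def del: cf_Vs)
    then have "N \<le> 2 * (B0 * R)"
      unfolding N_def ut_def using hn_herm_le[of "- s" "cf (Vs t p)"] s by (simp del: cf_Vs)
    then have "N\<^sup>2 \<le> (2 * (B0 * R))\<^sup>2"
      using N by (intro power_mono)
    then have N2: "N\<^sup>2 \<le> 8 * R\<^sup>2 * (2 + kap R) + (8 * R\<^sup>2 * K) * N"
      by (simp add: power_mult_distrib B0(2) algebra_simps)
    show ?thesis
    proof (rule ccontr)
      assume "\<not> ?thesis"
      moreover have "R' \<ge> 1" using kR K by (simp add: R'_def)
      ultimately have n: "N > R'" "N \<ge> 1" by (auto simp: N_def)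
      have "8 * R\<^sup>2 * (2 + kap R) \<le> 8 * R\<^sup>2 * (2 + kap R) * N"
        using mult_left_mono[OF n(2), of "8 * R\<^sup>2 * (2 + kap R)"] kR by simp
      then have "N * N \<le> (R' - 1) * N"
        using N2 by (simp add: R'_def power2_eq_square algebra_simps)
      then show False using n by simp
    qed
  qed
  have "hn (- s) (bodata.ut a t) \<le> B \<and>
    (\<forall>f. hn (- s) (cf (bodata.Vs a t f)) \<le> B * hn (- s) (cf f)) \<and>
    (\<forall>f. insob 1 (cf f) \<longrightarrow> hn (1/2) (cf (bodata.Vs a t f)) \<le> B * hn (1/2) (cf f) \<and>
      hn (1/2) (cf f) \<le> B * hn (1/2) (cf (bodata.Vs a t f)) \<and> hn (1/2) (cf (bodata.U a t f)) \<le> B * hn (1/2) (cf f))"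
    if d: "bodata a \<sigma>" "hn (- s) a \<le> R" for a \<sigma> t
  proof -
    interpret bodata a \<sigma> by fact
    have sq: "x \<le> B * y" if "x\<^sup>2 \<le> C * y\<^sup>2" "0 \<le> x" "0 \<le> y" for x y
    proof -
      have "sqrt (x\<^sup>2) \<le> sqrt (C * y\<^sup>2)" using that(1) by (rule real_sqrt_le_mono)
      then have "x \<le> sqrt C * y" using that by (simp add: real_sqrt_mult)
      also have "\<dots> \<le> B * y" using that by (intro mult_right_mono) (auto simp: B_def)
      finally show ?thesis .
    qed
    have fin: "2 * ((1 + K * R) * y\<^sup>2 + (1 + k) * y\<^sup>2) \<le> C * y\<^sup>2" if "k = kap R \<or> k = kap R'" for k y
    proof -
      have "2 * ((1 + K * R) + (1 + k)) \<le> C"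
        using that kR kR' K R' by (auto simp: C_def)
      from mult_right_mono[OF this, of "y\<^sup>2"] show ?thesis by (simp add: algebra_simps)
    qed
    have lo: "hn (1/2) (cf f) \<le> B * hn (1/2) (cf (Vs t f))" if f: "insob 1 (cf f)" for f
    proof -
      have "sqrt (2 * (2 + kap R + K * R')) \<le> sqrt C"
        using kR' K R by (intro real_sqrt_le_mono) (simp add: C_def)
      then have "sqrt (2 * (2 + kap R + K * R')) \<le> B" by (rule order_trans) (simp add: B_def)
      from order_trans[OF half_lower[OF d rough_ut[OF d] f] mult_right_mono[OF this hn_nonneg]] show ?thesis .
    qed
    have up: "hn (1/2) (cf (Vs t f)) \<le> B * hn (1/2) (cf f)" if f: "insob 1 (cf f)" for f
    proof (rule sq)
      have "(1 + kap R') * (norm f)\<^sup>2 \<le> (1 + kap R') * (hn (1/2) (cf f))\<^sup>2"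
        using kR' by (intro mult_left_mono norm_le_half f) auto
      then show "(hn (1/2) (cf (Vs t f)))\<^sup>2 \<le> C * (hn (1/2) (cf f))\<^sup>2"
        using q_lower[OF bodata_ut[of t] rough_ut[OF d] Vs_insob[OF f, of t]] q_upper[OF d f] fin[of "kap R'" "hn (1/2) (cf f)"]
        unfolding q_ut[OF f] norm_Vs by (simp del: cf_Vs)
    qed auto
    have u: "hn (1/2) (cf (U t f)) \<le> B * hn (1/2) (cf f)" if f: "insob 1 (cf f)" for f
    proof (rule sq)
      have "(1 + kap R) * (norm f)\<^sup>2 \<le> (1 + kap R) * (hn (1/2) (cf f))\<^sup>2"
        using kR by (intro mult_left_mono norm_le_half f) auto
      then show "(hn (1/2) (cf (U t f)))\<^sup>2 \<le> C * (hn (1/2) (cf f))\<^sup>2"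
        using q_lower[OF d U_insob[OF f, of t]] q_upper[OF d f] fin[of "kap R" "hn (1/2) (cf f)"]
        unfolding q_U[OF f] U_simps(5) by simp
    qed auto
    have "hn (- s) (ut t) \<le> B" using rough_ut[OF d, of t] by (simp add: B_def)
    moreover have "1 \<le> B" using sC unfolding B_def by (rule max.coboundedI2)
    ultimately show ?thesis
      using Vs_rough[OF d(1) _ lo] lo up u by blast
  qed
  moreover have "1 \<le> B" using sC unfolding B_def by (rule max.coboundedI2)
  ultimately show ?thesis by blast
qed

text \<open>The inner product of the two evolutions has as derivative, up to \<open>\<i>\<close>,
  the form of the Toeplitz operator with symbol \<open>a - b\<close> at two vectors bounded at order
  1/2. Both groups are unitary, so the squared distance is twice the loss of the real part of this
  product; hence the square root in \<open>v_close\<close>.\<close>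

lemma U_close:
  assumes d: "bodata a \<sigma>" "bodata b \<sigma>'" and f: "insob 1 (cf f)" and B: "0 \<le> B"
    "\<And>t. hn (1/2) (cf (bodata.U a t f)) \<le> B * hn (1/2) (cf f)" "\<And>t. hn (1/2) (cf (bodata.U b t f)) \<le> B * hn (1/2) (cf f)"
  shows "(norm (bodata.U a t f - bodata.U b t f))\<^sup>2 \<le> 2 * \<bar>t\<bar> * (K * hn (- s) (\<lambda>k. a k - b k) * (B * hn (1/2) (cf f))\<^sup>2)"
proof -
  interpret a: bodata a \<sigma> by fact
  interpret b: bodata b \<sigma>' by fact
  define M where "M = K * hn (- s) (\<lambda>k. a k - b k) * (B * hn (1/2) (cf f))\<^sup>2"
  define \<tau> where "\<tau> = min \<sigma> \<sigma>'"
  have \<tau>: "1 / 2 < \<tau>" "insob \<tau> a" "insob \<tau> b"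
    using a.s12 b.s12 insob_mono[OF a.a, of \<tau>] insob_mono[OF b.a, of \<tau>] by (auto simp: \<tau>_def)
  define \<phi> where "\<phi> t = cinner (a.U t f) (b.U t f) - cinner f f" for t
  have d\<phi>: "(\<phi> has_vector_derivative \<i> * cinner (b.L (a.U t f) - a.L (a.U t f)) (b.U t f)) (at t)" for t
  proof -
    have e: "cinner (a.U t f) ((- \<i>) *\<^sub>C b.L (b.U t f)) + cinner ((- \<i>) *\<^sub>C a.L (a.U t f)) (b.U t f) =
        \<i> * cinner (b.L (a.U t f) - a.L (a.U t f)) (b.U t f)"
      using b.L_sym[of "a.U t f" "b.U t f"] f by (simp add: cinner_diff_left algebra_simps)
    from has_vector_derivative_diff[OF bounded_bilinear.has_vector_derivative[OF bounded_bilinear_cinner a.U_deriv[OF f] b.U_deriv[OF f], of t] has_vector_derivative_const[of "cinner f f"]]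
    show ?thesis unfolding e \<phi>_def by simp
  qed
  have "norm (\<phi> t) \<le> M * \<bar>t\<bar> ^ Suc 0 / Suc 0"
  proof (rule norm_le_power_deriv[OF d\<phi>])
    fix t
    have i: "insob (3/8 + s/4) (cf (a.U t f))" "insob (3/8 + s/4) (cf (b.U t f))" "insob (1/2) (cf (a.U t f))" "insob (1/2) (cf (b.U t f))"
      using s insob_mono[OF a.U_insob[OF f, of t]] insob_mono[OF b.U_insob[OF f, of t]] by auto
    have "b.L (a.U t f) - a.L (a.U t f) = T (\<lambda>k. a k - b k) (a.U t f)"
      unfolding T_diff_symbol[OF \<tau>] by (simp add: a.L_def b.L_def)
    then have "cmod (cinner (b.L (a.U t f) - a.L (a.U t f)) (b.U t f)) \<le>
        K * hn (- s) (\<lambda>k. a k - b k) * hn (3/8 + s/4) (cf (a.U t f)) * hn (3/8 + s/4) (cf (b.U t f))"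
      using form[OF \<tau>(1) insob_diff[OF \<tau>(2,3)] i(1,2)] by simp
    also have "\<dots> \<le> K * hn (- s) (\<lambda>k. a k - b k) * (B * hn (1/2) (cf f)) * (B * hn (1/2) (cf f))"
      using K s B(1) by (intro mult_mono order_trans[OF hn_mono[OF i(3)] B(2)] order_trans[OF hn_mono[OF i(4)] B(3)]) auto
    finally show "norm (\<i> * cinner (b.L (a.U t f) - a.L (a.U t f)) (b.U t f)) \<le> M * \<bar>t\<bar> ^ 0"
      by (simp add: norm_mult M_def power2_eq_square mult_ac)
  qed (simp add: \<phi>_def)
  then have "- (M * \<bar>t\<bar>) \<le> Re (\<phi> t)"
    using abs_Re_le_cmod[of "\<phi> t"] by (simp add: abs_le_iff)
  moreover have "(norm (a.U t f - b.U t f))\<^sup>2 = (norm (a.U t f))\<^sup>2 + (norm (b.U t f))\<^sup>2 - 2 * Re (cinner (a.U t f) (b.U t f))"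
    by (simp add: power2_norm_eq_inner inner_diff_left inner_diff_right inner_commute Re_cinner del: a.U_simps b.U_simps)
  then have "(norm (a.U t f - b.U t f))\<^sup>2 = (norm f)\<^sup>2 + (norm f)\<^sup>2 - 2 * Re (cinner (a.U t f) (b.U t f))"
    by (simp only: a.U_simps(5) b.U_simps(5))
  ultimately show ?thesis
    by (simp add: \<phi>_def M_def Re_cinner power2_norm_eq_inner algebra_simps)
qed

text \<open>Induction on \<open>n\<close>: the old difference is carried by one isometry, and the
  difference of the two isometries acts on the vector of the second data. That vector is bounded at
  order 1/2 uniformly in the data, because its image under \<open>Vs t\<close> is
  \<open>unit2 n\<close>.\<close>

lemma v_close:
  assumes R: "0 \<le> R" "0 \<le> \<Theta>"
  shows "\<exists>C\<ge>0. \<forall>a \<sigma> b \<sigma>' t. bodata a \<sigma> \<longrightarrow> bodata b \<sigma>' \<longrightarrow> hn (- s) a \<le> R \<longrightarrow> hn (- s) b \<le> R \<longrightarrow> \<bar>t\<bar> \<le> \<Theta> \<longrightarrow>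
    norm (bodata.v a t n - bodata.v b t n) \<le> C * sqrt (hn (- s) (\<lambda>k. a k - b k))"
proof (induction n)
  case 0
  show ?case
  proof (intro exI[of _ 0] conjI allI impI order_refl)
    fix a \<sigma> b \<sigma>' t assume "bodata a \<sigma>" "bodata b \<sigma>'"
    then show "norm (bodata.v a t 0 - bodata.v b t 0) \<le> 0 * sqrt (hn (- s) (\<lambda>k. a k - b k))"
      using bodata.v_simps(1)[of a \<sigma> t] bodata.v_simps(1)[of b \<sigma>' t] by (simp only: diff_self norm_zero mult_zero_left order_refl)
  qed
next
  case (Suc n)
  obtain C where C: "C \<ge> 0" "\<And>a \<sigma> b \<sigma>' t. bodata a \<sigma> \<Longrightarrow> bodata b \<sigma>' \<Longrightarrow> hn (- s) a \<le> R \<Longrightarrow> hn (- s) b \<le> R \<Longrightarrow> \<bar>t\<bar> \<le> \<Theta> \<Longrightarrow>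
    norm (bodata.v a t n - bodata.v b t n) \<le> C * sqrt (hn (- s) (\<lambda>k. a k - b k))"
    using Suc.IH by blast
  obtain B where B: "1 \<le> B" "\<And>a \<sigma> t f. bodata a \<sigma> \<Longrightarrow> hn (- s) a \<le> R \<Longrightarrow> insob 1 (cf f) \<Longrightarrow>
      hn (1/2) (cf f) \<le> B * hn (1/2) (cf (bodata.Vs a t f)) \<and> hn (1/2) (cf (bodata.U a t f)) \<le> B * hn (1/2) (cf f)"
    using uniform_bounds[OF R(1)] by blast
  define Q where "Q = B * (B * hn (1/2) (cf (unit2 n :: nat ell2)))"
  define C' where "C' = C + sqrt (4 * \<Theta> * K) * Q"
  have Q: "Q \<ge> 0" using B(1) by (simp add: Q_def)
  have "norm (bodata.v a t (Suc n) - bodata.v b t (Suc n)) \<le> C' * sqrt (hn (- s) (\<lambda>k. a k - b k))"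
    if d: "bodata a \<sigma>" "bodata b \<sigma>'" "hn (- s) a \<le> R" "hn (- s) b \<le> R" "\<bar>t\<bar> \<le> \<Theta>" for a b \<sigma> \<sigma>' t
  proof -
    interpret a: bodata a \<sigma> by fact
    interpret b: bodata b \<sigma>' by fact
    let ?\<delta> = "hn (- s) (\<lambda>k. a k - b k)" and ?y = "b.v t n"
    have y: "insob 1 (cf ?y)" by (rule b.v_insob)
    have hy: "B * hn (1/2) (cf ?y) \<le> Q"
      using B(2)[OF d(2,4) y, of t] B(1) unfolding b.Vs_v Q_def by (intro mult_left_mono) auto
    have "(norm (a.U (2 * t) ?y - b.U (2 * t) ?y))\<^sup>2 \<le> 2 * \<bar>2 * t\<bar> * (K * ?\<delta> * (B * hn (1/2) (cf ?y))\<^sup>2)"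
      by (rule U_close[OF d(1,2) y]) (use B(1) B(2)[OF d(1,3) y] B(2)[OF d(2,4) y] in auto)
    also have "\<dots> \<le> (4 * \<Theta>) * (K * ?\<delta> * Q\<^sup>2)"
    proof (rule mult_mono)
      show "K * ?\<delta> * (B * hn (1/2) (cf ?y))\<^sup>2 \<le> K * ?\<delta> * Q\<^sup>2"
        using K B(1) hy by (intro mult_left_mono power_mono) auto
    qed (use d(5) K R(2) in auto)
    also have "\<dots> = (sqrt (4 * \<Theta> * K) * Q * sqrt ?\<delta>)\<^sup>2"
      using R(2) K by (simp add: power_mult_distrib)
    finally have 1: "norm (a.U (2 * t) ?y - b.U (2 * t) ?y) \<le> sqrt (4 * \<Theta> * K) * Q * sqrt ?\<delta>"
      by (rule power2_le_imp_le) (use Q R(2) K in auto)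
    have "a.v t (Suc n) - b.v t (Suc n) = a.St t (a.v t n - ?y) + cis (- t) *\<^sub>C Sh (a.U (2 * t) ?y - b.U (2 * t) ?y)"
      by (simp add: a.St_def b.St_def scaleC_diff_right)
    then have "norm (a.v t (Suc n) - b.v t (Suc n)) \<le> norm (a.v t n - ?y) + norm (a.U (2 * t) ?y - b.U (2 * t) ?y)"
      by (metis (no_types, lifting) norm_triangle_ineq a.St_simps(4) norm_scaleC norm_cis mult_1 norm_Sh)
    then show ?thesis
      using C(2)[OF d] 1 by (simp add: C'_def distrib_right)
  qed
  moreover have "C' \<ge> 0" using C(1) Q R(2) K by (simp add: C'_def)
  ultimately show ?case by blast
qed

text \<open>A Cauchy criterion around data \<open>v0\<close> that may be rough. A finitely supported
  \<open>h\<close> approximates the part of nonnegative frequencies of \<open>v0\<close>, hence that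
  of both regular data; for \<open>h\<close> the bound at order 1/2 controls the high frequencies
  and \<open>v_close\<close> the finitely many low ones. As \<open>h\<close> depends on
  \<open>v0\<close> and not on the regular data, all constants are fixed before
  \<open>\<delta>\<close>.\<close>

lemma flow_close:
  fixes v0 :: "int \<Rightarrow> complex"
  assumes v0: "insob (- s) v0" and "0 \<le> \<Theta>" "0 < \<epsilon>"
  shows "\<exists>\<delta>>0. \<forall>a \<sigma> b \<sigma>' t. bodata a \<sigma> \<longrightarrow> bodata b \<sigma>' \<longrightarrow> hn (- s) (\<lambda>k. a k - v0 k) < \<delta> \<longrightarrow> hn (- s) (\<lambda>k. b k - v0 k) < \<delta> \<longrightarrow>
    \<bar>t\<bar> \<le> \<Theta> \<longrightarrow> hn (- s) (\<lambda>k. bodata.ut a t k - bodata.ut b t k) \<le> \<epsilon>"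
proof -
  define R where "R = hn (- s) v0 + 1"
  have R: "0 \<le> R" by (simp add: R_def add_nonneg_nonneg)
  obtain B where B: "1 \<le> B" "\<And>a \<sigma> t f. bodata a \<sigma> \<Longrightarrow> hn (- s) a \<le> R \<Longrightarrow> hn (- s) (cf (bodata.Vs a t f)) \<le> B * hn (- s) (cf f)"
      "\<And>a \<sigma> t f. bodata a \<sigma> \<Longrightarrow> hn (- s) a \<le> R \<Longrightarrow> insob 1 (cf f) \<Longrightarrow> hn (1/2) (cf (bodata.Vs a t f)) \<le> B * hn (1/2) (cf f)"
    using uniform_bounds[OF R] by blast
  \<comment> \<open>Replacing the data by \<open>h\<close> costs \<open>B * (2 * \<eta>)\<close> for
    each of the two solutions, together \<open>\<epsilon> / 8\<close>; the comparison for
    \<open>h\<close> costs another \<open>\<epsilon> / 8\<close>, and \<open>herm\<close> doubles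
    the total.\<close>
  define \<eta> where "\<eta> = \<epsilon> / (32 * B)"
  have \<eta>: "\<eta> > 0" "4 * B * \<eta> = \<epsilon> / 8" using B(1) assms(3) by (auto simp: \<eta>_def)
  define y0 where "y0 n = v0 (int n)" for n
  have y0: "insob (- s) y0" unfolding y0_def by (rule insob_nat[OF v0])
  obtain A where A: "finite A" "hn (- s) (\<lambda>i. y0 i - (if i \<in> A then y0 i else 0)) < \<eta>"
    using insob_dense[OF y0 \<eta>(1)] by blast
  define h where "h = ell2_of (\<lambda>i. if i \<in> A then y0 i else 0)"
  have fin: "finite {i. (if i \<in> A then y0 i else 0) \<noteq> 0}"
    by (rule finite_subset[OF _ A(1)]) auto
  have h: "cf h = (\<lambda>i. if i \<in> A then y0 i else 0)"
    unfolding h_def by (rule cf_of[OF sqsum_finite[OF fin]])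
  have ih: "insob k (cf h)" for k unfolding h by (rule insob_finite[OF fin])
  define M where "M = 2 * (B * hn (1/2) (cf h))"
  have M: "M \<ge> 0" using B(1) by (simp add: M_def)
  obtain N :: nat where N: "1 \<le> N" "M \<le> \<epsilon> / 16 * sqrt N"
  proof -
    obtain n :: nat where n: "(16 * M / \<epsilon>)\<^sup>2 + 1 < real n" using reals_Archimedean2 by blast
    then have "16 * M / \<epsilon> \<le> sqrt n" by (intro real_le_rsqrt) auto
    moreover have "1 \<le> n" using n zero_le_power2[of "16 * M / \<epsilon>"] by linarith
    ultimately show ?thesis using that[of n] assms(3) by (simp add: field_simps)
  qed
  have "\<forall>n. \<exists>C\<ge>0. \<forall>a \<sigma> b \<sigma>' t. bodata a \<sigma> \<longrightarrow> bodata b \<sigma>' \<longrightarrow> hn (- s) a \<le> R \<longrightarrow> hn (- s) b \<le> R \<longrightarrow> \<bar>t\<bar> \<le> \<Theta> \<longrightarrow>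
    norm (bodata.v a t n - bodata.v b t n) \<le> C * sqrt (hn (- s) (\<lambda>k. a k - b k))"
    using v_close[OF R assms(2)] by blast
  then obtain C where C: "\<And>n. C n \<ge> 0" "\<And>n a \<sigma> b \<sigma>' t. bodata a \<sigma> \<Longrightarrow> bodata b \<sigma>' \<Longrightarrow> hn (- s) a \<le> R \<Longrightarrow> hn (- s) b \<le> R \<Longrightarrow> \<bar>t\<bar> \<le> \<Theta> \<Longrightarrow>
    norm (bodata.v a t n - bodata.v b t n) \<le> C n * sqrt (hn (- s) (\<lambda>k. a k - b k))"
    by metis
  define Q where "Q = (\<Sum>n<N. norm h * C n)"
  have Q: "Q \<ge> 0" unfolding Q_def using C(1) by (intro sum_nonneg) auto
  \<comment> \<open>The two data are at distance at most \<open>2 * \<delta>\<close>, so that the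
    \<open>N\<close> low frequencies together contribute at most
    \<open>Q * sqrt (2 * \<delta>)\<close>.\<close>
  define \<delta> where "\<delta> = min (min 1 \<eta>) ((\<epsilon> / (16 * (Q + 1)))\<^sup>2 / 2)"
  have \<delta>: "\<delta> > 0" "\<delta> \<le> 1" "\<delta> \<le> \<eta>" "2 * \<delta> \<le> (\<epsilon> / (16 * (Q + 1)))\<^sup>2"
    using \<eta> Q assms(3) by (auto simp: \<delta>_def)
  have "Q * sqrt (2 * \<delta>) \<le> \<epsilon> / 16"
  proof -
    have "sqrt (2 * \<delta>) \<le> \<epsilon> / (16 * (Q + 1))"
      using \<delta>(4) Q assms(3) by (intro real_le_lsqrt) auto
    then have "Q * sqrt (2 * \<delta>) \<le> Q * (\<epsilon> / (16 * (Q + 1)))"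
      using Q by (intro mult_left_mono)
    also have "\<dots> \<le> \<epsilon> / 16" using Q assms(3) by (simp add: field_simps)
    finally show ?thesis .
  qed
  note Q\<delta> = this
  have "hn (- s) (\<lambda>k. bodata.ut a t k - bodata.ut b t k) \<le> \<epsilon>"
    if d: "bodata a \<sigma>" "bodata b \<sigma>'" "hn (- s) (\<lambda>k. a k - v0 k) < \<delta>" "hn (- s) (\<lambda>k. b k - v0 k) < \<delta>" "\<bar>t\<bar> \<le> \<Theta>" for a b \<sigma> \<sigma>' t
  proof -
    interpret a: bodata a \<sigma> by fact
    interpret b: bodata b \<sigma>' by fact
    have s0: "- s \<le> 0" using s by simp
    have data: "hn (- s) c \<le> R \<and> hn (- s) (\<lambda>n. c (int n) - cf h n) \<le> 2 * \<eta>" if c: "insob (- s) c" "hn (- s) (\<lambda>k. c k - v0 k) < \<delta>" for c :: "int \<Rightarrow> complex"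
    proof
      have "hn (- s) (\<lambda>k. (c k - v0 k) + v0 k) \<le> hn (- s) (\<lambda>k. c k - v0 k) + hn (- s) v0"
        by (intro hn_add_le insob_diff c v0)
      then show "hn (- s) c \<le> R" using c(2) \<delta>(2) by (simp add: R_def)
      have "hn (- s) (\<lambda>n. c (int n) - cf h n) \<le> hn (- s) (\<lambda>n. c (int n) - y0 n) + hn (- s) (\<lambda>n. y0 n - cf h n)"
        by (intro hn_triangle3 insob_nat c y0 ih)
      also have "hn (- s) (\<lambda>n. c (int n) - y0 n) \<le> hn (- s) (\<lambda>k. c k - v0 k)"
        unfolding y0_def by (rule hn_nat_le[OF insob_diff[OF c(1) v0]])
      finally show "hn (- s) (\<lambda>n. c (int n) - cf h n) \<le> 2 * \<eta>"
        using c(2) \<delta>(3) A(2) unfolding h by linarith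
    qed
    have ia: "insob (- s) a" "insob (- s) b"
      using insob_mono[OF a.a, of "- s"] insob_mono[OF b.a, of "- s"] a.sig b.sig s by auto
    note da = data[OF ia(1) d(3)] and db = data[OF ia(2) d(4)]
    have "hn (- s) (\<lambda>k. a k - b k) \<le> hn (- s) (\<lambda>k. a k - v0 k) + hn (- s) (\<lambda>k. v0 k - b k)"
      by (intro hn_triangle3 ia v0)
    then have ab: "hn (- s) (\<lambda>k. a k - b k) \<le> 2 * \<delta>"
      using d(3,4) hn_diff_commute[OF v0 ia(2)] by simp
    let ?D = "\<lambda>n. cf (a.Vs t h) n - cf (b.Vs t h) n"
    have small: "hn (- s) (cf (a.Vs t (a.p - h))) \<le> B * (2 * \<eta>)" "hn (- s) (cf (b.Vs t (b.p - h))) \<le> B * (2 * \<eta>)"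
    proof -
      have e: "cf (a.p - h) = (\<lambda>n. a (int n) - cf h n)" "cf (b.p - h) = (\<lambda>n. b (int n) - cf h n)"
        by (simp_all only: minus_ell2.rep_eq a.cf_p b.cf_p)
      have "B * hn (- s) (\<lambda>n. a (int n) - cf h n) \<le> B * (2 * \<eta>)" "B * hn (- s) (\<lambda>n. b (int n) - cf h n) \<le> B * (2 * \<eta>)"
        using da db B(1) by (intro mult_left_mono; simp)+
      then show "hn (- s) (cf (a.Vs t (a.p - h))) \<le> B * (2 * \<eta>)" "hn (- s) (cf (b.Vs t (b.p - h))) \<le> B * (2 * \<eta>)"
        using B(2)[OF d(1) conjunct1[OF da], of t "a.p - h"] B(2)[OF d(2) conjunct1[OF db], of t "b.p - h"]
        unfolding e by linarith+
    qed
    have hD: "insob (1/2) ?D" "hn (1/2) ?D \<le> M"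
    proof -
      have i: "insob (1/2) (cf (a.Vs t h))" "insob (1/2) (cf (b.Vs t h))"
        using insob_mono[OF a.Vs_insob[OF ih], of "1/2" t] insob_mono[OF b.Vs_insob[OF ih], of "1/2" t] by auto
      show "insob (1/2) ?D" by (intro insob_diff i)
      show "hn (1/2) ?D \<le> M"
        using hn_diff_le[OF i] B(3)[OF d(1) conjunct1[OF da] ih, of t] B(3)[OF d(2) conjunct1[OF db] ih, of t]
        unfolding M_def by linarith
    qed
    have "hn (- s) ?D \<le> (\<Sum>n<N. br n powr (- s) * cmod (?D n)) + real N powr (- s - 1/2) * hn (1/2) ?D"
      by (rule hn_split[OF hD(1) _ N(1)]) (use s in simp)
    also have "(\<Sum>n<N. br n powr (- s) * cmod (?D n)) \<le> (\<Sum>n<N. norm h * (C n * sqrt (2 * \<delta>)))"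
    proof (rule sum_mono)
      fix n
      have "cmod (?D n) \<le> norm h * norm (a.v t n - b.v t n)"
        using cmod_cinner_le[of h "a.v t n - b.v t n"] by (simp add: a.cf_Vs b.cf_Vs cinner_diff_right)
      also have "\<dots> \<le> norm h * (C n * sqrt (2 * \<delta>))"
      proof (rule mult_left_mono)
        show "norm (a.v t n - b.v t n) \<le> C n * sqrt (2 * \<delta>)"
          using C(2)[OF d(1,2) conjunct1[OF da] conjunct1[OF db] d(5), of n]
            mult_left_mono[OF real_sqrt_le_mono[OF ab] C(1)[of n]] by linarith
      qed simp
      finally have "cmod (?D n) \<le> norm h * (C n * sqrt (2 * \<delta>))" .
      moreover have "br n powr (- s) \<le> 1"
        using powr_mono[OF s0 br_ge1[of n]] by (simp add: powr_zero_eq_one)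
      ultimately show "br n powr (- s) * cmod (?D n) \<le> norm h * (C n * sqrt (2 * \<delta>))"
        using mult_right_mono[OF _ norm_ge_zero, of "br n powr (- s)" 1 "?D n"] by linarith
    qed
    also have "(\<Sum>n<N. norm h * (C n * sqrt (2 * \<delta>))) = Q * sqrt (2 * \<delta>)"
      unfolding Q_def sum_distrib_right by (simp add: mult.assoc)
    also have "real N powr (- s - 1/2) * hn (1/2) ?D \<le> real N powr (- (1/2)) * (\<epsilon> / 16 * sqrt N)"
      by (rule mult_mono[OF powr_mono order_trans[OF hD(2) N(2)]]) (use N(1) s in auto)
    also have "\<dots> = \<epsilon> / 16"
      using N(1) by (simp add: powr_minus powr_half_sqrt)
    finally have D: "hn (- s) ?D \<le> \<epsilon> / 16 + \<epsilon> / 16"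
      using Q\<delta> by linarith
    let ?X = "\<lambda>n. cf (a.Vs t a.p) n - cf (b.Vs t b.p) n"
    have "?X = (\<lambda>n. ?D n + (cf (a.Vs t (a.p - h)) n - cf (b.Vs t (b.p - h)) n))"
      by (auto simp: a.cf_Vs b.cf_Vs cinner_diff_left)
    then have "hn (- s) ?X \<le> hn (- s) ?D + hn (- s) (\<lambda>n. cf (a.Vs t (a.p - h)) n - cf (b.Vs t (b.p - h)) n)"
      by (simp only:) (intro hn_add_le insob_diff insob_cf s0)
    also have "hn (- s) (\<lambda>n. cf (a.Vs t (a.p - h)) n - cf (b.Vs t (b.p - h)) n) \<le> B * (2 * \<eta>) + B * (2 * \<eta>)"
      using hn_diff_le[OF insob_cf[OF s0] insob_cf[OF s0], of "a.Vs t (a.p - h)" "b.Vs t (b.p - h)"] small by linarith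
    finally have X: "hn (- s) ?X \<le> \<epsilon> / 4"
      using D \<eta>(2) by simp
    have "(\<lambda>k. a.ut t k - b.ut t k) = herm ?X"
      by (auto simp: a.ut_def b.ut_def herm_def)
    then have "hn (- s) (\<lambda>k. a.ut t k - b.ut t k) \<le> 2 * hn (- s) ?X"
      using hn_herm_le[OF insob_diff[OF insob_cf[OF s0] insob_cf[OF s0]], of "a.Vs t a.p" "b.Vs t b.p"] by simp
    then show ?thesis using X assms(3) by simp
  qed
  with \<delta>(1) show ?thesis by blast
qed

end

section \<open>Fourier series of functions and distributions\<close>

definition per :: "(real \<Rightarrow> 'a::real_normed_vector) \<Rightarrow> bool" where
  "per f \<longleftrightarrow> continuous_on UNIV f \<and> (\<forall>x. f (x + 2 * pi) = f x)"

definition phat :: "(real \<Rightarrow> complex) \<Rightarrow> int \<Rightarrow> complex" where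
  "phat f n = integral {0..2 * pi} (\<lambda>x. f x * cis (- (of_int n * x))) / of_real (2 * pi)"

lemma per_cis_eq:
  assumes "per f" "cis x = cis y"
  shows "f x = f y"
proof -
  have nat: "f (y + 2 * pi * real n) = f y" for y n
  proof (induction n)
    case (Suc n)
    have "f (y + 2 * pi * real n + 2 * pi) = f (y + 2 * pi * real n)"
      using assms(1) unfolding per_def by blast
    then show ?case using Suc by (simp add: algebra_simps)
  qed simp
  have "\<exists>n::int. x = y + 2 * pi * of_int n"
    using sin_cos_eq_iff[of x y] assms(2) by (simp add: complex_eq_iff)
  then obtain n :: int where n: "x = y + 2 * pi * of_int n" by blast
  show ?thesis
  proof (cases "n \<ge> 0")
    case True
    then show ?thesis using nat[of y "nat n"] n by simp
  next
    case False
    then show ?thesis using nat[of x "nat (- n)"] n by simp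
  qed
qed

lemma per_continuous_on: "per f \<Longrightarrow> continuous_on A f"
  unfolding per_def by (auto intro: continuous_on_subset)

lemma continuous_on_cis' [continuous_intros]: "continuous_on A f \<Longrightarrow> continuous_on A (\<lambda>x. cis (f x))"
  by (simp add: cis_conv_exp continuous_intros)

lemma per_cis: "per (\<lambda>x. cis (of_int n * x))"
proof -
  have "cis (of_int n * (x + 2 * pi)) = cis (of_int n * x) * cis (2 * pi * of_int n)" for x
    by (simp add: cis_mult distrib_left mult_ac)
  moreover have "cis (2 * pi * of_int n) = 1"
    by (simp add: cis_multiple_2pi)
  ultimately show ?thesis
    by (auto simp: per_def intro!: continuous_intros)
qed

section \<open>Trigonometric polynomials and uniqueness of Fourier coefficients\<close>

inductive_set trigp :: "(real \<Rightarrow> complex) set" where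
  trigp_cis: "(\<lambda>x. cis (of_int n * x)) \<in> trigp"
| trigp_add: "f \<in> trigp \<Longrightarrow> g \<in> trigp \<Longrightarrow> (\<lambda>x. f x + g x) \<in> trigp"
| trigp_cmult: "f \<in> trigp \<Longrightarrow> (\<lambda>x. c * f x) \<in> trigp"

lemma trigp_mult:
  assumes "f \<in> trigp" "g \<in> trigp"
  shows "(\<lambda>x. f x * g x) \<in> trigp"
  using assms(1)
proof (induction rule: trigp.induct)
  case (trigp_cis n)
  show ?case using assms(2)
  proof (induction rule: trigp.induct)
    case (trigp_cis m)
    show ?case using trigp.trigp_cis[of "n + m"] by (simp add: cis_mult distrib_right)
  next
    case (trigp_add h k)
    show ?case using trigp.trigp_add[OF trigp_add.IH] by (simp add: distrib_left)
  next
    case (trigp_cmult h c)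
    show ?case using trigp.trigp_cmult[OF trigp_cmult.IH, of c] by (simp add: mult.left_commute)
  qed
next
  case (trigp_add h k)
  show ?case using trigp.trigp_add[OF trigp_add.IH] by (simp add: distrib_right)
next
  case (trigp_cmult h c)
  show ?case using trigp.trigp_cmult[OF trigp_cmult.IH, of c] by (simp add: mult.assoc)
qed

lemma trigp_continuous: "h \<in> trigp \<Longrightarrow> continuous_on A h"
  by (induction rule: trigp.induct) (auto intro!: continuous_intros)

lemma real_polynomial_trigp: "real_polynomial_function g \<Longrightarrow> (\<lambda>x. of_real (g (cis x))) \<in> trigp"
proof (induction rule: real_polynomial_function.induct)
  case (linear f)
  interpret bounded_linear f by fact
  have "of_real (f (cis x)) = (of_real (f 1) - \<i> * of_real (f \<i>)) / 2 * cis (of_int 1 * x) + (of_real (f 1) + \<i> * of_real (f \<i>)) / 2 * cis (of_int (- 1) * x)" for x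
  proof -
    have "cis x = cos x *\<^sub>R 1 + sin x *\<^sub>R \<i>" by (simp add: complex_eq_iff)
    then have "f (cis x) = cos x * f 1 + sin x * f \<i>" by (simp only: add scaleR) simp
    then show ?thesis by (simp add: complex_eq_iff field_simps)
  qed
  then show ?case by (simp only: trigp_add[OF trigp_cmult[OF trigp_cis] trigp_cmult[OF trigp_cis]])
next
  case (const c)
  show ?case using trigp_cmult[OF trigp_cis[of 0], of "of_real c"] by simp
next
  case (add f g)
  show ?case using trigp_add[OF add.IH] by simp
next
  case (mult f g)
  show ?case using trigp_mult[OF mult.IH] by simp
qed

text \<open>Off the nonpositive real axis \<open>Arg\<close> is continuous; near that axis
  \<open>Arg (- w) + pi\<close> is a continuous branch of the angle, and a periodic function does
  not see the difference.\<close>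

lemma per_circle_continuous:
  fixes f :: "real \<Rightarrow> real"
  assumes f: "per f"
  shows "continuous_on (sphere 0 1) (\<lambda>z. f (Arg z))"
proof (rule continuous_at_imp_continuous_on, rule ballI)
  fix z :: complex assume "z \<in> sphere 0 1"
  then have z: "z \<noteq> 0" by auto
  have fc: "isCont f x" for x
    using f by (simp add: per_def continuous_on_eq_continuous_at)
  show "isCont (\<lambda>z. f (Arg z)) z"
  proof (cases "z \<in> \<real>\<^sub>\<le>\<^sub>0")
    case False
    from isCont_o2[OF continuous_at_Arg[OF this] fc] show ?thesis .
  next
    case True
    then have "- z \<notin> \<real>\<^sub>\<le>\<^sub>0"
      using z by (auto simp: complex_nonpos_Reals_iff complex_eq_iff)
    then have "isCont (\<lambda>w. Arg (- w) + pi) z"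
      by (intro continuous_intros isCont_o2[of z uminus Arg]) (auto intro: continuous_at_Arg)
    from isCont_o2[OF this fc] have "isCont (\<lambda>w. f (Arg (- w) + pi)) z" .
    moreover have "f (Arg (- w) + pi) = f (Arg w)" if "w \<noteq> 0" for w
    proof (rule per_cis_eq[OF f])
      have "cis (Arg (- w) + pi) = - cis (Arg (- w))" by (simp add: complex_eq_iff)
      then show "cis (Arg (- w) + pi) = cis (Arg w)"
        using that by (simp add: cis_Arg sgn_minus)
    qed
    then have "\<forall>\<^sub>F w in nhds z. f (Arg (- w) + pi) = f (Arg w)"
      using eventually_nhds_in_open[of "- {0}" z] z by (intro eventually_mono[OF eventually_nhds_in_open[of "- {0}" z]]) auto
    ultimately show ?thesis
      using isCont_cong by fastforce
  qed
qed

text \<open>By Stone-Weierstrass on the circle some trigonometric polynomial is uniformly close to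
  \<open>f\<close>, and \<open>f\<close> is orthogonal to it; the integral of
  \<open>f\<^sup>2\<close> is therefore at most a multiple of the error, and continuity gives
  vanishing at every point.\<close>

lemma fourier_uniqueness_real:
  fixes f :: "real \<Rightarrow> real"
  assumes f: "per f" and z: "\<And>n. integral {0..2 * pi} (\<lambda>x. of_real (f x) * cis (of_int n * x)) = 0"
  shows "f x = 0"
proof -
  let ?I = "{0..2 * pi}"
  have fi: "continuous_on A (\<lambda>x. complex_of_real (f x))" for A
    using per_continuous_on[OF f] by (intro continuous_intros)
  have zt: "integral ?I (\<lambda>x. of_real (f x) * h x) = 0" if "h \<in> trigp" for h
    using that
  proof (induction rule: trigp.induct)
    case (trigp_add h g)
    have "integral ?I (\<lambda>x. of_real (f x) * h x + of_real (f x) * g x) = 0"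
      using trigp_add by (subst Henstock_Kurzweil_Integration.integral_add) (use trigp_add in \<open>auto intro!: integrable_continuous_real continuous_on_mult fi intro: trigp_continuous\<close>)
    then show ?case by (simp add: distrib_left)
  next
    case (trigp_cmult h c)
    have "integral ?I (\<lambda>x. c * (of_real (f x) * h x)) = 0"
      using trigp_cmult by simp
    then show ?case by (simp add: mult.left_commute)
  qed (rule z)
  obtain M where M: "M \<ge> 0" "\<And>x. x \<in> ?I \<Longrightarrow> \<bar>f x\<bar> \<le> M"
  proof -
    have "bounded (f ` ?I)"
      by (intro compact_imp_bounded compact_continuous_image per_continuous_on f) auto
    then show ?thesis
      using that unfolding bounded_real by (metis abs_ge_zero imageI order_trans order_refl)
  qed
  have le: "integral ?I (\<lambda>x. (f x)\<^sup>2) \<le> e * (2 * pi * M)" if e: "e > 0" for e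
  proof -
    obtain g :: "complex \<Rightarrow> real" where g: "real_polynomial_function g" "\<And>z. z \<in> sphere 0 1 \<Longrightarrow> \<bar>f (Arg z) - g z\<bar> < e"
      by (rule Stone_Weierstrass_real_polynomial_function[OF compact_sphere per_circle_continuous[OF f] e]) (rule that)
    have fg: "\<bar>f x - g (cis x)\<bar> < e" for x
    proof -
      have "cis (Arg (cis x)) = cis x" by (simp add: cis_Arg sgn_div_norm)
      then have "f (Arg (cis x)) = f x" by (rule per_cis_eq[OF f])
      then show ?thesis using g(2)[of "cis x"] by simp
    qed
    have gc: "continuous_on A (\<lambda>x. g (cis x))" for A
      using continuous_on_Re[OF trigp_continuous[OF real_polynomial_trigp[OF g(1)]]] by simp
    have "of_real (integral ?I (\<lambda>x. f x * g (cis x))) = integral ?I (\<lambda>x. complex_of_real (f x) * of_real (g (cis x)))"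
    proof -
      have "(\<lambda>x. f x * g (cis x)) integrable_on ?I"
        by (intro integrable_continuous_real continuous_intros gc per_continuous_on[OF f])
      from integral_unique[OF has_integral_of_real[OF integrable_integral[OF this], where 'b = complex]]
      show ?thesis by simp
    qed
    also have "\<dots> = 0" by (rule zt[OF real_polynomial_trigp[OF g(1)]])
    finally have 0: "integral ?I (\<lambda>x. f x * g (cis x)) = 0" by simp
    have "integral ?I (\<lambda>x. (f x)\<^sup>2) = integral ?I (\<lambda>x. (f x)\<^sup>2 - f x * g (cis x))"
      using 0 by (subst Henstock_Kurzweil_Integration.integral_diff) (auto intro!: integrable_continuous_real continuous_intros gc per_continuous_on[OF f])
    also have "\<dots> \<le> integral ?I (\<lambda>x. e * M)"
    proof (rule integral_le)
      fix x assume x: "x \<in> ?I"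
      have "(f x)\<^sup>2 - f x * g (cis x) = f x * (f x - g (cis x))"
        by (simp add: power2_eq_square algebra_simps)
      also have "\<dots> \<le> \<bar>f x\<bar> * \<bar>f x - g (cis x)\<bar>" by (metis abs_ge_self abs_mult)
      also have "\<dots> \<le> M * e" using M x fg[of x] by (intro mult_mono) auto
      finally show "(f x)\<^sup>2 - f x * g (cis x) \<le> e * M" by (simp add: mult.commute)
    qed (auto intro!: integrable_continuous_real continuous_intros gc per_continuous_on[OF f])
    also have "\<dots> = e * (2 * pi * M)" by simp
    finally show ?thesis .
  qed
  have "integral ?I (\<lambda>x. (f x)\<^sup>2) \<le> 0"
  proof (rule field_le_epsilon)
    fix e :: real assume "e > 0"
    define D where "D = 2 * pi * M + 1"
    have D: "D > 0" "2 * pi * M \<le> D" using M(1) by (auto simp: D_def add_nonneg_pos)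
    have "e / D > 0" "e / D * (2 * pi * M) \<le> e / D * D"
      using D \<open>e > 0\<close> by (auto intro!: mult_left_mono simp del: times_divide_eq_left)
    then show "integral ?I (\<lambda>x. (f x)\<^sup>2) \<le> 0 + e"
      using le[of "e / D"] D(1) by simp
  qed
  moreover have i: "(\<lambda>x. (f x)\<^sup>2) integrable_on ?I"
    by (intro integrable_continuous_real continuous_intros per_continuous_on[OF f])
  moreover have "integral ?I (\<lambda>x. (f x)\<^sup>2) \<ge> 0"
    by (rule Henstock_Kurzweil_Integration.integral_nonneg[OF i]) auto
  ultimately have "((\<lambda>x. (f x)\<^sup>2) has_integral 0) (cbox 0 (2 * pi))"
    by (metis antisym cbox_interval has_integral_integral)
  note hi = this
  have fz: "f y = 0" if "y \<in> ?I" for y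
  proof (rule ccontr)
    assume "f y \<noteq> 0"
    moreover have "continuous_on (cbox 0 (2 * pi)) (\<lambda>x. (f x)\<^sup>2)"
      by (intro continuous_intros per_continuous_on[OF f])
    moreover have "0 < 2 * pi" by simp
    ultimately show False
      using has_integral_0_cbox_imp_0[of 0 "2 * pi" "\<lambda>x. (f x)\<^sup>2" y] that
hi by (simp add: not_le)
  qed
  have "f x = f (Arg2pi (cis x))"
    by (rule per_cis_eq[OF f]) (metis Arg2pi_eq cis_conv_exp norm_cis mult_1 of_real_1 zero_neq_one norm_zero)
  also have "\<dots> = 0"
    using Arg2pi[of "cis x"] by (intro fz) auto
  finally show ?thesis .
qed

text \<open>Vanishing coefficients of \<open>F\<close> at all frequencies pass to the conjugate of
  \<open>F\<close>, hence to the real and imaginary parts.\<close>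

lemma fourier_uniqueness:
  assumes F: "per F" and z: "\<And>n. phat F n = 0"
  shows "F x = 0"
proof -
  have z': "((\<lambda>x. F x * cis (of_int n * x)) has_integral 0) {0..2 * pi}" for n
  proof -
    have "(\<lambda>x. F x * cis (of_int n * x)) integrable_on {0..2 * pi}"
      by (intro integrable_continuous_real continuous_intros per_continuous_on F)
    moreover have "integral {0..2 * pi} (\<lambda>x. F x * cis (of_int n * x)) = 0"
      using z[of "- n"] by (simp add: phat_def)
    ultimately show ?thesis by (metis has_integral_integral)
  qed
  have z'': "((\<lambda>x. cnj (F x) * cis (of_int n * x)) has_integral 0) {0..2 * pi}" for n
    using has_integral_cnj[of "\<lambda>x. F x * cis (of_int (- n) * x)" 0 "{0..2 * pi}"] z'[of "- n"]
    by (simp add: o_def cis_cnj)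
  have c: "per (\<lambda>x. Re (F x))" "per (\<lambda>x. Im (F x))"
    using F by (auto simp: per_def intro: continuous_intros)
  have "integral {0..2 * pi} (\<lambda>x. of_real (Re (F x)) * cis (of_int n * x)) = 0" for n
  proof (rule integral_unique)
    have eq: "(\<lambda>x. of_real (Re (F x)) * cis (of_int n * x)) = (\<lambda>x. (F x * cis (of_int n * x) + cnj (F x) * cis (of_int n * x)) * (1/2))"
      by (simp add: complex_add_cnj flip: distrib_right)
    show "((\<lambda>x. of_real (Re (F x)) * cis (of_int n * x)) has_integral 0) {0..2 * pi}"
      using has_integral_mult_left[OF has_integral_add[OF z'[of n] z''[of n]], of "1/2"] unfolding eq by simp
  qed
  then have "Re (F x) = 0" by (rule fourier_uniqueness_real[OF c(1)])
  moreover have "integral {0..2 * pi} (\<lambda>x. of_real (Im (F x)) * cis (of_int n * x)) = 0" for n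
  proof (rule integral_unique)
    have eq: "(\<lambda>x. of_real (Im (F x)) * cis (of_int n * x)) = (\<lambda>x. (F x * cis (of_int n * x) - cnj (F x) * cis (of_int n * x)) * (- \<i> / 2))"
      by (simp add: complex_diff_cnj flip: left_diff_distrib) (simp add: mult_ac)
    show "((\<lambda>x. of_real (Im (F x)) * cis (of_int n * x)) has_integral 0) {0..2 * pi}"
      using has_integral_mult_left[OF has_integral_diff[OF z'[of n] z''[of n]], of "- \<i> / 2"] unfolding eq by simp
  qed
  then have "Im (F x) = 0" by (rule fourier_uniqueness_real[OF c(2)])
  ultimately show ?thesis by (simp add: complex_eq_iff)
qed

lemma integral_cis: "integral {0..2 * pi} (\<lambda>x. cis (of_int k * x)) = (if k = 0 then of_real (2 * pi) else 0)"
proof (cases "k = 0")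
  case False
  have "((\<lambda>x. cis (of_int k * x) / (\<i> * of_int k)) has_vector_derivative cis (of_int k * x)) (at x within {0..2 * pi})" for x
    unfolding cis_conv_exp using False
    by (auto intro!: derivative_eq_intros has_vector_derivative_real_field simp: field_simps)
  then have "((\<lambda>x. cis (of_int k * x)) has_integral cis (of_int k * (2 * pi)) / (\<i> * of_int k) - cis (of_int k * 0) / (\<i> * of_int k)) {0..2 * pi}"
    by (intro fundamental_theorem_of_calculus) auto
  moreover have "cis (of_int k * (2 * pi)) = 1"
    using cis_multiple_2pi[of "of_int k"] by (simp add: mult_ac)
  ultimately show ?thesis using False by (simp add: integral_unique)
qed (simp add: scaleR_conv_of_real)

section \<open>Absolutely convergent Fourier series\<close>

definition fseries :: "(int \<Rightarrow> complex) \<Rightarrow> real \<Rightarrow> complex" where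
  "fseries a x = (\<Sum>\<^sub>\<infinity>n. a n * cis (of_int n * x))"

context
  fixes a :: "int \<Rightarrow> complex"
  assumes a: "(\<lambda>n. cmod (a n)) summable_on UNIV"
begin

lemma fseries_uniform: "uniform_limit A (\<lambda>F x. \<Sum>n\<in>F. a n * cis (of_int n * x)) (fseries a) (finite_subsets_at_top UNIV)"
  unfolding fseries_def[abs_def] by (rule Weierstrass_m_test_general[OF _ a]) (simp add: norm_mult)

lemma per_fseries: "per (fseries a)"
proof -
  have "continuous_on UNIV (fseries a)"
    by (rule uniform_limit_theorem[OF _ fseries_uniform]) (auto intro!: continuous_intros always_eventually)
  moreover have "cis (of_int n * (x + 2 * pi)) = cis (of_int n * x)" for n x
    using per_cis[of n] by (simp add: per_def)
  ultimately show ?thesis by (simp add: per_def fseries_def)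
qed

text \<open>Uniform convergence allows termwise integration. With \<open>f = 1\<close> this computes
  the coefficients of a series; with a series for \<open>f\<close> it gives the coefficients of a
  product as a convolution.\<close>

lemma phat_mult_fseries:
  assumes f: "per f"
  shows "((\<lambda>m. a m * phat f (n - m)) has_sum phat (\<lambda>x. fseries a x * f x) n) UNIV"
proof -
  let ?g = "\<lambda>x. f x * cis (- (of_int n * x))"
  have gc: "continuous_on A ?g" for A
    by (intro continuous_intros per_continuous_on[OF f])
  have "bounded (?g ` {0..2 * pi})" "bounded (fseries a ` {0..2 * pi})"
    by (intro compact_imp_bounded compact_continuous_image gc per_continuous_on per_fseries compact_Icc)+
  then have u: "uniform_limit {0..2 * pi} (\<lambda>F x. (\<Sum>m\<in>F. a m * cis (of_int m * x)) * ?g x) (\<lambda>x. fseries a x * ?g x) (finite_subsets_at_top UNIV)"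
    by (intro uniform_lim_mult fseries_uniform uniform_limit_const)
  obtain I J where IJ: "\<And>F. ((\<lambda>x. (\<Sum>m\<in>F. a m * cis (of_int m * x)) * ?g x) has_integral I F) {0..2 * pi}"
    "((\<lambda>x. fseries a x * ?g x) has_integral J) {0..2 * pi}" "(I \<longlongrightarrow> J) (finite_subsets_at_top UNIV)"
    by (rule uniform_limit_integral[OF u]) (auto intro!: continuous_intros gc)
  have "I F / of_real (2 * pi) = (\<Sum>m\<in>F. a m * phat f (n - m))" for F
  proof -
    have "I F = integral {0..2 * pi} (\<lambda>x. \<Sum>m\<in>F. a m * (f x * cis (- (of_int (n - m) * x))))"
    proof -
      have "(\<Sum>m\<in>F. a m * cis (of_int m * x)) * ?g x = (\<Sum>m\<in>F. a m * (f x * cis (- (of_int (n - m) * x))))" for x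
        unfolding sum_distrib_right
      proof (intro sum.cong refl)
        fix m
        have "cis (of_int m * x) * cis (- (of_int n * x)) = cis (- (of_int (n - m) * x))"
          by (simp add: cis_mult algebra_simps)
        then show "a m * cis (of_int m * x) * ?g x = a m * (f x * cis (- (of_int (n - m) * x)))"
          by (metis mult.assoc mult.left_commute)
      qed
      then show ?thesis using integral_unique[OF IJ(1)[of F]] by simp
    qed
    also have "\<dots> = (\<Sum>m\<in>F. a m * integral {0..2 * pi} (\<lambda>x. f x * cis (- (of_int (n - m) * x))))"
    proof (cases "finite F")
      case True
      then show ?thesis
        by (subst Henstock_Kurzweil_Integration.integral_sum) (auto intro!: integrable_continuous_real continuous_intros per_continuous_on[OF f])
    qed simp
    finally show ?thesis by (simp add: phat_def sum_divide_distrib)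
  qed
  moreover have "phat (\<lambda>x. fseries a x * f x) n = J / of_real (2 * pi)"
    using integral_unique[OF IJ(2)] by (simp add: phat_def mult.assoc)
  moreover have "((\<lambda>F. I F / of_real (2 * pi)) \<longlongrightarrow> J / of_real (2 * pi)) (finite_subsets_at_top UNIV)"
    by (intro tendsto_intros IJ) auto
  ultimately show ?thesis by (simp add: has_sum_def)
qed

lemma phat_fseries: "phat (fseries a) n = a n"
proof -
  have one: "per (\<lambda>x. 1 :: complex)" by (simp add: per_def)
  have "phat (\<lambda>x. 1) k = (if k = 0 then 1 else 0)" for k
    using integral_cis[of "- k"] by (simp add: phat_def)
  then have "a m * phat (\<lambda>x. 1) (n - m) = (if m = n then a m else 0)" for m
    by simp
  then have "((\<lambda>m. if m = n then a m else 0) has_sum phat (fseries a) n) UNIV"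
    using phat_mult_fseries[OF one, of n] by simp
  from infsumI[OF this] show ?thesis by (simp add: infsum_single)
qed

end

lemma fourier_inversion:
  assumes F: "per F" and s: "(\<lambda>n. cmod (phat F n)) summable_on UNIV"
  shows "F x = fseries (phat F) x"
proof -
  have "per (\<lambda>x. F x - fseries (phat F) x)"
    using F per_fseries[OF s] by (auto simp: per_def intro: continuous_intros)
  moreover have "phat (\<lambda>x. F x - fseries (phat F) x) n = 0" for n
  proof -
    have c: "continuous_on A (fseries (phat F))" for A
      by (rule per_continuous_on[OF per_fseries[OF s]])
    have "phat (\<lambda>x. F x - fseries (phat F) x) n = phat F n - phat (fseries (phat F)) n"
      unfolding phat_def[of _ n] left_diff_distrib diff_divide_distrib[symmetric]
      by (subst Henstock_Kurzweil_Integration.integral_diff)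
        (auto intro!: integrable_continuous_real continuous_intros per_continuous_on[OF F] c)
    then show ?thesis by (simp add: phat_fseries[OF s])
  qed
  ultimately have "F x - fseries (phat F) x = 0"
    by (rule fourier_uniqueness)
  then show ?thesis by simp
qed

section \<open>Distributions and their Fourier coefficients\<close>

lemma pairing_add: "\<phi> \<in> test_functions \<Longrightarrow> \<psi> \<in> test_functions \<Longrightarrow> pairing u (\<lambda>x. \<phi> x + \<psi> x) = pairing u \<phi> + pairing u \<psi>"
  using pairing[of u] by blast

lemma pairing_cmult: "\<phi> \<in> test_functions \<Longrightarrow> pairing u (\<lambda>x. c * \<phi> x) = c * pairing u \<phi>"
  using pairing[of u] by blast

lemma pairing_tendsto:
  assumes "\<phi> \<in> test_functions" "\<And>j. \<Phi> j \<in> test_functions" "test_converges \<Phi> \<phi>"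
  shows "(\<lambda>j. pairing u (\<Phi> j)) \<longlonglongrightarrow> pairing u \<phi>"
  using pairing[of u] assms by blast

lemma fourier_coeff_add: "fourier_coeff (u + w) n = fourier_coeff u n + fourier_coeff w n"
  by (simp add: fourier_coeff_def plus_distr.rep_eq field_simps)

lemma fourier_coeff_diff: "fourier_coeff (u - w) n = fourier_coeff u n - fourier_coeff w n"
  by (simp add: fourier_coeff_def minus_distr.rep_eq field_simps)

lemma fourier_coeff_scaleR: "fourier_coeff (c *\<^sub>R u) n = of_real c * fourier_coeff u n"
  by (simp add: fourier_coeff_def scaleR_distr.rep_eq field_simps)

lemma fourier_coeff_uminus: "fourier_coeff u (- n) = cnj (fourier_coeff u n)"
proof -
  have "pairing u (\<lambda>x. - 1 * sin (of_int n * x)) = - 1 * pairing u (\<lambda>x. sin (of_int n * x))"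
    by (rule pairing_cmult[OF sin_test_functions])
  then show ?thesis by (simp add: fourier_coeff_def)
qed

text \<open>The real part of the exponential sum with coefficients \<open>c\<close>, written with
  cosines and sines because test functions are real valued.\<close>

definition tpoly :: "(int \<Rightarrow> complex) \<Rightarrow> int set \<Rightarrow> real \<Rightarrow> real" where
  "tpoly c F x = (\<Sum>n\<in>F. Re (c n) * cos (of_int n * x) + (- Im (c n)) * sin (of_int n * x))"

lemma tpoly_Re: "tpoly c F x = Re (\<Sum>n\<in>F. c n * cis (of_int n * x))"
  by (simp add: tpoly_def)

lemma
  assumes "finite F"
  shows tpoly_test: "tpoly c F \<in> test_functions"
    and pairing_tpoly: "pairing u (tpoly c F) = 2 * pi * (\<Sum>n\<in>F. Re (c n * cnj (fourier_coeff u n)))"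
  using assms
proof (induction F)
  case empty
  have z: "tpoly c {} = (\<lambda>x. 0 * cos (of_int 0 * x))" by (simp add: tpoly_def fun_eq_iff)
  show "tpoly c {} \<in> test_functions" unfolding z by (rule test_functions_cmult[OF cos_test_functions])
  show "pairing u (tpoly c {}) = 2 * pi * (\<Sum>n\<in>{}. Re (c n * cnj (fourier_coeff u n)))"
    unfolding z by (simp only: pairing_cmult[OF cos_test_functions]) simp
next
  case (insert n F)
  have e: "tpoly c (insert n F) = (\<lambda>x. (Re (c n) * cos (of_int n * x) + (- Im (c n)) * sin (of_int n * x)) + tpoly c F x)"
    using insert(1,2) by (simp add: tpoly_def fun_eq_iff)
  show "tpoly c (insert n F) \<in> test_functions"
    unfolding e by (rule test_functions_add[OF cos_sin_test_functions insert(3)])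
  have "pairing u (\<lambda>x. Re (c n) * cos (of_int n * x) + (- Im (c n)) * sin (of_int n * x))
      = Re (c n) * pairing u (\<lambda>x. cos (of_int n * x)) + (- Im (c n)) * pairing u (\<lambda>x. sin (of_int n * x))"
    by (simp only: pairing_add[OF test_functions_cmult[OF cos_test_functions] test_functions_cmult[OF sin_test_functions]]
        pairing_cmult[OF cos_test_functions] pairing_cmult[OF sin_test_functions])
  also have "\<dots> = 2 * pi * Re (c n * cnj (fourier_coeff u n))"
    by (simp add: fourier_coeff_def Re_divide_of_real Im_divide_of_real del: of_real_mult)
  finally show "pairing u (tpoly c (insert n F)) = 2 * pi * (\<Sum>n\<in>insert n F. Re (c n * cnj (fourier_coeff u n)))"
    unfolding e by (subst pairing_add[OF cos_sin_test_functions insert(3)])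
      (use insert in \<open>simp add: distrib_left\<close>)
qed

lemma deriv_tpoly: "deriv (tpoly c F) = tpoly (\<lambda>n. \<i> * of_int n * c n) F"
proof (rule ext, rule DERIV_imp_deriv)
  fix x
  show "(tpoly c F has_field_derivative tpoly (\<lambda>n. \<i> * of_int n * c n) F x) (at x)"
    unfolding tpoly_def[abs_def]
    by (rule derivative_eq_intros refl | simp)+ (auto intro!: sum.cong simp: algebra_simps)
qed

lemma funpow_deriv_tpoly: "(deriv ^^ k) (tpoly c F) = tpoly (\<lambda>n. (\<i> * of_int n) ^ k * c n) F"
  by (induction k) (simp_all add: deriv_tpoly mult.assoc)

definition tcoef :: "(real \<Rightarrow> real) \<Rightarrow> int \<Rightarrow> complex" where
  "tcoef f = phat (\<lambda>x. of_real (f x))"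

lemma test_functions_funpow: "\<phi> \<in> test_functions \<Longrightarrow> (deriv ^^ k) \<phi> \<in> test_functions"
  by (induction k) (simp_all add: test_functions_deriv)

lemma test_functions_DERIV: "\<phi> \<in> test_functions \<Longrightarrow> (\<phi> has_real_derivative deriv \<phi> x) (at x)"
  by (simp add: DERIV_deriv_iff_field_differentiable test_functions_differentiable)

lemma test_functions_per:
  assumes "\<phi> \<in> test_functions"
  shows "per \<phi>" "per (\<lambda>x. complex_of_real (\<phi> x))"
proof -
  have "continuous_on UNIV \<phi>"
    using test_functions_DERIV[OF assms] by (intro DERIV_continuous_on) (auto intro: has_field_derivative_at_within)
  then show "per \<phi>" using assms by (simp add: per_def test_functions_def)
  then show "per (\<lambda>x. complex_of_real (\<phi> x))" by (auto simp: per_def intro: continuous_intros)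
qed

lemma tcoef_deriv:
  assumes p: "\<phi> \<in> test_functions"
  shows "tcoef (deriv \<phi>) n = \<i> * of_int n * tcoef \<phi> n"
proof -
  let ?e = "\<lambda>x. cis (- (of_int n * x))" and ?I = "{0..2 * pi}"
  note c = per_continuous_on[OF test_functions_per(2)[OF p]] per_continuous_on[OF test_functions_per(2)[OF test_functions_deriv[OF p]]]
  have d: "((\<lambda>x. of_real (\<phi> x) * ?e x) has_vector_derivative
      (of_real (deriv \<phi> x) * ?e x - \<i> * of_int n * (of_real (\<phi> x) * ?e x))) (at x within ?I)" for x
  proof -
    have "((\<lambda>x. complex_of_real (\<phi> x)) has_vector_derivative of_real (deriv \<phi> x)) (at x within ?I)"
      using test_functions_DERIV[OF p, of x]
      by (intro has_vector_derivative_of_real) (simp add: has_field_derivative_at_within flip: has_real_derivative_iff_has_vector_derivative)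
    moreover have "(?e has_vector_derivative - \<i> * of_int n * ?e x) (at x within ?I)"
      unfolding cis_conv_exp by (auto intro!: derivative_eq_intros has_vector_derivative_real_field simp: field_simps)
    ultimately show ?thesis
      using has_vector_derivative_mult by (fastforce simp: algebra_simps)
  qed
  have "((\<lambda>x. of_real (deriv \<phi> x) * ?e x - \<i> * of_int n * (of_real (\<phi> x) * ?e x)) has_integral
      of_real (\<phi> (2 * pi)) * ?e (2 * pi) - of_real (\<phi> 0) * ?e 0) ?I"
    by (rule fundamental_theorem_of_calculus[OF _ d]) simp
  moreover have "\<phi> (2 * pi) = \<phi> 0" using p by (auto simp: test_functions_def dest: spec[of _ 0])
  moreover have "?e (2 * pi) = 1"
    using cis_multiple_2pi[of "of_int (- n)"] by (simp add: mult_ac)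
  ultimately have "integral ?I (\<lambda>x. of_real (deriv \<phi> x) * ?e x - \<i> * of_int n * (of_real (\<phi> x) * ?e x)) = 0"
    by (intro integral_unique) simp
  then have "integral ?I (\<lambda>x. of_real (deriv \<phi> x) * ?e x) = \<i> * of_int n * integral ?I (\<lambda>x. of_real (\<phi> x) * ?e x)"
    by (subst (asm) Henstock_Kurzweil_Integration.integral_diff)
      (auto intro!: integrable_continuous_real continuous_intros c)
  then show ?thesis by (simp add: tcoef_def phat_def)
qed

lemma tcoef_funpow: "\<phi> \<in> test_functions \<Longrightarrow> tcoef ((deriv ^^ k) \<phi>) n = (\<i> * of_int n) ^ k * tcoef \<phi> n"
  by (induction k) (simp_all add: tcoef_deriv test_functions_funpow mult.assoc)

lemma phat_bounded:
  assumes "per f"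
  shows "\<exists>M. \<forall>n. cmod (phat f n) \<le> M"
proof -
  have "cmod (integral {0..2 * pi} (\<lambda>x. f x * cis (- (of_int n * x)))) \<le> integral {0..2 * pi} (\<lambda>x. cmod (f x))" for n
    by (rule integral_norm_bound_integral)
      (auto intro!: integrable_continuous_real continuous_intros per_continuous_on[OF assms] simp: norm_mult)
  then show ?thesis
    by (intro exI[of _ "integral {0..2 * pi} (\<lambda>x. cmod (f x)) / (2 * pi)"] allI)
      (auto simp: phat_def norm_divide intro: divide_right_mono)
qed

lemma abs_summable_decay:
  assumes "\<And>n. cmod (a n) \<le> M * br (n :: int) powr (- 2)"
  shows "(\<lambda>n. cmod (a n)) summable_on UNIV"
proof -
  obtain Z where Z: "\<And>F. finite F \<Longrightarrow> (\<Sum>n\<in>F. br (n :: int) powr (- 2)) \<le> Z"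
    using zeta_bound[of 1] by auto
  have "(\<lambda>n :: int. br n powr (- 2)) summable_on UNIV"
    by (intro nonneg_bdd_above_summable_on) (auto intro!: bdd_aboveI2[where M = Z] Z)
  then have "(\<lambda>n :: int. M * br n powr (- 2)) summable_on UNIV"
    by (rule summable_on_cmult_right)
  then show ?thesis
    by (rule summable_on_comparison_test) (use assms in auto)
qed

text \<open>The coefficients of the second derivative are bounded, which gives quadratic
  decay.\<close>

lemma tcoef_summable:
  assumes p: "\<phi> \<in> test_functions"
  shows "(\<lambda>n. cmod (tcoef \<phi> n)) summable_on UNIV"
proof -
  obtain M M' where M: "\<And>n. cmod (tcoef \<phi> n) \<le> M" "\<And>n. cmod (tcoef ((deriv ^^ 2) \<phi>) n) \<le> M'"
    using phat_bounded[OF test_functions_per(2)[OF p]] phat_bounded[OF test_functions_per(2)[OF test_functions_funpow[OF p, of 2]]]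
    unfolding tcoef_def by blast
  show ?thesis
  proof (rule abs_summable_decay)
    fix n :: int
    have nn: "0 \<le> M" "0 \<le> M'" using M[of 0] norm_ge_zero order_trans by blast+
    show "cmod (tcoef \<phi> n) \<le> (M + M') * br n powr (- 2)"
    proof (cases "n = 0")
      case True
      then show ?thesis using M(1)[of 0] nn by (simp add: br_int_simps)
    next
      case False
      have "cmod (tcoef \<phi> n) * (br n)\<^sup>2 \<le> M'"
      proof -
        have "br n = \<bar>of_int n\<bar>" using False by (simp add: br_int_simps max_def)
        then show ?thesis
          using M(2)[of n] unfolding tcoef_funpow[OF p] by (simp add: norm_mult norm_power mult.commute)
      qed
      then have "cmod (tcoef \<phi> n) * (br n)\<^sup>2 \<le> M + M'" using nn by simp
      moreover have e: "br n powr (- 2) = inverse ((br n)\<^sup>2)"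
        by (simp only: powr_minus powr_numeral[OF less_imp_le[OF br_pos(1)]])
      ultimately show ?thesis
        unfolding e divide_inverse[symmetric] by (simp only: pos_le_divide_eq[OF zero_less_power[OF br_pos(1)]])
    qed
  qed
qed

text \<open>All orders of derivatives are alike: the derivative of a partial sum is the partial sum
  of the derivative, which is a test function with absolutely summable coefficients.\<close>

lemma test_converges_tpoly:
  assumes p: "\<phi> \<in> test_functions"
  shows "test_converges (\<lambda>j. tpoly (tcoef \<phi>) {- int j..int j}) \<phi>"
  unfolding test_converges_def
proof
  fix k
  let ?\<psi> = "(deriv ^^ k) \<phi>"
  note q = test_functions_funpow[OF p, of k]
  have "filterlim (\<lambda>j. {- int j..int j}) (finite_subsets_at_top UNIV) sequentially"
    unfolding filterlim_finite_subsets_at_top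
  proof (intro allI impI)
    fix X :: "int set" assume "finite X \<and> X \<subseteq> UNIV"
    then have "finite ((\<lambda>x. nat \<bar>x\<bar>) ` X)" by blast
    then obtain N where N: "\<And>x. x \<in> X \<Longrightarrow> nat \<bar>x\<bar> \<le> N" by (metis finite_nat_set_iff_bounded_le imageI)
    have "X \<subseteq> {- int j..int j}" if "j \<ge> N" for j
      using N that by fastforce
    then show "\<forall>\<^sub>F j in sequentially. finite {- int j..int j} \<and> X \<subseteq> {- int j..int j} \<and> {- int j..int j} \<subseteq> UNIV"
      by (intro eventually_sequentiallyI[of N]) auto
  qed
  then have "uniform_limit UNIV (\<lambda>j x. \<Sum>n\<in>{- int j..int j}. tcoef ?\<psi> n * cis (of_int n * x)) (fseries (tcoef ?\<psi>)) sequentially"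
    using filterlim_compose[OF fseries_uniform[OF tcoef_summable[OF q], unfolded]] by blast
  from bounded_linear.uniform_limit[OF bounded_linear_Re this]
  have "uniform_limit UNIV (\<lambda>j. tpoly (tcoef ?\<psi>) {- int j..int j}) (\<lambda>x. Re (fseries (tcoef ?\<psi>) x)) sequentially"
    by (simp only: tpoly_Re[abs_def])
  moreover have "Re (fseries (tcoef ?\<psi>) x) = ?\<psi> x" for x
    using fourier_inversion[OF test_functions_per(2)[OF q], of x] tcoef_summable[OF q] by (simp add: tcoef_def flip: tcoef_def) (metis Re_complex_of_real tcoef_def)
  moreover have "tcoef ?\<psi> = (\<lambda>n. (\<i> * of_int n) ^ k * tcoef \<phi> n)"
    using tcoef_funpow[OF p] by blast
  ultimately show "uniform_limit UNIV (\<lambda>j. (deriv ^^ k) (tpoly (tcoef \<phi>) {- int j..int j})) ?\<psi> sequentially"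
    by (simp only: funpow_deriv_tpoly)
qed

text \<open>Trigonometric polynomials are dense in the test functions, and pairings with them are
  determined by the Fourier coefficients. This is the uniqueness behind the definite descriptions in
  \<open>hilbert\<close> and \<open>distr_square\<close>.\<close>

lemma distr_eqI:
  assumes "\<And>n. fourier_coeff u n = fourier_coeff w n"
  shows "u = w"
proof -
  have "pairing u \<phi> = pairing w \<phi>" for \<phi>
  proof (cases "\<phi> \<in> test_functions")
    case True
    have "(\<lambda>j. pairing u (tpoly (tcoef \<phi>) {- int j..int j})) = (\<lambda>j. pairing w (tpoly (tcoef \<phi>) {- int j..int j}))"
      by (simp add: pairing_tpoly assms)
    then show ?thesis
      using pairing_tendsto[OF True tpoly_test test_converges_tpoly[OF True], of u]
        pairing_tendsto[OF True tpoly_test test_converges_tpoly[OF True], of w]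
      by (metis LIMSEQ_unique finite_atLeastAtMost_int)
  next
    case False
    then show ?thesis using pairing[of u] pairing[of w] by simp
  qed
  then show ?thesis by (metis ext pairing_inject)
qed

lemma represents_exists:
  assumes f: "per f"
  shows "\<exists>u. represents f u"
proof -
  let ?I = "{0..2 * pi}"
  define L where "L \<phi> = (if \<phi> \<in> test_functions then integral ?I (\<lambda>x. f x * \<phi> x) else 0)" for \<phi>
  note fc = per_continuous_on[OF f] and tc = per_continuous_on[OF test_functions_per(1)]
  have i: "(\<lambda>x. f x * \<phi> x) integrable_on ?I" if "\<phi> \<in> test_functions" for \<phi>
    by (intro integrable_continuous_real continuous_intros fc tc that)
  have "L (\<lambda>x. \<phi> x + \<psi> x) = L \<phi> + L \<psi>" if "\<phi> \<in> test_functions" "\<psi> \<in> test_functions" for \<phi> \<psi>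
    using that Henstock_Kurzweil_Integration.integral_add[OF i[OF that(1)] i[OF that(2)]]
    by (simp add: L_def test_functions_add distrib_left)
  moreover have "L (\<lambda>x. c * \<phi> x) = c * L \<phi>" if "\<phi> \<in> test_functions" for c \<phi>
    using that integral_mult_right[of ?I c "\<lambda>x. f x * \<phi> x"] by (simp add: L_def test_functions_cmult mult.left_commute)
  moreover have "(\<lambda>j. L (\<Phi> j)) \<longlonglongrightarrow> L \<phi>"
    if p: "\<phi> \<in> test_functions" "\<forall>j. \<Phi> j \<in> test_functions" "test_converges \<Phi> \<phi>" for \<Phi> \<phi>
  proof -
    have u: "uniform_limit ?I \<Phi> \<phi> sequentially"
      using p(3) unfolding test_converges_def by (metis (no_types, lifting) funpow_0 uniform_limit_on_subset subset_UNIV ext)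
    have "bounded (\<phi> ` ?I)" "bounded (f ` ?I)"
      by (intro compact_imp_bounded compact_continuous_image fc tc p compact_Icc)+
    then have u: "uniform_limit ?I (\<lambda>j x. f x * \<Phi> j x) (\<lambda>x. f x * \<phi> x) sequentially"
      by (intro uniform_lim_mult u uniform_limit_const)
    have c: "continuous_on ?I (\<lambda>x. f x * \<Phi> j x)" for j
      by (intro continuous_on_mult fc tc p(2)[rule_format])
    obtain Q R where QR: "\<And>j. ((\<lambda>x. f x * \<Phi> j x) has_integral Q j) ?I"
      "((\<lambda>x. f x * \<phi> x) has_integral R) ?I" "Q \<longlonglongrightarrow> R"
      by (rule uniform_limit_integral[OF u c sequentially_bot]) (rule that)
    have "L (\<Phi> j) = Q j" for j using p(2) integral_unique[OF QR(1)] by (simp add: L_def)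
    moreover have "L \<phi> = R" using p(1) integral_unique[OF QR(2)] by (simp add: L_def)
    ultimately show ?thesis using QR(3) by simp
  qed
  ultimately have "pairing (Abs_distr L) = L"
    by (intro Abs_distr_inverse) (simp add: L_def)
  then have "represents f (Abs_distr L)"
    using f by (simp add: represents_def per_def L_def)
  then show ?thesis by blast
qed

lemma fourier_coeff_represents_phat: "represents f u \<Longrightarrow> fourier_coeff u n = phat (\<lambda>x. of_real (f x)) n"
  by (simp add: fourier_coeff_represents phat_def cis_conv_exp mult.assoc)

lemma represents_per: "represents f u \<Longrightarrow> per f"
  by (simp add: represents_def per_def)

lemma represents_unique:
  assumes "represents f u" "represents g u"
  shows "f = g"
proof
  fix x
  have p: "per (\<lambda>x. complex_of_real (f x))" "per (\<lambda>x. complex_of_real (g x))"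
    using assms[THEN represents_per] by (auto simp: per_def intro: continuous_intros)
  have "per (\<lambda>x. complex_of_real (f x) - complex_of_real (g x))"
    using p by (auto simp: per_def intro: continuous_intros)
  moreover have "phat (\<lambda>x. complex_of_real (f x) - complex_of_real (g x)) n = 0" for n
  proof -
    have "phat (\<lambda>x. complex_of_real (f x) - complex_of_real (g x)) n = phat (\<lambda>x. of_real (f x)) n - phat (\<lambda>x. of_real (g x)) n"
      unfolding phat_def left_diff_distrib diff_divide_distrib[symmetric]
      by (subst Henstock_Kurzweil_Integration.integral_diff)
        (auto intro!: integrable_continuous_real continuous_intros p[THEN per_continuous_on])
    then show ?thesis using assms[THEN fourier_coeff_represents_phat] by (metis diff_self)
  qed
  ultimately have "complex_of_real (f x) - complex_of_real (g x) = 0"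
    by (rule fourier_uniqueness)
  then show "f x = g x" by simp
qed

lemma represents_fseries:
  assumes s: "(\<lambda>n. cmod (a n)) summable_on UNIV" and h: "\<And>n. a (- n) = cnj (a n)"
  shows "\<exists>f u. represents f u \<and> (\<forall>x. complex_of_real (f x) = fseries a x) \<and> fourier_coeff u = a"
proof -
  have "cnj (fseries a x) = fseries a x" for x
  proof -
    have "cnj (fseries a x) = (\<Sum>\<^sub>\<infinity>n. a (- n) * cis (of_int (- n) * x))"
      unfolding fseries_def infsum_cnj[symmetric] by (simp add: h cis_cnj)
    also have "\<dots> = fseries a x"
      unfolding fseries_def by (rule infsum_reindex_bij_betw[where f = "\<lambda>n. a n * cis (of_int n * x)"]) (rule bij_uminus)
    finally show ?thesis .
  qed
  then have r: "complex_of_real (Re (fseries a x)) = fseries a x" for x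
    by (simp add: complex_eq_iff)
  have "per (\<lambda>x. Re (fseries a x))"
    using per_fseries[OF s] by (auto simp: per_def intro: continuous_intros)
  then obtain u where u: "represents (\<lambda>x. Re (fseries a x)) u" using represents_exists by blast
  have "fourier_coeff u = a"
    using fourier_coeff_represents_phat[OF u] phat_fseries[OF s] unfolding r by (intro ext) simp
  then show ?thesis using u r by blast
qed

text \<open>Division by \<open>n ^ 4\<close> makes the coefficients absolutely summable; the
  continuous function with these coefficients is differentiated four times, which multiplies by
  \<open>n ^ 4\<close> without a power of \<open>\<i>\<close>. The mean is lost on the way and added
  as a constant.\<close>

lemma distr_exists:
  assumes b: "\<And>n. cmod (a n) \<le> C * br n" and h: "\<And>n. a (- n) = cnj (a n)"
  shows "\<exists>u. fourier_coeff u = a"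
proof -
  define b where "b n = (if n = 0 then 0 else a n / of_int n ^ 4)" for n
  have "C \<ge> 0" using order_trans[OF norm_ge_zero assms(1)[of 0]] by (simp add: br_int_simps)
  have "(\<lambda>n. cmod (b n)) summable_on UNIV"
  proof (rule abs_summable_decay)
    fix n :: int
    show "cmod (b n) \<le> C * br n powr (- 2)"
    proof (cases "n = 0")
      case False
      then have br: "br n = \<bar>of_int n\<bar>" by (simp add: br_int_simps max_def)
      have "cmod (b n) = cmod (a n) / br n ^ 4" using False by (simp add: b_def norm_divide norm_power br)
      also have "\<dots> \<le> C * br n / br n ^ 4" by (intro divide_right_mono assms(1)) simp
      also have "\<dots> = C * (br n ^ 1 / br n ^ 4)" by simp
      also have "\<dots> \<le> C * (br n ^ 2 / br n ^ 4)"
        using \<open>C \<ge> 0\<close> br_ge1[of n] by (intro mult_left_mono divide_right_mono power_increasing) auto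
      also have "br n ^ 2 / br n ^ 4 = inverse (br n ^ 2)" by (simp add: field_simps flip: power_add)
      also have "\<dots> = br n powr (- 2)" by (simp only: powr_minus powr_numeral[OF less_imp_le[OF br_pos(1)]])
      finally show ?thesis .
    qed (use \<open>C \<ge> 0\<close> in \<open>simp add: b_def br_int_simps\<close>)
  qed
  moreover have "b (- n) = cnj (b n)" for n by (simp add: b_def h)
  ultimately obtain u where u: "fourier_coeff u = b" using represents_fseries[of b] by blast
  define c where "c n = (if n = 0 then a 0 else 0)" for n :: int
  have "(\<lambda>n. cmod (c n)) summable_on UNIV"
    by (rule finite_nonzero_values_imp_summable_on) (simp add: c_def)
  moreover have "c (- n) = cnj (c n)" for n using h[of 0] by (simp add: c_def)
  ultimately obtain w where w: "fourier_coeff w = c" using represents_fseries[of c] by blast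
  have "fourier_coeff (distr_deriv (distr_deriv (distr_deriv (distr_deriv u))) + w) n = a n" for n
    by (simp add: fourier_coeff_add fourier_coeff_distr_deriv u w b_def c_def power4_eq_xxxx)
  then show ?thesis by blast
qed

section \<open>Sobolev spaces and the terms of the equation in Fourier coefficients\<close>

lemma sobolev_iff: "u \<in> sobolev \<sigma> \<longleftrightarrow> insob \<sigma> (fourier_coeff u)"
  by (simp add: sobolev_def insob_summable br_int_def)

lemma sobolev_norm_hn:
  assumes "insob \<sigma> (fourier_coeff u)"
  shows "sobolev_norm \<sigma> u = hn \<sigma> (fourier_coeff u)"
  using hn_sq[OF assms] by (simp add: sobolev_norm_def br_int_def real_sqrt_unique)

text \<open>An order of at least -1 means at most linear growth, which \<open>distr_exists\<close>
  admits; this covers the rough order \<open>- s\<close> and the order \<open>\<sigma> - 2\<close>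
  of second derivatives.\<close>

lemma insob_distr_exists:
  assumes "insob r a" "- 1 \<le> r" "\<And>n. a (- n) = cnj (a n)"
  shows "\<exists>u. fourier_coeff u = a"
proof (rule distr_exists)
  fix n
  show "a (- n) = cnj (a n)" by (rule assms(3))
  have "cmod (a n) \<le> br n powr (- r) * hn r a" by (rule coord_le_hn[OF assms(1)])
  also have "\<dots> \<le> br n powr 1 * hn r a"
    using br_ge1[of n] assms(2) by (intro mult_right_mono powr_mono) auto
  finally show "cmod (a n) \<le> hn r a * br n" by (simp add: mult.commute)
qed

lemma fourier_coeff_hilbert:
  assumes "insob r (fourier_coeff u)" "- 1 \<le> r"
  shows "fourier_coeff (hilbert u) n = - \<i> * of_int (sgn n) * fourier_coeff u n"
proof -
  let ?a = "\<lambda>n. - \<i> * of_int (sgn n) * fourier_coeff u n"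
  have "insob r ?a"
    by (rule insob_dominated(1)[OF assms(1), of _ _ 1]) (auto simp: norm_mult sgn_if intro!: mult_left_mono)
  then have "\<exists>w. fourier_coeff w = ?a"
    by (rule insob_distr_exists[OF _ assms(2)]) (simp add: fourier_coeff_uminus)
  then have "\<exists>!w. \<forall>n. fourier_coeff w n = ?a n"
    by (metis distr_eqI)
  from theI'[OF this] show ?thesis unfolding hilbert_def by blast
qed

lemma insob_abs_summable:
  assumes a: "insob \<sigma> a" and "\<sigma> > 1 / 2"
  shows "(\<lambda>n :: int. cmod (a n)) summable_on UNIV"
proof -
  obtain Z where Z: "Z \<ge> 0" "\<And>F. finite F \<Longrightarrow> (\<Sum>n\<in>F. br (n :: int) powr (- 2 * \<sigma>)) \<le> Z"
    using zeta_bound[OF assms(2)] by auto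
  have "(\<Sum>n\<in>F. cmod (a n)) \<le> sqrt Z * hn \<sigma> a" if F: "finite F" for F
  proof -
    have "(\<Sum>n\<in>F. cmod (a n)) = (\<Sum>n\<in>F. br n powr (- \<sigma>) * (br n powr \<sigma> * cmod (a n)))"
      by (simp flip: mult.assoc powr_add)
    also have "\<dots> \<le> L2_set (\<lambda>n. br n powr (- \<sigma>)) F * L2_set (\<lambda>n. br n powr \<sigma> * cmod (a n)) F"
      using L2_set_mult_ineq[of "\<lambda>n. br n powr (- \<sigma>)" "\<lambda>n. br n powr \<sigma> * cmod (a n)" F] by simp
    also have "\<dots> \<le> sqrt Z * hn \<sigma> a"
      using Z(2)[OF F] sum_le_hn[OF a F]
      by (intro mult_mono) (auto simp: L2_set_def power_mult_distrib br_powr_sq real_le_lsqrt Z(1) intro: sum_nonneg)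
    finally show ?thesis .
  qed
  then show ?thesis
    by (intro nonneg_bdd_above_summable_on) (auto intro!: bdd_aboveI2)
qed

text \<open>Above order 1/2 the Fourier series converges absolutely to a function that represents
  \<open>u\<close>, so the square is the described distribution; its coefficients come from
  \<open>phat_mult_fseries\<close>.\<close>

lemma fourier_coeff_distr_square:
  assumes "insob \<sigma> (fourier_coeff u)" "\<sigma> > 1 / 2"
  shows "fourier_coeff (distr_square u) = conv (fourier_coeff u) (fourier_coeff u)"
proof -
  let ?a = "fourier_coeff u"
  note s = insob_abs_summable[OF assms]
  obtain f u' where f: "represents f u'" "\<And>x. complex_of_real (f x) = fseries ?a x" "fourier_coeff u' = ?a"
    using represents_fseries[OF s fourier_coeff_uminus] by blast
  have u: "u' = u" by (rule distr_eqI) (simp add: f(3))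
  have "per (\<lambda>x. (f x)\<^sup>2)" using represents_per[OF f(1)] by (auto simp: per_def intro: continuous_intros)
  then obtain w where w: "represents (\<lambda>x. (f x)\<^sup>2) w" using represents_exists by blast
  have "distr_square u = w"
    unfolding distr_square_def
  proof (rule the_equality)
    show "\<exists>f. represents f u \<and> represents (\<lambda>x. (f x)\<^sup>2) w" using f(1) u w by blast
  next
    fix w' assume "\<exists>f. represents f u \<and> represents (\<lambda>x. (f x)\<^sup>2) w'"
    then have "represents (\<lambda>x. (f x)\<^sup>2) w'" using represents_unique f(1) u by metis
    then show "w' = w" using w by (intro distr_eqI) (simp add: fourier_coeff_represents_phat)
  qed
  moreover have "fourier_coeff w n = conv ?a ?a n" for n
  proof -
    have "fourier_coeff w n = phat (\<lambda>x. fseries ?a x * fseries ?a x) n"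
      by (simp add: fourier_coeff_represents_phat[OF w] f(2) power2_eq_square)
    also have "\<dots> = (\<Sum>\<^sub>\<infinity>m. ?a m * ?a (n - m))"
      using infsumI[OF phat_mult_fseries[OF s per_fseries[OF s], of n]] by (simp add: phat_fseries[OF s])
    finally show ?thesis by (simp add: conv_def mult.commute)
  qed
  ultimately show ?thesis by blast
qed

lemma fourier_coeff_bo_rhs:
  assumes "insob \<sigma> (fourier_coeff u)" "\<sigma> \<ge> 1"
  shows "fourier_coeff (bo_rhs u) n =
    \<i> * of_int (sgn n * n\<^sup>2) * fourier_coeff u n - \<i> * of_int n * conv (fourier_coeff u) (fourier_coeff u) n"
proof -
  have "insob (\<sigma> - 2) (fourier_coeff (distr_deriv (distr_deriv u)))"
  proof (rule insob_dominated(1)[OF assms(1), of _ _ 1])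
    fix n
    have "cmod (fourier_coeff (distr_deriv (distr_deriv u)) n) = \<bar>of_int n\<bar> ^ 2 * cmod (fourier_coeff u n)"
      by (simp add: fourier_coeff_distr_deriv norm_mult power2_eq_square)
    also have "\<dots> \<le> br n ^ 2 * cmod (fourier_coeff u n)"
      by (intro mult_right_mono power_mono) (auto simp: br_int_simps)
    finally have "br n powr (\<sigma> - 2) * cmod (fourier_coeff (distr_deriv (distr_deriv u)) n) \<le> br n powr (\<sigma> - 2) * (br n powr 2 * cmod (fourier_coeff u n))"
      by (intro mult_left_mono) simp_all
    also have "\<dots> = 1 * (br n powr \<sigma> * cmod (fourier_coeff u n))"
      by (simp only: mult.assoc[symmetric] powr_add[symmetric]) simp
    finally show "br n powr (\<sigma> - 2) * cmod (fourier_coeff (distr_deriv (distr_deriv u)) n) \<le> 1 * (br n powr \<sigma> * cmod (fourier_coeff u n))" .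
  qed simp
  moreover have "- \<i> * s * (\<i> * m * (\<i> * m * c)) = \<i> * (s * m\<^sup>2) * c" for s m c :: complex
  proof -
    have "- \<i> * s * (\<i> * m * (\<i> * m * c)) = - (\<i> * \<i>) * (\<i> * (s * m\<^sup>2) * c)" by (simp only: power2_eq_square minus_mult_left mult_ac)
    then show ?thesis by simp
  qed
  ultimately show ?thesis
    using fourier_coeff_hilbert[of "\<sigma> - 2" "distr_deriv (distr_deriv u)" n] assms
    by (simp add: bo_rhs_def fourier_coeff_diff fourier_coeff_distr_deriv fourier_coeff_distr_square[of \<sigma>])
qed

section \<open>Classical solutions\<close>

definition bo :: "(int \<Rightarrow> complex) \<Rightarrow> int \<Rightarrow> complex" where
  "bo x k = \<i> * of_int (sgn k * k\<^sup>2) * x k - \<i> * of_int k * conv x x k"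

lemma symbol_bound:
  fixes x :: "int \<Rightarrow> complex"
  assumes "insob r x" "\<And>k. cmod (m k) \<le> br k powr d"
  shows "insob (r - d) (\<lambda>k. m k * x k)" "hn (r - d) (\<lambda>k. m k * x k) \<le> hn r x"
proof -
  have "br k powr (r - d) * cmod (m k * x k) \<le> 1 * (br k powr r * cmod (x k))" for k
  proof -
    have "br k powr (r - d) * cmod (m k * x k) \<le> br k powr (r - d) * (br k powr d * cmod (x k))"
      unfolding norm_mult by (intro mult_left_mono mult_right_mono assms(2)) simp_all
    also have "\<dots> = 1 * (br k powr r * cmod (x k))"
      by (simp only: mult.assoc[symmetric] powr_add[symmetric]) simp
    finally show ?thesis .
  qed
  from insob_dominated[OF assms(1) this zero_le_one]
  show "insob (r - d) (\<lambda>k. m k * x k)" "hn (r - d) (\<lambda>k. m k * x k) \<le> hn r x" by simp_all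
qed

lemma symbol_k: "cmod (of_int k) \<le> br (k :: int) powr 1"
  by (simp add: br_int_simps)

lemma symbol_k2: "cmod (\<i> * of_int (sgn k * k\<^sup>2)) \<le> br (k :: int) powr 2"
proof -
  have "cmod (\<i> * of_int (sgn k * k\<^sup>2)) \<le> \<bar>of_int k\<bar> ^ 2" by (simp add: norm_mult abs_mult sgn_if norm_power)
  also have "\<dots> \<le> br k ^ 2" by (intro power_mono) (auto simp: br_int_simps)
  finally show ?thesis by simp
qed

lemma conv_commute: "conv x y k = conv y x k"
proof -
  have "(\<Sum>\<^sub>\<infinity>m. x (k - m) * y m) = (\<Sum>\<^sub>\<infinity>m. x (k - (k - m)) * y (k - m))"
    by (rule infsum_reindex_bij_betw[symmetric, of "\<lambda>m. k - m" UNIV UNIV "\<lambda>m. x (k - m) * y m"])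
      (rule bij_betwI[of _ _ _ "\<lambda>m. k - m"]; simp)
  then show ?thesis by (simp add: conv_def mult.commute)
qed

lemma conv_0_bound:
  assumes "\<sigma> > 1 / 2"
  shows "\<exists>K\<ge>0. \<forall>b c. insob \<sigma> b \<longrightarrow> insob 0 c \<longrightarrow>
    (\<forall>k. (\<lambda>m. b (k - m) * c m) summable_on UNIV) \<and> insob 0 (conv b c) \<and> hn 0 (conv b c) \<le> K * hn \<sigma> b * hn 0 c"
  using conv_bound[of \<sigma> 0 0] assms by auto

lemma conv_summable:
  fixes b c :: "int \<Rightarrow> complex"
  assumes "\<sigma> > 1 / 2" "insob \<sigma> b" "insob 0 c"
  shows "(\<lambda>m. b (k - m) * c m) summable_on UNIV"
  using conv_0_bound[OF assms(1)] assms(2,3) by blast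

lemma
  fixes f g :: "'a \<Rightarrow> complex"
  assumes "f summable_on A" "g summable_on A"
  shows summable_on_minus: "(\<lambda>i. f i - g i) summable_on A"
    and infsum_minus: "(\<Sum>\<^sub>\<infinity>i\<in>A. f i - g i) = infsum f A - infsum g A"
proof -
  have g: "(\<lambda>i. - g i) summable_on A" using assms(2) by (simp add: summable_on_uminus)
  show "(\<lambda>i. f i - g i) summable_on A" using summable_on_add[OF assms(1) g] by simp
  show "(\<Sum>\<^sub>\<infinity>i\<in>A. f i - g i) = infsum f A - infsum g A"
    using infsum_add[OF assms(1) g] by (simp add: infsum_uminus)
qed

text \<open>The difference of two squares, factored by commutativity of the convolution.\<close>

lemma bo_diff:
  assumes "\<sigma> > 1 / 2" "insob \<sigma> x" "insob \<sigma> y"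
  shows "bo x k - bo y k = \<i> * of_int (sgn k * k\<^sup>2) * (x k - y k) - \<i> * (of_int k * conv (\<lambda>j. x j + y j) (\<lambda>j. x j - y j) k)"
proof -
  have z: "insob 0 x" "insob 0 y" using insob_mono[OF assms(2), of 0] insob_mono[OF assms(3), of 0] assms(1) by auto
  note s = conv_summable[OF assms(1,2) z(1)] conv_summable[OF assms(1,2) z(2)] conv_summable[OF assms(1,3) z(1)] conv_summable[OF assms(1,3) z(2)]
  have "conv (\<lambda>j. x j + y j) (\<lambda>j. x j - y j) k =
      (\<Sum>\<^sub>\<infinity>m. (x (k - m) * x m - x (k - m) * y m) + (y (k - m) * x m - y (k - m) * y m))"
    by (simp add: conv_def algebra_simps)
  also have "\<dots> = (conv x x k - conv x y k) + (conv y x k - conv y y k)"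
    unfolding conv_def by (simp only: infsum_add[OF summable_on_minus[OF s(1,2)] summable_on_minus[OF s(3,4)]] infsum_minus[OF s(1,2)] infsum_minus[OF s(3,4)])
  finally have "conv (\<lambda>j. x j + y j) (\<lambda>j. x j - y j) k = conv x x k - conv y y k"
    by (simp add: conv_commute[of x y])
  then show ?thesis by (simp only: bo_def right_diff_distrib mult.assoc) simp
qed

lemma bo_lipschitz:
  assumes "\<sigma> > 1 / 2"
  shows "\<exists>K\<ge>0. \<forall>x y. insob \<sigma> x \<longrightarrow> insob \<sigma> y \<longrightarrow> insob (\<sigma> - 2) (bo x) \<and>
    hn (\<sigma> - 2) (\<lambda>k. bo x k - bo y k) \<le> (1 + K * (hn \<sigma> x + hn \<sigma> y)) * hn \<sigma> (\<lambda>k. x k - y k)"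
proof -
  obtain K where K: "K \<ge> 0" "\<And>b c. insob \<sigma> b \<Longrightarrow> insob \<sigma> c \<Longrightarrow>
      insob (\<sigma> - 1) (conv b c) \<and> hn (\<sigma> - 1) (conv b c) \<le> K * hn \<sigma> b * hn \<sigma> c"
    using conv_bound[of \<sigma> \<sigma> "\<sigma> - 1"] assms by auto
  have main: "insob (\<sigma> - 2) (\<lambda>k. bo x k - bo y k) \<and>
      hn (\<sigma> - 2) (\<lambda>k. bo x k - bo y k) \<le> (1 + K * (hn \<sigma> x + hn \<sigma> y)) * hn \<sigma> (\<lambda>k. x k - y k)"
    if xy: "insob \<sigma> x" "insob \<sigma> y" for x y
  proof -
    let ?z = "\<lambda>k. x k - y k" and ?w = "\<lambda>k. x k + y k"
    let ?A = "\<lambda>k. \<i> * of_int (sgn k * k\<^sup>2) * ?z k" and ?B = "\<lambda>k. \<i> * (of_int k * conv ?w ?z k)"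
    note z = insob_diff[OF xy] and w = insob_add[OF xy]
    have A: "insob (\<sigma> - 2) ?A" "hn (\<sigma> - 2) ?A \<le> hn \<sigma> ?z"
      using symbol_bound[OF z symbol_k2] by auto
    note c = K(2)[OF w z]
    have B': "insob (\<sigma> - 2) (\<lambda>k. of_int k * conv ?w ?z k)" "hn (\<sigma> - 2) (\<lambda>k. of_int k * conv ?w ?z k) \<le> hn (\<sigma> - 1) (conv ?w ?z)"
      using symbol_bound[OF conjunct1[OF c] symbol_k] by auto
    have B: "insob (\<sigma> - 2) ?B" by (rule insob_cmult[OF B'(1)])
    have "hn (\<sigma> - 2) ?B = hn (\<sigma> - 2) (\<lambda>k. of_int k * conv ?w ?z k)"
      by (simp add: hn_cmult[OF B'(1)])
    also have "\<dots> \<le> K * hn \<sigma> ?w * hn \<sigma> ?z" using B'(2) c by linarith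
    also have "\<dots> \<le> K * (hn \<sigma> x + hn \<sigma> y) * hn \<sigma> ?z"
      by (intro mult_right_mono mult_left_mono hn_add_le xy K(1) hn_nonneg)
    finally have "hn (\<sigma> - 2) (\<lambda>k. ?A k - ?B k) \<le> hn \<sigma> ?z + K * (hn \<sigma> x + hn \<sigma> y) * hn \<sigma> ?z"
      using hn_diff_le[OF A(1) B] A(2) by linarith
    then show ?thesis
      using insob_diff[OF A(1) B] unfolding bo_diff[OF assms xy] by (simp add: distrib_right)
  qed
  \<comment> \<open>The case \<open>y = 0\<close> of \<open>main\<close> yields the membership of
    \<open>bo x\<close>.\<close>
  have z: "bo (\<lambda>k. 0) k = 0" for k by (simp add: bo_def conv_def)
  show ?thesis
    using K(1) main[of _ "\<lambda>k. 0"] main by (intro exI[of _ K]) (simp add: z)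
qed

lemma insob_bo:
  assumes "\<sigma> > 1 / 2" "insob \<sigma> x"
  shows "insob (\<sigma> - 2) (bo x)"
  using bo_lipschitz[OF assms(1)] assms(2) by blast

lemma conv_selfadjoint:
  fixes f g :: "int \<Rightarrow> complex"
  assumes "\<sigma> > 1 / 2" "insob \<sigma> a" and real: "\<And>k. a (- k) = cnj (a k)" and f: "insob 0 f" and g: "insob 0 g"
  shows "(\<Sum>\<^sub>\<infinity>k. conv a f k * cnj (g k)) = (\<Sum>\<^sub>\<infinity>k. f k * cnj (conv a g k))"
proof -
  have "0 \<le> 0 + \<sigma>" "0 \<le> (0::real) + 0" "(0::real) \<le> \<sigma>" "0 + \<sigma> + 0 > 1 / 2" using assms(1) by auto
  from tri_sob[OF this(3) order_refl this(1,2,4)] obtain K where K: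
    "\<And>P a b c. finite P \<Longrightarrow> insob 0 a \<Longrightarrow> insob \<sigma> b \<Longrightarrow> insob 0 c \<Longrightarrow>
    (\<Sum>(m, n)\<in>P. cmod (a (m + n)) * cmod (b m) * cmod (c n)) \<le> K * hn 0 a * hn \<sigma> b * hn 0 (c :: int \<Rightarrow> complex)"
    by blast
  have D: "(\<Sum>k\<in>F. \<Sum>m\<in>M. cmod (a (k - m) * f m * cnj (g k))) \<le> K * hn 0 g * hn \<sigma> a * hn 0 f"
    if "finite F" "finite M" for F M
  proof -
    have "(\<Sum>k\<in>F. \<Sum>m\<in>M. cmod (a (k - m) * f m * cnj (g k))) =
        (\<Sum>(p, m)\<in>(\<lambda>(k, m). (k - m, m)) ` (F \<times> M). cmod (g (p + m)) * cmod (a p) * cmod (f m))"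
      by (subst sum.reindex) (auto simp: inj_on_def sum.cartesian_product norm_mult mult_ac intro!: sum.cong)
    also have "\<dots> \<le> K * hn 0 g * hn \<sigma> a * hn 0 f"
      using that assms by (intro K) auto
    finally show ?thesis .
  qed
  have "(\<Sum>\<^sub>\<infinity>k. conv a f k * cnj (g k)) = (\<Sum>\<^sub>\<infinity>k. \<Sum>\<^sub>\<infinity>m. a (k - m) * f m * cnj (g k))"
    by (simp add: conv_def infsum_cmult_left')
  also have "\<dots> = (\<Sum>\<^sub>\<infinity>m. \<Sum>\<^sub>\<infinity>k. a (k - m) * f m * cnj (g k))"
    by (rule infsum_swap_banach, rule double_sum_bound(1)) (rule D)
  also have "\<dots> = (\<Sum>\<^sub>\<infinity>m. \<Sum>\<^sub>\<infinity>k. f m * cnj (a (m - k) * g k))"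
  proof -
    have "a (k - m) * f m * cnj (g k) = f m * cnj (a (m - k) * g k)" for m k
      using real[of "m - k"] by simp
    then show ?thesis by (simp only:)
  qed
  also have "\<dots> = (\<Sum>\<^sub>\<infinity>k. f k * cnj (conv a g k))"
    by (simp only: infsum_cmult_right' infsum_cnj conv_def)
  finally show ?thesis .
qed

lemma cf_J_0: "insob 0 x \<Longrightarrow> cf (J 0 x) = x"
  by (rule ext) simp

lemma cinner_J_dual:
  fixes a b :: "'i::weight \<Rightarrow> complex"
  assumes "insob r a" "insob r' b" "r + r' = 0"
  shows "cinner (J r a) (J r' b) = (\<Sum>\<^sub>\<infinity>k. a k * cnj (b k))"
  unfolding cinner_def
proof (intro infsum_cong)
  fix k :: 'i
  have "complex_of_real (br k powr r) * complex_of_real (br k powr r') = of_real (br k powr (r + r'))"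
    by (simp add: powr_add)
  then have e: "complex_of_real (br k powr r) * complex_of_real (br k powr r') = 1"
    using assms(3) by (simp add: powr_zero_eq_one)
  have "cf (J r a) k * cnj (cf (J r' b) k) = (complex_of_real (br k powr r) * complex_of_real (br k powr r')) * (a k * cnj (b k))"
    unfolding cf_J[OF assms(1)] cf_J[OF assms(2)] complex_cnj_mult complex_cnj_complex_of_real by (simp only: mult_ac)
  then show "cf (J r a) k * cnj (cf (J r' b) k) = a k * cnj (b k)" unfolding e by simp
qed

text \<open>With \<open>z = x - y\<close> and \<open>w = x + y\<close>, the dispersive part pairs to
  \<open>\<i>\<close> times a real number. In the nonlinear part the derivative of \<open>z\<close>
  is removed by symmetry: \<open>Q - cnj Q\<close> is the pairing of the product of
  \<open>w'\<close> and \<open>z\<close> with \<open>z\<close>, and \<open>w'\<close> has order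
  \<open>\<sigma> - 1 > 1/2\<close>. The outer pairing joins the orders \<open>\<sigma> - 2\<close>
  and \<open>2 - \<sigma>\<close> because \<open>bo\<close> loses two orders.\<close>

lemma energy_estimate:
  assumes "\<sigma> > 3 / 2"
  shows "\<exists>K\<ge>0. \<forall>x y. insob \<sigma> x \<longrightarrow> insob \<sigma> y \<longrightarrow> (\<forall>k. x (- k) = cnj (x k)) \<longrightarrow> (\<forall>k. y (- k) = cnj (y k)) \<longrightarrow>
    \<bar>Re (cinner (J (\<sigma> - 2) (\<lambda>k. bo x k - bo y k)) (J (2 - \<sigma>) (\<lambda>k. x k - y k)))\<bar>
      \<le> K * (hn \<sigma> x + hn \<sigma> y) * (hn 0 (\<lambda>k. x k - y k))\<^sup>2"
proof -
  obtain K where K: "K \<ge> 0" "\<And>b c. insob (\<sigma> - 1) b \<Longrightarrow> insob 0 c \<Longrightarrow>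
    insob 0 (conv b c) \<and> hn 0 (conv b c) \<le> K * hn (\<sigma> - 1) b * hn 0 c"
    using conv_0_bound[of "\<sigma> - 1"] assms by auto
  have s12: "\<sigma> > 1 / 2" "\<sigma> - 1 > 1 / 2" using assms by auto
  have "\<bar>Re (cinner (J (\<sigma> - 2) (\<lambda>k. bo x k - bo y k)) (J (2 - \<sigma>) (\<lambda>k. x k - y k)))\<bar>
      \<le> K * (hn \<sigma> x + hn \<sigma> y) * (hn 0 (\<lambda>k. x k - y k))\<^sup>2"
    if xy: "insob \<sigma> x" "insob \<sigma> y" and rl: "\<forall>k. x (- k) = cnj (x k)" "\<forall>k. y (- k) = cnj (y k)" for x y
  proof -
    define z w where "z = (\<lambda>k. x k - y k)" and "w = (\<lambda>k. x k + y k)"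
    have z: "insob \<sigma> z" and w: "insob \<sigma> w" unfolding z_def w_def by (rule insob_diff[OF xy], rule insob_add[OF xy])
    have wr: "w (- k) = cnj (w k)" for k using rl by (simp add: w_def)
    define z' w' where "z' = (\<lambda>k. of_int k * z k)" and "w' = (\<lambda>k. of_int k * w k)"
    have z'1: "insob (\<sigma> - 1) z'" and w': "insob (\<sigma> - 1) w'" "hn (\<sigma> - 1) w' \<le> hn \<sigma> w"
      unfolding z'_def w'_def using symbol_bound[OF z symbol_k] symbol_bound[OF w symbol_k] by auto
    have z0: "insob 0 z" by (rule insob_mono[OF z]) (use assms in simp)
    have z'0: "insob 0 z'" by (rule insob_mono[OF z'1]) (use assms in simp)
    define q where "q = (\<lambda>k. of_int k * conv w z k)"
    have q: "q k = conv w' z k + conv w z' k" for k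
    proof -
      have "q k = (\<Sum>\<^sub>\<infinity>m. w' (k - m) * z m + w (k - m) * z' m)"
        unfolding q_def conv_def infsum_cmult_right'[symmetric]
        by (intro infsum_cong) (simp add: w'_def z'_def algebra_simps)
      also have "\<dots> = conv w' z k + conv w z' k"
        unfolding conv_def by (rule infsum_add[OF conv_summable[OF s12(2) w'(1) z0] conv_summable[OF s12(1) w z'0]])
      finally show ?thesis .
    qed
    have c1: "insob 0 (conv w' z)" "hn 0 (conv w' z) \<le> K * hn (\<sigma> - 1) w' * hn 0 z"
      using K(2)[OF w'(1) z0] by auto
    have c2: "insob 0 (conv w z')" "insob 0 (conv w z)"
      using conv_0_bound[OF s12(1)] w z'0 z0 by blast+
    have q0: "insob 0 q" using insob_add[OF c1(1) c2(1)] unfolding q .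
    note cfJ = cf_J_0[OF z0] cf_J_0[OF z'0] cf_J_0[OF q0] cf_J_0[OF c1(1)] cf_J_0[OF c2(1)] cf_J_0[OF c2(2)]
    define Q where "Q = cinner (J 0 q) (J 0 z)"
    have "Q = cinner (J 0 (conv w' z)) (J 0 z) + cinner (J 0 (conv w z')) (J 0 z)"
      unfolding Q_def q J_add[OF c1(1) c2(1)] by (rule cinner_add_left)
    also have "cinner (J 0 (conv w z')) (J 0 z) = cinner (J 0 z') (J 0 (conv w z))"
      unfolding cinner_def cfJ by (rule conv_selfadjoint[OF s12(1) w wr z'0 z0])
    also have "\<dots> = cnj (cinner (J 0 (conv w z)) (J 0 z'))" by (rule cinner_commute)
    also have "cinner (J 0 (conv w z)) (J 0 z') = Q"
      unfolding Q_def cinner_def cfJ by (intro infsum_cong) (simp add: q_def z'_def)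
    finally have "Q - cnj Q = cinner (J 0 (conv w' z)) (J 0 z)" by (metis add_diff_cancel_right')
    then have "cmod (Q - cnj Q) \<le> hn 0 (conv w' z) * hn 0 z"
      unfolding hn_def by (metis cmod_cinner_le)
    also have "\<dots> \<le> (K * hn \<sigma> w * hn 0 z) * hn 0 z"
      by (intro mult_right_mono order_trans[OF c1(2)] mult_left_mono w'(2) K(1) hn_nonneg)
    also have "\<dots> \<le> (K * (hn \<sigma> x + hn \<sigma> y) * hn 0 z) * hn 0 z"
      unfolding w_def by (intro mult_right_mono mult_left_mono hn_add_le xy K(1) hn_nonneg)
    finally have Q: "2 * \<bar>Im Q\<bar> \<le> K * (hn \<sigma> x + hn \<sigma> y) * (hn 0 z)\<^sup>2"
      by (simp add: complex_diff_cnj norm_mult power2_eq_square mult_ac)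
    define e where "e = (\<lambda>k. of_int (sgn k) * z' k)"
    have e0: "insob 0 e"
      by (rule insob_dominated(1)[OF z'0, of _ _ 1]) (auto simp: e_def norm_mult sgn_if intro!: mult_left_mono)
    define P where "P = cinner (J 0 e) (J 0 z')"
    have "P = cnj P"
    proof -
      have "cnj P = cinner (J 0 z') (J 0 e)" unfolding P_def by (metis cinner_commute)
      also have "\<dots> = P"
        unfolding P_def cinner_def cf_J_0[OF e0] cfJ by (intro infsum_cong) (simp add: e_def)
      finally show ?thesis by simp
    qed
    then have P: "Im P = 0" by (metis complex_cnj Im_complex_of_real Reals_cnj_iff complex_is_Real_iff)
    have d: "bo x k - bo y k = \<i> * of_int (sgn k * k\<^sup>2) * z k - \<i> * q k" for k
      unfolding bo_diff[OF s12(1) xy] by (simp add: z_def q_def w_def)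
    have dd: "insob (\<sigma> - 2) (\<lambda>k. bo x k - bo y k)"
      by (rule insob_diff[OF insob_bo[OF s12(1) xy(1)] insob_bo[OF s12(1) xy(2)]])
    have z2: "insob (2 - \<sigma>) z" by (rule insob_mono[OF z]) (use assms in simp)
    have "cinner (J (\<sigma> - 2) (\<lambda>k. bo x k - bo y k)) (J (2 - \<sigma>) z) = (\<Sum>\<^sub>\<infinity>k. (bo x k - bo y k) * cnj (z k))"
      by (rule cinner_J_dual[OF dd z2]) simp
    also have "\<dots> = (\<Sum>\<^sub>\<infinity>k. \<i> * (cf (J 0 e) k * cnj (cf (J 0 z') k)) - \<i> * (cf (J 0 q) k * cnj (cf (J 0 z) k)))"
      unfolding d cf_J_0[OF e0] cfJ by (intro infsum_cong) (simp add: e_def z'_def algebra_simps power2_eq_square)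
    also have "\<dots> = \<i> * P - \<i> * Q"
      unfolding P_def Q_def cinner_def infsum_cmult_right'[symmetric]
      by (intro infsum_minus summable_on_cmult_right cinner_summable)
    finally have "\<bar>Re (cinner (J (\<sigma> - 2) (\<lambda>k. bo x k - bo y k)) (J (2 - \<sigma>) z))\<bar> = \<bar>Im Q\<bar>" using P by simp
    then show ?thesis using Q unfolding z_def by simp
  qed
  with K(1) show ?thesis by blast
qed

text \<open>Classical solutions in terms of Fourier coefficients, see
  \<open>classical_solution_iff\<close>. Composition with \<open>J\<close> turns Sobolev norms into
  the norm of one fixed Hilbert space, so that ordinary vector derivatives can be used.\<close>

definition bo_curve :: "real \<Rightarrow> (real \<Rightarrow> int \<Rightarrow> complex) \<Rightarrow> bool" where
  "bo_curve \<sigma> x \<longleftrightarrow> (\<forall>t. insob \<sigma> (x t)) \<and> (\<forall>t k. x t (- k) = cnj (x t k)) \<and>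
     continuous_on UNIV (\<lambda>t. J \<sigma> (x t)) \<and>
     (\<forall>t. ((\<lambda>s. J (\<sigma> - 2) (x s)) has_vector_derivative J (\<sigma> - 2) (bo (x t))) (at t))"

lemma gronwall_zero:
  fixes E :: "real \<Rightarrow> real"
  assumes d: "\<And>t. (E has_real_derivative E' t) (at t)" and le: "\<And>t. \<bar>t\<bar> \<le> \<Theta> \<Longrightarrow> \<bar>E' t\<bar> \<le> C * E t"
    and E: "E 0 = 0" "\<And>t. 0 \<le> E t" and t: "\<bar>t\<bar> \<le> \<Theta>"
  shows "E t = 0"
proof -
  have main: "E t \<le> 0" if d: "\<And>t. (E has_real_derivative E' t) (at t)" and le: "\<And>t. \<bar>t\<bar> \<le> \<Theta> \<Longrightarrow> \<bar>E' t\<bar> \<le> C * E t"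
    and E: "E 0 = 0" and t: "0 \<le> t" "t \<le> \<Theta>" for t and E E' :: "real \<Rightarrow> real"
  proof -
    have "exp (- C * t) * E t \<le> exp (- C * 0) * E 0"
    proof (rule DERIV_nonpos_imp_nonincreasing[OF t(1)])
      fix x assume x: "0 \<le> x" "x \<le> t"
      have "((\<lambda>x. exp (- C * x) * E x) has_real_derivative exp (- C * x) * (E' x - C * E x)) (at x)"
        by (rule derivative_eq_intros d refl | simp)+ (simp add: algebra_simps)
      moreover have "exp (- C * x) * (E' x - C * E x) \<le> 0"
        using le[of x] x t by (intro mult_nonneg_nonpos) auto
      ultimately show "\<exists>y. ((\<lambda>x. exp (- C * x) * E x) has_real_derivative y) (at x) \<and> y \<le> 0" by blast
    qed
    then show ?thesis using E by (simp add: mult_le_0_iff)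
  qed
  have "E t \<le> 0"
  proof (cases "0 \<le> t")
    case True
    then show ?thesis using main[OF d le E(1)] t by simp
  next
    case False
    have d': "((\<lambda>t. E (- t)) has_real_derivative - E' (- t)) (at t)" for t
      using DERIV_mirror[of E "E' (- t)" t] d by simp
    have "\<bar>- E' (- s)\<bar> \<le> C * E (- s)" if "\<bar>s\<bar> \<le> \<Theta>" for s using le[of "- s"] that by simp
    from main[OF d' this, of "- t"] show ?thesis using E t False by simp
  qed
  then show ?thesis using E(2)[of t] by simp
qed

text \<open>Gronwall's inequality for the squared norm of order 0 of the difference. The curves are
  differentiable at order \<open>\<sigma> - 2\<close> only, so this norm is written as the pairing
  of \<open>F\<close> at that order with \<open>G\<close> at the order \<open>2 - \<sigma>\<close>,
  where continuity is all that is known.\<close>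

lemma bo_curve_unique:
  assumes \<sigma>: "\<sigma> > 3 / 2" and x: "bo_curve \<sigma> x" and y: "bo_curve \<sigma> y" and 0: "x 0 = y 0"
  shows "x = y"
proof -
  note X = x[unfolded bo_curve_def] and Y = y[unfolded bo_curve_def]
  define z where "z t = (\<lambda>k. x t k - y t k)" for t
  have i: "insob \<sigma> (x t)" "insob \<sigma> (y t)" for t using X Y by auto
  have z: "insob \<sigma> (z t)" for t unfolding z_def by (rule insob_diff[OF i])
  have zr: "insob r (z t)" if "r \<le> \<sigma>" for r t by (rule insob_mono[OF z that])
  obtain K where K: "K \<ge> 0" "\<And>x y. insob \<sigma> x \<Longrightarrow> insob \<sigma> y \<Longrightarrow> (\<forall>k. x (- k) = cnj (x k)) \<Longrightarrow> (\<forall>k. y (- k) = cnj (y k)) \<Longrightarrow>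
    \<bar>Re (cinner (J (\<sigma> - 2) (\<lambda>k. bo x k - bo y k)) (J (2 - \<sigma>) (\<lambda>k. x k - y k)))\<bar>
      \<le> K * (hn \<sigma> x + hn \<sigma> y) * (hn 0 (\<lambda>k. x k - y k))\<^sup>2"
    using energy_estimate[OF \<sigma>] by blast
  define d where "d t = (\<lambda>k. bo (x t) k - bo (y t) k)" for t
  have bi: "insob (\<sigma> - 2) (bo w)" if "insob \<sigma> w" for w
    using \<sigma> that by (intro insob_bo) auto
  define F G where "F t = J (\<sigma> - 2) (z t)" and "G t = J (2 - \<sigma>) (z t)" for t
  have F: "(F has_vector_derivative J (\<sigma> - 2) (d t)) (at t)" for t
  proof -
    have "((\<lambda>s. J (\<sigma> - 2) (x s) - J (\<sigma> - 2) (y s)) has_vector_derivative J (\<sigma> - 2) (bo (x t)) - J (\<sigma> - 2) (bo (y t))) (at t)"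
      using X Y by (intro has_vector_derivative_diff) auto
    then show ?thesis
      unfolding F_def[abs_def] z_def d_def by (simp add: J_diff bi i insob_mono[OF i(1)] insob_mono[OF i(2)])
  qed
  have Gc: "(G \<longlongrightarrow> G t) (at t)" for t
  proof -
    have c: "continuous_on UNIV (\<lambda>t. J \<sigma> (x t) - J \<sigma> (y t))"
      using X Y by (intro continuous_on_diff) auto
    then have "((\<lambda>s. J \<sigma> (x s) - J \<sigma> (y s)) \<longlongrightarrow> J \<sigma> (x t) - J \<sigma> (y t)) (at t)"
      by (simp add: continuous_on)
    then have lim: "((\<lambda>s. norm ((J \<sigma> (x s) - J \<sigma> (y s)) - (J \<sigma> (x t) - J \<sigma> (y t)))) \<longlongrightarrow> 0) (at t)"
      by (simp add: LIM_zero tendsto_norm_zero)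
    have le: "norm (G s - G t) \<le> norm ((J \<sigma> (x s) - J \<sigma> (y s)) - (J \<sigma> (x t) - J \<sigma> (y t)))" for s
    proof -
      have "norm (G s - G t) = hn (2 - \<sigma>) (\<lambda>k. z s k - z t k)"
        unfolding G_def hn_def using \<sigma> by (simp add: J_diff zr)
      also have "\<dots> \<le> hn \<sigma> (\<lambda>k. z s k - z t k)"
        using \<sigma> by (intro hn_mono insob_diff z) simp
      also have "\<dots> = norm ((J \<sigma> (x s) - J \<sigma> (y s)) - (J \<sigma> (x t) - J \<sigma> (y t)))"
        unfolding hn_def J_diff[OF z z] by (simp only: z_def J_diff[OF i])
      finally show ?thesis .
    qed
    have "((\<lambda>s. G s - G t) \<longlongrightarrow> 0) (at t)"
      by (rule Lim_null_comparison[OF _ lim]) (rule always_eventually, rule allI, rule le)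
    then show ?thesis by (rule LIM_zero_cancel)
  qed
  have FG: "cinner (J (\<sigma> - 2) a) (J (2 - \<sigma>) b) = (\<Sum>\<^sub>\<infinity>k. a k * cnj (b k))" if "insob (\<sigma> - 2) a" "insob (2 - \<sigma>) b" for a b :: "int \<Rightarrow> complex"
    by (rule cinner_J_dual[OF that]) simp
  define E where "E t = (hn 0 (z t))\<^sup>2" for t
  have FGc: "cinner (F s) (G t) = cnj (cinner (F t) (G s))" for s t
    unfolding F_def G_def using \<sigma> by (simp add: FG zr infsum_cnj[symmetric] mult.commute)
  have EE: "E t = Re (cinner (F t) (G t))" for t
  proof -
    have "E t = (norm (J 0 (z t)))\<^sup>2" by (simp add: E_def hn_def)
    also have "\<dots> = Re (cinner (J 0 (z t)) (J 0 (z t)))" by (simp add: cinner_self)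
    also have "cinner (J 0 (z t)) (J 0 (z t)) = cinner (F t) (G t)"
      unfolding F_def G_def using \<sigma> by (simp add: FG zr) (simp add: cinner_def cf_J_0 zr)
    finally show ?thesis .
  qed
  have dE: "(E has_real_derivative 2 * Re (cinner (J (\<sigma> - 2) (d t)) (G t))) (at t)" for t
  proof -
    \<comment> \<open>By the symmetry \<open>FGc\<close> the real parts of the cross terms cancel;
      the difference quotient falls on \<open>F\<close> alone and \<open>G\<close> is never
      differentiated.\<close>
    have "(E s - E t) / (s - t) = Re (cinner ((F s - F t) /\<^sub>R (s - t)) (G s + G t))" for s
    proof -
      have "Re (cinner (F s - F t) (G s + G t)) = E s - E t"
        using arg_cong[OF FGc[of s t], of Re] by (simp add: EE cinner_diff_left cinner_add_right)
      then show ?thesis by (simp add: Re_cinner divide_inverse mult.commute del: cinner_scaleR_left)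
    qed
    moreover have "((\<lambda>s. Re (cinner ((F s - F t) /\<^sub>R (s - t)) (G s + G t))) \<longlongrightarrow> Re (cinner (J (\<sigma> - 2) (d t)) (G t + G t))) (at t)"
      using F[of t] unfolding has_vector_derivative_iff_tendsto by (intro tendsto_intros Gc)
    ultimately show ?thesis
      by (simp add: has_field_derivative_iff cinner_add_right)
  qed
  have "hn 0 (z t) = 0" for t
  proof -
    have bd: "\<exists>M. \<forall>s. \<bar>s\<bar> \<le> \<bar>t\<bar> \<longrightarrow> hn \<sigma> (w s) \<le> M" if "continuous_on UNIV (\<lambda>s. J \<sigma> (w s))" for w :: "real \<Rightarrow> int \<Rightarrow> complex"
    proof -
      have "bounded ((\<lambda>s. J \<sigma> (w s)) ` {- \<bar>t\<bar>..\<bar>t\<bar>})"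
        by (intro compact_imp_bounded compact_continuous_image continuous_on_subset[OF that]) auto
      then obtain M where "\<And>s. s \<in> {- \<bar>t\<bar>..\<bar>t\<bar>} \<Longrightarrow> norm (J \<sigma> (w s)) \<le> M" unfolding bounded_iff by blast
      then show ?thesis unfolding hn_def by (intro exI[of _ M]) (simp add: abs_le_iff minus_le_iff)
    qed
    obtain M M' where M: "\<And>s. \<bar>s\<bar> \<le> \<bar>t\<bar> \<Longrightarrow> hn \<sigma> (x s) \<le> M" "\<And>s. \<bar>s\<bar> \<le> \<bar>t\<bar> \<Longrightarrow> hn \<sigma> (y s) \<le> M'"
      using bd[of x] bd[of y] X Y by blast
    have "E t = 0"
    proof (rule gronwall_zero[OF dE])
      fix s assume s: "\<bar>s\<bar> \<le> \<bar>t\<bar>"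
      have "\<bar>2 * Re (cinner (J (\<sigma> - 2) (d s)) (G s))\<bar> \<le> 2 * (K * (hn \<sigma> (x s) + hn \<sigma> (y s)) * E s)"
        using K(2)[OF i[of s]] X Y by (simp add: d_def G_def z_def E_def abs_mult)
      also have "\<dots> \<le> 2 * (K * (M + M') * E s)"
        using M[OF s] K(1) by (intro mult_left_mono mult_right_mono) (auto simp: E_def)
      finally show "\<bar>2 * Re (cinner (J (\<sigma> - 2) (d s)) (G s))\<bar> \<le> 2 * (K * (M + M')) * E s" by (simp add: mult_ac)
    qed (auto simp: E_def z_def 0)
    then show ?thesis by (simp add: E_def)
  qed
  then have "x t k = y t k" for t k
    using coord_le_hn[OF zr[of 0 t], of k] \<sigma> by (simp add: z_def)
  then show ?thesis by blast
qed

lemma continuous_at_J_iff: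
  fixes x :: "real \<Rightarrow> 'i::weight \<Rightarrow> complex"
  assumes i: "\<And>t. insob r (x t)"
  shows "((\<lambda>s. J r (x s)) \<longlongrightarrow> J r (x t)) (at t) \<longleftrightarrow> ((\<lambda>s. hn r (\<lambda>k. x s k - x t k)) \<longlongrightarrow> 0) (at t)"
proof -
  have "hn r (\<lambda>k. x s k - x t k) = norm (J r (x s) - J r (x t))" for s
    unfolding hn_def by (simp add: J_diff i)
  then show ?thesis by (simp add: tendsto_norm_zero_iff LIM_zero_iff)
qed

lemma continuous_on_J_iff:
  fixes x :: "real \<Rightarrow> 'i::weight \<Rightarrow> complex"
  assumes i: "\<And>t. insob r (x t)"
  shows "continuous_on UNIV (\<lambda>s. J r (x s)) \<longleftrightarrow> (\<forall>t. ((\<lambda>s. hn r (\<lambda>k. x s k - x t k)) \<longlongrightarrow> 0) (at t))"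
  using continuous_at_J_iff[of r x, OF i] by (simp add: continuous_on)

lemma cnj_conv:
  assumes "\<And>k. x (- k) = cnj (x k)"
  shows "conv x x (- k) = cnj (conv x x k)"
proof -
  have "conv x x (- k) = (\<Sum>\<^sub>\<infinity>m. x (- k - - m) * x (- m))"
    unfolding conv_def
    by (rule infsum_reindex_bij_betw[symmetric, of uminus UNIV UNIV "\<lambda>m. x (- k - m) * x m"]) (rule bij_uminus)
  also have "\<dots> = (\<Sum>\<^sub>\<infinity>m. cnj (x (k - m) * x m))"
    using assms[of "k - _"] assms by (intro infsum_cong) (simp add: assms flip: assms)
  finally show ?thesis by (simp add: conv_def infsum_cnj[symmetric])
qed

lemma bo_curve_continuous_bo:
  fixes x :: "real \<Rightarrow> int \<Rightarrow> complex"
  assumes s: "\<sigma> > 1 / 2" and i: "\<And>t. insob \<sigma> (x t)" and c: "continuous_on UNIV (\<lambda>t. J \<sigma> (x t))"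
  shows "continuous_on UNIV (\<lambda>t. J (\<sigma> - 2) (bo (x t)))"
proof -
  obtain K where K: "K \<ge> 0" "\<And>x y. insob \<sigma> x \<Longrightarrow> insob \<sigma> y \<Longrightarrow>
    hn (\<sigma> - 2) (\<lambda>k. bo x k - bo y k) \<le> (1 + K * (hn \<sigma> x + hn \<sigma> y)) * hn \<sigma> (\<lambda>k. x k - y k)"
    using bo_lipschitz[OF s] by blast
  have "((\<lambda>s. hn (\<sigma> - 2) (\<lambda>k. bo (x s) k - bo (x t) k)) \<longlongrightarrow> 0) (at t)" for t
  proof (rule tendsto_sandwich[OF _ _ tendsto_const])
    have "((\<lambda>s. J \<sigma> (x s)) \<longlongrightarrow> J \<sigma> (x t)) (at t)" using c by (simp add: continuous_on)
    then have "((\<lambda>s. hn \<sigma> (x s)) \<longlongrightarrow> hn \<sigma> (x t)) (at t)" unfolding hn_def by (rule tendsto_norm)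
    moreover have "((\<lambda>s. hn \<sigma> (\<lambda>k. x s k - x t k)) \<longlongrightarrow> 0) (at t)" using c i by (simp add: continuous_on_J_iff)
    ultimately have "((\<lambda>s. (1 + K * (hn \<sigma> (x s) + hn \<sigma> (x t))) * hn \<sigma> (\<lambda>k. x s k - x t k)) \<longlongrightarrow> (1 + K * (hn \<sigma> (x t) + hn \<sigma> (x t))) * 0) (at t)"
      by (intro tendsto_intros)
    then show "((\<lambda>s. (1 + K * (hn \<sigma> (x s) + hn \<sigma> (x t))) * hn \<sigma> (\<lambda>k. x s k - x t k)) \<longlongrightarrow> 0) (at t)" by simp
    show "\<forall>\<^sub>F s in at t. hn (\<sigma> - 2) (\<lambda>k. bo (x s) k - bo (x t) k) \<le> (1 + K * (hn \<sigma> (x s) + hn \<sigma> (x t))) * hn \<sigma> (\<lambda>k. x s k - x t k)"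
      by (rule always_eventually, rule allI, rule K(2)[OF i i])
  qed simp
  then show ?thesis by (simp add: continuous_on_J_iff insob_bo[OF s i])
qed

text \<open>Differentiability of each coefficient is upgraded to differentiability in norm: at order
  \<open>\<sigma> - 2\<close> the right-hand side is a continuous curve, and its antiderivative
  \<open>G\<close> has the same derivative in each coefficient, so that the two differ by a
  constant.\<close>

lemma bo_curveI:
  fixes x :: "real \<Rightarrow> int \<Rightarrow> complex"
  assumes s: "\<sigma> > 1 / 2" and i: "\<And>t. insob \<sigma> (x t)" and c: "continuous_on UNIV (\<lambda>t. J \<sigma> (x t))"
    and real: "\<And>t k. x t (- k) = cnj (x t k)"
    and d: "\<And>t k. ((\<lambda>t. x t k) has_vector_derivative bo (x t) k) (at t)"
  shows "bo_curve \<sigma> x"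
proof -
  obtain G where G: "G 0 = 0" "\<And>t. (G has_vector_derivative J (\<sigma> - 2) (bo (x t))) (at t)"
    using antiderivative_exists[OF bo_curve_continuous_bo[OF s i c]] by blast
  have i2: "insob (\<sigma> - 2) (x t)" for t by (rule insob_mono[OF i]) simp
  have eq: "J (\<sigma> - 2) (x t) = J (\<sigma> - 2) (x 0) + G t" for t
  proof (rule ell2_eqI)
    fix k :: int
    let ?w = "complex_of_real (br k powr (\<sigma> - 2))"
    have "((\<lambda>t. ?w * x t k - cf (G t) k) has_vector_derivative ?w * bo (x t) k - cf (J (\<sigma> - 2) (bo (x t))) k) (at t)" for t
      by (intro has_vector_derivative_diff has_vector_derivative_mult_right d bounded_linear.has_vector_derivative[OF bounded_linear_cf] G)
    then have d0: "((\<lambda>t. ?w * x t k - cf (G t) k) has_vector_derivative 0) (at t within UNIV)" for t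
      by (simp add: insob_bo[OF s i])
    obtain c where "\<And>t. t \<in> UNIV \<Longrightarrow> ?w * x t k - cf (G t) k = c"
      using has_vector_derivative_zero_constant[OF convex_UNIV d0] by blast
    from this[OF UNIV_I, of t] this[OF UNIV_I, of 0]
    have "?w * x t k - cf (G t) k = ?w * x 0 k" by (simp only: G(1) cf_simps) simp
    then show "cf (J (\<sigma> - 2) (x t)) k = cf (J (\<sigma> - 2) (x 0) + G t) k"
      unfolding plus_ell2.rep_eq cf_J[OF i2] by (simp only: diff_eq_eq)
  qed
  have "(\<lambda>t. J (\<sigma> - 2) (x t)) = (\<lambda>t. J (\<sigma> - 2) (x 0) + G t)" by (rule ext) (rule eq)
  then have "((\<lambda>t. J (\<sigma> - 2) (x t)) has_vector_derivative J (\<sigma> - 2) (bo (x t))) (at t)" for t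
    using has_vector_derivative_add[OF has_vector_derivative_const G(2), of "J (\<sigma> - 2) (x 0)" t] unfolding add_0 by argo
  then show ?thesis using i c real unfolding bo_curve_def by blast
qed

text \<open>Nonnegative frequencies are covered by \<open>ut_deriv\<close>, negative ones by
  conjugation; continuity at order \<open>\<sigma>\<close> comes from \<open>Vs_cont\<close> for
  \<open>p\<close>.\<close>

lemma (in bodata) bo_curve_ut: "bo_curve \<sigma> ut"
proof (rule bo_curveI[OF s12])
  have i: "insob \<sigma> (ut t)" for t using bodata_ut[of t] by (simp add: bodata_def)
  then show "insob \<sigma> (ut t)" for t .
  show real: "ut t (- k) = cnj (ut t k)" for t k by (rule ut_real)
  have n: "((\<lambda>t. ut t k) has_vector_derivative bo (ut t) k) (at t)" if "0 \<le> k" for t k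
    using ut_deriv[of "nat k" t] that by (cases "k = 0") (simp_all add: bo_def sgn_if mult.assoc del: ut_nat)
  show "((\<lambda>t. ut t k) has_vector_derivative bo (ut t) k) (at t)" for t k
  proof (cases "0 \<le> k")
    case False
    have "((\<lambda>t. cnj (ut t (- k))) has_vector_derivative cnj (bo (ut t) (- k))) (at t)"
      by (rule has_vector_derivative_cnj[OF n]) (use False in simp)
    moreover have "cnj (ut t (- k)) = ut t k" for t by (simp add: real)
    moreover have "cnj (bo (ut t) (- k)) = bo (ut t) k"
      by (simp add: bo_def real cnj_conv[of "ut t", OF real])
    ultimately show ?thesis by simp
  qed (rule n)
  have "((\<lambda>s. hn \<sigma> (\<lambda>k. ut s k - ut t k)) \<longlongrightarrow> 0) (at t)" for t
  proof (rule tendstoI)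
    fix e :: real assume "e > 0"
    then have "e / 2 > 0" by simp
    then have "\<forall>\<^sub>F s in at t. hn \<sigma> (\<lambda>n. cf (Vs s p) n - cf (Vs t p) n) < e / 2"
      using Vs_cont[OF _ order_refl insob_p, of "e / 2" t] sig by linarith
    then show "\<forall>\<^sub>F s in at t. dist (hn \<sigma> (\<lambda>k. ut s k - ut t k)) 0 < e"
    proof (rule eventually_mono)
      fix s assume h: "hn \<sigma> (\<lambda>n. cf (Vs s p) n - cf (Vs t p) n) < e / 2"
      have v: "insob \<sigma> (cf (Vs t p))" for t
        using Vbd[of \<sigma>] sig insob_p unfolding Vbd_def by auto
      have "(\<lambda>k. ut s k - ut t k) = herm (\<lambda>n. cf (Vs s p) n - cf (Vs t p) n)"
        by (auto simp: ut_def herm_def fun_eq_iff simp del: cf_Vs)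
      then have "hn \<sigma> (\<lambda>k. ut s k - ut t k) \<le> 2 * hn \<sigma> (\<lambda>n. cf (Vs s p) n - cf (Vs t p) n)"
        using hn_herm_le[OF insob_diff[OF v[of s] v[of t]]] by simp
      then show "dist (hn \<sigma> (\<lambda>k. ut s k - ut t k)) 0 < e" using h by simp
    qed
  qed
  then show "continuous_on UNIV (\<lambda>t. J \<sigma> (ut t))" by (simp add: continuous_on_J_iff i)
qed

section \<open>Translation of classical solutions from distributions to coefficients\<close>

lemma continuous_curve_iff:
  "continuous_curve \<sigma> \<gamma> \<longleftrightarrow> (\<forall>t. insob \<sigma> (fourier_coeff (\<gamma> t))) \<and> continuous_on UNIV (\<lambda>t. J \<sigma> (fourier_coeff (\<gamma> t)))"
proof (cases "\<forall>t. insob \<sigma> (fourier_coeff (\<gamma> t))")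
  case True
  have "sobolev_norm \<sigma> (\<gamma> r - \<gamma> t) = hn \<sigma> (\<lambda>k. fourier_coeff (\<gamma> r) k - fourier_coeff (\<gamma> t) k)" for r t
  proof -
    have e: "fourier_coeff (\<gamma> r - \<gamma> t) = (\<lambda>k. fourier_coeff (\<gamma> r) k - fourier_coeff (\<gamma> t) k)"
      by (rule ext) (rule fourier_coeff_diff)
    show ?thesis using True by (subst sobolev_norm_hn) (auto simp: e insob_diff)
  qed
  then show ?thesis using True by (simp add: continuous_curve_def sobolev_iff continuous_on_J_iff)
next
  case False
  then show ?thesis unfolding continuous_curve_def sobolev_iff by blast
qed

lemma fourier_coeff_bo: "insob \<sigma> (fourier_coeff u) \<Longrightarrow> \<sigma> \<ge> 1 \<Longrightarrow> fourier_coeff (bo_rhs u) = bo (fourier_coeff u)"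
  by (rule ext) (simp only: fourier_coeff_bo_rhs bo_def)

lemma classical_solution_iff:
  assumes s: "\<sigma> > 3 / 2"
  shows "classical_solution \<sigma> v0 v \<longleftrightarrow> bo_curve \<sigma> (\<lambda>t. fourier_coeff (v t)) \<and> v 0 = v0"
proof (cases "(\<forall>t. insob \<sigma> (fourier_coeff (v t))) \<and> continuous_on UNIV (\<lambda>t. J \<sigma> (fourier_coeff (v t)))")
  case True
  let ?x = "\<lambda>t. fourier_coeff (v t)"
  have i: "insob \<sigma> (?x t)" for t using True by blast
  have i2: "insob (\<sigma> - 2) (?x t)" for t by (rule insob_mono[OF i]) simp
  have s12: "\<sigma> > 1 / 2" using s by simp
  have b: "fourier_coeff (bo_rhs (v t)) = bo (?x t)" for t
    using s by (intro fourier_coeff_bo[OF i]) simp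
  note ib = insob_bo[OF s12 i]
  have cc: "continuous_curve (\<sigma> - 2) (\<lambda>t. bo_rhs (v t))"
    unfolding continuous_curve_iff b using ib bo_curve_continuous_bo[OF s12 i] True by auto
  have "has_curve_derivative (\<sigma> - 2) v (bo_rhs (v t)) t \<longleftrightarrow>
      ((\<lambda>t. J (\<sigma> - 2) (?x t)) has_vector_derivative J (\<sigma> - 2) (bo (?x t))) (at t)" for t
  proof -
    let ?F = "\<lambda>t. J (\<sigma> - 2) (?x t)"
    have "sobolev_norm (\<sigma> - 2) ((v (t + h) - v t) /\<^sub>R h - bo_rhs (v t)) = norm ((?F (t + h) - ?F t) /\<^sub>R h - J (\<sigma> - 2) (bo (?x t)))" for h
    proof -
      have e: "fourier_coeff ((v (t + h) - v t) /\<^sub>R h - bo_rhs (v t)) = (\<lambda>k. of_real (inverse h) * (?x (t + h) k - ?x t k) - bo (?x t) k)"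
        by (rule ext) (simp only: fourier_coeff_diff fourier_coeff_scaleR b)
      have "J (\<sigma> - 2) (\<lambda>k. of_real (inverse h) * (?x (t + h) k - ?x t k) - bo (?x t) k) = (?F (t + h) - ?F t) /\<^sub>R h - J (\<sigma> - 2) (bo (?x t))"
        by (simp only: J_diff[OF insob_cmult[OF insob_diff[OF i2 i2]] ib] J_cmult[OF insob_diff[OF i2 i2]] J_diff[OF i2 i2] scaleR_scaleC)
      then show ?thesis
        by (subst sobolev_norm_hn) (simp_all only: e hn_def insob_diff[OF insob_cmult[OF insob_diff[OF i2 i2]] ib])
    qed
    then show ?thesis
      unfolding has_curve_derivative_def has_vector_derivative_iff_tendsto
      by (subst (2) LIM_offset_zero_iff) (simp_all add: tendsto_norm_zero_iff LIM_zero_iff)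
  qed
  then show ?thesis
    using True cc fourier_coeff_uminus by (auto simp: classical_solution_def bo_curve_def continuous_curve_iff)
next
  case False
  then show ?thesis unfolding classical_solution_def bo_curve_def continuous_curve_iff by blast
qed

lemma bodata_coeff: "\<sigma> > 3 / 2 \<Longrightarrow> v0 \<in> sobolev \<sigma> \<Longrightarrow> bodata (fourier_coeff v0) \<sigma>"
  by (simp add: bodata_def sobolev_iff fourier_coeff_uminus)

lemma classical_flow:
  assumes "\<sigma> > 3 / 2" "v0 \<in> sobolev \<sigma>"
  shows "fourier_coeff (classical_flow \<sigma> v0 t) = bodata.ut (fourier_coeff v0) t"
proof -
  interpret bodata "fourier_coeff v0" \<sigma> by (rule bodata_coeff[OF assms])
  have "\<exists>u. fourier_coeff u = ut t" for t
    using bodata_ut[of t] sig by (intro insob_distr_exists[of \<sigma>]) (auto simp: bodata_def)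
  then obtain v where v: "\<And>t. fourier_coeff (v t) = ut t" by metis
  have "classical_solution \<sigma> v0 v"
    unfolding classical_solution_iff[OF assms(1)] using bo_curve_ut
    by (auto simp: v intro!: distr_eqI) (simp add: ut_0)
  moreover have "w = v" if "classical_solution \<sigma> v0 w" for w
  proof -
    have w: "bo_curve \<sigma> (\<lambda>t. fourier_coeff (w t))" "w 0 = v0"
      using that unfolding classical_solution_iff[OF assms(1)] by auto
    have "(\<lambda>t. fourier_coeff (w t)) = ut"
      by (rule bo_curve_unique[OF assms(1) w(1) bo_curve_ut]) (simp add: w(2) ut_0)
    then show ?thesis by (metis v distr_eqI ext)
  qed
  ultimately have "classical_flow \<sigma> v0 = v" unfolding classical_flow_def by (rule the_equality)
  then show ?thesis by (simp add: v)
qed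

text \<open>A translate of the curve is a classical curve with data \<open>ut s\<close>, so
  uniqueness applies; the explicit formula does not display the group law.\<close>

lemma (in bodata) ut_add: "bodata.ut (ut s) t = ut (t + s)"
proof -
  interpret b: bodata "ut s" \<sigma> by (rule bodata_ut)
  have "bo_curve \<sigma> (\<lambda>t. ut (t + s))"
    unfolding bo_curve_def
  proof (intro conjI allI)
    fix t
    note c = bo_curve_ut[unfolded bo_curve_def]
    show "insob \<sigma> (ut (t + s))" "ut (t + s) (- k) = cnj (ut (t + s) k)" for k using c by auto
    show "continuous_on UNIV (\<lambda>t. J \<sigma> (ut (t + s)))"
      using c by (intro continuous_on_compose2[of UNIV "\<lambda>t. J \<sigma> (ut t)" UNIV "\<lambda>t. t + s"] continuous_intros) auto
    have "((\<lambda>t. J (\<sigma> - 2) (ut t)) has_vector_derivative J (\<sigma> - 2) (bo (ut (t + s)))) (at (t + s))" using c by blast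
    then show "((\<lambda>t. J (\<sigma> - 2) (ut (t + s))) has_vector_derivative J (\<sigma> - 2) (bo (ut (t + s)))) (at t)"
      using vector_derivative_affine[of "\<lambda>t. J (\<sigma> - 2) (ut t)" _ 1 t s] by simp
  qed
  from bo_curve_unique[OF sig b.bo_curve_ut this] show ?thesis by (simp add: b.ut_0 fun_eq_iff)
qed

section \<open>The flow on rough data\<close>

text \<open>A finite truncation has every order. Making its frequency set symmetric preserves
  reality, and as the set only grows the error does not. The order 2 stands for any order above
  3/2.\<close>

lemma hermitian_dense:
  assumes a: "insob r a" and real: "\<And>k :: int. a (- k) = cnj (a k)" and "\<delta> > 0"
  shows "\<exists>b. bodata b 2 \<and> hn r (\<lambda>k. b k - a k) < \<delta>"
proof -
  obtain A where A: "finite A" "hn r (\<lambda>k. a k - (if k \<in> A then a k else 0)) < \<delta>"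
    using insob_dense[OF a \<open>\<delta> > 0\<close>] by blast
  define F where "F = A \<union> uminus ` A"
  define b where "b k = (if k \<in> F then a k else 0)" for k
  have "finite {k. b k \<noteq> 0}"
    by (rule finite_subset[of _ F]) (use A(1) in \<open>auto simp: b_def F_def\<close>)
  then have ib: "insob q b" for q by (rule insob_finite)
  have "- k \<in> F \<longleftrightarrow> k \<in> F" for k by (auto simp: F_def image_iff) (metis minus_minus)+
  then have "bodata b 2" by (simp add: bodata_def ib) (simp add: b_def real)
  moreover have "hn r (\<lambda>k. b k - a k) < \<delta>"
  proof -
    have "hn r (\<lambda>k. b k - a k) = hn r (\<lambda>k. a k - b k)" by (rule hn_diff_commute[OF ib a])
    also have "(\<lambda>k. a k - b k) = (\<lambda>k. if k \<in> - F then a k - (if k \<in> A then a k else 0) else 0)"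
      by (auto simp: b_def F_def fun_eq_iff)
    also have "hn r \<dots> \<le> hn r (\<lambda>k. a k - (if k \<in> A then a k else 0))"
      by (intro hn_restr_le insob_diff insob_restr a)
    finally show ?thesis using A(2) by simp
  qed
  ultimately show ?thesis by blast
qed

lemma hn_eq_0:
  fixes x :: "'i::weight \<Rightarrow> complex"
  assumes "insob r x" "insob r y" "\<And>e. e > 0 \<Longrightarrow> hn r (\<lambda>k. x k - y k) \<le> e"
  shows "x = y"
proof
  fix k
  have "hn r (\<lambda>k. x k - y k) \<le> 0" by (rule field_le_epsilon) (use assms(3) in simp)
  then have "cmod (x k - y k) \<le> 0"
    using coord_le_hn[OF insob_diff[OF assms(1,2)], of k] hn_nonneg[of r "\<lambda>k. x k - y k"] by simp
  then show "x k = y k" by simp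
qed

context rough
begin

text \<open>Extension by continuity at the level of coefficients: one \<open>\<delta>\<close> serves
  regular data of every order \<open>\<sigma>\<close> and all times up to \<open>\<Theta>\<close>,
  which matches the quantifiers of \<open>global_solution\<close>.\<close>

definition flow_limit :: "(int \<Rightarrow> complex) \<Rightarrow> (real \<Rightarrow> int \<Rightarrow> complex) \<Rightarrow> bool" where
  "flow_limit a x \<longleftrightarrow> (\<forall>t. insob (- s) (x t)) \<and> (\<forall>t k. x t (- k) = cnj (x t k)) \<and>
     (\<forall>\<Theta>\<ge>0. \<forall>\<epsilon>>0. \<exists>\<delta>>0. \<forall>b \<sigma> t. bodata b \<sigma> \<longrightarrow> hn (- s) (\<lambda>k. b k - a k) < \<delta> \<longrightarrow> \<bar>t\<bar> \<le> \<Theta> \<longrightarrow>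
        hn (- s) (\<lambda>k. bodata.ut b t k - x t k) \<le> \<epsilon>)"

lemma flow_limit_insob: "flow_limit a x \<Longrightarrow> insob (- s) (x t)"
  by (simp add: flow_limit_def)

lemma flow_limit_real: "flow_limit a x \<Longrightarrow> x t (- k) = cnj (x t k)"
  by (simp add: flow_limit_def)

lemma flow_limitD:
  assumes "flow_limit a x" "0 < \<epsilon>"
  obtains \<delta> where "\<delta> > 0" "\<And>b \<sigma> t. bodata b \<sigma> \<Longrightarrow> hn (- s) (\<lambda>k. b k - a k) < \<delta> \<Longrightarrow> \<bar>t\<bar> \<le> \<bar>\<Theta>\<bar> \<Longrightarrow>
    hn (- s) (\<lambda>k. bodata.ut b t k - x t k) \<le> \<epsilon>"
  using assms abs_ge_zero[of \<Theta>] unfolding flow_limit_def by blast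

lemma insob_ut: "bodata b \<sigma> \<Longrightarrow> insob (- s) (bodata.ut b t)"
  using bodata.bodata_ut[of b \<sigma> t] s unfolding bodata_def by (auto intro: insob_mono)

text \<open>Completeness: along regular data that tend to \<open>a\<close>, the solutions, mapped by
  \<open>J (- s)\<close>, form a Cauchy sequence by \<open>flow_close\<close>, and its uniform
  estimate passes to the limit.\<close>

lemma flow_limit_exists:
  assumes a: "insob (- s) a" and real: "\<And>k. a (- k) = cnj (a k)"
  shows "\<exists>x. flow_limit a x"
proof -
  have "\<exists>b. bodata b 2 \<and> hn (- s) (\<lambda>k. b k - a k) < inverse (Suc n)" for n
    by (rule hermitian_dense[OF a real]) simp
  then obtain b where b: "\<And>n. bodata (b n) 2" "\<And>n. hn (- s) (\<lambda>k. b n k - a k) < inverse (Suc n)"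
    by metis
  have ev: "\<exists>N. \<forall>n\<ge>N. hn (- s) (\<lambda>k. b n k - a k) < \<delta>" if "\<delta> > 0" for \<delta> :: real
  proof -
    obtain N where N: "inverse (real (Suc N)) < \<delta>" using reals_Archimedean[OF \<open>\<delta> > 0\<close>] by blast
    have "hn (- s) (\<lambda>k. b n k - a k) < \<delta>" if "n \<ge> N" for n
    proof -
      have "inverse (real (Suc n)) \<le> inverse (real (Suc N))" using that by (intro le_imp_inverse_le) auto
      then show ?thesis using b(2)[of n] N by linarith
    qed
    then show ?thesis by blast
  qed
  define u where "u n t = J (- s) (bodata.ut (b n) t)" for n t
  note iu = insob_ut[OF b(1)]
  have nu: "norm (u n t - u m t) = hn (- s) (\<lambda>k. bodata.ut (b n) t k - bodata.ut (b m) t k)" for n m t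
    unfolding u_def hn_def by (simp add: J_diff iu)
  have "convergent (\<lambda>n. u n t)" for t
  proof (rule Cauchy_convergent, rule CauchyI)
    fix e :: real assume "e > 0"
    then obtain \<delta> where \<delta>: "\<delta> > 0" "\<And>a' \<sigma> b \<sigma>'. bodata a' \<sigma> \<Longrightarrow> bodata b \<sigma>' \<Longrightarrow> hn (- s) (\<lambda>k. a' k - a k) < \<delta> \<Longrightarrow> hn (- s) (\<lambda>k. b k - a k) < \<delta> \<Longrightarrow>
        hn (- s) (\<lambda>k. bodata.ut a' t k - bodata.ut b t k) \<le> e / 2"
      using flow_close[OF a abs_ge_zero[of t], of "e / 2"] by auto
    obtain N where N: "\<And>n. n \<ge> N \<Longrightarrow> hn (- s) (\<lambda>k. b n k - a k) < \<delta>" using ev[OF \<delta>(1)] by blast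
    have "norm (u m t - u n t) < e" if "m \<ge> N" "n \<ge> N" for m n
      unfolding nu using \<delta>(2)[OF b(1) b(1) N[OF that(1)] N[OF that(2)]] \<open>e > 0\<close> by simp
    then show "\<exists>M. \<forall>m\<ge>M. \<forall>n\<ge>M. norm (u m t - u n t) < e" by blast
  qed
  then obtain y where y: "\<And>t. (\<lambda>n. u n t) \<longlonglongrightarrow> y t" unfolding convergent_def by metis
  define x where "x t k = of_real (br k powr s) * cf (y t) k" for t k
  have w: "br k powr (- s) * br k powr s = 1" for k :: int by (simp flip: powr_add)
  have w': "complex_of_real (br k powr (- s)) * (of_real (br k powr s) * z) = z" for k :: int and z
    unfolding mult.assoc[symmetric] of_real_mult[symmetric] w by simp
  have ix: "insob (- s) (x t)" for t
    unfolding insob_def x_def w' by (rule sqsum_cf)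
  have Jx: "J (- s) (x t) = y t" for t
    by (rule ell2_eqI) (simp only: cf_J[OF ix], simp only: x_def w')
  have nx: "hn (- s) (\<lambda>k. bodata.ut (b n) t k - x t k) = norm (u n t - y t)" for n t
    unfolding hn_def J_diff[OF iu ix] Jx u_def ..
  have "(\<lambda>n. bodata.ut (b n) t k) \<longlonglongrightarrow> x t k" for t k
  proof -
    have "(\<lambda>n. of_real (br k powr s) * cf (u n t) k) \<longlonglongrightarrow> x t k"
      unfolding x_def by (intro tendsto_intros y)
    moreover have "of_real (br k powr s) * cf (u n t) k = bodata.ut (b n) t k" for n
    proof -
      have "of_real (br k powr s) * cf (u n t) k = of_real (br k powr s) * (of_real (br k powr (- s)) * bodata.ut (b n) t k)"
        unfolding u_def cf_J[OF iu] ..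
      then show ?thesis by (metis w' mult.left_commute)
    qed
    ultimately show ?thesis by simp
  qed note lim = this
  have "x t (- k) = cnj (x t k)" for t k
  proof (rule LIMSEQ_unique[OF lim])
    show "(\<lambda>n. bodata.ut (b n) t (- k)) \<longlonglongrightarrow> cnj (x t k)"
      unfolding bodata.ut_real[OF b(1)] by (rule tendsto_cnj[OF lim])
  qed
  moreover have "\<exists>\<delta>>0. \<forall>c \<sigma> t. bodata c \<sigma> \<longrightarrow> hn (- s) (\<lambda>k. c k - a k) < \<delta> \<longrightarrow> \<bar>t\<bar> \<le> \<Theta> \<longrightarrow>
      hn (- s) (\<lambda>k. bodata.ut c t k - x t k) \<le> \<epsilon>" if te: "0 \<le> \<Theta>" "0 < \<epsilon>" for \<Theta> \<epsilon>
  proof -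
    obtain \<delta> where \<delta>: "\<delta> > 0" "\<And>a' \<sigma> b \<sigma>' t. bodata a' \<sigma> \<Longrightarrow> bodata b \<sigma>' \<Longrightarrow> hn (- s) (\<lambda>k. a' k - a k) < \<delta> \<Longrightarrow> hn (- s) (\<lambda>k. b k - a k) < \<delta> \<Longrightarrow>
        \<bar>t\<bar> \<le> \<Theta> \<Longrightarrow> hn (- s) (\<lambda>k. bodata.ut a' t k - bodata.ut b t k) \<le> \<epsilon>"
      using flow_close[OF a te] by blast
    obtain N where N: "\<And>n. n \<ge> N \<Longrightarrow> hn (- s) (\<lambda>k. b n k - a k) < \<delta>" using ev[OF \<delta>(1)] by blast
    have "hn (- s) (\<lambda>k. bodata.ut c t k - x t k) \<le> \<epsilon>"
      if c: "bodata c \<sigma>" "hn (- s) (\<lambda>k. c k - a k) < \<delta>" "\<bar>t\<bar> \<le> \<Theta>" for c \<sigma> t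
    proof -
      have "(\<lambda>n. norm (J (- s) (bodata.ut c t) - u n t)) \<longlonglongrightarrow> norm (J (- s) (bodata.ut c t) - y t)"
        by (intro tendsto_intros y)
      moreover have "norm (J (- s) (bodata.ut c t) - u n t) \<le> \<epsilon>" if "n \<ge> N" for n
        using \<delta>(2)[OF c(1) b(1) c(2) N[OF that] c(3)]
        unfolding hn_def u_def J_diff[OF insob_ut[OF c(1)] iu] .
      ultimately have "norm (J (- s) (bodata.ut c t) - y t) \<le> \<epsilon>"
        by (intro LIMSEQ_le_const2[where a = \<epsilon>]) auto
      then show ?thesis unfolding hn_def J_diff[OF insob_ut[OF c(1)] ix] Jx .
    qed
    with \<delta>(1) show ?thesis by blast
  qed
  ultimately have "flow_limit a x" unfolding flow_limit_def using ix by blast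
  then show ?thesis by blast
qed

context
  fixes a :: "int \<Rightarrow> complex" and x :: "real \<Rightarrow> int \<Rightarrow> complex"
  assumes a: "insob (- s) a" and real: "\<And>k. a (- k) = cnj (a k)" and x: "flow_limit a x"
begin

lemma flow_limit_approx:
  assumes "\<epsilon> > 0"
  obtains b where "bodata b 2" "hn (- s) (\<lambda>k. b k - a k) < \<epsilon>" "\<And>t. \<bar>t\<bar> \<le> \<bar>\<Theta>\<bar> \<Longrightarrow> hn (- s) (\<lambda>k. bodata.ut b t k - x t k) \<le> \<epsilon>"
proof -
  obtain \<delta> where \<delta>: "\<delta> > 0" "\<And>b \<sigma> t. bodata b \<sigma> \<Longrightarrow> hn (- s) (\<lambda>k. b k - a k) < \<delta> \<Longrightarrow> \<bar>t\<bar> \<le> \<bar>\<Theta>\<bar> \<Longrightarrow>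
      hn (- s) (\<lambda>k. bodata.ut b t k - x t k) \<le> \<epsilon>"
    using flow_limitD[OF x assms] by blast
  obtain b where "bodata b 2" "hn (- s) (\<lambda>k. b k - a k) < min \<delta> \<epsilon>"
    using hermitian_dense[OF a real, of "min \<delta> \<epsilon>"] \<delta>(1) assms by auto
  then show ?thesis using \<delta>(2) that by auto
qed

lemma flow_limit_0: "x 0 = a"
proof (rule hn_eq_0[OF flow_limit_insob[OF x] a])
  fix e :: real assume "e > 0"
  then have "e / 2 > 0" by simp
  then obtain b where b: "bodata b 2" "hn (- s) (\<lambda>k. b k - a k) < e / 2" "\<And>t. \<bar>t\<bar> \<le> \<bar>0\<bar> \<Longrightarrow> hn (- s) (\<lambda>k. bodata.ut b t k - x t k) \<le> e / 2"
    using flow_limit_approx[where \<epsilon> = "e / 2" and \<Theta> = 0] by blast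
  have ib: "insob (- s) b" using insob_ut[OF b(1), of 0] by (simp add: bodata.ut_0[OF b(1)])
  have "hn (- s) (\<lambda>k. x 0 k - a k) \<le> hn (- s) (\<lambda>k. x 0 k - b k) + hn (- s) (\<lambda>k. b k - a k)"
    by (rule hn_triangle3[OF flow_limit_insob[OF x] ib a])
  also have "hn (- s) (\<lambda>k. x 0 k - b k) = hn (- s) (\<lambda>k. b k - x 0 k)"
    by (rule hn_diff_commute[OF flow_limit_insob[OF x] ib])
  finally show "hn (- s) (\<lambda>k. x 0 k - a k) \<le> e"
    using b(2) b(3)[of 0] by (simp add: bodata.ut_0[OF b(1)])
qed

text \<open>A locally uniform limit of continuous curves; the approximating solutions are continuous
  even at order 2.\<close>

lemma flow_limit_continuous: "continuous_on UNIV (\<lambda>t. J (- s) (x t))"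
  unfolding continuous_on_J_iff[OF flow_limit_insob[OF x]]
proof (intro allI tendstoI)
  fix t e :: real assume "e > 0"
  then have "e / 4 > 0" by simp
  then obtain b where b: "bodata b 2" "\<And>r. \<bar>r\<bar> \<le> \<bar>\<bar>t\<bar> + 1\<bar> \<Longrightarrow> hn (- s) (\<lambda>k. bodata.ut b r k - x r k) \<le> e / 4"
    using flow_limit_approx[where \<epsilon> = "e / 4" and \<Theta> = "\<bar>t\<bar> + 1"] by blast
  note ib = insob_ut[OF b(1)] and ix = flow_limit_insob[OF x]
  have i2: "insob 2 (bodata.ut b r)" for r using bodata.bodata_ut[OF b(1)] by (simp add: bodata_def)
  have "((\<lambda>r. hn 2 (\<lambda>k. bodata.ut b r k - bodata.ut b t k)) \<longlongrightarrow> 0) (at t)"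
    using bodata.bo_curve_ut[OF b(1)] i2 unfolding bo_curve_def by (simp add: continuous_on_J_iff)
  then have "\<forall>\<^sub>F r in at t. hn 2 (\<lambda>k. bodata.ut b r k - bodata.ut b t k) < e / 4"
    by (rule order_tendstoD) (use \<open>e > 0\<close> in simp)
  moreover have "\<forall>\<^sub>F r in at t. dist r t < 1"
    by (simp add: eventually_at) (rule exI[of _ 1], simp)
  ultimately show "\<forall>\<^sub>F r in at t. dist (hn (- s) (\<lambda>k. x r k - x t k)) 0 < e"
  proof eventually_elim
    case (elim r)
    have r: "\<bar>r\<bar> \<le> \<bar>\<bar>t\<bar> + 1\<bar>" "\<bar>t\<bar> \<le> \<bar>\<bar>t\<bar> + 1\<bar>" using elim(2) by (auto simp: dist_real_def)
    have "hn (- s) (\<lambda>k. x r k - x t k) \<le> hn (- s) (\<lambda>k. x r k - bodata.ut b r k) + hn (- s) (\<lambda>k. bodata.ut b r k - x t k)"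
      by (rule hn_triangle3[OF ix ib ix])
    also have "hn (- s) (\<lambda>k. bodata.ut b r k - x t k) \<le> hn (- s) (\<lambda>k. bodata.ut b r k - bodata.ut b t k) + hn (- s) (\<lambda>k. bodata.ut b t k - x t k)"
      by (rule hn_triangle3[OF ib ib ix])
    also have "hn (- s) (\<lambda>k. x r k - bodata.ut b r k) = hn (- s) (\<lambda>k. bodata.ut b r k - x r k)"
      by (rule hn_diff_commute[OF ix ib])
    also have "hn (- s) (\<lambda>k. bodata.ut b r k - bodata.ut b t k) \<le> hn 2 (\<lambda>k. bodata.ut b r k - bodata.ut b t k)"
      by (rule hn_mono[OF insob_diff[OF i2 i2]]) (use s in simp)
    finally have "hn (- s) (\<lambda>k. x r k - x t k) < e"
      using b(2)[OF r(1)] b(2)[OF r(2)] elim(1) \<open>e > 0\<close> by simp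
    then show ?case by simp
  qed
qed

text \<open>Regular solutions keep their mean by \<open>ut_zero\<close>, and a single coefficient
  depends continuously on the norm.\<close>

lemma flow_limit_mean: "x t 0 = a 0"
proof -
  have "cmod (x t 0 - a 0) \<le> 0"
  proof (rule field_le_epsilon)
    fix e :: real assume "e > 0"
    then have "e / 2 > 0" by simp
    then obtain b where b: "bodata b 2" "hn (- s) (\<lambda>k. b k - a k) < e / 2" "\<And>r. \<bar>r\<bar> \<le> \<bar>t\<bar> \<Longrightarrow> hn (- s) (\<lambda>k. bodata.ut b r k - x r k) \<le> e / 2"
      using flow_limit_approx[where \<epsilon> = "e / 2" and \<Theta> = t] by blast
    have ib: "insob (- s) b" using insob_ut[OF b(1), of 0] by (simp add: bodata.ut_0[OF b(1)])
    have "cmod (b 0 - a 0) \<le> hn (- s) (\<lambda>k. b k - a k)"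
      using coord_le_hn[OF insob_diff[OF ib a], of 0] by (simp add: br_int_simps)
    moreover have "cmod (bodata.ut b t 0 - x t 0) \<le> hn (- s) (\<lambda>k. bodata.ut b t k - x t k)"
      using coord_le_hn[OF insob_diff[OF insob_ut[OF b(1), of t] flow_limit_insob[OF x, of t]], of 0] by (simp add: br_int_simps)
    ultimately have "cmod (b 0 - a 0) + cmod (b 0 - x t 0) \<le> e"
      using b(2) b(3)[of t] by (simp add: bodata.ut_zero[OF b(1)])
    moreover have "cmod (x t 0 - a 0) \<le> cmod (x t 0 - b 0) + cmod (b 0 - a 0)"
      using norm_triangle_ineq[of "x t 0 - b 0" "b 0 - a 0"] by simp
    ultimately show "cmod (x t 0 - a 0) \<le> 0 + e" by (simp add: norm_minus_commute)
  qed
  then show ?thesis by simp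
qed

text \<open>Regular data within distance 1 of \<open>a\<close> have a rough norm of at most
  \<open>hn (- s) a + 1\<close>, so one constant of \<open>uniform_bounds\<close> serves all times,
  although the approximating data depend on the time.\<close>

lemma flow_limit_bounded: "\<exists>B. \<forall>t. hn (- s) (x t) \<le> B"
proof -
  have "0 \<le> hn (- s) a + 1" by (simp add: add_nonneg_nonneg)
  from uniform_bounds[OF this] obtain B where B: "\<And>b \<sigma> t. bodata b \<sigma> \<Longrightarrow> hn (- s) b \<le> hn (- s) a + 1 \<Longrightarrow> hn (- s) (bodata.ut b t) \<le> B"
    by blast
  have "hn (- s) (x t) \<le> B + 1" for t
  proof -
    obtain b where b: "bodata b 2" "hn (- s) (\<lambda>k. b k - a k) < 1" "\<And>r. \<bar>r\<bar> \<le> \<bar>t\<bar> \<Longrightarrow> hn (- s) (\<lambda>k. bodata.ut b r k - x r k) \<le> 1"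
      using flow_limit_approx[OF zero_less_one] by blast
    have ib: "insob (- s) b" using insob_ut[OF b(1), of 0] by (simp add: bodata.ut_0[OF b(1)])
    have "hn (- s) b \<le> hn (- s) a + 1"
      using hn_add_le[OF insob_diff[OF ib a] a] b(2) by simp
    then have "hn (- s) (bodata.ut b t) \<le> B" by (rule B[OF b(1)])
    moreover have "hn (- s) (x t) \<le> hn (- s) (bodata.ut b t) + hn (- s) (\<lambda>k. bodata.ut b t k - x t k)"
      using hn_diff_le[OF insob_ut[OF b(1)] insob_diff[OF insob_ut[OF b(1)] flow_limit_insob[OF x]], of t t t] by simp
    ultimately show ?thesis using b(3)[of t] by simp
  qed
  then show ?thesis by blast
qed

text \<open>Regular data very close to \<open>a'\<close> are also close to \<open>a\<close>, so both
  limits are compared with one and the same regular solution.\<close>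

lemma flow_limit_close:
  assumes "0 < \<epsilon>"
  obtains \<delta> where "\<delta> > 0" "\<And>a' x' t. insob (- s) a' \<Longrightarrow> (\<And>k. a' (- k) = cnj (a' k)) \<Longrightarrow> flow_limit a' x' \<Longrightarrow>
    hn (- s) (\<lambda>k. a' k - a k) < \<delta> \<Longrightarrow> \<bar>t\<bar> \<le> \<bar>\<Theta>\<bar> \<Longrightarrow> hn (- s) (\<lambda>k. x' t k - x t k) \<le> \<epsilon>"
proof -
  have e2: "\<epsilon> / 2 > 0" using assms by simp
  obtain \<delta> where \<delta>: "\<delta> > 0" "\<And>b \<sigma> t. bodata b \<sigma> \<Longrightarrow> hn (- s) (\<lambda>k. b k - a k) < \<delta> \<Longrightarrow> \<bar>t\<bar> \<le> \<bar>\<Theta>\<bar> \<Longrightarrow>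
      hn (- s) (\<lambda>k. bodata.ut b t k - x t k) \<le> \<epsilon> / 2"
    using flow_limitD[OF x e2] by blast
  have *: "hn (- s) (\<lambda>k. x' t k - x t k) \<le> \<epsilon>"
    if a': "insob (- s) a'" "\<And>k. a' (- k) = cnj (a' k)" and x': "flow_limit a' x'"
      and c: "hn (- s) (\<lambda>k. a' k - a k) < \<delta> / 2" and t: "\<bar>t\<bar> \<le> \<bar>\<Theta>\<bar>" for a' x' t
  proof -
    note ix = flow_limit_insob[OF x] and ix' = flow_limit_insob[OF x']
    obtain \<delta>' where \<delta>': "\<delta>' > 0" "\<And>b \<sigma> t. bodata b \<sigma> \<Longrightarrow> hn (- s) (\<lambda>k. b k - a' k) < \<delta>' \<Longrightarrow> \<bar>t\<bar> \<le> \<bar>\<Theta>\<bar> \<Longrightarrow>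
        hn (- s) (\<lambda>k. bodata.ut b t k - x' t k) \<le> \<epsilon> / 2"
      using flow_limitD[OF x' e2] by blast
    have "min \<delta>' (\<delta> / 2) > 0" using \<delta>(1) \<delta>'(1) by simp
    from hermitian_dense[OF a' this] obtain b where b: "bodata b 2" "hn (- s) (\<lambda>k. b k - a' k) < min \<delta>' (\<delta> / 2)" by blast
    have ib: "insob (- s) b" using insob_ut[OF b(1), of 0] by (simp add: bodata.ut_0[OF b(1)])
    have "hn (- s) (\<lambda>k. b k - a k) < \<delta>"
      using hn_triangle3[OF ib a'(1) a] b(2) c by simp
    from \<delta>(2)[OF b(1) this t] have 1: "hn (- s) (\<lambda>k. bodata.ut b t k - x t k) \<le> \<epsilon> / 2" .
    have 2: "hn (- s) (\<lambda>k. bodata.ut b t k - x' t k) \<le> \<epsilon> / 2" by (rule \<delta>'(2)[OF b(1) _ t]) (use b(2) in simp)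
    show ?thesis
      using hn_triangle3[OF ix' insob_ut[OF b(1)] ix, of t t t] hn_diff_commute[OF ix' insob_ut[OF b(1)], of t t] 1 2 by simp
  qed
  show ?thesis by (rule that[OF half_gt_zero[OF \<delta>(1)]]) (rule *)
qed

text \<open>A regular solution close to \<open>x\<close> up to time
  \<open>\<bar>t\<bar> + \<bar>r\<bar>\<close> has at time \<open>r\<close> a value that is
  admissible data for \<open>y\<close>; \<open>ut_add\<close> identifies its further course.\<close>

lemma flow_limit_shift:
  assumes y: "flow_limit (x r) y"
  shows "y t = x (t + r)"
proof (rule hn_eq_0[OF flow_limit_insob[OF y] flow_limit_insob[OF x]])
  fix e :: real assume "e > 0"
  then have e: "e / 2 > 0" by simp
  note ix = flow_limit_insob[OF x] and iy = flow_limit_insob[OF y]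
  obtain \<delta> where \<delta>: "\<delta> > 0" "\<And>b \<sigma> r'. bodata b \<sigma> \<Longrightarrow> hn (- s) (\<lambda>k. b k - x r k) < \<delta> \<Longrightarrow> \<bar>r'\<bar> \<le> \<bar>t\<bar> \<Longrightarrow>
      hn (- s) (\<lambda>k. bodata.ut b r' k - y r' k) \<le> e / 2"
    using flow_limitD[OF y e] by blast
  have "min (\<delta> / 2) (e / 2) > 0" using \<delta>(1) e by simp
  then obtain b where b: "bodata b 2" "\<And>r'. \<bar>r'\<bar> \<le> \<bar>\<bar>t\<bar> + \<bar>r\<bar>\<bar> \<Longrightarrow> hn (- s) (\<lambda>k. bodata.ut b r' k - x r' k) \<le> min (\<delta> / 2) (e / 2)"
    using flow_limit_approx[where \<epsilon> = "min (\<delta> / 2) (e / 2)" and \<Theta> = "\<bar>t\<bar> + \<bar>r\<bar>"] by blast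
  note ib = insob_ut[OF b(1)]
  have "hn (- s) (\<lambda>k. bodata.ut b r k - x r k) < \<delta>" using b(2)[of r] \<delta>(1) by simp
  from \<delta>(2)[OF bodata.bodata_ut[OF b(1)] this, of t]
  have "hn (- s) (\<lambda>k. bodata.ut b (t + r) k - y t k) \<le> e / 2" by (simp add: bodata.ut_add[OF b(1)])
  moreover have "hn (- s) (\<lambda>k. bodata.ut b (t + r) k - x (t + r) k) \<le> e / 2" using b(2)[of "t + r"] by simp
  ultimately show "hn (- s) (\<lambda>k. y t k - x (t + r) k) \<le> e"
    using hn_triangle3[OF iy ib ix, of t "t + r" "t + r"] hn_diff_commute[OF iy ib, of t "t + r"] by simp
qed

end

end

section \<open>The flow on distributions, its well-posedness and the integral\<close>

context rough
begin

lemma sobolev_norm_diff: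
  assumes "insob r (fourier_coeff u)" "insob r (fourier_coeff w)"
  shows "sobolev_norm r (u - w) = hn r (\<lambda>k. fourier_coeff u k - fourier_coeff w k)"
proof -
  have e: "fourier_coeff (u - w) = (\<lambda>k. fourier_coeff u k - fourier_coeff w k)"
    by (rule ext) (rule fourier_coeff_diff)
  show ?thesis by (subst sobolev_norm_hn) (simp_all only: e insob_diff[OF assms])
qed

lemma global_solutionI:
  assumes v0: "v0 \<in> sobolev (- s)" and \<gamma>: "flow_limit (fourier_coeff v0) (\<lambda>t. fourier_coeff (\<gamma> t))"
  shows "global_solution s v0 \<gamma>"
proof -
  have a: "insob (- s) (fourier_coeff v0)" using v0 by (simp add: sobolev_iff)
  note l = a fourier_coeff_uminus \<gamma>
  have "uniform_limit {- \<Theta>..\<Theta>} (\<lambda>k t. sobolev_norm (- s) (classical_flow \<sigma> (w k) t - \<gamma> t)) (\<lambda>_. 0) sequentially"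
    if \<sigma>: "\<sigma> > 3 / 2" and w: "\<forall>k. w k \<in> sobolev \<sigma>" and lim: "(\<lambda>k. sobolev_norm (- s) (w k - v0)) \<longlonglongrightarrow> 0" and "\<Theta> > 0" for \<sigma> w \<Theta>
  proof (rule uniform_limitI)
    fix e :: real assume "e > 0"
    then have e: "e / 2 > 0" by simp
    have b: "bodata (fourier_coeff (w k)) \<sigma>" for k by (rule bodata_coeff[OF \<sigma> w[rule_format]])
    have ib: "insob (- s) (fourier_coeff (w k))" for k
      using insob_ut[OF b[of k], of 0] by (simp add: bodata.ut_0[OF b])
    obtain \<delta> where \<delta>: "\<delta> > 0" "\<And>b \<sigma> t. bodata b \<sigma> \<Longrightarrow> hn (- s) (\<lambda>k. b k - fourier_coeff v0 k) < \<delta> \<Longrightarrow> \<bar>t\<bar> \<le> \<bar>\<Theta>\<bar> \<Longrightarrow>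
        hn (- s) (\<lambda>k. bodata.ut b t k - fourier_coeff (\<gamma> t) k) \<le> e / 2"
      using flow_limitD[OF \<gamma> e] by blast
    have "\<forall>\<^sub>F k in sequentially. sobolev_norm (- s) (w k - v0) < \<delta>"
      by (rule order_tendstoD(2)[OF lim \<delta>(1)])
    then show "\<forall>\<^sub>F k in sequentially. \<forall>t\<in>{- \<Theta>..\<Theta>}. dist (sobolev_norm (- s) (classical_flow \<sigma> (w k) t - \<gamma> t)) 0 < e"
    proof (rule eventually_mono, intro ballI)
      fix k t assume k: "sobolev_norm (- s) (w k - v0) < \<delta>" and t: "t \<in> {- \<Theta>..\<Theta>}"
      have k: "hn (- s) (\<lambda>j. fourier_coeff (w k) j - fourier_coeff v0 j) < \<delta>"
        using k by (simp only: sobolev_norm_diff[OF ib a])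
      have t: "\<bar>t\<bar> \<le> \<bar>\<Theta>\<bar>" using t by auto
      have c: "fourier_coeff (classical_flow \<sigma> (w k) t) = bodata.ut (fourier_coeff (w k)) t"
        by (rule classical_flow[OF \<sigma> w[rule_format]])
      have "sobolev_norm (- s) (classical_flow \<sigma> (w k) t - \<gamma> t) = hn (- s) (\<lambda>j. bodata.ut (fourier_coeff (w k)) t j - fourier_coeff (\<gamma> t) j)"
        by (subst sobolev_norm_diff) (simp_all only: c insob_ut[OF b] flow_limit_insob[OF \<gamma>])
      also have "\<dots> \<le> e / 2" by (rule \<delta>(2)[OF b k t])
      finally show "dist (sobolev_norm (- s) (classical_flow \<sigma> (w k) t - \<gamma> t)) 0 < e"
        using e hn_nonneg by (simp add: sobolev_norm_diff[OF _ flow_limit_insob[OF \<gamma>]] c insob_ut[OF b])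
    qed
  qed
  moreover have "continuous_curve (- s) \<gamma>"
    unfolding continuous_curve_iff using flow_limit_insob[OF \<gamma>] flow_limit_continuous[OF l] by blast
  moreover have "\<gamma> 0 = v0"
    by (rule distr_eqI) (simp only: flow_limit_0[OF l])
  ultimately show ?thesis using v0 unfolding global_solution_def by blast
qed

text \<open>Both curves are limits of the same classical solutions, whose data of order 2 converge
  to \<open>v0\<close>.\<close>

lemma global_solution_unique:
  assumes \<gamma>: "global_solution s v0 \<gamma>" and \<gamma>': "global_solution s v0 \<gamma>'"
  shows "\<gamma> = \<gamma>'"
proof
  fix t
  have v0: "insob (- s) (fourier_coeff v0)" using \<gamma> by (simp add: global_solution_def sobolev_iff)
  have ig: "insob (- s) (fourier_coeff (\<gamma> t))" "insob (- s) (fourier_coeff (\<gamma>' t))"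
    using \<gamma> \<gamma>' by (auto simp: global_solution_def continuous_curve_iff)
  have "\<exists>w. bodata (fourier_coeff w) 2 \<and> sobolev_norm (- s) (w - v0) < inverse (Suc n)" for n
  proof -
    obtain b where b: "bodata b 2" "hn (- s) (\<lambda>k. b k - fourier_coeff v0 k) < inverse (Suc n)"
      using hermitian_dense[OF v0 fourier_coeff_uminus, of "inverse (Suc n)"] by auto
    have "\<exists>w. fourier_coeff w = b"
      using b(1) by (intro insob_distr_exists[of 2]) (auto simp: bodata_def)
    then obtain w where w: "fourier_coeff w = b" ..
    have "insob (- s) b" using insob_ut[OF b(1), of 0] by (simp add: bodata.ut_0[OF b(1)])
    then show ?thesis using b by (intro exI[of _ w]) (simp add: sobolev_norm_diff w v0)
  qed
  then obtain w where w: "\<And>n. bodata (fourier_coeff (w n)) 2" "\<And>n. sobolev_norm (- s) (w n - v0) < inverse (Suc n)"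
    by metis
  have l: "(\<lambda>n. sobolev_norm (- s) (w n - v0)) \<longlonglongrightarrow> 0"
  proof (rule tendsto_sandwich[OF _ _ tendsto_const LIMSEQ_inverse_real_of_nat])
    show "\<forall>\<^sub>F n in sequentially. sobolev_norm (- s) (w n - v0) \<le> inverse (real (Suc n))"
      using w(2) by (intro always_eventually allI less_imp_le)
    show "\<forall>\<^sub>F n in sequentially. 0 \<le> sobolev_norm (- s) (w n - v0)"
      unfolding sobolev_norm_def by (intro always_eventually allI real_sqrt_ge_zero infsum_nonneg) simp
  qed
  have w2: "w n \<in> sobolev 2" for n using w(1)[of n] by (simp add: bodata_def sobolev_iff)
  have u: "uniform_limit {- (\<bar>t\<bar> + 1)..\<bar>t\<bar> + 1} (\<lambda>k t. sobolev_norm (- s) (classical_flow 2 (w k) t - \<eta> t)) (\<lambda>_. 0) sequentially"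
    if "global_solution s v0 \<eta>" for \<eta>
  proof -
    have "(2 :: real) > 3 / 2" "\<bar>t\<bar> + 1 > 0" by auto
    then show ?thesis using that l w2 unfolding global_solution_def by blast
  qed
  let ?n = "\<lambda>\<eta> k. sobolev_norm (- s) (classical_flow 2 (w k) t - \<eta> t)"
  have "(\<lambda>k. ?n \<gamma> k) \<longlonglongrightarrow> 0" "(\<lambda>k. ?n \<gamma>' k) \<longlonglongrightarrow> 0"
    by (rule tendsto_uniform_limitI[OF u[OF \<gamma>]] tendsto_uniform_limitI[OF u[OF \<gamma>']]; auto)+
  then have lim: "(\<lambda>k. ?n \<gamma> k + ?n \<gamma>' k) \<longlonglongrightarrow> 0 + 0" by (rule tendsto_add)
  have le: "hn (- s) (\<lambda>k. fourier_coeff (\<gamma> t) k - fourier_coeff (\<gamma>' t) k) \<le> ?n \<gamma> k + ?n \<gamma>' k" for k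
  proof -
    have c: "insob (- s) (fourier_coeff (classical_flow 2 (w k) t))"
      using insob_ut[OF w(1)] by (subst classical_flow) (auto simp: w2)
    show ?thesis
      unfolding sobolev_norm_diff[OF c ig(1)] sobolev_norm_diff[OF c ig(2)] hn_diff_commute[OF c ig(1)]
      by (rule hn_triangle3[OF ig(1) c ig(2)])
  qed
  have "hn (- s) (\<lambda>k. fourier_coeff (\<gamma> t) k - fourier_coeff (\<gamma>' t) k) \<le> 0"
    using tendsto_lowerbound[OF lim, of "hn (- s) (\<lambda>k. fourier_coeff (\<gamma> t) k - fourier_coeff (\<gamma>' t) k)"] le by (simp add: always_eventually)
  then have "fourier_coeff (\<gamma> t) = fourier_coeff (\<gamma>' t)"
    by (intro hn_eq_0[OF ig]) simp
  then show "\<gamma> t = \<gamma>' t" by (intro distr_eqI) simp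
qed

lemma bo_flow:
  assumes v0: "v0 \<in> sobolev (- s)"
  shows "global_solution s v0 (\<lambda>t. bo_flow s t v0)"
    and "flow_limit (fourier_coeff v0) (\<lambda>t. fourier_coeff (bo_flow s t v0))"
proof -
  have a: "insob (- s) (fourier_coeff v0)" using v0 by (simp add: sobolev_iff)
  obtain x where x: "flow_limit (fourier_coeff v0) x" using flow_limit_exists[OF a fourier_coeff_uminus] by blast
  have "\<exists>u. fourier_coeff u = x t" for t
    by (rule insob_distr_exists[OF flow_limit_insob[OF x]]) (use s flow_limit_real[OF x] in auto)
  then obtain \<gamma> where \<gamma>: "\<And>t. fourier_coeff (\<gamma> t) = x t" by metis
  have f: "flow_limit (fourier_coeff v0) (\<lambda>t. fourier_coeff (\<gamma> t))" using x by (simp add: \<gamma>)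
  note g = global_solutionI[OF v0 f]
  have "(THE \<gamma>. global_solution s v0 \<gamma>) = \<gamma>"
    using g global_solution_unique[OF _ g] by (rule the_equality)
  then have e: "(\<lambda>t. bo_flow s t v0) = \<gamma>" by (simp add: bo_flow_def fun_eq_iff)
  show "global_solution s v0 (\<lambda>t. bo_flow s t v0)" using g e by simp
  show "flow_limit (fourier_coeff v0) (\<lambda>t. fourier_coeff (bo_flow s t v0))"
    using f fun_cong[OF e] by simp
qed

lemma bo_flow_sobolev: "v0 \<in> sobolev (- s) \<Longrightarrow> bo_flow s t v0 \<in> sobolev (- s)"
  unfolding sobolev_iff by (rule flow_limit_insob[OF bo_flow(2)]) (simp add: sobolev_iff)

lemma bo_flow_0: "v0 \<in> sobolev (- s) \<Longrightarrow> bo_flow s 0 v0 = v0"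
  using bo_flow(1)[of v0] by (simp add: global_solution_def)

lemma bo_flow_add:
  assumes v0: "v0 \<in> sobolev (- s)"
  shows "bo_flow s t (bo_flow s r v0) = bo_flow s (t + r) v0"
  by (rule distr_eqI) (metis flow_limit_shift[OF _ fourier_coeff_uminus bo_flow(2)[OF v0] bo_flow(2)[OF bo_flow_sobolev[OF v0]]] v0 sobolev_iff)

text \<open>Makes the real supremum over all times in \<open>bounding_integral\<close> meaningful; a
  supremum of an unbounded set would be unspecified.\<close>

lemma bo_flow_bounded:
  assumes v0: "v0 \<in> sobolev (- s)"
  shows "bdd_above (range (\<lambda>t. sobolev_norm (- s) (bo_flow s t v0)))"
proof -
  obtain B where "\<And>t. hn (- s) (fourier_coeff (bo_flow s t v0)) \<le> B"
    using flow_limit_bounded[OF _ fourier_coeff_uminus bo_flow(2)[OF v0]] v0 sobolev_iff by blast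
  then show ?thesis
    using bo_flow_sobolev[OF v0] by (intro bdd_aboveI2[where M = B]) (simp add: sobolev_norm_hn sobolev_iff)
qed

lemma well_posed: "globally_C0_well_posed s"
  unfolding globally_C0_well_posed_def
proof (intro conjI ballI allI impI)
  fix v0 assume v0: "v0 \<in> sobolev (- s)"
  show "\<exists>\<gamma>. global_solution s v0 \<gamma>" using bo_flow(1)[OF v0] by blast
  fix \<Theta> \<epsilon> :: real assume "\<Theta> > 0" "\<epsilon> > 0"
  have a: "insob (- s) (fourier_coeff v0)" using v0 by (simp add: sobolev_iff)
  obtain \<delta> where \<delta>: "\<delta> > 0" "\<And>a' x' t. insob (- s) a' \<Longrightarrow> (\<And>k. a' (- k) = cnj (a' k)) \<Longrightarrow> flow_limit a' x' \<Longrightarrow>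
      hn (- s) (\<lambda>k. a' k - fourier_coeff v0 k) < \<delta> \<Longrightarrow> \<bar>t\<bar> \<le> \<bar>\<Theta>\<bar> \<Longrightarrow> hn (- s) (\<lambda>k. x' t k - fourier_coeff (bo_flow s t v0) k) \<le> \<epsilon>"
    using flow_limit_close[OF a fourier_coeff_uminus bo_flow(2)[OF v0] \<open>\<epsilon> > 0\<close>] by blast
  have "(SUP t\<in>{- \<Theta>..\<Theta>}. ereal (sobolev_norm (- s) (bo_flow s t w0 - bo_flow s t v0))) \<le> ereal \<epsilon>"
    if w0: "w0 \<in> sobolev (- s)" and d: "sobolev_norm (- s) (w0 - v0) < \<delta>" for w0
  proof (rule SUP_least)
    fix t assume t: "t \<in> {- \<Theta>..\<Theta>}"
    have b: "insob (- s) (fourier_coeff w0)" using w0 by (simp add: sobolev_iff)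
    have "hn (- s) (\<lambda>k. fourier_coeff (bo_flow s t w0) k - fourier_coeff (bo_flow s t v0) k) \<le> \<epsilon>"
      by (rule \<delta>(2)[OF b fourier_coeff_uminus bo_flow(2)[OF w0]]) (use d t in \<open>auto simp: sobolev_norm_diff[OF b a]\<close>)
    then show "ereal (sobolev_norm (- s) (bo_flow s t w0 - bo_flow s t v0)) \<le> ereal \<epsilon>"
      using bo_flow_sobolev[OF w0] bo_flow_sobolev[OF v0] by (simp add: sobolev_norm_diff sobolev_iff)
  qed
  with \<delta>(1) show "\<exists>\<delta>>0. \<forall>w0\<in>sobolev (- s). sobolev_norm (- s) (w0 - v0) < \<delta> \<longrightarrow>
      (SUP t\<in>{- \<Theta>..\<Theta>}. ereal (sobolev_norm (- s) (bo_flow s t w0 - bo_flow s t v0))) \<le> ereal \<epsilon>"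
    by blast
qed

lemma bo_flow_mean: "bo_flow s t ` sobolev_mean (- s) c \<subseteq> sobolev_mean (- s) c"
proof
  fix u assume "u \<in> bo_flow s t ` sobolev_mean (- s) c"
  then obtain v where v: "u = bo_flow s t v" "v \<in> sobolev (- s)" "fourier_coeff v 0 = of_real c"
    by (auto simp: sobolev_mean_def)
  have "fourier_coeff u 0 = of_real c"
    using flow_limit_mean[OF _ fourier_coeff_uminus bo_flow(2)[OF v(2)]] v sobolev_iff by simp
  then show "u \<in> sobolev_mean (- s) c"
    using bo_flow_sobolev[OF v(2)] v(1) by (simp add: sobolev_mean_def)
qed

lemma bounding_integral:
  "\<exists>I. (\<forall>v \<in> sobolev (- s). 0 \<le> I v) \<and> bo_integral s I \<and> (\<forall>v \<in> sobolev (- s). sobolev_norm (- s) v \<le> I v) \<and>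
     (\<forall>v0 \<in> sobolev (- s). (SUP t. ereal (sobolev_norm (- s) (bo_flow s t v0))) \<le> ereal (I v0))"
proof -
  define I where "I v = (SUP t. sobolev_norm (- s) (bo_flow s t v))" for v
  have le: "sobolev_norm (- s) (bo_flow s t v) \<le> I v" if "v \<in> sobolev (- s)" for v t
    unfolding I_def by (rule cSUP_upper[OF UNIV_I bo_flow_bounded[OF that]])
  have le0: "sobolev_norm (- s) v \<le> I v" if "v \<in> sobolev (- s)" for v
    using le[OF that, of 0] by (simp add: bo_flow_0[OF that])
  have "0 \<le> I v" if "v \<in> sobolev (- s)" for v
    using le0[OF that] that order_trans[OF hn_nonneg] by (simp add: sobolev_norm_hn sobolev_iff)
  moreover have "I (bo_flow s t v) = I v" if v: "v \<in> sobolev (- s)" for t v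
  proof -
    have "range (\<lambda>r. sobolev_norm (- s) (bo_flow s r (bo_flow s t v))) = (\<lambda>r. sobolev_norm (- s) (bo_flow s r v)) ` range (\<lambda>r. r + t)"
      unfolding image_image bo_flow_add[OF v] ..
    also have "range (\<lambda>r. r + t) = UNIV" using surj_plus_right[of t] by (simp add: add.commute)
    finally show ?thesis by (simp add: I_def)
  qed
  moreover have "(SUP t. ereal (sobolev_norm (- s) (bo_flow s t v))) \<le> ereal (I v)" if "v \<in> sobolev (- s)" for v
    by (rule SUP_least) (simp add: le[OF that])
  ultimately show ?thesis using le0 by (intro exI[of _ I]) (simp add: bo_integral_def)
qed

end

theorem theorem1:
  fixes s :: real
  assumes "0 \<le> s" and "s < 1 / 2"
  shows "globally_C0_well_posed s \<and>
    (\<forall>c t. bo_flow s t ` sobolev_mean (- s) c \<subseteq> sobolev_mean (- s) c) \<and>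
    (\<exists>I :: distr \<Rightarrow> real.
       (\<forall>v \<in> sobolev (- s). 0 \<le> I v) \<and>
       bo_integral s I \<and>
       (\<forall>v \<in> sobolev (- s). sobolev_norm (- s) v \<le> I v) \<and>
       (\<forall>v0 \<in> sobolev (- s).
          (SUP t. ereal (sobolev_norm (- s) (bo_flow s t v0))) \<le> ereal (I v0)))"
proof -
  obtain K where "rough s K" using rough_exists[OF assms] by blast
  then interpret rough s K .
  show ?thesis using well_posed bo_flow_mean bounding_integral by blast
qed

end
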